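(* Let $W\subset H^-$ be a closed subspace of finite codimension and $k\ge0$, and let $\mathrm{Lag}^W(k)=\{L\in\mathrm{Lag}^-\mid\dim(L\cap W)=k\}$. (a) Every $L\in\mathrm{Lag}^W(k)$ has an orthogonal decomposition $L=\ell\oplus (L\cap W)\oplus\Lambda$, where $\ell$ is the orthogonal complement of $L\cap W$ in $L\cap W^\omega$ and $\Lambda$ is the orthogonal complement of $L\cap W^\omega$ in $L$. The space of operators $S\in\mathrm{Sym}(L)=T_L\mathrm{Lag}^-$ with block decomposition $$S=\begin{pmatrix}0&S_1^*&0\\ S_1&S_2&0\\0&0&0\end{pmatrix}$$ (relative to this decomposition) is an algebraic complement of $T_L\mathrm{Lag}^W(k)$ in $T_L\mathrm{Lag}^-$. (b) The algebraic complement of $T\mathrm{Lag}^W(k)$ in $T\mathrm{Lag}^-|_{\mathrm{Lag}^W(k)}$ described in (a) is a finite-dimensional orientable vector bundle over $\mathrm{Lag}^W(k)$. If $k=1$, it has a natural orientation.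
   Context: $H$ is a separable complex Hilbert space, $\hat H=H\oplus H$, $H^-=0\oplus H$, $J(x,y)=(y,-x)$. A subspace $L\subset\hat H$ is lagrangian if $JL=L^\perp$; $\mathrm{Lag}$ is the set of lagrangians, topologized by $L\mapsto P_L\in\mathcal B(\hat H)$. $\mathrm{Sym}(E)$ is the space of bounded self-adjoint operators on $E$. The Arnold charts $\mathrm{Sym}(L)\ni S\mapsto\{v+JSv\mid v\in L\}$ make $\mathrm{Lag}$ a real Banach manifold and identify $T_L\mathrm{Lag}$ with $\mathrm{Sym}(L)$. $\mathrm{Lag}^-$ is the open set of $L$ with $\dim(L\cap H^-)<\infty$ and $L+H^-$ closed. For $W\subset H^-$, $W^\omega:=(JW)^\perp$. For $W$ closed of finite codimension $p$, $\mathrm{Lag}^W(k)$ is a submanifold of $\mathrm{Lag}^-$ of codimension $k^2+2pk$. An algebraic complement of a subbundle $E\subset F$ is a subbundle $G\subset F$ with $F=E\oplus G$. In (b), with $V=L\cap W$, the fibre of the complement is $\mathrm{Sym}(V)\oplus\mathrm{Hom}(\ell,V)$; for $k=1$ the natural orientation is the one where $\mathrm{Sym}(V)\cong\mathbb R$ is oriented by the identity of $V$ and $\mathrm{Hom}(\ell,V)$ by its complex structure. *)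

theory Defs
  imports "HOL-Analysis.Analysis" "Jordan_Normal_Form.Determinant"
begin

section \<open>Complex Hilbert spaces\<close>

text \<open>The Hermitian product is antilinear in the first argument.  Its real part is the product of
  the underlying real Hilbert space, which supplies positivity, norm, topology and completeness.\<close>

class complex_hilbert_space = real_inner + complete_space +
  fixes scaleC :: "complex \<Rightarrow> 'a \<Rightarrow> 'a" (infixr \<open>*\<^sub>C\<close> 75)
    and cinner :: "'a \<Rightarrow> 'a \<Rightarrow> complex"
  assumes scaleC_add_right: "c *\<^sub>C (x + y) = c *\<^sub>C x + c *\<^sub>C y"
    and scaleC_add_left: "(c + d) *\<^sub>C x = c *\<^sub>C x + d *\<^sub>C x"
    and scaleC_scaleC: "c *\<^sub>C d *\<^sub>C x = (c * d) *\<^sub>C x"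
    and scaleR_scaleC: "r *\<^sub>R x = complex_of_real r *\<^sub>C x"
    and cinner_commute: "cinner x y = cnj (cinner y x)"
    and cinner_add_left: "cinner (x + y) z = cinner x z + cinner y z"
    and cinner_scaleC_left: "cinner (c *\<^sub>C x) y = cnj c * cinner x y"
    and inner_cinner: "inner x y = Re (cinner x y)"

instantiation complex :: complex_hilbert_space
begin
definition scaleC_complex :: "complex \<Rightarrow> complex \<Rightarrow> complex" where
  "scaleC_complex c x = c * x"
definition cinner_complex :: "complex \<Rightarrow> complex \<Rightarrow> complex" where
  "cinner_complex x y = cnj x * y"
instance
  by standard
     (auto simp: scaleC_complex_def cinner_complex_def algebra_simps scaleR_conv_of_real
        inner_complex_def)
end

instantiation prod :: (complex_hilbert_space, complex_hilbert_space) complex_hilbert_space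
begin
definition scaleC_prod :: "complex \<Rightarrow> 'a \<times> 'b \<Rightarrow> 'a \<times> 'b" where
  "scaleC_prod c x = (c *\<^sub>C fst x, c *\<^sub>C snd x)"
definition cinner_prod :: "'a \<times> 'b \<Rightarrow> 'a \<times> 'b \<Rightarrow> complex" where
  "cinner_prod x y = cinner (fst x) (fst y) + cinner (snd x) (snd y)"
instance
proof
  fix x y z :: "'a \<times> 'b" and c d :: complex and r :: real
  show "c *\<^sub>C (x + y) = c *\<^sub>C x + c *\<^sub>C y"
    by (simp add: scaleC_prod_def scaleC_add_right)
  show "(c + d) *\<^sub>C x = c *\<^sub>C x + d *\<^sub>C x"
    by (simp add: scaleC_prod_def scaleC_add_left)
  show "c *\<^sub>C d *\<^sub>C x = (c * d) *\<^sub>C x"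
    by (simp add: scaleC_prod_def scaleC_scaleC)
  show "r *\<^sub>R x = complex_of_real r *\<^sub>C x"
    by (simp add: scaleC_prod_def scaleR_prod_def scaleR_scaleC)
  show "cinner x y = cnj (cinner y x)"
    unfolding cinner_prod_def complex_cnj_add
    using cinner_commute[of "fst x" "fst y"] cinner_commute[of "snd x" "snd y"] by simp
  show "cinner (x + y) z = cinner x z + cinner y z"
    by (simp add: cinner_prod_def cinner_add_left)
  show "cinner (c *\<^sub>C x) y = cnj c * cinner x y"
    by (simp add: cinner_prod_def scaleC_prod_def cinner_scaleC_left distrib_left)
  show "inner x y = Re (cinner x y)"
    by (simp add: cinner_prod_def inner_prod_def inner_cinner)
qed
end

global_interpretation cvs: vector_space "scaleC :: complex \<Rightarrow> 'a \<Rightarrow> 'a::complex_hilbert_space"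
proof
  show "1 *\<^sub>C x = x" for x :: 'a
    using scaleR_scaleC[of 1 x] by simp
qed (simp_all add: scaleC_add_right scaleC_add_left scaleC_scaleC)

definition corth :: "'a::complex_hilbert_space set \<Rightarrow> 'a set" where
  "corth E = {x. \<forall>y\<in>E. cinner y x = 0}"

definition cfinite_dim :: "'a::complex_hilbert_space set \<Rightarrow> bool" where
  "cfinite_dim E \<longleftrightarrow> (\<exists>B. finite B \<and> E \<subseteq> cvs.span B)"

definition cfinite_codim_in :: "'a::complex_hilbert_space set \<Rightarrow> 'a set \<Rightarrow> bool" where
  "cfinite_codim_in W E \<longleftrightarrow> W \<subseteq> E \<and> (\<exists>B. finite B \<and> cvs.span (W \<union> B) = E)"

definition is_orth_decomp3 ::
    "'a::complex_hilbert_space set \<Rightarrow> 'a set \<Rightarrow> 'a set \<Rightarrow> 'a set \<Rightarrow> bool" where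
  "is_orth_decomp3 L A B C \<longleftrightarrow>
     cvs.subspace A \<and> cvs.subspace B \<and> cvs.subspace C \<and>
     A \<subseteq> corth B \<and> A \<subseteq> corth C \<and> B \<subseteq> corth C \<and>
     L = {a + b + c | a b c. a \<in> A \<and> b \<in> B \<and> c \<in> C}"

subsection \<open>Operators\<close>

text \<open>A bounded complex linear operator between closed subspaces \<open>E\<close>, \<open>F\<close> of a Hilbert space is
  represented by its extension by zero on the orthogonal complement of \<open>E\<close>; this is isometric for
  the operator norm.  Bounded real linear maps are the library's \<open>blinfun\<close>.\<close>

definition Hom_op ::
    "'a::complex_hilbert_space set \<Rightarrow> 'a set \<Rightarrow> ('a \<Rightarrow>\<^sub>L 'a) set" where
  "Hom_op E F = {A. (\<forall>c x. blinfun_apply A (c *\<^sub>C x) = c *\<^sub>C blinfun_apply A x) \<and>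
                    (\<forall>x. blinfun_apply A x \<in> F) \<and>
                    (\<forall>x\<in>corth E. blinfun_apply A x = 0)}"

definition Sym_op :: "'a::complex_hilbert_space set \<Rightarrow> ('a \<Rightarrow>\<^sub>L 'a) set" where
  "Sym_op E = {A \<in> Hom_op E E.
     \<forall>x y. cinner (blinfun_apply A x) y = cinner x (blinfun_apply A y)}"

definition hadjoint :: "('a::complex_hilbert_space \<Rightarrow>\<^sub>L 'a) \<Rightarrow> ('a \<Rightarrow>\<^sub>L 'a)" where
  "hadjoint A = (THE B. \<forall>x y. cinner (blinfun_apply A x) y = cinner x (blinfun_apply B y))"

definition orth_proj :: "'a::complex_hilbert_space set \<Rightarrow> ('a \<Rightarrow>\<^sub>L 'a)" where
  "orth_proj E = Blinfun (\<lambda>x. THE y. y \<in> E \<and> x - y \<in> corth E)"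

definition i_op :: "'a::complex_hilbert_space \<Rightarrow>\<^sub>L 'a" where
  "i_op = Blinfun (\<lambda>x. \<i> *\<^sub>C x)"

section \<open>Smooth maps\<close>

text \<open>On open subsets of Banach spaces, \<open>smooth_on\<close> is smoothness in the usual Frechet sense:
  the higher derivatives are only required to be continuous and differentiable after evaluation on
  fixed vectors, but by the uniform boundedness principle this costs just one order of
  differentiability, hence nothing when all orders are required.\<close>

primrec Ck_on ::
    "nat \<Rightarrow> 'a::real_normed_vector set \<Rightarrow> ('a \<Rightarrow> 'b::real_normed_vector) \<Rightarrow> bool" where
  "Ck_on 0 U f \<longleftrightarrow> continuous_on U f"
| "Ck_on (Suc n) U f \<longleftrightarrow>
     (\<exists>f'. (\<forall>x\<in>U. (f has_derivative f' x) (at x)) \<and> (\<forall>v. Ck_on n U (\<lambda>x. f' x v)))"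

definition smooth_on ::
    "'a::real_normed_vector set \<Rightarrow> ('a \<Rightarrow> 'b::real_normed_vector) \<Rightarrow> bool" where
  "smooth_on U f \<longleftrightarrow> (\<forall>n. Ck_on n U f)"

section \<open>Linear orientations\<close>

definition ordered_basis :: "'v::real_vector set \<Rightarrow> 'v list \<Rightarrow> bool" where
  "ordered_basis C bs \<longleftrightarrow> distinct bs \<and> independent (set bs) \<and> span (set bs) = C"

definition same_oriented :: "'v::real_vector list \<Rightarrow> 'v list \<Rightarrow> bool" where
  "same_oriented bs cs \<longleftrightarrow> length cs = length bs \<and>
     (\<exists>M \<in> carrier_mat (length bs) (length bs).
        (\<forall>j < length bs. cs ! j = (\<Sum>i < length bs. (M $$ (i, j)) *\<^sub>R (bs ! i))) \<and>
        Determinant.det M > (0::real))"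

text \<open>An orientation of a finite-dimensional real vector space is an equivalence class of ordered
  bases, two bases being equivalent if the determinant of the change of basis is positive.\<close>

definition is_orientation :: "'v::real_vector set \<Rightarrow> 'v list set \<Rightarrow> bool" where
  "is_orientation C Or \<longleftrightarrow>
     (\<exists>bs. ordered_basis C bs \<and> Or = {cs. ordered_basis C cs \<and> same_oriented bs cs})"

definition algebraic_complement ::
    "'v::real_vector set \<Rightarrow> 'v set \<Rightarrow> 'v set \<Rightarrow> bool" where
  "algebraic_complement F E G \<longleftrightarrow>
     subspace F \<and> subspace E \<and> subspace G \<and> E \<inter> G = {0} \<and> F = {e + g | e g. e \<in> E \<and> g \<in> G}"

section \<open>The lagrangian Grassmannian\<close>

definition Jmap :: "'h::complex_hilbert_space \<times> 'h \<Rightarrow> 'h \<times> 'h" where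
  "Jmap z = (snd z, - fst z)"

definition Hminus :: "('h::complex_hilbert_space \<times> 'h) set" where
  "Hminus = {0} \<times> UNIV"

definition Lag :: "('h::complex_hilbert_space \<times> 'h) set set" where
  "Lag = {L. cvs.subspace L \<and> Jmap ` L = corth L}"

definition Lagminus :: "('h::complex_hilbert_space \<times> 'h) set set" where
  "Lagminus = {L \<in> Lag. cfinite_dim (L \<inter> Hminus) \<and>
                        closed {x + y | x y. x \<in> L \<and> y \<in> Hminus}}"

definition omega_compl :: "('h::complex_hilbert_space \<times> 'h) set \<Rightarrow> ('h \<times> 'h) set" where
  "omega_compl W = corth (Jmap ` W)"

text \<open>\<open>cvs.dim\<close> is \<open>0\<close> on infinite-dimensional spaces, but \<open>L \<inter> W\<close> is finite-dimensional
  whenever \<open>L\<close> is in \<open>Lagminus\<close> and \<open>W \<subseteq> Hminus\<close>.\<close>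

definition LagW :: "('h::complex_hilbert_space \<times> 'h) set \<Rightarrow> nat \<Rightarrow> ('h \<times> 'h) set set" where
  "LagW W k = {L \<in> Lagminus. cvs.dim (L \<inter> W) = k}"

subsection \<open>Arnold charts, tangent vectors\<close>

definition arnold ::
    "('h::complex_hilbert_space \<times> 'h) set \<Rightarrow> (('h \<times> 'h) \<Rightarrow>\<^sub>L ('h \<times> 'h)) \<Rightarrow> ('h \<times> 'h) set" where
  "arnold L S = {v + Jmap (blinfun_apply S v) | v. v \<in> L}"

text \<open>\<open>velocity L \<gamma> A\<close>: near time \<open>0\<close>, \<open>\<gamma>\<close> is a smooth curve in \<open>Lag\<close> with \<open>\<gamma> 0 = L\<close>, and
  \<open>A \<in> Sym_op L\<close> is its velocity at \<open>0\<close> under the identification of the tangent space at \<open>L\<close> with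
  \<open>Sym_op L\<close> given by the Arnold chart centred at \<open>L\<close>.\<close>

definition velocity ::
    "('h::complex_hilbert_space \<times> 'h) set \<Rightarrow> (real \<Rightarrow> ('h \<times> 'h) set) \<Rightarrow>
     (('h \<times> 'h) \<Rightarrow>\<^sub>L ('h \<times> 'h)) \<Rightarrow> bool" where
  "velocity L \<gamma> A \<longleftrightarrow>
     (\<exists>\<epsilon>>0. \<exists>\<sigma>. smooth_on {-\<epsilon><..<\<epsilon>} \<sigma> \<and>
        (\<forall>t\<in>{-\<epsilon><..<\<epsilon>}. \<sigma> t \<in> Sym_op L \<and> \<gamma> t = arnold L (\<sigma> t)) \<and>
        \<sigma> 0 = 0 \<and> (\<sigma> has_vector_derivative A) (at 0))"

definition tangent_space ::
    "('h::complex_hilbert_space \<times> 'h) set set \<Rightarrow> ('h \<times> 'h) set \<Rightarrow>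
     (('h \<times> 'h) \<Rightarrow>\<^sub>L ('h \<times> 'h)) set" where
  "tangent_space N L = {A. \<exists>\<gamma>. velocity L \<gamma> A \<and> (\<exists>\<epsilon>>0. \<forall>t\<in>{-\<epsilon><..<\<epsilon>}. \<gamma> t \<in> N)}"

text \<open>The differential at \<open>S\<close> of the Arnold chart centred at \<open>L\<close>, i.e. the trivialisation of the
  tangent bundle of \<open>Lag\<close> that this chart induces: it maps \<open>T \<in> Sym_op L\<close> to a tangent vector at
  \<open>arnold L S\<close>, that is, to an element of \<open>Sym_op (arnold L S)\<close>.\<close>

definition arnold_deriv ::
    "('h::complex_hilbert_space \<times> 'h) set \<Rightarrow> (('h \<times> 'h) \<Rightarrow>\<^sub>L ('h \<times> 'h)) \<Rightarrow>
     (('h \<times> 'h) \<Rightarrow>\<^sub>L ('h \<times> 'h)) \<Rightarrow> (('h \<times> 'h) \<Rightarrow>\<^sub>L ('h \<times> 'h))" where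
  "arnold_deriv L S T = (THE A. velocity (arnold L S) (\<lambda>t. arnold L (S + t *\<^sub>R T)) A)"

subsection \<open>Subbundles of the restriction of the tangent bundle to a submanifold\<close>

text \<open>\<open>local_frame N C L ss\<close>: on a neighbourhood in \<open>N\<close> of its point \<open>L\<close>, the list \<open>ss\<close> is a
  smooth frame of the family \<open>C\<close> of subspaces of the tangent spaces of \<open>Lag\<close> along \<open>N\<close>, written in
  the Arnold chart centred at \<open>L\<close>.  A section over the submanifold \<open>N\<close> is smooth if it is locally
  the restriction of a smooth map on the ambient manifold.  As \<open>Sym_op L\<close> is a complemented
  subspace of the space of all operators, the smooth maps on its open subsets are the
  restrictions of smooth maps on open sets \<open>U\<close> of operators.  The frame at the point
  \<open>arnold L S\<close> is \<open>frame_at L ss S\<close>.\<close>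

definition frame_at ::
    "('h::complex_hilbert_space \<times> 'h) set \<Rightarrow>
     ((('h \<times> 'h) \<Rightarrow>\<^sub>L ('h \<times> 'h)) \<Rightarrow> (('h \<times> 'h) \<Rightarrow>\<^sub>L ('h \<times> 'h))) list \<Rightarrow>
     (('h \<times> 'h) \<Rightarrow>\<^sub>L ('h \<times> 'h)) \<Rightarrow> (('h \<times> 'h) \<Rightarrow>\<^sub>L ('h \<times> 'h)) list" where
  "frame_at L ss S = map (\<lambda>s. arnold_deriv L S (s S)) ss"

definition local_frame ::
    "('h::complex_hilbert_space \<times> 'h) set set \<Rightarrow>
     (('h \<times> 'h) set \<Rightarrow> (('h \<times> 'h) \<Rightarrow>\<^sub>L ('h \<times> 'h)) set) \<Rightarrow> ('h \<times> 'h) set \<Rightarrow>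
     (('h \<times> 'h) \<Rightarrow>\<^sub>L ('h \<times> 'h)) set \<Rightarrow>
     ((('h \<times> 'h) \<Rightarrow>\<^sub>L ('h \<times> 'h)) \<Rightarrow> (('h \<times> 'h) \<Rightarrow>\<^sub>L ('h \<times> 'h))) list \<Rightarrow> bool" where
  "local_frame N C L U ss \<longleftrightarrow>
     open U \<and> 0 \<in> U \<and>
     (\<forall>s\<in>set ss. smooth_on U s \<and> (\<forall>S \<in> U \<inter> Sym_op L. s S \<in> Sym_op L)) \<and>
     (\<forall>S \<in> U \<inter> Sym_op L. arnold L S \<in> N \<longrightarrow>
        ordered_basis (C (arnold L S)) (frame_at L ss S))"

definition finite_rank_subbundle ::
    "('h::complex_hilbert_space \<times> 'h) set set \<Rightarrow>
     (('h \<times> 'h) set \<Rightarrow> (('h \<times> 'h) \<Rightarrow>\<^sub>L ('h \<times> 'h)) set) \<Rightarrow> bool" where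
  "finite_rank_subbundle N C \<longleftrightarrow>
     (\<forall>L\<in>N. subspace (C L) \<and> C L \<subseteq> Sym_op L) \<and>
     (\<exists>n. \<forall>L\<in>N. \<exists>U ss. length ss = n \<and> local_frame N C L U ss)"

text \<open>An orientation of the bundle is a choice of orientations of the fibres which near every point
  is represented by a local frame.\<close>

definition bundle_orientation ::
    "('h::complex_hilbert_space \<times> 'h) set set \<Rightarrow>
     (('h \<times> 'h) set \<Rightarrow> (('h \<times> 'h) \<Rightarrow>\<^sub>L ('h \<times> 'h)) set) \<Rightarrow>
     (('h \<times> 'h) set \<Rightarrow> (('h \<times> 'h) \<Rightarrow>\<^sub>L ('h \<times> 'h)) list set) \<Rightarrow> bool" where
  "bundle_orientation N C Or \<longleftrightarrow>
     (\<forall>L\<in>N. is_orientation (C L) (Or L)) \<and>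
     (\<forall>L\<in>N. \<exists>U ss. local_frame N C L U ss \<and>
        (\<forall>S \<in> U \<inter> Sym_op L. arnold L S \<in> N \<longrightarrow> frame_at L ss S \<in> Or (arnold L S)))"

definition orientable_bundle ::
    "('h::complex_hilbert_space \<times> 'h) set set \<Rightarrow>
     (('h \<times> 'h) set \<Rightarrow> (('h \<times> 'h) \<Rightarrow>\<^sub>L ('h \<times> 'h)) set) \<Rightarrow> bool" where
  "orientable_bundle N C \<longleftrightarrow> (\<exists>Or. bundle_orientation N C Or)"

subsection \<open>The complement of the tangent bundle of \<open>LagW W k\<close>\<close>

definition ell :: "('h::complex_hilbert_space \<times> 'h) set \<Rightarrow> ('h \<times> 'h) set \<Rightarrow> ('h \<times> 'h) set" where
  "ell W L = (L \<inter> omega_compl W) \<inter> corth (L \<inter> W)"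

definition Lam :: "('h::complex_hilbert_space \<times> 'h) set \<Rightarrow> ('h \<times> 'h) set \<Rightarrow> ('h \<times> 'h) set" where
  "Lam W L = L \<inter> corth (L \<inter> omega_compl W)"

text \<open>With operators extended by zero, \<open>block_op S1 S2\<close> is the block matrix whose blocks are
  \<open>S1 : ell W L \<rightarrow> L \<inter> W\<close>, its adjoint, \<open>S2 : L \<inter> W \<rightarrow> L \<inter> W\<close>, and zero.\<close>

definition block_op :: "('a::complex_hilbert_space \<Rightarrow>\<^sub>L 'a) \<Rightarrow> ('a \<Rightarrow>\<^sub>L 'a) \<Rightarrow> ('a \<Rightarrow>\<^sub>L 'a)" where
  "block_op S1 S2 = hadjoint S1 + S1 + S2"

definition compl_fibre ::
    "('h::complex_hilbert_space \<times> 'h) set \<Rightarrow> ('h \<times> 'h) set \<Rightarrow>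
     (('h \<times> 'h) \<Rightarrow>\<^sub>L ('h \<times> 'h)) set" where
  "compl_fibre W L = {S \<in> Sym_op L.
     \<exists>S1 \<in> Hom_op (ell W L) (L \<inter> W). \<exists>S2 \<in> Hom_op (L \<inter> W) (L \<inter> W). S = block_op S1 S2}"

text \<open>For \<open>dim (L \<inter> W) = 1\<close>: the direct sum of the orientation of \<open>Sym_op (L \<inter> W)\<close> given by the
  identity of \<open>L \<inter> W\<close> (extended by zero, this is \<open>orth_proj (L \<inter> W)\<close>) and of the complex
  orientation of \<open>Hom_op (ell W L) (L \<inter> W)\<close>.  The latter is represented by
  \<open>T\<^sub>1, \<i>T\<^sub>1, \<dots>, T\<^sub>p, \<i>T\<^sub>p\<close> for complex bases \<open>T\<^sub>1, \<dots>, T\<^sub>p\<close>, i.e. lists for which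
  \<open>realify [T\<^sub>1, \<dots>, T\<^sub>p]\<close> is a real basis.  The order of the two summands is immaterial because
  the second one has even real dimension.\<close>

definition realify :: "('a::complex_hilbert_space \<Rightarrow>\<^sub>L 'a) list \<Rightarrow> ('a \<Rightarrow>\<^sub>L 'a) list" where
  "realify Ts = concat (map (\<lambda>T. [T, i_op o\<^sub>L T]) Ts)"

definition natural_orientation ::
    "('h::complex_hilbert_space \<times> 'h) set \<Rightarrow> ('h \<times> 'h) set \<Rightarrow>
     (('h \<times> 'h) \<Rightarrow>\<^sub>L ('h \<times> 'h)) list set" where
  "natural_orientation W L = {bs. ordered_basis (compl_fibre W L) bs \<and>
     (\<exists>Ts. ordered_basis (Hom_op (ell W L) (L \<inter> W)) (realify Ts) \<and>
        same_oriented
          (block_op 0 (orth_proj (L \<inter> W)) # map (\<lambda>T. block_op T 0) (realify Ts)) bs)}"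

end

theory Submission
  imports Defs
begin

text \<open>
  Write \<open>V = L \<inter> W\<close> and \<open>Z = L \<inter> W\<^sup>\<omega>\<close>.  The operators of (a) are the self-adjoint operators that map
  \<open>V\<^sup>\<bottom>\<close> to \<open>V\<close> and vanish on \<open>Z\<^sup>\<bottom>\<close>, so they depend only on the flag \<open>V \<subseteq> Z\<close>, and every isomorphism \<open>\<Phi>\<close> of flags
  transports them by \<open>A \<mapsto> \<Phi> A \<Phi>\<^sup>*\<close>.  The tangent space of \<open>LagW W k\<close> consists of the \<open>A\<close> with
  \<open>\<langle>A v, u\<rangle> = 0\<close> for \<open>v \<in> V\<close>, \<open>u \<in> Z\<close>: differentiate \<open>v\<^sub>t + J \<sigma>\<^sub>t v\<^sub>t \<in> W\<close> for one inclusion, and write down an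
  explicit polynomial curve for the other.

  Near \<open>L\<close>, the spaces \<open>L' \<inter> W\<close> and \<open>L' \<inter> W\<^sup>\<omega>\<close> are parametrised by \<open>V\<close> and \<open>Z\<close> through the solution of a coercive
  linear equation that depends smoothly on \<open>L'\<close>; this yields flag isomorphisms depending smoothly on \<open>L'\<close>, hence
  local frames.  The rank is constant since \<open>Z\<close> modulo \<open>V\<close> is a lagrangian subspace of the reduction of \<open>W\<^sup>\<omega>\<close> modulo
  \<open>W\<close>.  Two isomorphisms between the same flags are joined by a connected family, the nonsingular members of a complex
  pencil, so they transport bases with the same orientation.  This makes any choice of orientation on one fibre spread
  consistently, and for \<open>k = 1\<close> it applies to the natural orientation, which is preserved by the isomorphisms respecting
  the decomposition \<open>Z = V \<oplus> \<ell>\<close>.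
\<close>

section \<open>Real Hilbert spaces\<close>

text \<open>\<open>Lagminus\<close> only asks for a closed sum, while the coercive equation needs a
  number: a lower bound \<open>c\<close> for the distance of unit vectors of one space to the other.
  It is extracted once, for \<open>Hminus\<close>, by uniform boundedness. It passes to
  \<open>W\<close> and to \<open>omega_compl W\<close> because each step changes a space by finitely
  many dimensions, and it survives operators whose size is limited by \<open>c\<close>. Congruence
  by \<open>\<Phi>\<close> needs neither unitarity nor compatibility with the splitting of
  \<open>Z\<close>, because \<open>adj \<Phi>\<close> carries the orthogonal complements of the
  target flag to those of the source. Hence no moving orthonormal frames occur, and the admissible
  \<open>\<Phi>\<close> are cut out of a complex vector space by nonsingularity alone. The
  differential of an Arnold chart is itself a congruence, by the orthogonal projection onto the
  target. A frame built at \<open>arnold L S\<close> is brought back into the chart by the factor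
  \<open>1 + S S\<close>, without inverting that differential. The analysis is done for the real
  product; Hermitian statements follow because complex subspaces and operators are compatible with
  multiplication by \<open>i\<close>.\<close>

lemma parallelogram_law:
  fixes x y :: "'a::real_inner"
  shows "(norm (x + y))\<^sup>2 + (norm (x - y))\<^sup>2 = 2 * (norm x)\<^sup>2 + 2 * (norm y)\<^sup>2"
  by (simp add: power2_norm_eq_inner inner_add_left inner_add_right inner_diff_left inner_diff_right)

text \<open>A minimising sequence for the distance is Cauchy by the parallelogram law, midpoints
  being in \<open>M\<close>. Its limit \<open>y\<close> is orthogonal to \<open>z\<close>, since
  otherwise subtracting a multiple of \<open>z\<close> would shorten \<open>x - y\<close>.\<close>

lemma closed_subspace_projection_exists:
  fixes M :: "'a::{real_inner,complete_space} set"
  assumes M: "subspace M" "closed M"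
  shows "\<exists>y\<in>M. \<forall>z\<in>M. inner z (x - y) = 0"
proof -
  have ne: "M \<noteq> {}" using M subspace_0 by blast
  define d where "d = infdist x M"
  have d0: "0 \<le> d" by (simp add: d_def infdist_nonneg)
  have dle: "d \<le> norm (x - z)" if "z \<in> M" for z
    using infdist_le[OF that, of x] by (simp add: d_def dist_norm)
  have "\<exists>y\<in>M. norm (x - y) < d + 1 / Suc n" for n
  proof (rule ccontr)
    assume "\<not> ?thesis"
    then have "\<forall>y\<in>M. d + 1 / Suc n \<le> dist x y" by (auto simp: dist_norm not_less)
    then have "d + 1 / Suc n \<le> infdist x M"
      unfolding infdist_notempty[OF ne] using ne by (intro cINF_greatest) auto
    then show False by (simp add: d_def)
  qed
  then obtain Y where Y: "\<And>n. Y n \<in> M" "\<And>n. norm (x - Y n) < d + 1 / Suc n" by metis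
  have close: "(norm (Y m - Y n))\<^sup>2 \<le> 4 * (2 * d + 1) * (1 / Suc N)" if "m \<ge> N" "n \<ge> N" for m n N
  proof -
    let ?e = "1 / Suc N"
    have b: "norm (x - Y k) \<le> d + ?e" if "k \<ge> N" for k
    proof -
      have "1 / Suc k \<le> 1 / Suc N" using that by (simp add: frac_le)
      then show ?thesis using Y(2)[of k] by linarith
    qed
    have mid: "(1/2) *\<^sub>R (Y m + Y n) \<in> M" using M Y by (simp add: subspace_add subspace_scale)
    have "(x - Y m) + (x - Y n) = 2 *\<^sub>R (x - (1/2) *\<^sub>R (Y m + Y n))"
      by (simp add: algebra_simps scaleR_2)
    then have "norm ((x - Y m) + (x - Y n)) = 2 * norm (x - (1/2) *\<^sub>R (Y m + Y n))" by simp
    then have "2 * d \<le> norm ((x - Y m) + (x - Y n))" using dle[OF mid] by simp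
    then have s: "(2 * d)\<^sup>2 \<le> (norm ((x - Y m) + (x - Y n)))\<^sup>2" using d0 by (intro power_mono) auto
    have "(norm (Y m - Y n))\<^sup>2 = (norm ((x - Y m) - (x - Y n)))\<^sup>2"
      by (simp add: norm_minus_commute)
    also have "\<dots> = 2 * (norm (x - Y m))\<^sup>2 + 2 * (norm (x - Y n))\<^sup>2
        - (norm ((x - Y m) + (x - Y n)))\<^sup>2"
      using parallelogram_law[of "x - Y m" "x - Y n"] by simp
    also have "\<dots> \<le> 2 * (d + ?e)\<^sup>2 + 2 * (d + ?e)\<^sup>2 - (2 * d)\<^sup>2"
      using s power_mono[OF b[OF that(1)], of 2] power_mono[OF b[OF that(2)], of 2] by simp
    also have "\<dots> = 4 * (2 * d + ?e) * ?e" by (simp add: power2_eq_square algebra_simps)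
    also have "\<dots> \<le> 4 * (2 * d + 1) * ?e" by (intro mult_right_mono) (auto simp: field_simps)
    finally show ?thesis .
  qed
  have "Cauchy Y"
  proof (rule metric_CauchyI)
    fix e :: real assume e: "e > 0"
    define a where "a = 4 * (2 * d + 1)"
    have a: "a > 0" using d0 by (simp add: a_def)
    obtain N :: nat where "a / e\<^sup>2 < real N" using reals_Archimedean2 by blast
    then have "a / e\<^sup>2 < real (Suc N)" by simp
    then have N: "a * (1 / Suc N) < e\<^sup>2" using e a by (simp add: field_simps)
    have "dist (Y m) (Y n) < e" if "m \<ge> N" "n \<ge> N" for m n
    proof -
      have "(norm (Y m - Y n))\<^sup>2 < e\<^sup>2" using close[OF that] N by (simp add: a_def)
      then show ?thesis using e by (simp add: dist_norm power2_less_imp_less)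
    qed
    then show "\<exists>N. \<forall>m\<ge>N. \<forall>n\<ge>N. dist (Y m) (Y n) < e" by blast
  qed
  then obtain y where y: "Y \<longlonglongrightarrow> y" using Cauchy_convergent convergent_def by blast
  have yM: "y \<in> M" using M(2) Y(1) y closed_sequentially by blast
  have "(\<lambda>n. norm (x - Y n)) \<longlonglongrightarrow> norm (x - y)" by (intro tendsto_intros y)
  moreover have "(\<lambda>n. d + 1 / Suc n) \<longlonglongrightarrow> d + 0"
    by (intro tendsto_add tendsto_const) (rule LIMSEQ_Suc[OF lim_1_over_n])
  ultimately have yd: "norm (x - y) \<le> d"
    using Y(2) by (metis (no_types, lifting) LIMSEQ_le add_0_right less_imp_le)
  have "inner z (x - y) = 0" if z: "z \<in> M" for z
  proof (cases "z = 0")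
    case False
    \<comment> \<open>The minimiser of the quadratic polynomial in \<open>t\<close> that is expanded
      below.\<close>
    define t where "t = inner z (x - y) / (norm z)\<^sup>2"
    have "y + t *\<^sub>R z \<in> M" using M yM z by (simp add: subspace_add subspace_scale)
    then have "norm (x - y) \<le> norm ((x - y) - t *\<^sub>R z)" using yd dle by (metis diff_diff_eq order_trans)
    then have "(norm (x - y))\<^sup>2 \<le> (norm ((x - y) - t *\<^sub>R z))\<^sup>2" by (intro power_mono) auto
    also have "\<dots> = (norm (x - y))\<^sup>2 - 2 * t * inner z (x - y) + t\<^sup>2 * (norm z)\<^sup>2"
      unfolding power2_norm_eq_inner
      by (simp add: inner_diff_left inner_diff_right inner_commute power2_eq_square)
    also have "\<dots> = (norm (x - y))\<^sup>2 - (inner z (x - y))\<^sup>2 / (norm z)\<^sup>2"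
      using False by (simp add: t_def field_simps power2_eq_square)
    finally have "(inner z (x - y))\<^sup>2 / (norm z)\<^sup>2 \<le> 0" by simp
    then show ?thesis using False by (simp add: divide_le_0_iff)
  qed simp
  then show ?thesis using yM by blast
qed

text \<open>The vector \<open>w\<close>, orthogonal to the kernel of \<open>f\<close>, represents
  \<open>f\<close> up to a scalar: every \<open>z\<close> differs from a multiple of
  \<open>w\<close> by an element of the kernel.\<close>

lemma riesz_representation:
  fixes f :: "'a::{real_inner,complete_space} \<Rightarrow> real"
  assumes f: "bounded_linear f"
  shows "\<exists>w. \<forall>x. f x = inner w x"
proof (cases "\<forall>x. f x = 0")
  case True
  then show ?thesis by (intro exI[of _ 0]) simp
next
  case False
  interpret f: bounded_linear f by fact
  obtain x where x: "f x \<noteq> 0" using False by blast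
  define M where "M = {x. f x = 0}"
  have "subspace M" by (auto simp: M_def subspace_def f.add f.scaleR f.zero)
  moreover have "closed M" unfolding M_def
    by (intro closed_Collect_eq continuous_intros f.continuous_on)
  ultimately obtain y where y: "y \<in> M" "\<forall>z\<in>M. inner z (x - y) = 0"
    using closed_subspace_projection_exists by blast
  define w where "w = x - y"
  have fw: "f w = f x" using y by (simp add: w_def M_def f.diff)
  then have w0: "w \<noteq> 0" using x f.zero by auto
  have "f z = inner ((f w / (norm w)\<^sup>2) *\<^sub>R w) z" for z
  proof -
    have "z - (f z / f w) *\<^sub>R w \<in> M" using fw x by (simp add: M_def f.diff f.scaleR)
    then have "inner (z - (f z / f w) *\<^sub>R w) w = 0" using y by (simp add: w_def)
    then have "inner z w = (f z / f w) * (norm w)\<^sup>2"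
      by (simp add: inner_diff_left power2_norm_eq_inner)
    then show ?thesis using fw x w0 by (simp add: inner_commute field_simps)
  qed
  then show ?thesis by blast
qed

subsection \<open>Adjoints\<close>

text \<open>Taken for the real product, so that it exists for every bounded real-linear operator and
  depends on it in a bounded linear, hence smooth, way. On complex-linear operators it agrees with
  \<open>hadjoint\<close>.\<close>

definition adj :: "('a::{real_inner,complete_space} \<Rightarrow>\<^sub>L 'b::real_inner) \<Rightarrow> ('b \<Rightarrow>\<^sub>L 'a)" where
  "adj A = (SOME B. \<forall>x y. inner (A x) y = inner x (blinfun_apply B y))"

lemma adjoint_exists:
  fixes A :: "'a::{real_inner,complete_space} \<Rightarrow>\<^sub>L 'b::real_inner"
  shows "\<exists>B. \<forall>x y. inner (A x) y = inner x (blinfun_apply B y)"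
proof -
  have "bounded_linear (\<lambda>x. inner (A x) y)" for y
    by (intro bounded_linear_inner_left_comp blinfun.bounded_linear_right)
  then have "\<exists>w. \<forall>x. inner (A x) y = inner w x" for y by (rule riesz_representation)
  then obtain B where B: "\<And>x y. inner (A x) y = inner (B y) x" by metis
  have "bounded_linear B"
  proof (rule bounded_linear_intro[where K = "norm A"])
    fix x y and r :: real
    show "B (x + y) = B x + B y"
      by (rule vector_eq_rdot[THEN iffD1]) (simp add: B[symmetric] inner_add_left inner_add_right)
    show "B (r *\<^sub>R x) = r *\<^sub>R B x"
      by (rule vector_eq_rdot[THEN iffD1]) (simp add: B[symmetric])
    have "(norm (B x))\<^sup>2 = inner (A (B x)) x" by (simp add: power2_norm_eq_inner B)
    also have "\<dots> \<le> norm (A (B x)) * norm x" by (rule norm_cauchy_schwarz)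
    also have "\<dots> \<le> (norm A * norm (B x)) * norm x"
      by (intro mult_right_mono norm_blinfun) auto
    finally have "norm (B x) * norm (B x) \<le> norm (B x) * (norm x * norm A)"
      by (simp add: power2_eq_square mult_ac)
    then show "norm (B x) \<le> norm x * norm A"
      by (cases "norm (B x) = 0") (auto simp: mult_le_cancel_left intro: order_trans[OF norm_ge_zero])
  qed
  then show ?thesis
    by (intro exI[of _ "Blinfun B"]) (simp add: bounded_linear_Blinfun_apply B inner_commute[of _ "B _"])
qed

lemma inner_adj: "inner (blinfun_apply A x) y = inner x (adj A y)"
  using someI_ex[OF adjoint_exists[of A]] unfolding adj_def by blast

lemma inner_adj_left: "inner (adj A y) x = inner y (blinfun_apply A x)"
  by (metis inner_adj inner_commute)

lemma adj_eqI:
  assumes "\<And>x y. inner (blinfun_apply A x) y = inner x (blinfun_apply B y)"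
  shows "adj A = B"
proof (rule blinfun_eqI)
  fix y
  show "adj A y = blinfun_apply B y"
    by (rule vector_eq_ldot[THEN iffD1]) (metis assms inner_adj)
qed

lemma adj_adj [simp]:
  fixes A :: "'a::{real_inner,complete_space} \<Rightarrow>\<^sub>L 'b::{real_inner,complete_space}"
  shows "adj (adj A) = A"
  by (rule adj_eqI) (rule inner_adj_left)

lemma adj_compose:
  fixes A :: "'b::{real_inner,complete_space} \<Rightarrow>\<^sub>L 'c::real_inner"
    and B :: "'a::{real_inner,complete_space} \<Rightarrow>\<^sub>L 'b"
  shows "adj (A o\<^sub>L B) = adj B o\<^sub>L adj A"
  by (rule adj_eqI) (simp add: inner_adj)

lemma norm_adj_le: "norm (adj A) \<le> norm A"
proof (rule norm_blinfun_bound)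
  fix y
  have "(norm (adj A y))\<^sup>2 = inner (A (adj A y)) y" by (simp add: power2_norm_eq_inner inner_adj)
  also have "\<dots> \<le> norm (A (adj A y)) * norm y" by (rule norm_cauchy_schwarz)
  also have "\<dots> \<le> (norm A * norm (adj A y)) * norm y"
    by (intro mult_right_mono norm_blinfun) auto
  finally have "norm (adj A y) * norm (adj A y) \<le> norm (adj A y) * (norm A * norm y)"
    by (simp add: power2_eq_square mult_ac)
  then show "norm (adj A y) \<le> norm A * norm y"
    by (cases "norm (adj A y) = 0") (auto simp: mult_le_cancel_left)
qed simp

lemma bounded_linear_adj: "bounded_linear adj"
  by (rule bounded_linear_intro[where K = 1])
     (auto intro!: adj_eqI simp: norm_adj_le blinfun.add_left blinfun.scaleR_left inner_add_left
        inner_add_right inner_adj)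

lemmas adj_add = bounded_linear_adj[THEN bounded_linear.axioms(1), THEN linear_add]
lemmas adj_scaleR = bounded_linear_adj[THEN bounded_linear.axioms(1), THEN linear_scale]
lemmas adj_zero [simp] = bounded_linear_adj[THEN bounded_linear.axioms(1), THEN linear_0]

lemma adj_id [simp]: "adj id_blinfun = id_blinfun"
  by (rule adj_eqI) simp

subsection \<open>Coercive operators, uniform boundedness\<close>

lemma complete_image_bounded_below:
  fixes T :: "'a::{real_normed_vector,complete_space} \<Rightarrow>\<^sub>L 'b::real_normed_vector"
  assumes "subspace M" "closed M" "c > 0" "\<And>m. m \<in> M \<Longrightarrow> c * norm m \<le> norm (T m)"
  shows "complete (blinfun_apply T ` M)"
  by (rule complete_isometric_image[OF assms(3,1)])
     (use assms in \<open>auto simp: blinfun.bounded_linear_right complete_eq_closed mult.commute\<close>)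

text \<open>Coercivity bounds \<open>A\<close> from below, so the range is closed; it also shows
  that a vector orthogonal to the range vanishes, by pairing that vector with its own image.\<close>

lemma lax_milgram:
  fixes A :: "'a::{real_inner,complete_space} \<Rightarrow>\<^sub>L 'a"
  assumes c: "c > 0" and co: "\<And>x. c * (norm x)\<^sup>2 \<le> inner (A x) x"
  shows "\<exists>B. A o\<^sub>L B = id_blinfun \<and> B o\<^sub>L A = id_blinfun"
proof -
  have bb: "c * norm x \<le> norm (A x)" for x
  proof (cases "x = 0")
    case False
    have "c * (norm x)\<^sup>2 \<le> norm (A x) * norm x" using co norm_cauchy_schwarz order_trans by blast
    then show ?thesis using False by (simp add: power2_eq_square mult.assoc[symmetric])
  qed simp
  have inj: "inj (blinfun_apply A)"
  proof (rule injI)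
    fix x y assume "A x = A y"
    then have "norm (A (x - y)) = 0" by (simp add: blinfun.diff_right)
    then have "norm (x - y) \<le> 0" using bb[of "x - y"] c by (simp add: mult_le_0_iff)
    then show "x = y" by simp
  qed
  have "complete (range (blinfun_apply A))"
    by (rule complete_image_bounded_below[OF _ _ c]) (auto simp: bb)
  then have cl: "closed (range (blinfun_apply A))" by (rule complete_imp_closed)
  have sub: "subspace (range (blinfun_apply A))"
    by (intro linear_subspace_image bounded_linear.linear[OF blinfun.bounded_linear_right]) auto
  have surj: "y \<in> range (blinfun_apply A)" for y
  proof -
    obtain z where z: "z \<in> range (blinfun_apply A)" "\<forall>w\<in>range (blinfun_apply A). inner w (y - z) = 0"
      using closed_subspace_projection_exists[OF sub cl] by blast
    then have "c * (norm (y - z))\<^sup>2 \<le> 0" using co[of "y - z"] by simp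
    then have "y = z" using c by (simp add: mult_le_0_iff)
    then show ?thesis using z by simp
  qed
  define B where "B = inv_into UNIV (blinfun_apply A)"
  have AB: "A (B x) = x" for x unfolding B_def using surj f_inv_into_f by metis
  have BA: "B (A x) = x" for x unfolding B_def using inj by simp
  have "bounded_linear B"
  proof (rule bounded_linear_intro[where K = "1 / c"])
    fix x y and r :: real
    show "B (x + y) = B x + B y" by (metis AB BA blinfun.add_right)
    show "B (r *\<^sub>R x) = r *\<^sub>R B x" by (metis AB BA blinfun.scaleR_right)
    show "norm (B x) \<le> norm x * (1 / c)" using bb[of "B x"] c by (simp add: AB field_simps)
  qed
  then show ?thesis
    by (intro exI[of _ "Blinfun B"] conjI blinfun_eqI)
       (simp_all add: bounded_linear_Blinfun_apply AB BA)
qed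

text \<open>The bound on the inverse depends on \<open>c\<close> only. For a family of operators
  with a common constant it is the uniform bound that \<open>smooth_on_inverse\<close> asks
  for.\<close>

lemma lax_milgram_bound:
  fixes A :: "'a::{real_inner,complete_space} \<Rightarrow>\<^sub>L 'a"
  assumes c: "c > 0" and co: "\<And>x. c * (norm x)\<^sup>2 \<le> inner (A x) x"
  shows "\<exists>B. A o\<^sub>L B = id_blinfun \<and> B o\<^sub>L A = id_blinfun \<and> norm B \<le> 1 / c"
proof -
  obtain B where B: "A o\<^sub>L B = id_blinfun" "B o\<^sub>L A = id_blinfun" using lax_milgram[OF assms] by blast
  have "norm (B x) \<le> 1 / c * norm x" for x
  proof (cases "B x = 0")
    case False
    have "A (B x) = x" using arg_cong[OF B(1), of "\<lambda>T. blinfun_apply T x"] by simp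
    then have "c * (norm (B x))\<^sup>2 \<le> norm x * norm (B x)"
      using co[of "B x"] norm_cauchy_schwarz[of x "B x"] by simp
    then show ?thesis using c False by (simp add: power2_eq_square field_simps)
  qed (use c in simp)
  then have "norm B \<le> 1 / c" using c by (intro norm_blinfun_bound) auto
  then show ?thesis using B by blast
qed

text \<open>Baire's argument written out: nested balls with radii at most \<open>(1/2)^n\<close>, on
  each of which some \<open>b\<close> has a product of absolute value above \<open>n\<close>; their
  common point violates the pointwise bound. In \<open>Lagminus_transv\<close> this does the work of
  the open mapping theorem.\<close>

lemma uniform_boundedness:
  fixes B :: "'a::{real_inner,complete_space} set"
  assumes pw: "\<And>h. \<exists>C. \<forall>b\<in>B. \<bar>inner b h\<bar> \<le> C"
  shows "bounded B"
proof (rule ccontr)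
  assume unb: "\<not> bounded B"
  have step: "\<exists>x' r'. 0 < r' \<and> r' \<le> (1/2)^n \<and> cball x' r' \<subseteq> cball x r \<and>
      (\<exists>b\<in>B. \<forall>h\<in>cball x' r'. \<bar>inner b h\<bar> > real n)" if r: "r > 0" for x r n
  proof -
    \<comment> \<open>This \<open>b\<close> is so long that moving by \<open>u\<close>, half the
      radius in its direction, changes the product with \<open>b\<close> by more than
      \<open>2 * (n + 1)\<close>. So the product exceeds \<open>n + 1\<close> in absolute value at
      \<open>x\<close> or at \<open>x + u\<close>, and on the ball of radius \<open>r'\<close> at
      most 1 of this is lost.\<close>
    obtain b where b: "b \<in> B" "norm b > 4 * (real n + 1) / r"
      using unb by (auto simp: bounded_iff not_le)
    have b0: "norm b > 0" using b r by (smt (verit) divide_pos_pos of_nat_0_le_iff)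
    define u where "u = (r / 2 / norm b) *\<^sub>R b"
    have nu: "norm u = r / 2" using b0 r by (simp add: u_def)
    have bu: "inner b u = r / 2 * norm b"
      using b0 by (simp add: u_def power2_norm_eq_inner[symmetric] power2_eq_square)
    then have "inner b u > 2 * (real n + 1)" using b r by (simp add: field_simps)
    then have "\<bar>inner b x\<bar> > real n + 1 \<or> \<bar>inner b (x + u)\<bar> > real n + 1"
      by (auto simp: inner_add_right)
    then obtain x' where x': "dist x x' \<le> r / 2" "\<bar>inner b x'\<bar> > real n + 1"
      using nu r by (metis dist_norm dist_self add_diff_cancel_left' less_eq_real_def norm_minus_commute half_gt_zero)
    define r' where "r' = min (min (r/2) ((1/2)^n)) (1 / norm b)"
    have r': "0 < r'" "r' \<le> (1/2)^n" "r' \<le> r/2" "r' \<le> 1 / norm b" using r b0 by (auto simp: r'_def)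
    have "cball x' r' \<subseteq> cball x r"
    proof
      fix h assume "h \<in> cball x' r'"
      then have "dist x' h \<le> r/2" using r' by simp
      then show "h \<in> cball x r" using x'(1) dist_triangle[of x h x'] by simp
    qed
    moreover have "\<bar>inner b h\<bar> > real n" if "h \<in> cball x' r'" for h
    proof -
      have "\<bar>inner b (h - x')\<bar> \<le> norm b * norm (h - x')" by (rule Cauchy_Schwarz_ineq2)
      also have "\<dots> \<le> norm b * (1 / norm b)"
        using that r' by (intro mult_left_mono) (auto simp: dist_norm norm_minus_commute)
      also have "\<dots> = 1" using b0 by simp
      finally show ?thesis using x'(2) by (simp add: inner_diff_right)
    qed
    ultimately show ?thesis using b r' by blast
  qed
  define good where "good n p \<longleftrightarrow> snd p > 0 \<and> snd p \<le> (1/2)^n \<and>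
     (\<exists>b\<in>B. \<forall>h\<in>cball (fst p) (snd p). \<bar>inner b h\<bar> > real n)" for n :: nat and p :: "'a \<times> real"
  have "\<exists>p. good 0 p" using step[of 1 0 0] by (auto simp: good_def)
  moreover have "\<exists>q. good (Suc n) q \<and> cball (fst q) (snd q) \<subseteq> cball (fst p) (snd p)"
    if "good n p" for n p
    using step[of "snd p" "Suc n" "fst p"] that by (auto simp: good_def)
  ultimately obtain f where f: "\<And>n. good n (f n)"
    "\<And>n. cball (fst (f (Suc n))) (snd (f (Suc n))) \<subseteq> cball (fst (f n)) (snd (f n))"
    using dependent_nat_choice[of good "\<lambda>n p q. cball (fst q) (snd q) \<subseteq> cball (fst p) (snd p)"]
    by metis
  let ?C = "\<lambda>n. cball (fst (f n)) (snd (f n))"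
  have mono: "?C n \<subseteq> ?C m" if "m \<le> n" for m n
    using that by (rule lift_Suc_antimono_le[of ?C, OF f(2)])
  have cen: "fst (f n) \<in> ?C m" if "m \<le> n" for m n
    using mono[OF that] f(1)[of n] unfolding good_def
    by (meson centre_in_cball less_imp_le subsetD)
  have "Cauchy (\<lambda>n. fst (f n))"
  proof (rule metric_CauchyI)
    fix e :: real assume "e > 0"
    then obtain N where N: "(1/2)^N < e / 2" using real_arch_pow_inv[of "e/2" "1/2"] by auto
    have "dist (fst (f m)) (fst (f n)) < e" if "m \<ge> N" "n \<ge> N" for m n
    proof -
      have "snd (f N) < e / 2" using f(1)[of N] N by (auto simp: good_def)
      then show ?thesis using cen[OF that(1)] cen[OF that(2)]
        by (metis dist_commute dist_triangle_half_r le_less_trans mem_cball)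
    qed
    then show "\<exists>M. \<forall>m\<ge>M. \<forall>n\<ge>M. dist (fst (f m)) (fst (f n)) < e" by blast
  qed
  then obtain h where h: "(\<lambda>n. fst (f n)) \<longlonglongrightarrow> h" using Cauchy_convergent convergent_def by blast
  have hin: "h \<in> ?C m" for m
    by (rule Lim_in_closed_set[OF closed_cball _ _ h])
       (auto intro!: eventually_sequentiallyI[of m] cen simp del: mem_cball)
  obtain C where C: "\<And>b. b \<in> B \<Longrightarrow> \<bar>inner b h\<bar> \<le> C" using pw by blast
  obtain n :: nat where n: "C < real n" using reals_Archimedean2 by blast
  obtain b where "b \<in> B" "\<bar>inner b h\<bar> > real n" using f(1)[of n] hin[of n] unfolding good_def by blast
  then show False using C[of b] n by linarith
qed

section \<open>Complex Hilbert spaces\<close>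

global_interpretation cvp: vector_space_pair
  "scaleC :: complex \<Rightarrow> 'a \<Rightarrow> 'a::complex_hilbert_space"
  "scaleC :: complex \<Rightarrow> 'b \<Rightarrow> 'b::complex_hilbert_space" ..

lemma cinner_add_right: "cinner x (y + z) = cinner x y + cinner x z"
  by (subst (1 2 3) cinner_commute) (simp add: cinner_add_left)

lemma cinner_scaleC_right: "cinner x (c *\<^sub>C y) = c * cinner x y"
  by (subst (1 2) cinner_commute) (simp add: cinner_scaleC_left)

lemma cinner_zero_left [simp]: "cinner 0 y = 0"
  using cinner_scaleC_left[of 0 0 y] by simp

lemma cinner_zero_right [simp]: "cinner y 0 = 0"
  using cinner_scaleC_right[of y 0 0] by simp

lemma cinner_minus_left [simp]: "cinner (- x) y = - cinner x y"
  using cinner_add_left[of x "- x" y] by (simp add: eq_neg_iff_add_eq_0 add.commute)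

lemma cinner_minus_right [simp]: "cinner x (- y) = - cinner x y"
  using cinner_add_right[of x y "- y"] by (simp add: eq_neg_iff_add_eq_0 add.commute)

lemma cinner_diff_left: "cinner (x - y) z = cinner x z - cinner y z"
  using cinner_add_left[of x "- y" z] by simp

lemma cinner_diff_right: "cinner x (y - z) = cinner x y - cinner x z"
  using cinner_add_right[of x y "- z"] by simp

lemmas cinner_bilin = cinner_add_left cinner_add_right cinner_diff_left cinner_diff_right
  cinner_scaleC_left cinner_scaleC_right

lemma cinner_eq_0_commute: "cinner x y = 0 \<longleftrightarrow> cinner y x = 0"
  by (metis cinner_commute complex_cnj_zero_iff)

lemma Im_cinner: "Im (cinner x y) = inner (\<i> *\<^sub>C x) y"
  by (simp add: inner_cinner cinner_scaleC_left)

text \<open>The imaginary part of the Hermitian product is a real product with \<open>i\<close>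
  times the first argument, so identities between Hermitian products split into two real
  ones.\<close>

lemma cinner_eq_iff_inner: "cinner x y = cinner u v \<longleftrightarrow>
    inner x y = inner u v \<and> inner (\<i> *\<^sub>C x) y = inner (\<i> *\<^sub>C u) v"
  by (simp add: complex_eq_iff Im_cinner inner_cinner[symmetric])

lemma cinner_self: "cinner x x = complex_of_real ((norm x)\<^sup>2)"
proof -
  have "Im (cinner x x) = 0" using arg_cong[OF cinner_commute[of x x], of Im] by simp
  then show ?thesis by (simp add: complex_eq_iff power2_norm_eq_inner inner_cinner)
qed

lemma cinner_self_eq_0 [simp]: "cinner x x = 0 \<longleftrightarrow> x = 0"
  by (simp add: cinner_self)

lemma cinner_ext: "(\<And>z. cinner z x = cinner z y) \<Longrightarrow> x = y"
  by (metis cinner_diff_right cinner_self_eq_0 eq_iff_diff_eq_0)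

lemma norm_scaleC: "norm (c *\<^sub>C x) = cmod c * norm x"
proof -
  have "complex_of_real ((norm (c *\<^sub>C x))\<^sup>2) = (c * cnj c) * complex_of_real ((norm x)\<^sup>2)"
    by (simp only: cinner_self[symmetric] cinner_scaleC_left cinner_scaleC_right mult_ac)
  also have "\<dots> = complex_of_real ((cmod c * norm x)\<^sup>2)"
    by (simp only: complex_norm_square[symmetric]) (simp add: power_mult_distrib)
  finally have "(norm (c *\<^sub>C x))\<^sup>2 = (cmod c * norm x)\<^sup>2" using of_real_eq_iff by blast
  then show ?thesis by (simp add: power2_eq_iff_nonneg)
qed

lemma bounded_linear_scaleC: "bounded_linear (\<lambda>x::'a::complex_hilbert_space. c *\<^sub>C x)"
  by (rule bounded_linear_intro[where K = "cmod c"])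
     (simp_all add: scaleC_add_right norm_scaleC scaleR_scaleC scaleC_scaleC mult.commute)

lemma bounded_linear_scaleC_left: "bounded_linear (\<lambda>c. c *\<^sub>C (x::'a::complex_hilbert_space))"
  by (rule bounded_linear_intro[where K = "norm x"])
     (simp_all add: scaleC_add_left norm_scaleC scaleR_scaleC scaleC_scaleC scaleC_complex_def)

text \<open>The factor 2 comes from estimating real and imaginary part separately; the bound serves
  to make \<open>cinner x\<close> continuous.\<close>

lemma cmod_cinner_le: "cmod (cinner x y) \<le> 2 * (norm x * norm y)"
proof -
  have "cmod (cinner x y) \<le> \<bar>Re (cinner x y)\<bar> + \<bar>Im (cinner x y)\<bar>" by (rule cmod_le)
  also have "\<dots> \<le> norm x * norm y + norm (\<i> *\<^sub>C x) * norm y"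
    unfolding Im_cinner inner_cinner[symmetric] by (intro add_mono Cauchy_Schwarz_ineq2)
  finally show ?thesis by (simp add: norm_scaleC)
qed

lemma bounded_linear_cinner_right: "bounded_linear (cinner x)"
  by (rule bounded_linear_intro[where K = "2 * norm x"])
     (use cmod_cinner_le[of x] in
       \<open>simp_all add: cinner_bilin scaleR_scaleC scaleC_complex_def mult_ac\<close>)

lemma csubspace_imp_subspace: "cvs.subspace E \<Longrightarrow> subspace E"
  by (auto simp: cvs.subspace_def subspace_def scaleR_scaleC)

subsection \<open>Orthogonal complements and projections\<close>

definition hsub :: "'a::complex_hilbert_space set \<Rightarrow> bool" where
  "hsub E \<longleftrightarrow> cvs.subspace E \<and> closed E"

text \<open>A complex subspace contains \<open>i\<close> times each of its vectors, so real
  orthogonality to it already controls the imaginary part.\<close>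

lemma corth_iff_inner:
  assumes "cvs.subspace E"
  shows "x \<in> corth E \<longleftrightarrow> (\<forall>y\<in>E. inner y x = 0)"
proof -
  have "cinner y x = 0 \<longleftrightarrow> inner y x = 0 \<and> inner (\<i> *\<^sub>C y) x = 0" for y
    using cinner_eq_iff_inner[of y x 0 0] by simp
  moreover have "\<i> *\<^sub>C y \<in> E" if "y \<in> E" for y using assms that by (rule cvs.subspace_scale)
  ultimately show ?thesis by (auto simp: corth_def)
qed

lemma corthD: "x \<in> corth E \<Longrightarrow> y \<in> E \<Longrightarrow> cinner y x = 0"
  by (simp add: corth_def)

lemma corthD': "x \<in> corth E \<Longrightarrow> y \<in> E \<Longrightarrow> cinner x y = 0"
  by (metis corthD cinner_eq_0_commute)

lemma corth_antimono: "E \<subseteq> F \<Longrightarrow> corth F \<subseteq> corth E"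
  by (auto simp: corth_def)

lemma subset_corth_commute: "E \<subseteq> corth F \<Longrightarrow> F \<subseteq> corth E"
  unfolding corth_def[of E] using corthD' by blast

lemma subset_corth_corth: "E \<subseteq> corth (corth E)"
  by (rule subset_corth_commute) simp

lemma hsub_corth [simp, intro]: "hsub (corth E)"
proof -
  have "corth E = (\<Inter>y\<in>E. {x. cinner y x = 0})" by (auto simp: corth_def)
  moreover have "closed {x. cinner y x = 0}" for y :: 'a
    by (intro closed_Collect_eq continuous_intros
        linear_continuous_on[OF bounded_linear_cinner_right])
  ultimately have "closed (corth E)" by auto
  then show ?thesis by (auto simp: hsub_def corth_def cvs.subspace_def cinner_bilin)
qed

lemma corth_disjoint: "x \<in> E \<Longrightarrow> x \<in> corth E \<Longrightarrow> x = 0"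
  using corthD by fastforce

lemma hsub_0 [simp]: "hsub E \<Longrightarrow> 0 \<in> E"
  by (simp add: hsub_def cvs.subspace_0)
lemma hsub_add: "hsub E \<Longrightarrow> x \<in> E \<Longrightarrow> y \<in> E \<Longrightarrow> x + y \<in> E"
  by (simp add: hsub_def cvs.subspace_add)
lemma hsub_diff: "hsub E \<Longrightarrow> x \<in> E \<Longrightarrow> y \<in> E \<Longrightarrow> x - y \<in> E"
  by (simp add: hsub_def cvs.subspace_diff)
lemma hsub_minus: "hsub E \<Longrightarrow> x \<in> E \<Longrightarrow> - x \<in> E"
  by (simp add: hsub_def cvs.subspace_neg)
lemma hsub_scaleC: "hsub E \<Longrightarrow> x \<in> E \<Longrightarrow> c *\<^sub>C x \<in> E"
  by (simp add: hsub_def cvs.subspace_scale)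
lemma hsub_scaleR: "hsub E \<Longrightarrow> x \<in> E \<Longrightarrow> r *\<^sub>R x \<in> E"
  by (simp add: hsub_scaleC scaleR_scaleC)
lemma hsub_Int: "hsub E \<Longrightarrow> hsub F \<Longrightarrow> hsub (E \<inter> F)"
  by (simp add: hsub_def cvs.subspace_inter closed_Int)

lemma csubspace_neg_iff: "cvs.subspace E \<Longrightarrow> - x \<in> E \<longleftrightarrow> x \<in> E"
  using cvs.subspace_neg[of E x] cvs.subspace_neg[of E "- x"] by auto

lemma csubspace_corth [simp]: "cvs.subspace (corth E)"
  using hsub_corth hsub_def by blast

section \<open>Complex-linear operators and their Hermitian adjoints\<close>

definition clin :: "('a::complex_hilbert_space \<Rightarrow>\<^sub>L 'b::complex_hilbert_space) \<Rightarrow> bool" where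
  "clin A \<longleftrightarrow> (\<forall>c x. blinfun_apply A (c *\<^sub>C x) = c *\<^sub>C blinfun_apply A x)"

lemma clinD: "clin A \<Longrightarrow> A (c *\<^sub>C x) = c *\<^sub>C A x"
  by (simp add: clin_def)

lemma clin_add: "clin A \<Longrightarrow> clin B \<Longrightarrow> clin (A + B)"
  by (simp add: clin_def blinfun.add_left scaleC_add_right)
lemma clin_diff: "clin A \<Longrightarrow> clin B \<Longrightarrow> clin (A - B)"
  by (simp add: clin_def blinfun.diff_left cvs.scale_right_diff_distrib)
lemma clin_compose: "clin A \<Longrightarrow> clin B \<Longrightarrow> clin (A o\<^sub>L B)"
  by (simp add: clin_def)
lemma clin_scaleR: "clin A \<Longrightarrow> clin (r *\<^sub>R A)"
  by (simp add: clin_def blinfun.scaleR_left scaleR_scaleC scaleC_scaleC mult.commute)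
lemma clin_0 [simp]: "clin 0" by (simp add: clin_def)
lemma clin_id [simp]: "clin id_blinfun" by (simp add: clin_def)

lemma clin_inverse:
  fixes A B :: "'a::complex_hilbert_space \<Rightarrow>\<^sub>L 'a"
  assumes "clin A" "A o\<^sub>L B = id_blinfun" "B o\<^sub>L A = id_blinfun" shows "clin B"
  unfolding clin_def
proof (intro allI)
  fix c x
  have AB: "A (B y) = y" and BA: "B (A y) = y" for y
    using arg_cong[OF assms(2), of "\<lambda>T. blinfun_apply T y"] arg_cong[OF assms(3), of "\<lambda>T. blinfun_apply T y"] by auto
  show "B (c *\<^sub>C x) = c *\<^sub>C B x" using BA[of "c *\<^sub>C B x"] by (simp add: clinD[OF assms(1)] AB)
qed

lemmas clin_intros = clin_add clin_diff clin_compose clin_scaleR clin_0 clin_id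

lemma clin_linear: "clin A \<Longrightarrow> Vector_Spaces.linear scaleC scaleC (blinfun_apply A)"
  by (simp add: Vector_Spaces.linear_iff clinD blinfun.add_right cvs.vector_space_axioms)

lemma cinner_adj:
  assumes "clin A" shows "cinner (blinfun_apply A x) y = cinner x (adj A y)"
  unfolding cinner_eq_iff_inner clinD[OF assms, symmetric] by (simp add: inner_adj)

lemma cinner_adj_left:
  assumes "clin A" shows "cinner (adj A y) x = cinner y (blinfun_apply A x)"
  by (metis cinner_adj[OF assms] cinner_commute)

lemma clin_adj: "clin A \<Longrightarrow> clin (adj A)"
  unfolding clin_def[of "adj A"]
  by (intro allI, rule cinner_ext) (simp add: cinner_adj[symmetric] cinner_scaleC_right)

lemma adj_eqI_cinner:
  assumes "\<And>x y. cinner (blinfun_apply A x) y = cinner x (blinfun_apply B y)"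
  shows "adj A = B"
  by (rule adj_eqI) (simp add: inner_cinner assms)

lemma hadjoint_eq_adj: "clin A \<Longrightarrow> hadjoint A = adj A"
  unfolding hadjoint_def
  by (rule the_equality) (use cinner_adj adj_eqI_cinner in blast)+

section \<open>Orthogonal projections onto closed complex subspaces\<close>

lemma orth_proj_ex1:
  assumes "hsub E" shows "\<exists>!y. y \<in> E \<and> x - y \<in> corth E"
proof -
  have E: "cvs.subspace E" "closed E" using assms by (auto simp: hsub_def)
  obtain y where y: "y \<in> E" "\<forall>z\<in>E. inner z (x - y) = 0"
    using closed_subspace_projection_exists[OF csubspace_imp_subspace] E by blast
  show ?thesis
  proof (rule ex1I)
    show "y \<in> E \<and> x - y \<in> corth E" using y E by (simp add: corth_iff_inner)
    fix z assume z: "z \<in> E \<and> x - z \<in> corth E"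
    have "x - y \<in> corth E" using y E by (simp add: corth_iff_inner)
    then have "(x - y) - (x - z) \<in> corth E" using z hsub_diff[OF hsub_corth] by blast
    then have "z - y \<in> corth E" by simp
    moreover have "z - y \<in> E" using z y assms by (simp add: hsub_diff)
    ultimately show "z = y" using corth_disjoint by fastforce
  qed
qed

context
  fixes E :: "'a::complex_hilbert_space set" and p
  assumes E: "hsub E"
  defines "p \<equiv> \<lambda>x. THE y. y \<in> E \<and> x - y \<in> corth E"
begin

private lemma p: "p x \<in> E" "x - p x \<in> corth E"
  using theI'[OF orth_proj_ex1[OF E, of x]] by (simp_all add: p_def)

private lemma p_eqI: "y \<in> E \<Longrightarrow> x - y \<in> corth E \<Longrightarrow> p x = y"
  using orth_proj_ex1[OF E, of x] p[of x] by blast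

private lemma p_blin: "bounded_linear p"
proof (rule bounded_linear_intro[where K = 1])
  fix x y and r :: real
  show "p (x + y) = p x + p y"
    using hsub_add[OF hsub_corth p(2) p(2), of x y] by (intro p_eqI hsub_add E p) (simp add: algebra_simps)
  show "p (r *\<^sub>R x) = r *\<^sub>R p x"
    using hsub_scaleR[OF hsub_corth p(2), of r x]
    by (intro p_eqI hsub_scaleR E p) (simp add: algebra_simps)
  have "inner (p x) (x - p x) = 0" using p corth_iff_inner E hsub_def by blast
  then have "(norm (p x))\<^sup>2 = inner (p x) x" by (simp add: inner_diff_right power2_norm_eq_inner)
  also have "\<dots> \<le> norm (p x) * norm x" by (rule norm_cauchy_schwarz)
  finally show "norm (p x) \<le> norm x * 1"
    by (cases "p x = 0") (auto simp: power2_eq_square)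
qed

private lemma orth_proj_apply: "orth_proj E x = p x"
  unfolding orth_proj_def p_def[symmetric] using p_blin by (simp add: bounded_linear_Blinfun_apply)

lemma orth_proj_in [simp, intro]: "orth_proj E x \<in> E"
  by (simp add: orth_proj_apply p)

lemma orth_proj_diff_in [simp, intro]: "x - orth_proj E x \<in> corth E"
  by (simp add: orth_proj_apply p)

lemma orth_proj_eqI: "y \<in> E \<Longrightarrow> x - y \<in> corth E \<Longrightarrow> orth_proj E x = y"
  by (simp add: orth_proj_apply p_eqI)

end

lemma orth_proj_id [simp]: "hsub E \<Longrightarrow> x \<in> E \<Longrightarrow> orth_proj E x = x"
  by (rule orth_proj_eqI) auto

lemma orth_proj_0 [simp]: "hsub E \<Longrightarrow> x \<in> corth E \<Longrightarrow> orth_proj E x = 0"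
  by (rule orth_proj_eqI) auto

lemma clin_orth_proj [simp]: "hsub E \<Longrightarrow> clin (orth_proj E)"
  unfolding clin_def
  using hsub_scaleC[OF hsub_corth orth_proj_diff_in]
  by (auto intro!: orth_proj_eqI hsub_scaleC simp: cvs.scale_right_diff_distrib[symmetric])

lemma cinner_orth_proj: "hsub E \<Longrightarrow> cinner (orth_proj E x) y = cinner x (orth_proj E y)"
  using corthD[of "y - orth_proj E y" E "orth_proj E x"]
    corthD'[of "x - orth_proj E x" E "orth_proj E y"]
  by (simp add: cinner_bilin)

lemma adj_orth_proj [simp]: "hsub E \<Longrightarrow> adj (orth_proj E) = orth_proj E"
  by (rule adj_eqI_cinner) (rule cinner_orth_proj)

lemma corth_corth: "hsub E \<Longrightarrow> corth (corth E) = E"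
proof
  assume E: "hsub E"
  show "corth (corth E) \<subseteq> E"
  proof
    fix x assume x: "x \<in> corth (corth E)"
    have "x - orth_proj E x \<in> corth (corth E)"
      using x subset_corth_corth[of E] E hsub_diff[OF hsub_corth] by blast
    then have "x - orth_proj E x = 0" using E by (intro corth_disjoint[of _ "corth E"]) auto
    then show "x \<in> E" using E orth_proj_in[of E x] by simp
  qed
qed (rule subset_corth_corth)

lemma orth_proj_corth: "hsub E \<Longrightarrow> orth_proj (corth E) x = x - orth_proj E x"
  by (rule orth_proj_eqI) (use corth_corth in auto)

lemma orth_proj_eq_self_iff: "hsub E \<Longrightarrow> orth_proj E x = x \<longleftrightarrow> x \<in> E"
  using orth_proj_id orth_proj_in by metis

lemma orth_proj_eq_0_iff: "hsub E \<Longrightarrow> orth_proj E x = 0 \<longleftrightarrow> x \<in> corth E"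
  using orth_proj_0 orth_proj_diff_in[of E x] by fastforce

lemma norm_orth_proj_split: "hsub E \<Longrightarrow>
    (norm x)\<^sup>2 = (norm (orth_proj E x))\<^sup>2 + (norm (orth_proj (corth E) x))\<^sup>2"
proof -
  assume E: "hsub E"
  have "inner (orth_proj E x) (x - orth_proj E x) = 0"
    using E corth_iff_inner[of E] orth_proj_in[OF E] orth_proj_diff_in[OF E] by (simp add: hsub_def)
  then show ?thesis unfolding orth_proj_corth[OF E]
    by (simp add: power2_norm_eq_inner inner_diff_left inner_diff_right inner_commute)
qed

lemma norm_orth_proj_le: "hsub E \<Longrightarrow> norm (orth_proj E x) \<le> norm x"
  using norm_orth_proj_split[of E x] by (auto intro: power2_le_imp_le)

lemma orth_proj_Int_corth:
  assumes "hsub E" "hsub F" "E \<subseteq> F"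
  shows "orth_proj (F \<inter> corth E) x = orth_proj F x - orth_proj E x"
proof (rule orth_proj_eqI)
  have PE: "orth_proj E (orth_proj F x) = orth_proj E x"
  proof (rule orth_proj_eqI)
    have "x - orth_proj F x \<in> corth E" using assms corth_antimono by blast
    then have "(x - orth_proj E x) - (x - orth_proj F x) \<in> corth E"
      using assms hsub_diff[OF hsub_corth] by blast
    then show "orth_proj F x - orth_proj E x \<in> corth E" by simp
  qed (use assms in auto)
  show "hsub (F \<inter> corth E)" using assms by (simp add: hsub_Int)
  show "orth_proj F x - orth_proj E x \<in> F \<inter> corth E"
    using assms orth_proj_diff_in[OF assms(1), of "orth_proj F x"] PE
    by (auto intro!: hsub_diff)
  have "x - orth_proj F x \<in> corth (F \<inter> corth E)"
    using assms corth_antimono[of "F \<inter> corth E" F] by blast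
  moreover have "orth_proj E x \<in> corth (F \<inter> corth E)"
    using assms subset_corth_corth[of E] corth_antimono[of "F \<inter> corth E" "corth E"] by blast
  ultimately have "(x - orth_proj F x) + orth_proj E x \<in> corth (F \<inter> corth E)"
    by (rule hsub_add[OF hsub_corth])
  then show "x - (orth_proj F x - orth_proj E x) \<in> corth (F \<inter> corth E)"
    by (simp add: algebra_simps)
qed

subsection \<open>Finite-dimensional perturbations\<close>

text \<open>After replacing \<open>x\<close> by its part \<open>u\<close> orthogonal to
  \<open>M\<close>, the coefficient of \<open>u\<close> in an element of the span is a continuous
  function of that element. The span is then the preimage of \<open>M\<close> under the map that
  subtracts this component.\<close>

lemma closed_span_insert:
  assumes M: "hsub M" shows "hsub (cvs.span (insert x M))"
proof -
  define u where "u = x - orth_proj M x"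
  have sM: "cvs.span M = M" using M by (simp add: hsub_def cvs.span_eq_iff)
  have uo: "u \<in> corth M" using M by (simp add: u_def)
  have mem: "y \<in> cvs.span (insert x M) \<longleftrightarrow> (\<exists>k. y - k *\<^sub>C u \<in> M)" for y
  proof -
    have "y - k *\<^sub>C x \<in> M \<longleftrightarrow> y - k *\<^sub>C u \<in> M" for k
    proof -
      have e: "y - k *\<^sub>C u = (y - k *\<^sub>C x) + k *\<^sub>C orth_proj M x"
        by (simp add: u_def cvs.scale_right_diff_distrib)
      have "k *\<^sub>C orth_proj M x \<in> M" using M by (simp add: hsub_scaleC)
      then show ?thesis unfolding e using hsub_add[OF M] hsub_diff[OF M] by (metis add_diff_cancel_right')
    qed
    then show ?thesis by (simp add: cvs.span_insert sM)
  qed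
  have "closed (cvs.span (insert x M))"
  proof (cases "u = 0")
    case True
    then have "cvs.span (insert x M) = M" using mem by auto
    then show ?thesis using M by (simp add: hsub_def)
  next
    case False
    let ?f = "\<lambda>y. y - (cinner u y / cinner u u) *\<^sub>C u"
    have "y \<in> cvs.span (insert x M) \<longleftrightarrow> ?f y \<in> M" for y
    proof
      assume "y \<in> cvs.span (insert x M)"
      then obtain k where k: "y - k *\<^sub>C u \<in> M" using mem by blast
      have "cinner u (y - k *\<^sub>C u) = 0" using corthD'[OF uo k] .
      then have "k = cinner u y / cinner u u" using False by (simp add: cinner_bilin field_simps)
      then show "?f y \<in> M" using k by simp
    qed (use mem in blast)
    then have "cvs.span (insert x M) = ?f -` M" by auto
    moreover have "continuous_on UNIV ?f"
      unfolding divide_inverse using False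
      by (intro continuous_intros bounded_linear.continuous_on[OF bounded_linear_scaleC_left]
          bounded_linear.continuous_on[OF bounded_linear_cinner_right])
    ultimately show ?thesis using M by (simp add: hsub_def continuous_closed_vimage continuous_on_eq_continuous_within)
  qed
  then show ?thesis by (simp add: hsub_def)
qed

lemma span_insert_Un: "cvs.span (insert x (cvs.span A)) = cvs.span (insert x A)"
  by (simp add: cvs.span_insert cvs.span_span)

lemma closed_span_Un_finite:
  assumes M: "hsub M" and "finite B"
  shows "hsub (cvs.span (M \<union> B))"
  using assms(2)
proof (induction B)
  case empty
  then show ?case using M by (simp add: hsub_def cvs.span_eq_iff[THEN iffD2])
next
  case (insert x B)
  then show ?case using closed_span_insert[of "cvs.span (M \<union> B)" x] by (simp add: span_insert_Un)
qed

lemma hsub_span_finite: "finite B \<Longrightarrow> hsub (cvs.span B)"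
  using closed_span_Un_finite[of "{0}" B] by (simp add: hsub_def cvs.span_insert_0)

section \<open>Dimension counts for finite-dimensional complex subspaces\<close>

lemma cfinite_dimE:
  assumes "cfinite_dim E" "cvs.subspace E"
  obtains B where "finite B" "cvs.independent B" "B \<subseteq> E" "cvs.span B = E" "card B = cvs.dim E"
proof -
  obtain B where B: "B \<subseteq> E" "cvs.independent B" "E \<subseteq> cvs.span B" "card B = cvs.dim E"
    using cvs.basis_exists by blast
  moreover obtain C where "finite C" "E \<subseteq> cvs.span C" using assms(1) cfinite_dim_def by blast
  ultimately have "finite B" using cvs.independent_span_bound by blast
  then show ?thesis using that B assms(2) cvs.span_minimal by blast
qed

lemma cfinite_dim_hsub: "cfinite_dim E \<Longrightarrow> cvs.subspace E \<Longrightarrow> hsub E"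
  using cfinite_dimE hsub_span_finite by metis

lemma cfinite_dim_subset: "cfinite_dim F \<Longrightarrow> E \<subseteq> F \<Longrightarrow> cfinite_dim E"
  by (meson cfinite_dim_def order_trans)

lemma cfinite_dim_image:
  assumes "clin A" "cfinite_dim E" shows "cfinite_dim (blinfun_apply A ` E)"
proof -
  obtain B where "finite B" "E \<subseteq> cvs.span B" using assms(2) cfinite_dim_def by blast
  then have "finite (A ` B)" "A ` E \<subseteq> cvs.span (A ` B)"
    using cvp.linear_span_image[OF clin_linear[OF assms(1)], of B] by auto
  then show ?thesis unfolding cfinite_dim_def by blast
qed

lemma csubspace_image:
  "clin A \<Longrightarrow> cvs.subspace E \<Longrightarrow> cvs.subspace (blinfun_apply A ` E)"
  by (rule cvp.linear_subspace_image[OF clin_linear])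

lemma cdim_le:
  assumes "cfinite_dim F" "cvs.subspace F" "E \<subseteq> F"
  shows "cvs.dim E \<le> cvs.dim F"
proof -
  obtain B where B: "finite B" "cvs.span B = F" "card B = cvs.dim F" using cfinite_dimE assms by metis
  then show ?thesis using cvs.dim_le_card[of E B] assms(3) by simp
qed

lemma csubspace_dim_eq:
  assumes F: "cfinite_dim F" "cvs.subspace F" and E: "cvs.subspace E" "E \<subseteq> F"
    and "cvs.dim F \<le> cvs.dim E"
  shows "E = F"
proof -
  obtain B where B: "finite B" "cvs.span B = F" "card B = cvs.dim F" using cfinite_dimE F by metis
  obtain C where C: "finite C" "cvs.independent C" "C \<subseteq> E" "cvs.span C = E" "card C = cvs.dim E"
    using cfinite_dimE[OF cfinite_dim_subset[OF F(1) E(2)] E(1)] by metis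
  have "F \<subseteq> E"
  proof (rule ccontr)
    assume "\<not> F \<subseteq> E"
    then obtain x where x: "x \<in> F" "x \<notin> cvs.span C" using C by blast
    then have "cvs.independent (insert x C)" using C by (simp add: cvs.independent_insertI)
    moreover have "insert x C \<subseteq> cvs.span B" using B C E x by auto
    ultimately have "card (insert x C) \<le> card B" using cvs.independent_span_bound B by blast
    moreover have "x \<notin> C" using x cvs.span_base by blast
    ultimately show False using C B assms(5) by simp
  qed
  then show ?thesis using E by blast
qed

lemma cdim_image_eq:
  assumes A: "clin A" and E: "cfinite_dim E" "cvs.subspace E" and inj: "inj_on (blinfun_apply A) E"
  shows "cvs.dim (blinfun_apply A ` E) = cvs.dim E"
proof -
  obtain B where B: "finite B" "cvs.independent B" "B \<subseteq> E" "cvs.span B = E" "card B = cvs.dim E"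
    using cfinite_dimE E by metis
  have "cvs.independent (A ` B)"
    using cvp.linear_independent_injective_image[OF clin_linear[OF A] B(2)] inj B by simp
  moreover have "cvs.span (A ` B) = A ` E"
    using cvp.linear_span_image[OF clin_linear[OF A], of B] B by simp
  moreover have "card (A ` B) = card B" using inj B by (metis card_image inj_on_subset)
  ultimately show ?thesis using B by (metis cvs.dim_span_eq_card_independent)
qed

lemma cdim_image_le:
  assumes A: "clin A" and E: "cfinite_dim E" "cvs.subspace E"
  shows "cvs.dim (blinfun_apply A ` E) \<le> cvs.dim E"
proof -
  obtain B where B: "finite B" "cvs.span B = E" "card B = cvs.dim E"
    using cfinite_dimE E by metis
  have "cvs.span (A ` B) = A ` E"
    using cvp.linear_span_image[OF clin_linear[OF A], of B] B by simp
  then have "cvs.dim (A ` E) \<le> card (A ` B)" using B by (intro cvs.dim_le_card) auto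
  also have "\<dots> \<le> card B" using B card_image_le[of B "blinfun_apply A"] by simp
  finally show ?thesis using B by simp
qed

definition ssum :: "'a::complex_hilbert_space set \<Rightarrow> 'a set \<Rightarrow> 'a set" where
  "ssum L Y = {x + y | x y. x \<in> L \<and> y \<in> Y}"

lemma ssum_superset: "0 \<in> A \<Longrightarrow> 0 \<in> B \<Longrightarrow> A \<subseteq> ssum A B \<and> B \<subseteq> ssum A B"
  unfolding ssum_def by force

lemma corth_ssum:
  assumes "0 \<in> A" "0 \<in> B" shows "corth (ssum A B) = corth A \<inter> corth B"
proof (rule subset_antisym)
  show "corth (ssum A B) \<subseteq> corth A \<inter> corth B"
    using ssum_superset[OF assms] corth_antimono[of A "ssum A B"] corth_antimono[of B "ssum A B"] by blast
  show "corth A \<inter> corth B \<subseteq> corth (ssum A B)"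
  proof
    fix x assume x: "x \<in> corth A \<inter> corth B"
    have "cinner (a + b) x = 0" if "a \<in> A" "b \<in> B" for a b
      using x that corthD[of x A a] corthD[of x B b] by (simp add: cinner_add_left)
    then show "x \<in> corth (ssum A B)" by (auto simp: corth_def ssum_def)
  qed
qed

lemma cdim_orth_sum:
  assumes A: "cvs.subspace A" "cfinite_dim A" and B: "cvs.subspace B" "cfinite_dim B" and o: "A \<subseteq> corth B"
  shows "cvs.dim (ssum A B) = cvs.dim A + cvs.dim B" "cfinite_dim (ssum A B)"
proof -
  obtain a where a: "finite a" "cvs.independent a" "a \<subseteq> A" "cvs.span a = A" "card a = cvs.dim A"
    using cfinite_dimE A by metis
  obtain b where b: "finite b" "cvs.independent b" "b \<subseteq> B" "cvs.span b = B" "card b = cvs.dim B"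
    using cfinite_dimE B by metis
  have sp: "cvs.span (a \<union> b) = ssum A B"
    unfolding cvs.span_Un a(4) b(4) ssum_def by blast
  show "cfinite_dim (ssum A B)" unfolding cfinite_dim_def using a(1) b(1) sp by (metis finite_Un order_refl)
  have zero: "x = 0" if "x \<in> A" "x \<in> B" for x using that o corth_disjoint by blast
  have ind: "cvs.independent (a' \<union> b)" if "finite a'" "cvs.independent a'" "a' \<subseteq> A" for a'
    using that
  proof (induction a')
    case empty
    then show ?case using b by simp
  next
    case (insert x a')
    have x: "x \<notin> cvs.span a'" "cvs.independent a'" using insert by (auto simp: cvs.independent_insert)
    have "x \<notin> cvs.span (a' \<union> b)"
    proof
      assume "x \<in> cvs.span (a' \<union> b)"
      then obtain y z where yz: "y \<in> cvs.span a'" "z \<in> B" "x = y + z" unfolding cvs.span_Un b(4) by blast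
      have "y \<in> A" using yz(1) insert.prems A(1) cvs.span_minimal[of a' A] by blast
      then have "x - y \<in> A" using insert.prems A(1) cvs.subspace_diff by blast
      then have "z = 0" using yz zero by simp
      then show False using yz x by simp
    qed
    then show ?case using insert x by (simp add: cvs.independent_insertI)
  qed
  have "a \<inter> b = {}"
  proof (rule ccontr)
    assume "a \<inter> b \<noteq> {}"
    then obtain x where "x \<in> a" "x \<in> b" by blast
    then have "x = 0" using zero a b by blast
    then show False using \<open>x \<in> a\<close> a(2) cvs.dependent_zero by blast
  qed
  then have "card (a \<union> b) = card a + card b" using a b by (simp add: card_Un_disjoint)
  then show "cvs.dim (ssum A B) = cvs.dim A + cvs.dim B"
    using cvs.dim_span_eq_card_independent[OF ind[OF a(1-3)]] sp a b by simp
qed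

lemma cfinite_dim_injective:
  assumes A: "clin A" "cvs.subspace E" "inj_on (blinfun_apply A) E" and F: "cfinite_dim F" "A ` E \<subseteq> F"
  shows "cfinite_dim E"
proof -
  obtain B where B: "B \<subseteq> E" "cvs.independent B" "E \<subseteq> cvs.span B" using cvs.basis_exists by metis
  obtain C where C: "finite C" "F \<subseteq> cvs.span C" using F(1) cfinite_dim_def by blast
  have "cvs.span B \<subseteq> E" using B(1) A(2) cvs.span_minimal by blast
  then have injB: "inj_on A (cvs.span B)" using A(3) inj_on_subset by blast
  then have "cvs.independent (A ` B)"
    using cvp.linear_independent_injective_image[OF clin_linear[OF A(1)] B(2)] by blast
  moreover have "A ` B \<subseteq> cvs.span C" using B(1) F(2) C(2) by blast
  ultimately have "finite (A ` B)" using cvs.independent_span_bound[OF C(1)] by blast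
  moreover have "inj_on A B" by (rule inj_on_subset[OF injB cvs.span_superset])
  ultimately have "finite B" using finite_imageD by blast
  then show ?thesis using B(3) cfinite_dim_def by blast
qed

text \<open>The image of \<open>N\<close> is complete, so \<open>T x\<close> has a positive distance
  \<open>d\<close> to it. This distance controls the coefficient of \<open>x\<close>, and then the
  bound on \<open>N\<close> controls the remaining part; \<open>K\<close> adds up the two
  estimates.\<close>

lemma bounded_below_span_insert:
  fixes T :: "'a::complex_hilbert_space \<Rightarrow>\<^sub>L 'b::complex_hilbert_space"
  assumes T: "clin T" and N: "hsub N" and c: "c > 0"
    and bb: "\<And>n. n \<in> N \<Longrightarrow> c * norm n \<le> norm (T n)" and x: "T x \<notin> T ` N"
  shows "\<exists>c'>0. \<forall>y\<in>cvs.span (insert x N). c' * norm y \<le> norm (T y)"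
proof -
  define F where "F = blinfun_apply T ` N"
  have sN: "cvs.subspace N" "cvs.span N = N" using N by (simp_all add: hsub_def cvs.span_eq_iff)
  have "complete F" unfolding F_def
    using N by (intro complete_image_bounded_below[OF _ _ c bb])
      (auto simp: hsub_def csubspace_imp_subspace)
  then have F: "hsub F" using csubspace_image[OF T sN(1)]
    by (simp add: hsub_def F_def complete_imp_closed)
  define u where "u = T x - orth_proj F (T x)"
  have "orth_proj F (T x) \<noteq> T x" using x orth_proj_eq_self_iff[OF F] by (simp add: F_def)
  then have u: "u \<in> corth F" "u \<noteq> 0" using F by (auto simp: u_def)
  define d where "d = norm u"
  have d: "d > 0" using u by (simp add: d_def)
  define K where "K = (1 + norm (T x) / d) / c + norm x / d"
  have K: "K > 0" unfolding K_def using c d by (intro add_pos_nonneg divide_pos_pos add_pos_nonneg) auto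
  have main: "norm y \<le> K * norm (T y)" if y: "y \<in> cvs.span (insert x N)" for y
  proof -
    obtain k where k: "y - k *\<^sub>C x \<in> N" using y unfolding cvs.span_insert sN by blast
    define n where "n = y - k *\<^sub>C x"
    have n: "n \<in> N" "y = n + k *\<^sub>C x" using k by (auto simp: n_def)
    have Ty: "T y = (T n + k *\<^sub>C orth_proj F (T x)) + k *\<^sub>C u"
      by (simp add: n u_def blinfun.add_right clinD[OF T] cvs.scale_right_diff_distrib)
    have in1: "T n + k *\<^sub>C orth_proj F (T x) \<in> F"
      using F n by (intro hsub_add hsub_scaleC) (auto simp: F_def)
    have in2: "k *\<^sub>C u \<in> corth F" using u by (simp add: hsub_scaleC)
    have "orth_proj F (T y) = T n + k *\<^sub>C orth_proj F (T x)"
      using in1 in2 F by (intro orth_proj_eqI) (auto simp: Ty)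
    then have "orth_proj (corth F) (T y) = k *\<^sub>C u" using F by (simp add: orth_proj_corth Ty)
    then have "norm (k *\<^sub>C u) \<le> norm (T y)" using norm_orth_proj_le[OF hsub_corth, of F "T y"] by simp
    then have kd: "cmod k \<le> norm (T y) / d" using d by (simp add: norm_scaleC d_def field_simps)
    have "T n = T y - k *\<^sub>C T x" by (simp add: n(2) blinfun.add_right clinD[OF T])
    then have "norm (T n) \<le> norm (T y) + cmod k * norm (T x)"
      using norm_triangle_ineq4[of "T y" "k *\<^sub>C T x"] by (simp add: norm_scaleC)
    also have "\<dots> \<le> norm (T y) + norm (T y) / d * norm (T x)"
      by (intro add_left_mono mult_right_mono kd) auto
    also have "\<dots> = (1 + norm (T x) / d) * norm (T y)" by (simp add: field_simps)
    finally have "c * norm n \<le> (1 + norm (T x) / d) * norm (T y)" using bb[OF n(1)] by simp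
    then have nn: "norm n \<le> (1 + norm (T x) / d) / c * norm (T y)" using c by (simp add: field_simps)
    have "norm y \<le> norm n + cmod k * norm x"
      unfolding n(2) using norm_triangle_ineq[of n "k *\<^sub>C x"] by (simp add: norm_scaleC)
    also have "\<dots> \<le> (1 + norm (T x) / d) / c * norm (T y) + norm (T y) / d * norm x"
      by (intro add_mono mult_right_mono kd nn) auto
    also have "\<dots> = K * norm (T y)" by (simp add: K_def algebra_simps)
    finally show ?thesis .
  qed
  show ?thesis
    by (intro exI[of _ "1 / K"] conjI ballI) (use K main in \<open>auto simp: field_simps\<close>)
qed

text \<open>Lower bounds survive finite-dimensional enlargement as long as \<open>T\<close> stays
  injective. In the induction, a new vector whose image is already reached must itself lie in the
  old span; any other one falls under \<open>bounded_below_span_insert\<close>.\<close>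

lemma bounded_below_span_Un_finite:
  fixes T :: "'a::complex_hilbert_space \<Rightarrow>\<^sub>L 'b::complex_hilbert_space"
  assumes T: "clin T" and M: "hsub M" and "c > 0"
    and "\<And>n. n \<in> M \<Longrightarrow> c * norm n \<le> norm (T n)" and "finite B"
    and "\<And>y. y \<in> cvs.span (M \<union> B) \<Longrightarrow> T y = 0 \<Longrightarrow> y = 0"
  shows "\<exists>c'>0. \<forall>y\<in>cvs.span (M \<union> B). c' * norm y \<le> norm (T y)"
  using assms(5,6)
proof (induction B)
  case empty
  then show ?case using assms by (auto simp: hsub_def cvs.span_eq_iff[THEN iffD2])
next
  case (insert x B)
  let ?N = "cvs.span (M \<union> B)"
  have sub: "?N \<subseteq> cvs.span (M \<union> insert x B)" by (intro cvs.span_mono) auto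
  then obtain c' where c': "c' > 0" "\<And>y. y \<in> ?N \<Longrightarrow> c' * norm y \<le> norm (T y)"
    using insert by (metis subsetD)
  have N: "hsub ?N" using closed_span_Un_finite M insert by blast
  have eq: "cvs.span (insert x ?N) = cvs.span (M \<union> insert x B)" by (simp add: span_insert_Un)
  show ?case
  proof (cases "T x \<in> T ` ?N")
    case True
    then obtain n where n: "n \<in> ?N" "T x = T n" by blast
    have "x - n \<in> cvs.span (M \<union> insert x B)"
      using n sub by (intro cvs.span_diff) (auto intro: cvs.span_base)
    then have "x = n" using insert.prems[of "x - n"] n by (simp add: blinfun.diff_right)
    then have "cvs.span (M \<union> insert x B) = ?N" using n eq by (metis cvs.span_redundant cvs.span_span)
    then show ?thesis using c' by auto
  next
    case False
    then show ?thesis using bounded_below_span_insert[OF T N c' False] eq by simp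
  qed
qed

subsection \<open>Operators on finite-dimensional subspaces\<close>

definition rank1 :: "'a::complex_hilbert_space \<Rightarrow> 'a \<Rightarrow> 'a \<Rightarrow>\<^sub>L 'a" where
  "rank1 u w = Blinfun (\<lambda>x. cinner w x *\<^sub>C u)"

lemma rank1_apply [simp]: "rank1 u w x = cinner w x *\<^sub>C u"
  unfolding rank1_def
  using bounded_linear_compose[OF bounded_linear_scaleC_left bounded_linear_cinner_right, of w u]
  by (simp add: bounded_linear_Blinfun_apply)

lemma clin_rank1 [simp]: "clin (rank1 u w)"
  by (simp add: clin_def cinner_scaleC_right scaleC_scaleC)

lemma adj_rank1: "adj (rank1 u w) = rank1 w u"
  by (rule adj_eqI_cinner) (simp add: cinner_bilin cinner_commute[of _ w])

text \<open>Gram-Schmidt for operators: the value at the new basis vector \<open>x\<close> is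
  corrected by a rank-one operator in the direction \<open>u\<close> orthogonal to the earlier span,
  which leaves all earlier values untouched.\<close>

lemma finite_rank_extension:
  fixes g :: "'a::complex_hilbert_space \<Rightarrow> 'a"
  assumes "finite B" "cvs.independent B"
  shows "\<exists>\<Phi>. clin \<Phi> \<and> (\<forall>b\<in>B. \<Phi> b = g b) \<and> (\<forall>x\<in>corth (cvs.span B). \<Phi> x = 0) \<and>
    (\<forall>x. \<Phi> x \<in> cvs.span (g ` B))"
  using assms
proof (induction B)
  case empty
  then show ?case by (intro exI[of _ 0]) simp
next
  case (insert x B)
  have ind: "cvs.independent B" "x \<notin> cvs.span B"
    using insert by (auto simp: cvs.independent_insert)
  then obtain \<Phi> where \<Phi>: "clin \<Phi>" "\<forall>b\<in>B. \<Phi> b = g b" "\<forall>x\<in>corth (cvs.span B). \<Phi> x = 0"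
    "\<forall>x. \<Phi> x \<in> cvs.span (g ` B)" using insert by blast
  let ?N = "cvs.span B"
  have N: "hsub ?N" using insert hsub_span_finite by blast
  define u where "u = x - orth_proj ?N x"
  have "orth_proj ?N x \<noteq> x" using ind orth_proj_eq_self_iff[OF N] by simp
  then have u: "u \<in> corth ?N" "u \<noteq> 0" using N by (auto simp: u_def)
  have ux: "cinner u x = cinner u u"
  proof -
    have "cinner u (orth_proj ?N x) = 0" using u N by (intro corthD'[of _ ?N]) auto
    then show ?thesis by (simp add: u_def cinner_diff_right)
  qed
  have ui: "u \<in> cvs.span (insert x B)"
    unfolding u_def using orth_proj_in[OF N, of x]
    by (intro cvs.span_diff) (auto intro: cvs.span_base cvs.span_mono[THEN subsetD])
  define \<Psi> where "\<Psi> = \<Phi> + rank1 ((1 / cinner u u) *\<^sub>C (g x - \<Phi> x)) u"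
  have "\<Psi> b = g b" if "b \<in> insert x B" for b
  proof (cases "b = x")
    case True
    then show ?thesis using u ux by (simp add: \<Psi>_def blinfun.add_left scaleC_scaleC)
  next
    case False
    then have "cinner u b = 0" using that u by (auto intro: corthD' cvs.span_base)
    then show ?thesis using False that \<Phi> by (simp add: \<Psi>_def blinfun.add_left)
  qed
  moreover have "\<Psi> y = 0" if "y \<in> corth (cvs.span (insert x B))" for y
  proof -
    have "y \<in> corth ?N" using that corth_antimono cvs.span_mono subset_insertI by (metis subsetD)
    moreover have "cinner u y = 0" using that ui corthD by blast
    ultimately show ?thesis using \<Phi> by (simp add: \<Psi>_def blinfun.add_left)
  qed
  moreover have "\<Psi> y \<in> cvs.span (g ` insert x B)" for y
  proof -
    have "\<Phi> z \<in> cvs.span (g ` insert x B)" for z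
      using \<Phi>(4) cvs.span_mono[of "g ` B" "g ` insert x B"] by auto
    then show ?thesis unfolding \<Psi>_def
      by (auto simp: blinfun.add_left intro!: cvs.span_add cvs.span_scale cvs.span_diff intro: cvs.span_base)
  qed
  moreover have "clin \<Psi>" unfolding \<Psi>_def using \<Phi> by (intro clin_intros) auto
  ultimately show ?case by blast
qed

lemma isomorphism_exists:
  fixes V V' :: "'a::complex_hilbert_space set"
  assumes V: "cvs.subspace V" "cfinite_dim V" and V': "cvs.subspace V'" "cfinite_dim V'" and d: "cvs.dim V = cvs.dim V'"
  shows "\<exists>\<Phi>. clin \<Phi> \<and> (\<forall>x\<in>V. \<Phi> x \<in> V') \<and> (\<forall>x\<in>V. \<Phi> x = 0 \<longrightarrow> x = 0)"
proof -
  obtain B where B: "finite B" "cvs.independent B" "cvs.span B = V" "card B = cvs.dim V" using cfinite_dimE V by metis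
  obtain B' where B': "finite B'" "cvs.independent B'" "cvs.span B' = V'" "card B' = cvs.dim V'" using cfinite_dimE V' by metis
  obtain h where h: "bij_betw h B B'" using finite_same_card_bij[OF B(1) B'(1)] B(4) B'(4) d by metis
  obtain \<Phi> where \<Phi>: "clin \<Phi>" "\<forall>b\<in>B. \<Phi> b = h b" using finite_rank_extension[OF B(1,2), of h] by blast
  obtain \<Psi> where \<Psi>: "clin \<Psi>" "\<forall>b\<in>B'. \<Psi> b = inv_into B h b" using finite_rank_extension[OF B'(1,2), of "inv_into B h"] by blast
  have im: "\<Phi> ` B = B'" using \<Phi>(2) h by (auto simp: bij_betw_def)
  have "\<Phi> ` V = V'" using cvp.linear_span_image[OF clin_linear[OF \<Phi>(1)], of B] im B(3) B'(3) by simp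
  moreover have "x = 0" if x: "x \<in> V" "\<Phi> x = 0" for x
  proof -
    have "\<Psi> (\<Phi> b) = b" if "b \<in> B" for b
      using that \<Phi>(2) \<Psi>(2) h bij_betw_inv_into_left[OF h that] by (auto simp: bij_betw_def)
    then have "(\<Psi> o\<^sub>L \<Phi>) x = id_blinfun x"
      using cvp.linear_eq_on[OF clin_linear[OF clin_compose[OF \<Psi>(1) \<Phi>(1)]] clin_linear[OF clin_id], of x B] x(1) B(3)
      by simp
    then show ?thesis using x(2) by simp
  qed
  ultimately show ?thesis using \<Phi>(1) by blast
qed

definition orthonormal :: "'a::complex_hilbert_space set \<Rightarrow> bool" where
  "orthonormal B \<longleftrightarrow> (\<forall>x\<in>B. \<forall>y\<in>B. cinner x y = (if x = y then 1 else 0))"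

lemma orthonormal_basis_exists:
  assumes "cfinite_dim E" "cvs.subspace E"
  shows "\<exists>B. finite B \<and> orthonormal B \<and> cvs.span B = E"
proof -
  obtain C where "finite C" "cvs.span C = E" using cfinite_dimE assms by metis
  moreover have "\<exists>B. finite B \<and> orthonormal B \<and> cvs.span B = cvs.span C" if "finite C" for C :: "'a set"
    using that
  proof (induction C)
    case empty
    then show ?case by (intro exI[of _ "{}"]) (simp add: orthonormal_def)
  next
    case (insert x C)
    then obtain B where B: "finite B" "orthonormal B" "cvs.span B = cvs.span C" by blast
    let ?N = "cvs.span B"
    have N: "hsub ?N" using B hsub_span_finite by blast
    have eq: "cvs.span (insert x C) = cvs.span (insert x B)" by (metis B(3) span_insert_Un)
    define u where "u = x - orth_proj ?N x"
    show ?case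
    proof (cases "u = 0")
      case True
      then have "x \<in> ?N" using orth_proj_in[OF N, of x] by (simp add: u_def)
      then show ?thesis using B eq by (auto simp: cvs.span_redundant)
    next
      case False
      have uo: "u \<in> corth ?N" using N by (simp add: u_def)
      define e where "e = (1 / complex_of_real (norm u)) *\<^sub>C u"
      have e: "e \<in> corth ?N" unfolding e_def using uo by (intro hsub_scaleC) auto
      have "cinner e e = 1" using False by (simp add: e_def cinner_self norm_scaleC norm_divide)
      then have "orthonormal (insert e B)"
        using B(2) corthD[OF e] corthD'[OF e] by (auto simp: orthonormal_def cvs.span_base)
      moreover have "cvs.span (insert e B) = cvs.span (insert x B)"
      proof -
        have xe: "x = complex_of_real (norm u) *\<^sub>C e + orth_proj ?N x"
          using False by (simp add: e_def scaleC_scaleC) (simp add: u_def)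
        have 1: "orth_proj ?N x \<in> cvs.span (insert y B)" for y
          using orth_proj_in[OF N, of x] cvs.span_mono[of B "insert y B"] by auto
        have "x \<in> cvs.span (insert e B)"
          by (subst xe) (intro cvs.span_add cvs.span_scale 1 cvs.span_base, simp)
        moreover have "e \<in> cvs.span (insert x B)"
          unfolding e_def u_def by (intro cvs.span_scale cvs.span_diff 1 cvs.span_base) simp
        ultimately show ?thesis
          by (intro cvs.span_eq[THEN iffD2] conjI insert_subsetI) (auto intro: cvs.span_base)
      qed
      ultimately show ?thesis using B eq by (metis finite_insert)
    qed
  qed
  ultimately show ?thesis by metis
qed

lemma orth_proj_orthonormal:
  assumes "finite B" "orthonormal B"
  shows "orth_proj (cvs.span B) x = (\<Sum>b\<in>B. cinner b x *\<^sub>C b)"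
proof (rule orth_proj_eqI[OF hsub_span_finite[OF assms(1)]])
  interpret cr: bounded_linear "cinner b" for b :: 'a by (rule bounded_linear_cinner_right)
  show "(\<Sum>b\<in>B. cinner b x *\<^sub>C b) \<in> cvs.span B"
    by (intro cvs.span_sum cvs.span_scale cvs.span_base)
  let ?y = "x - (\<Sum>b\<in>B. cinner b x *\<^sub>C b)"
  have "cinner a ?y = 0" if "a \<in> B" for a
  proof -
    have "cinner a (\<Sum>b\<in>B. cinner b x *\<^sub>C b) = (\<Sum>b\<in>B. if b = a then cinner b x else 0)"
      unfolding cr.sum using assms that by (intro sum.cong) (auto simp: orthonormal_def cinner_bilin)
    then show ?thesis using assms that by (simp add: cinner_diff_right)
  qed
  then have "B \<subseteq> corth {?y}" unfolding corth_def using cinner_eq_0_commute by blast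
  then have "cvs.span B \<subseteq> corth {?y}"
    using hsub_corth by (intro cvs.span_minimal) (auto simp: hsub_def)
  then show "?y \<in> corth (cvs.span B)" using subset_corth_commute by blast
qed

section \<open>Calculus of smooth maps\<close>

lemma Ck_on_lower: "Ck_on (Suc n) U f \<Longrightarrow> Ck_on n U f"
proof (induction n arbitrary: f)
  case 0
  then obtain f' where "\<forall>x\<in>U. (f has_derivative f' x) (at x)" by auto
  then have "\<forall>x\<in>U. isCont f x" using has_derivative_continuous by blast
  then show ?case by (simp add: continuous_at_imp_continuous_on)
next
  case (Suc n)
  then show ?case by (metis Ck_on.simps(2))
qed

lemma Ck_on_const: "Ck_on n U (\<lambda>x. c)"
proof (induction n arbitrary: c)
  case (Suc n)
  then show ?case by (auto intro!: exI[of _ "\<lambda>x v. 0"])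
qed simp

lemma Ck_on_bounded_linear_compose:
  assumes g: "bounded_linear g"
  shows "Ck_on n U f \<Longrightarrow> Ck_on n U (\<lambda>x. g (f x))"
proof (induction n arbitrary: f)
  case 0
  then show ?case using bounded_linear.continuous_on[OF g] by simp
next
  case (Suc n)
  then obtain f' where f': "\<forall>x\<in>U. (f has_derivative f' x) (at x)" "\<forall>v. Ck_on n U (\<lambda>x. f' x v)" by auto
  have "((\<lambda>x. g (f x)) has_derivative (\<lambda>v. g (f' x v))) (at x)" if "x \<in> U" for x
    by (rule bounded_linear.has_derivative[OF g]) (use f'(1) that in blast)
  then show ?case using Suc.IH f'(2) by (auto intro!: exI[of _ "\<lambda>x v. g (f' x v)"])
qed

lemma Ck_on_bounded_linear:
  assumes g: "bounded_linear g" shows "Ck_on n U g"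
proof (cases n)
  case 0
  then show ?thesis using linear_continuous_on[OF g] by simp
next
  case (Suc m)
  then show ?thesis
    using bounded_linear_imp_has_derivative[OF g] Ck_on_const by (auto intro!: exI[of _ "\<lambda>x. g"])
qed

lemma Ck_on_add:
  "Ck_on n U f \<Longrightarrow> Ck_on n U g \<Longrightarrow> Ck_on n U (\<lambda>x. f x + g x)"
proof (induction n arbitrary: f g)
  case 0
  then show ?case by (simp add: continuous_on_add)
next
  case (Suc n)
  then obtain f' g' where
    "\<forall>x\<in>U. (f has_derivative f' x) (at x)" "\<forall>v. Ck_on n U (\<lambda>x. f' x v)"
    "\<forall>x\<in>U. (g has_derivative g' x) (at x)" "\<forall>v. Ck_on n U (\<lambda>x. g' x v)" by auto
  then show ?case using Suc.IH
    by (auto intro!: exI[of _ "\<lambda>x v. f' x v + g' x v"] has_derivative_add)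
qed

lemma Ck_on_bilinear:
  assumes p: "bounded_bilinear pr"
  shows "Ck_on n U f \<Longrightarrow> Ck_on n U g \<Longrightarrow> Ck_on n U (\<lambda>x. pr (f x) (g x))"
proof (induction n arbitrary: f g)
  case 0
  then show ?case using bounded_bilinear.continuous_on[OF p] by simp
next
  case (Suc n)
  then obtain f' g' where
    f': "\<forall>x\<in>U. (f has_derivative f' x) (at x)" "\<forall>v. Ck_on n U (\<lambda>x. f' x v)" and
    g': "\<forall>x\<in>U. (g has_derivative g' x) (at x)" "\<forall>v. Ck_on n U (\<lambda>x. g' x v)" by auto
  have "Ck_on n U f" "Ck_on n U g" using Suc.prems Ck_on_lower by blast+
  then have "Ck_on n U (\<lambda>x. pr (f x) (g' x v) + pr (f' x v) (g x))" for v
    using f' g' by (intro Ck_on_add Suc.IH) auto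
  moreover have "((\<lambda>x. pr (f x) (g x)) has_derivative
      (\<lambda>v. pr (f x) (g' x v) + pr (f' x v) (g x))) (at x)" if "x \<in> U" for x
    using f' g' that by (intro bounded_bilinear.FDERIV[OF p]) auto
  ultimately show ?case
    by (auto intro!: exI[of _ "\<lambda>x v. pr (f x) (g' x v) + pr (f' x v) (g x)"])
qed

text \<open>Where \<open>g\<close> vanishes, the term of the product rule that contains the
  derivative of \<open>f\<close> drops out, so continuity of \<open>f\<close> suffices. This is what
  allows inverses to be differentiated before they are known to be differentiable.\<close>

lemma has_derivative_bilinear_zero:
  assumes p: "bounded_bilinear pr" and f: "isCont f x"
    and g: "(g has_derivative g') (at x)" and g0: "g x = 0"
  shows "((\<lambda>y. pr (f y) (g y)) has_derivative (\<lambda>h. pr (f x) (g' h))) (at x)"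
proof -
  interpret p: bounded_bilinear pr by fact
  obtain K where K: "K > 0" "\<And>a b. norm (pr a b) \<le> norm a * norm b * K" using p.pos_bounded by blast
  have bl: "bounded_linear g'" using g has_derivative_bounded_linear by blast
  obtain G where G: "G > 0" "\<And>h. norm (g' h) \<le> norm h * G"
    using bounded_linear.pos_bounded[OF bl] by blast
  let ?r = "\<lambda>y. norm (g y - g x - g' (y - x)) / norm (y - x)"
  let ?H = "\<lambda>y. norm (f y) * ?r y * K + norm (f y - f x) * G * K"
  have r: "(?r \<longlongrightarrow> 0) (at x)" using g by (simp add: has_derivative_iff_norm)
  show ?thesis
  proof (rule has_derivativeI_sandwich[of 1 _ _ _ _ ?H])
    show "bounded_linear (\<lambda>h. pr (f x) (g' h))"
      by (rule bounded_linear_compose[OF p.bounded_linear_right bl])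
    have "(?H \<longlongrightarrow> norm (f x) * 0 * K + norm (f x - f x) * G * K) (at x)"
      using f by (intro tendsto_intros r) (simp_all add: isCont_def)
    then show "(?H \<longlongrightarrow> 0) (at x)" by simp
    fix y assume "y \<noteq> x"
    then have yx: "norm (y - x) > 0" by simp
    have "pr (f y) (g y) - pr (f x) (g x) - pr (f x) (g' (y - x)) =
        pr (f y) (g y - g x - g' (y - x)) + pr (f y - f x) (g' (y - x))"
      by (simp add: g0 p.diff_left p.diff_right p.zero_right)
    then have "norm (pr (f y) (g y) - pr (f x) (g x) - pr (f x) (g' (y - x))) \<le>
        norm (f y) * norm (g y - g x - g' (y - x)) * K + norm (f y - f x) * norm (g' (y - x)) * K"
      by (metis (no_types, lifting) K(2) add_mono norm_triangle_le)
    also have "\<dots> \<le> norm (f y) * norm (g y - g x - g' (y - x)) * K + norm (f y - f x) * (norm (y - x) * G) * K"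
      using K G by (intro add_left_mono mult_right_mono mult_left_mono) auto
    finally show "norm (pr (f y) (g y) - pr (f x) (g x) - pr (f x) (g' (y - x))) / norm (y - x) \<le> ?H y"
      using yx by (simp add: field_simps)
  qed auto
qed

lemma blinfun_compose_id [simp]: "id_blinfun o\<^sub>L A = A" "A o\<^sub>L id_blinfun = A"
  by (auto intro!: blinfun_eqI)

lemma blinfun_compose_assoc: "(A o\<^sub>L B) o\<^sub>L C = A o\<^sub>L (B o\<^sub>L C)"
  by (rule blinfun_eqI) simp

text \<open>Everything rests on the identity \<open>diff\<close>. With the bound \<open>K\<close> it
  gives continuity of \<open>R\<close>; then \<open>has_derivative_bilinear_zero\<close> applies to
  its right-hand side, which vanishes at \<open>y = x\<close>. The derivative is a product of copies
  of \<open>R\<close> and of a derivative of \<open>F\<close>, so induction on the order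
  closes.\<close>

lemma Ck_on_inverse:
  fixes F R :: "'b::real_normed_vector \<Rightarrow> ('a::real_normed_vector \<Rightarrow>\<^sub>L 'a)"
  assumes U: "open U" and inv: "\<And>x. x \<in> U \<Longrightarrow> F x o\<^sub>L R x = id_blinfun \<and> R x o\<^sub>L F x = id_blinfun"
    and K: "\<And>x. x \<in> U \<Longrightarrow> norm (R x) \<le> K"
  shows "Ck_on n U F \<Longrightarrow> Ck_on n U R"
proof -
  interpret c: bounded_bilinear "(o\<^sub>L)" by (rule bounded_bilinear_blinfun_compose)
  have diff: "R y - R x = - (R y o\<^sub>L ((F y - F x) o\<^sub>L R x))" if "x \<in> U" "y \<in> U" for x y
  proof -
    have "R y o\<^sub>L ((F y - F x) o\<^sub>L R x) = ((R y o\<^sub>L F y) o\<^sub>L R x) - (R y o\<^sub>L (F x o\<^sub>L R x))"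
      by (simp only: c.diff_left c.diff_right blinfun_compose_assoc)
    then have "R y o\<^sub>L ((F y - F x) o\<^sub>L R x) = R x - R y" using inv that by simp
    then show ?thesis by simp
  qed
  have cont: "isCont R x" if F: "isCont F x" and x: "x \<in> U" for x
  proof -
    have K0: "K \<ge> 0" using K[OF x] norm_ge_zero order_trans by blast
    have "(\<lambda>y. K * (norm (F y - F x) * K)) \<midarrow>x\<rightarrow> K * (norm (F x - F x) * K)"
      using F by (intro tendsto_intros) (simp add: isCont_def)
    then have "(\<lambda>y. K * (norm (F y - F x) * K)) \<midarrow>x\<rightarrow> 0" by simp
    moreover have "\<forall>\<^sub>F y in at x. norm (R y - R x) \<le> K * (norm (F y - F x) * K)"
      using eventually_at_in_open'[OF U x]
    proof (rule eventually_mono)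
      fix y assume y: "y \<in> U"
      have "norm (R y - R x) \<le> norm (R y) * norm ((F y - F x) o\<^sub>L R x)"
        unfolding diff[OF x y] norm_minus_cancel by (rule norm_blinfun_compose)
      also have "\<dots> \<le> norm (R y) * (norm (F y - F x) * norm (R x))"
        by (intro mult_left_mono norm_blinfun_compose) auto
      also have "\<dots> \<le> K * (norm (F y - F x) * K)"
        using K x y K0 by (intro mult_mono mult_left_mono) auto
      finally show "norm (R y - R x) \<le> K * (norm (F y - F x) * K)" .
    qed
    ultimately have "(\<lambda>y. R y - R x) \<midarrow>x\<rightarrow> 0" by (rule Lim_null_comparison[rotated])
    then show ?thesis unfolding isCont_def by (rule LIM_zero_cancel)
  qed
  show "Ck_on n U F \<Longrightarrow> Ck_on n U R"
  proof (induction n)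
  case 0
  then show ?case using cont U by (simp add: continuous_on_eq_continuous_at)
next
  case (Suc n)
  then obtain F' where F': "\<forall>x\<in>U. (F has_derivative F' x) (at x)" "\<forall>v. Ck_on n U (\<lambda>x. F' x v)" by auto
  have Rn: "Ck_on n U R" using Suc Ck_on_lower by blast
  let ?R' = "\<lambda>x v. - (R x o\<^sub>L (F' x v o\<^sub>L R x))"
  have "(R has_derivative ?R' x) (at x)" if x: "x \<in> U" for x
  proof -
    have Fx: "(F has_derivative F' x) (at x)" using F' x by blast
    have Rx: "isCont R x" using cont[OF has_derivative_continuous[OF Fx] x] .
    have "((\<lambda>y. (F y - F x) o\<^sub>L R x) has_derivative (\<lambda>v. F' x v o\<^sub>L R x)) (at x)"
      using bounded_linear.has_derivative[OF c.bounded_linear_left has_derivative_diff[OF Fx has_derivative_const]]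
      by simp
    then have "((\<lambda>y. R y o\<^sub>L ((F y - F x) o\<^sub>L R x)) has_derivative (\<lambda>v. R x o\<^sub>L (F' x v o\<^sub>L R x))) (at x)"
      by (intro has_derivative_bilinear_zero[OF bounded_bilinear_blinfun_compose Rx]) auto
    then have "((\<lambda>y. R x - (R y o\<^sub>L ((F y - F x) o\<^sub>L R x))) has_derivative
        (\<lambda>v. 0 - (R x o\<^sub>L (F' x v o\<^sub>L R x)))) (at x)"
      by (intro has_derivative_diff has_derivative_const)
    then have "((\<lambda>y. R x - (R y o\<^sub>L ((F y - F x) o\<^sub>L R x))) has_derivative ?R' x) (at x)" by simp
    then show ?thesis
      by (rule has_derivative_transform_within_open[OF _ U x])
         (use diff[OF x] in \<open>simp add: algebra_simps\<close>)
  qed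
  moreover have "Ck_on n U (\<lambda>x. ?R' x v)" for v
    using F' Rn
    by (intro Ck_on_bounded_linear_compose[OF bounded_linear_minus[OF bounded_linear_ident]]
        Ck_on_bilinear[OF bounded_bilinear_blinfun_compose]) auto
  ultimately show ?case unfolding Ck_on.simps by (intro exI[of _ ?R']) blast
  qed
qed

lemma Ck_on_subset: "Ck_on n U f \<Longrightarrow> V \<subseteq> U \<Longrightarrow> Ck_on n V f"
proof (induction n arbitrary: f)
  case 0
  then show ?case using continuous_on_subset by auto
next
  case (Suc n)
  then obtain f' where f': "\<forall>x\<in>U. (f has_derivative f' x) (at x)" "\<forall>v. Ck_on n U (\<lambda>x. f' x v)" by auto
  then have "\<forall>x\<in>V. (f has_derivative f' x) (at x)" "\<forall>v. Ck_on n V (\<lambda>x. f' x v)"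
    using Suc.IH Suc.prems(2) by blast+
  then show ?case unfolding Ck_on.simps by blast
qed

lemma smooth_on_subset: "smooth_on U f \<Longrightarrow> V \<subseteq> U \<Longrightarrow> smooth_on V f"
  unfolding smooth_on_def using Ck_on_subset by blast

lemma smooth_on_const: "smooth_on U (\<lambda>x. c)"
  by (simp add: smooth_on_def Ck_on_const)
lemma smooth_on_add: "smooth_on U f \<Longrightarrow> smooth_on U g \<Longrightarrow> smooth_on U (\<lambda>x. f x + g x)"
  by (simp add: smooth_on_def Ck_on_add)
lemma smooth_on_bounded_linear: "bounded_linear g \<Longrightarrow> smooth_on U g"
  by (simp add: smooth_on_def Ck_on_bounded_linear)
lemma smooth_on_id: "smooth_on U (\<lambda>x. x)"
  by (rule smooth_on_bounded_linear) (rule bounded_linear_ident)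
lemma smooth_on_bounded_linear_compose:
  "bounded_linear g \<Longrightarrow> smooth_on U f \<Longrightarrow> smooth_on U (\<lambda>x. g (f x))"
  by (simp add: smooth_on_def Ck_on_bounded_linear_compose)
lemma smooth_on_minus: "smooth_on U f \<Longrightarrow> smooth_on U (\<lambda>x. - f x)"
  by (rule smooth_on_bounded_linear_compose[OF bounded_linear_minus[OF bounded_linear_ident]])
lemma smooth_on_diff: "smooth_on U f \<Longrightarrow> smooth_on U g \<Longrightarrow> smooth_on U (\<lambda>x. f x - g x)"
  using smooth_on_add[OF _ smooth_on_minus, of U f g] by simp
lemma smooth_on_scaleR: "smooth_on U f \<Longrightarrow> smooth_on U g \<Longrightarrow> smooth_on U (\<lambda>x. f x *\<^sub>R g x)"
  by (simp add: smooth_on_def Ck_on_bilinear[OF bounded_bilinear_scaleR])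
lemma smooth_on_compose: "smooth_on U f \<Longrightarrow> smooth_on U g \<Longrightarrow> smooth_on U (\<lambda>x. f x o\<^sub>L g x)"
  by (simp add: smooth_on_def Ck_on_bilinear[OF bounded_bilinear_blinfun_compose])
lemma smooth_on_adj: "smooth_on U f \<Longrightarrow> smooth_on U (\<lambda>x. adj (f x))"
  by (rule smooth_on_bounded_linear_compose[OF bounded_linear_adj])
lemma smooth_on_inverse:
  fixes F R :: "'b::real_normed_vector \<Rightarrow> ('a::real_normed_vector \<Rightarrow>\<^sub>L 'a)"
  assumes "open U" "\<And>x. x \<in> U \<Longrightarrow> F x o\<^sub>L R x = id_blinfun \<and> R x o\<^sub>L F x = id_blinfun"
    and "\<And>x. x \<in> U \<Longrightarrow> norm (R x) \<le> K" and "smooth_on U F"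
  shows "smooth_on U R"
  using assms Ck_on_inverse[OF assms(1-3)] by (simp add: smooth_on_def)

lemmas smooth_intros = smooth_on_const smooth_on_add smooth_on_id smooth_on_minus smooth_on_diff
  smooth_on_scaleR smooth_on_compose smooth_on_adj

lemma smooth_on_continuous: "smooth_on U f \<Longrightarrow> continuous_on U f"
  unfolding smooth_on_def by (metis Ck_on.simps(1))

section \<open>Orientations\<close>

lemma ordered_basis_in: "ordered_basis C bs \<Longrightarrow> i < length bs \<Longrightarrow> bs ! i \<in> C"
  unfolding ordered_basis_def using span_base nth_mem by blast

lemma sum_list_index:
  "distinct bs \<Longrightarrow> (\<Sum>i<length bs. f (bs ! i)) = (\<Sum>b\<in>set bs. f b)"
  by (simp add: sum.distinct_set_conv_list sum_list_sum_nth atLeast0LessThan)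

lemma ordered_basis_coords_unique:
  assumes bs: "ordered_basis C bs"
    and eq: "(\<Sum>i<length bs. x i *\<^sub>R (bs ! i)) = (\<Sum>i<length bs. y i *\<^sub>R (bs ! i))"
    and i: "i < length bs"
  shows "x i = y i"
proof -
  have d: "distinct bs" "independent (set bs)" using bs by (auto simp: ordered_basis_def)
  define ix where "ix b = (THE i. i < length bs \<and> bs ! i = b)" for b
  have ix: "ix (bs ! i) = i" if "i < length bs" for i
    unfolding ix_def using that d(1) by (intro the_equality) (auto simp: nth_eq_iff_index_eq)
  have "(\<Sum>b\<in>set bs. (x (ix b) - y (ix b)) *\<^sub>R b) = (\<Sum>i<length bs. (x (ix (bs ! i)) - y (ix (bs ! i))) *\<^sub>R (bs ! i))"
    by (rule sum_list_index[OF d(1), symmetric])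
  also have "\<dots> = (\<Sum>i<length bs. x i *\<^sub>R (bs ! i) - y i *\<^sub>R (bs ! i))"
    by (intro sum.cong) (auto simp: ix scaleR_diff_left)
  also have "\<dots> = 0" using eq by (simp add: sum_subtractf)
  finally have "(\<Sum>b\<in>set bs. (x (ix b) - y (ix b)) *\<^sub>R b) = 0" .
  then have "x (ix (bs ! i)) - y (ix (bs ! i)) = 0"
    by (rule independentD[OF d(2) finite_set subset_refl]) (use i in simp)
  then show ?thesis using ix i by simp
qed

lemma ordered_basis_coords_exist:
  assumes bs: "ordered_basis C bs" and c: "c \<in> C"
  shows "\<exists>x. c = (\<Sum>i<length bs. x i *\<^sub>R (bs ! i))"
proof -
  have "c \<in> span (set bs)" "distinct bs" using bs c by (auto simp: ordered_basis_def)
  then obtain u where "c = (\<Sum>b\<in>set bs. u b *\<^sub>R b)" unfolding span_finite[OF finite_set] by blast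
  then show ?thesis using sum_list_index[OF \<open>distinct bs\<close>, of "\<lambda>b. u b *\<^sub>R b"]
    by (intro exI[of _ "\<lambda>i. u (bs ! i)"]) simp
qed

text \<open>Names the matrix that \<open>same_oriented\<close> hides behind an existential
  quantifier: its uniqueness over a basis and the continuity of its entries in a parameter are both
  needed.\<close>

definition base_change :: "'v::real_vector list \<Rightarrow> real mat \<Rightarrow> 'v list \<Rightarrow> bool" where
  "base_change bs M cs \<longleftrightarrow> length cs = length bs \<and> M \<in> carrier_mat (length bs) (length bs) \<and>
     (\<forall>j < length bs. cs ! j = (\<Sum>i < length bs. (M $$ (i, j)) *\<^sub>R (bs ! i)))"

lemma same_oriented_iff: "same_oriented bs cs \<longleftrightarrow> (\<exists>M. base_change bs M cs \<and> Determinant.det M > 0)"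
  by (auto simp: same_oriented_def base_change_def)

lemma base_change_id: "base_change bs (1\<^sub>m (length bs)) bs"
proof -
  have "(\<Sum>i<length bs. (1\<^sub>m (length bs) $$ (i, j)) *\<^sub>R (bs ! i)) = (\<Sum>i<length bs. if i = j then bs ! i else 0)"
    if "j < length bs" for j
    using that by (intro sum.cong) auto
  then show ?thesis by (auto simp: base_change_def)
qed

lemma base_change_trans:
  assumes M: "base_change bs M cs" and N: "base_change cs N ds"
  shows "base_change bs (M * N) ds"
proof -
  let ?n = "length bs"
  have l: "length cs = ?n" "length ds = ?n" and c: "M \<in> carrier_mat ?n ?n" "N \<in> carrier_mat ?n ?n"
    using M N by (auto simp: base_change_def)
  have "ds ! j = (\<Sum>i<?n. ((M * N) $$ (i, j)) *\<^sub>R (bs ! i))" if j: "j < ?n" for j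
  proof -
    have "ds ! j = (\<Sum>k<?n. (N $$ (k, j)) *\<^sub>R (cs ! k))" using N j l by (simp add: base_change_def)
    also have "\<dots> = (\<Sum>k<?n. (N $$ (k, j)) *\<^sub>R (\<Sum>i<?n. (M $$ (i, k)) *\<^sub>R (bs ! i)))"
      using M by (intro sum.cong) (auto simp: base_change_def)
    also have "\<dots> = (\<Sum>i<?n. (\<Sum>k<?n. M $$ (i, k) * N $$ (k, j)) *\<^sub>R (bs ! i))"
      unfolding scaleR_sum_right scaleR_sum_left by (subst sum.swap) (simp add: mult.commute)
    also have "\<dots> = (\<Sum>i<?n. ((M * N) $$ (i, j)) *\<^sub>R (bs ! i))"
      using c j by (intro sum.cong) (auto simp: scalar_prod_def atLeast0LessThan)
    finally show ?thesis .
  qed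
  then show ?thesis using l c by (auto simp: base_change_def)
qed

lemma base_change_unique:
  assumes "ordered_basis C bs" "base_change bs M cs" "base_change bs N cs"
  shows "M = N"
proof (rule eq_matI)
  fix i j assume "i < dim_row N" "j < dim_col N"
  then have ij: "i < length bs" "j < length bs" using assms by (auto simp: base_change_def)
  show "M $$ (i, j) = N $$ (i, j)"
    by (rule ordered_basis_coords_unique[OF assms(1) _ ij(1)])
       (use assms ij in \<open>auto simp: base_change_def\<close>)
qed (use assms in \<open>auto simp: base_change_def\<close>)

lemma base_change_exists:
  assumes "ordered_basis C bs" "length cs = length bs" "set cs \<subseteq> C"
  shows "\<exists>M. base_change bs M cs"
proof -
  have "\<forall>j<length bs. \<exists>x. cs ! j = (\<Sum>i<length bs. x i *\<^sub>R (bs ! i))"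
    using assms by (auto intro!: ordered_basis_coords_exist[OF assms(1)])
  then obtain x where "\<And>j. j < length bs \<Longrightarrow> cs ! j = (\<Sum>i<length bs. x j i *\<^sub>R (bs ! i))" by metis
  then have "base_change bs (mat (length bs) (length bs) (\<lambda>(i, j). x j i)) cs"
    using assms by (auto simp: base_change_def)
  then show ?thesis by blast
qed

lemma ordered_basis_length:
  assumes "ordered_basis C bs" "ordered_basis C cs"
  shows "length bs = length cs"
proof -
  have "length as = dim C" if "ordered_basis C as" for as
    using that dim_span_eq_card_independent[of "set as"]
    by (auto simp: ordered_basis_def distinct_card)
  then show ?thesis using assms by simp
qed

lemma ordered_basis_subset: "ordered_basis C bs \<Longrightarrow> set bs \<subseteq> C"
  unfolding ordered_basis_def using span_superset by blast

lemma base_change_inverse: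
  assumes "ordered_basis C bs" "ordered_basis C cs" "base_change bs M cs"
  shows "\<exists>N. base_change cs N bs \<and> Determinant.det M * Determinant.det N = 1"
proof -
  obtain N where N: "base_change cs N bs"
    using base_change_exists[OF assms(2) ordered_basis_length[OF assms(1,2)]]
      ordered_basis_subset[OF assms(1)] by blast
  have "M * N = 1\<^sub>m (length bs)"
    using base_change_unique[OF assms(1) base_change_trans[OF assms(3) N] base_change_id] .
  moreover have "Determinant.det (M * N) = Determinant.det M * Determinant.det N"
    using assms(3) N by (intro det_mult[of _ "length bs"]) (auto simp: base_change_def)
  ultimately have "Determinant.det M * Determinant.det N = 1" by simp
  then show ?thesis using N by blast
qed

lemma same_oriented_trans:
  assumes "same_oriented bs cs" "same_oriented cs ds" shows "same_oriented bs ds"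
proof -
  obtain M N where MN: "base_change bs M cs" "Determinant.det M > 0" "base_change cs N ds" "Determinant.det N > 0"
    using assms by (auto simp: same_oriented_iff)
  moreover have "Determinant.det (M * N) = Determinant.det M * Determinant.det N"
    using MN by (intro det_mult[of _ "length bs"]) (auto simp: base_change_def)
  ultimately have "base_change bs (M * N) ds" "Determinant.det (M * N) > 0"
    using base_change_trans by auto
  then show ?thesis unfolding same_oriented_iff by blast
qed

lemma same_oriented_sym:
  assumes "ordered_basis C bs" "ordered_basis C cs" "same_oriented bs cs"
  shows "same_oriented cs bs"
proof -
  obtain M where M: "base_change bs M cs" "Determinant.det M > 0" using assms by (auto simp: same_oriented_iff)
  obtain N where N: "base_change cs N bs" "Determinant.det M * Determinant.det N = 1"
    using base_change_inverse[OF assms(1,2) M(1)] by blast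
  then have "Determinant.det N > 0"
    using M zero_less_mult_pos[of "Determinant.det M" "Determinant.det N"] by simp
  then show ?thesis using N same_oriented_iff by blast
qed

lemma ordered_basis_map:
  assumes f: "linear f" "inj_on f C" and bs: "ordered_basis C bs"
  shows "ordered_basis (f ` C) (map f bs)"
proof -
  have C: "span (set bs) = C" and "distinct bs" "independent (set bs)"
    using bs by (auto simp: ordered_basis_def)
  then show ?thesis unfolding ordered_basis_def
    using f linear_independent_injective_image[OF f(1), of "set bs"] linear_span_image[OF f(1), of "set bs"]
    by (auto simp: distinct_map intro: inj_on_subset[OF f(2)] span_base)
qed

lemma ordered_basis_exists:
  assumes "subspace C" "finite B" "C \<subseteq> span B"
  shows "\<exists>bs. ordered_basis C bs"
proof -
  obtain A where A: "A \<subseteq> C" "independent A" "C \<subseteq> span A" using maximal_independent_subset by blast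
  then have "finite A" using independent_span_bound[OF assms(2) A(2)] assms(3) by blast
  then obtain bs where "set bs = A" "distinct bs" using finite_distinct_list by blast
  then show ?thesis using A assms(1) span_minimal[of A C] unfolding ordered_basis_def by blast
qed

lemma continuous_on_det:
  fixes M :: "'b::topological_space \<Rightarrow> real mat"
  assumes "\<And>z. z \<in> S \<Longrightarrow> M z \<in> carrier_mat n n"
    and "\<And>i j. i < n \<Longrightarrow> j < n \<Longrightarrow> continuous_on S (\<lambda>z. M z $$ (i, j))"
  shows "continuous_on S (\<lambda>z. Determinant.det (M z))"
proof -
  have "Determinant.det (M z) = (\<Sum>p | p permutes {0..<n}. signof p * (\<Prod>i = 0..<n. M z $$ (i, p i)))"
    if "z \<in> S" for z using assms(1)[OF that] by (auto simp: det_def)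
  moreover have "continuous_on S (\<lambda>z. \<Sum>p | p permutes {0..<n}. signof p * (\<Prod>i = 0..<n. M z $$ (i, p i)))"
    using permutes_in_image by (intro continuous_intros assms(2)) fastforce+
  ultimately show ?thesis by (simp cong: continuous_on_cong)
qed

text \<open>The determinant of the change of basis cannot change sign along a connected family.\<close>

lemma same_oriented_connected_family:
  fixes S :: "'b::topological_space set" and f :: "'b \<Rightarrow> 'v::real_vector list"
  assumes S: "connected S" and C: "ordered_basis C bs"
    and f: "\<And>z. z \<in> S \<Longrightarrow> ordered_basis C (f z)" "\<And>z. z \<in> S \<Longrightarrow> base_change bs (M z) (f z)"
    and M: "\<And>i j. i < length bs \<Longrightarrow> j < length bs \<Longrightarrow> continuous_on S (\<lambda>z. M z $$ (i, j))"
    and zw: "z \<in> S" "w \<in> S"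
  shows "same_oriented (f z) (f w)"
proof -
  define d where "d z = Determinant.det (M z)" for z
  have "continuous_on S d" unfolding d_def
    by (rule continuous_on_det[of _ _ "length bs"]) (use f(2) M in \<open>auto simp: base_change_def\<close>)
  then have con: "connected (d ` S)" using S connected_continuous_image by blast
  have nz: "d z \<noteq> 0" if "z \<in> S" for z
    using base_change_inverse[OF C f(1)[OF that] f(2)[OF that]] by (auto simp: d_def)
  have pos: "d z * d w > 0"
  proof (rule ccontr)
    assume "\<not> ?thesis"
    then have "(d z \<le> 0 \<and> 0 \<le> d w) \<or> (d w \<le> 0 \<and> 0 \<le> d z)" by (auto simp: not_less mult_le_0_iff)
    then have "0 \<in> d ` S" using connected_contains_Icc[OF con] zw by (meson atLeastAtMost_iff image_eqI subsetD)
    then show False using nz by auto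
  qed
  obtain N where N: "base_change (f z) N bs" "d z * Determinant.det N = 1"
    using base_change_inverse[OF C f(1)[OF zw(1)] f(2)[OF zw(1)]] by (auto simp: d_def)
  have b: "base_change (f z) (N * M w) (f w)" by (rule base_change_trans[OF N(1) f(2)[OF zw(2)]])
  have "Determinant.det (N * M w) = Determinant.det N * d w"
    unfolding d_def using N(1) f(2)[OF zw(2)] by (intro det_mult[of _ "length bs"]) (auto simp: base_change_def)
  moreover have "Determinant.det N * d w > 0"
  proof -
    have "Determinant.det N = 1 / d z" using N(2) nz[OF zw(1)] by (simp add: field_simps)
    then show ?thesis using pos by (auto simp: zero_less_mult_iff zero_less_divide_iff)
  qed
  ultimately show ?thesis unfolding same_oriented_iff using b by auto
qed

subsection \<open>Pencils of injective operators\<close>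

text \<open>A kernel vector at parameter \<open>z\<close> is a generalised eigenvector: there
  \<open>\<Psi>\<close> equals \<open>- (1 / z)\<close> times \<open>\<Phi>\<close>. Eigenvectors
  for distinct parameters are independent, so there are at most as many parameters as the dimension
  of \<open>Z\<close>.\<close>

lemma finite_singular_pencil:
  fixes \<Phi> \<Psi> :: "'a::complex_hilbert_space \<Rightarrow>\<^sub>L 'a"
  assumes lin: "clin \<Phi>" "clin \<Psi>" and Z: "cvs.subspace Z" "cfinite_dim Z"
    and inj: "\<And>x. x \<in> Z \<Longrightarrow> \<Phi> x = 0 \<Longrightarrow> x = 0"
  shows "finite {z. \<exists>x\<in>Z. x \<noteq> 0 \<and> \<Phi> x + z *\<^sub>C \<Psi> x = 0}"
proof -
  define S where "S = {z. \<exists>x. x \<in> Z \<and> x \<noteq> 0 \<and> \<Phi> x + z *\<^sub>C \<Psi> x = 0}"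
  define x where "x z = (SOME x. x \<in> Z \<and> x \<noteq> 0 \<and> \<Phi> x + z *\<^sub>C \<Psi> x = 0)" for z
  have x: "x z \<in> Z \<and> x z \<noteq> 0 \<and> \<Phi> (x z) + z *\<^sub>C \<Psi> (x z) = 0" if "z \<in> S" for z
    using that unfolding S_def x_def mem_Collect_eq by (rule someI_ex)
  have z0: "z \<noteq> 0" if "z \<in> S" for z
  proof
    assume "z = 0"
    then show False using x[OF that] inj[of "x z"] by simp
  qed
  have \<Psi>x: "\<Psi> (x z) = - (1 / z) *\<^sub>C \<Phi> (x z)" if "z \<in> S" for z
  proof -
    have "z *\<^sub>C \<Psi> (x z) = - \<Phi> (x z)" using x[OF that] by (simp add: eq_neg_iff_add_eq_0 add.commute)
    then have "(1 / z) *\<^sub>C z *\<^sub>C \<Psi> (x z) = (1 / z) *\<^sub>C (- \<Phi> (x z))" by simp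
    then show ?thesis using z0[OF that] by (simp add: scaleC_scaleC)
  qed
  have ind: "\<forall>a. (\<Sum>z\<in>F. a z *\<^sub>C x z) = 0 \<longrightarrow> (\<forall>z\<in>F. a z = 0)" if "finite F" "F \<subseteq> S" for F
    using that
  proof (induction F)
    case (insert w F)
    show ?case
    proof (intro allI impI)
      fix a assume a: "(\<Sum>z\<in>insert w F. a z *\<^sub>C x z) = 0"
      \<comment> \<open>Applying \<open>\<Psi>\<close> to the relation and cancelling
        \<open>\<Phi>\<close>, which is injective on \<open>Z\<close>, divides the coefficient at
        each \<open>z\<close> by \<open>z\<close>.\<close>
      have "0 = \<Psi> (\<Sum>z\<in>insert w F. a z *\<^sub>C x z)" by (simp add: a)
      also have "\<dots> = (\<Sum>z\<in>insert w F. a z *\<^sub>C (- (1 / z) *\<^sub>C \<Phi> (x z)))"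
        unfolding blinfun.sum_right clinD[OF lin(2)]
      proof (rule sum.cong[OF refl])
        fix z assume "z \<in> insert w F"
        then have "z \<in> S" using insert.prems by blast
        then show "a z *\<^sub>C \<Psi> (x z) = a z *\<^sub>C (- (1 / z) *\<^sub>C \<Phi> (x z))" by (simp only: \<Psi>x)
      qed
      also have "\<dots> = - \<Phi> (\<Sum>z\<in>insert w F. (a z / z) *\<^sub>C x z)"
        unfolding blinfun.sum_right clinD[OF lin(1)] sum_negf[symmetric]
        by (rule sum.cong[OF refl]) (simp add: scaleC_scaleC)
      finally have "\<Phi> (\<Sum>z\<in>insert w F. (a z / z) *\<^sub>C x z) = 0" by simp
      moreover have "(\<Sum>z\<in>insert w F. (a z / z) *\<^sub>C x z) \<in> Z"
      proof (rule cvs.subspace_sum[OF Z(1)])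
        fix z assume "z \<in> insert w F"
        then have "z \<in> S" using insert.prems by blast
        then show "(a z / z) *\<^sub>C x z \<in> Z" using x cvs.subspace_scale[OF Z(1)] by simp
      qed
      ultimately have b: "(\<Sum>z\<in>insert w F. (a z / z) *\<^sub>C x z) = 0" using inj by blast
      \<comment> \<open>Subtracting \<open>1 / w\<close> times the original relation removes the
        term of \<open>w\<close>; the new coefficients vanish only with the old ones because the
        parameters are distinct.\<close>
      have "(\<Sum>z\<in>insert w F. (a z / z - a z / w) *\<^sub>C x z) =
          (\<Sum>z\<in>insert w F. (a z / z) *\<^sub>C x z) - (1 / w) *\<^sub>C (\<Sum>z\<in>insert w F. a z *\<^sub>C x z)"
        unfolding cvs.scale_sum_right sum_subtractf[symmetric]
        by (rule sum.cong[OF refl]) (simp add: cvs.scale_left_diff_distrib scaleC_scaleC)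
      then have "(\<Sum>z\<in>F. (a z / z - a z / w) *\<^sub>C x z) = 0" using a b insert by simp
      then have "\<forall>z\<in>F. a z / z - a z / w = 0"
        using insert.IH[THEN spec[of _ "\<lambda>z. a z / z - a z / w"], THEN mp] insert.prems by simp
      moreover have "z \<noteq> 0" "w \<noteq> 0" "z \<noteq> w" if "z \<in> F" for z
        using that insert z0[of z] z0[of w] by auto
      ultimately have az: "\<forall>z\<in>F. a z = 0" by (auto simp: field_simps)
      then have "(\<Sum>z\<in>insert w F. a z *\<^sub>C x z) = a w *\<^sub>C x w" using insert by (simp add: sum.neutral)
      then have "a w = 0" using a x[of w] insert.prems by simp
      then show "\<forall>z\<in>insert w F. a z = 0" using az by blast
    qed
  qed simp
  have bound: "card F \<le> cvs.dim Z" if F: "finite F" "F \<subseteq> S" for F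
  proof -
    have injx: "inj_on x F"
    proof (rule inj_onI, rule ccontr)
      fix z w assume zw: "z \<in> F" "w \<in> F" "x z = x w" "z \<noteq> w"
      define a :: "complex \<Rightarrow> complex" where "a v = (if v = z then 1 else if v = w then - 1 else 0)" for v
      have "(\<Sum>v\<in>F. a v *\<^sub>C x v) = (\<Sum>v\<in>{z, w}. a v *\<^sub>C x v)"
        using zw F by (intro sum.mono_neutral_right) (auto simp: a_def)
      also have "\<dots> = 0" using zw by (simp add: a_def)
      finally show False using ind[OF F, THEN spec[of _ a], THEN mp] zw(1) by (auto simp: a_def)
    qed
    have "cvs.independent (x ` F)"
    proof (rule cvs.independent_if_scalars_zero)
      fix f y assume "(\<Sum>v\<in>x ` F. f v *\<^sub>C v) = 0" "y \<in> x ` F"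
      then show "f y = 0" using ind[OF F, rule_format, of "\<lambda>z. f (x z)"]
        by (auto simp: sum.reindex[OF injx])
    qed (use F in simp)
    moreover obtain B where B: "finite B" "cvs.span B = Z" "card B = cvs.dim Z" using cfinite_dimE Z by metis
    moreover have "x ` F \<subseteq> Z" using x F by blast
    ultimately have "card (x ` F) \<le> cvs.dim Z" using cvs.independent_span_bound[of B "x ` F"] by simp
    then show ?thesis using card_image[OF injx] by simp
  qed
  have "finite S"
  proof (rule ccontr)
    assume "infinite S"
    then obtain F where "F \<subseteq> S" "finite F" "card F = Suc (cvs.dim Z)"
      using infinite_arbitrarily_large[of S "Suc (cvs.dim Z)"] by blast
    then show False using bound[of F] by simp
  qed
  then show ?thesis by (rule finite_subset[rotated]) (auto simp: S_def)
qed

section \<open>Self-adjoint operators adapted to a flag\<close>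

definition flag :: "'a::complex_hilbert_space set \<Rightarrow> 'a set \<Rightarrow> bool" where
  "flag V Z \<longleftrightarrow> cvs.subspace V \<and> cvs.subspace Z \<and> cfinite_dim Z \<and> V \<subseteq> Z"

definition flag_ops :: "'a::complex_hilbert_space set \<Rightarrow> 'a set \<Rightarrow> ('a \<Rightarrow>\<^sub>L 'a) set" where
  "flag_ops V Z = {S. clin S \<and> adj S = S \<and> (\<forall>x\<in>corth V. S x \<in> V) \<and> (\<forall>x\<in>corth Z. S x = 0)}"

text \<open>Vanishing on \<open>corth Z\<close> is a normalisation: the operator is determined by
  its restriction to \<open>Z\<close>, and \<open>orth_proj Z\<close> becomes the neutral element
  for composition.\<close>

definition flag_map ::
    "('a::complex_hilbert_space \<Rightarrow>\<^sub>L 'a) \<Rightarrow> 'a set \<Rightarrow> 'a set \<Rightarrow> 'a set \<Rightarrow> 'a set \<Rightarrow> bool" where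
  "flag_map \<Phi> V Z V' Z' \<longleftrightarrow> clin \<Phi> \<and> (\<forall>x\<in>V. \<Phi> x \<in> V') \<and> (\<forall>x\<in>Z. \<Phi> x \<in> Z') \<and>
     (\<forall>x\<in>corth Z. \<Phi> x = 0)"

definition flag_iso ::
    "('a::complex_hilbert_space \<Rightarrow>\<^sub>L 'a) \<Rightarrow> 'a set \<Rightarrow> 'a set \<Rightarrow> 'a set \<Rightarrow> 'a set \<Rightarrow> bool" where
  "flag_iso \<Phi> V Z V' Z' \<longleftrightarrow> clin \<Phi> \<and> \<Phi> ` V = V' \<and> \<Phi> ` Z = Z' \<and>
     (\<forall>x\<in>Z. \<Phi> x = 0 \<longrightarrow> x = 0) \<and> (\<forall>x\<in>corth Z. \<Phi> x = 0)"

definition congr :: "('a::complex_hilbert_space \<Rightarrow>\<^sub>L 'a) \<Rightarrow> ('a \<Rightarrow>\<^sub>L 'a) \<Rightarrow> ('a \<Rightarrow>\<^sub>L 'a)" where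
  "congr \<Phi> A = \<Phi> o\<^sub>L (A o\<^sub>L adj \<Phi>)"

lemma congr_apply [simp]: "congr \<Phi> A x = \<Phi> (A (adj \<Phi> x))"
  by (simp add: congr_def)

lemma flagD:
  assumes "flag V Z"
  shows "hsub V" "hsub Z" "V \<subseteq> Z" "cfinite_dim Z" "cfinite_dim V" "cvs.subspace V" "cvs.subspace Z"
  using assms cfinite_dim_subset[of Z V] cfinite_dim_hsub by (auto simp: flag_def)

lemma inj_on_if_kernel:
  assumes "cvs.subspace Z" "\<And>x. x \<in> Z \<Longrightarrow> blinfun_apply A x = 0 \<Longrightarrow> x = 0"
  shows "inj_on (blinfun_apply A) Z"
proof (rule inj_onI)
  fix x y assume xy: "x \<in> Z" "y \<in> Z" "A x = A y"
  have "x - y \<in> Z" using cvs.subspace_diff[OF assms(1) xy(1,2)] .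
  moreover have "A (x - y) = 0" using xy(3) by (simp add: blinfun.diff_right)
  ultimately have "x - y = 0" by (rule assms(2))
  then show "x = y" by simp
qed

lemma flag_iso_imp_map: "flag_iso \<Phi> V Z V' Z' \<Longrightarrow> flag_map \<Phi> V Z V' Z'"
  by (auto simp: flag_iso_def flag_map_def)

lemma flag_map_add: "flag V' Z' \<Longrightarrow> flag_map \<Phi> V Z V' Z' \<Longrightarrow> flag_map \<Psi> V Z V' Z' \<Longrightarrow>
    flag_map (\<Phi> + \<Psi>) V Z V' Z'"
  by (auto simp: flag_map_def flag_def blinfun.add_left clin_add cvs.subspace_add)

lemma flag_map_diff: "flag V' Z' \<Longrightarrow> flag_map \<Phi> V Z V' Z' \<Longrightarrow> flag_map \<Psi> V Z V' Z' \<Longrightarrow>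
    flag_map (\<Phi> - \<Psi>) V Z V' Z'"
  by (auto simp: flag_map_def flag_def blinfun.diff_left clin_diff cvs.subspace_diff)

lemma flag_map_scaleR: "flag V' Z' \<Longrightarrow> flag_map \<Phi> V Z V' Z' \<Longrightarrow> flag_map (r *\<^sub>R \<Phi>) V Z V' Z'"
  by (auto simp: flag_map_def flag_def blinfun.scaleR_left clin_scaleR scaleR_scaleC cvs.subspace_scale)

lemma i_op_apply [simp]: "i_op x = \<i> *\<^sub>C x"
  unfolding i_op_def by (simp add: bounded_linear_Blinfun_apply bounded_linear_scaleC)

lemma clin_i_op [simp]: "clin i_op"
  by (simp add: clin_def scaleC_scaleC mult.commute)

lemma flag_map_i_op: "flag V' Z' \<Longrightarrow> flag_map \<Phi> V Z V' Z' \<Longrightarrow> flag_map (i_op o\<^sub>L \<Phi>) V Z V' Z'"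
  by (auto simp: flag_map_def flag_def clin_compose cvs.subspace_scale)

lemma flag_ops_range:
  assumes "flag V Z" "S \<in> flag_ops V Z" shows "S x \<in> Z"
proof -
  have "cinner y (S x) = 0" if "y \<in> corth Z" for y
    using assms(2) that cinner_adj_left[of S y x] by (auto simp: flag_ops_def)
  then have "S x \<in> corth (corth Z)" by (simp add: corth_def)
  then show ?thesis using flagD[OF assms(1)] by (simp add: corth_corth)
qed

lemma subspace_flag_ops: "flag V Z \<Longrightarrow> subspace (flag_ops V Z)"
  unfolding subspace_def flag_ops_def
  by (auto simp: flag_def clin_add clin_scaleR adj_add adj_scaleR blinfun.add_left blinfun.scaleR_left
      cvs.subspace_0 cvs.subspace_add scaleR_scaleC cvs.subspace_scale)

section \<open>Finite dimension of the operator space of a flag\<close>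

lemma rank1_in_span: "rank1 (c *\<^sub>C u) w \<in> span {rank1 u w, rank1 (\<i> *\<^sub>C u) w}"
proof -
  have "rank1 (c *\<^sub>C u) w = Re c *\<^sub>R rank1 u w + Im c *\<^sub>R rank1 (\<i> *\<^sub>C u) w"
  proof (rule blinfun_eqI)
    fix x
    have c: "cinner w x * c = complex_of_real (Re c) * cinner w x + complex_of_real (Im c) * (cinner w x * \<i>)"
      by (simp add: complex_eq_iff)
    show "rank1 (c *\<^sub>C u) w x = (Re c *\<^sub>R rank1 u w + Im c *\<^sub>R rank1 (\<i> *\<^sub>C u) w) x"
      by (simp add: blinfun.add_left blinfun.scaleR_left scaleR_scaleC scaleC_scaleC c scaleC_add_left)
  qed
  then show ?thesis by (auto intro!: span_add span_scale intro: span_base)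
qed

lemma rank1_sum_left: "rank1 (\<Sum>i\<in>I. u i) w = (\<Sum>i\<in>I. rank1 (u i) w)"
  by (rule blinfun_eqI) (simp add: blinfun.sum_left cvs.scale_sum_right)

lemma flag_ops_finite_span:
  assumes "flag V Z"
  shows "\<exists>B. finite B \<and> flag_ops V Z \<subseteq> span B"
proof -
  obtain B where B: "finite B" "orthonormal B" "cvs.span B = Z"
    using orthonormal_basis_exists flagD[OF assms] by metis
  define C where "C = (\<Union>(b, c)\<in>B \<times> B. {rank1 b c, rank1 (\<i> *\<^sub>C b) c})"
  have "S \<in> span C" if S: "S \<in> flag_ops V Z" for S
  proof -
    have lin: "clin S" and S0: "\<forall>x\<in>corth Z. S x = 0" using S by (auto simp: flag_ops_def)
    have "S = (\<Sum>c\<in>B. rank1 (S c) c)"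
    proof (rule blinfun_eqI)
      fix x
      have "S (x - orth_proj Z x) = 0" using S0 flagD[OF assms] by simp
      then have "S x = S (\<Sum>c\<in>B. cinner c x *\<^sub>C c)"
        using orth_proj_orthonormal[OF B(1,2), of x] B(3) by (simp add: blinfun.diff_right)
      then show "S x = (\<Sum>c\<in>B. rank1 (S c) c) x"
        by (simp add: blinfun.sum_right blinfun.sum_left clinD[OF lin])
    qed
    also have "\<dots> = (\<Sum>c\<in>B. \<Sum>b\<in>B. rank1 (cinner b (S c) *\<^sub>C b) c)"
    proof (rule sum.cong[OF refl])
      fix c
      have "S c = (\<Sum>b\<in>B. cinner b (S c) *\<^sub>C b)"
        using orth_proj_orthonormal[OF B(1,2), of "S c"] B(3) flagD[OF assms]
          flag_ops_range[OF assms S, of c] by simp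
      then show "rank1 (S c) c = (\<Sum>b\<in>B. rank1 (cinner b (S c) *\<^sub>C b) c)"
        by (metis rank1_sum_left)
    qed
    also have "\<dots> \<in> span C"
    proof (intro span_sum)
      fix b c assume "b \<in> B" "c \<in> B"
      then have "{rank1 c b, rank1 (\<i> *\<^sub>C c) b} \<subseteq> C" by (auto simp: C_def)
      then show "rank1 (cinner c (S b) *\<^sub>C c) b \<in> span C" using rank1_in_span span_mono by blast
    qed
    finally show ?thesis .
  qed
  moreover have "finite C" using B by (auto simp: C_def)
  ultimately show ?thesis by blast
qed

lemma flag_ops_basis_exists: "flag V Z \<Longrightarrow> \<exists>bs. ordered_basis (flag_ops V Z) bs"
  using flag_ops_finite_span ordered_basis_exists subspace_flag_ops by metis

text \<open>This is why congruence by a non-unitary map is harmless: passing to adjoints turns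
  preservation of a subspace into preservation of its orthogonal complement, in the opposite
  direction.\<close>

lemma adj_flag_map:
  assumes "flag V Z" "flag_map \<Phi> V Z V' Z'"
  shows "x \<in> corth V' \<Longrightarrow> adj \<Phi> x \<in> corth V" "x \<in> corth Z' \<Longrightarrow> adj \<Phi> x \<in> corth Z"
    "adj \<Phi> x \<in> Z"
proof -
  have lin: "clin \<Phi>" using assms(2) by (simp add: flag_map_def)
  show "x \<in> corth V' \<Longrightarrow> adj \<Phi> x \<in> corth V"
    using assms(2) by (auto simp: corth_def[of V] cinner_adj[OF lin, symmetric] flag_map_def intro: corthD)
  show "x \<in> corth Z' \<Longrightarrow> adj \<Phi> x \<in> corth Z"
    using assms(2) by (auto simp: corth_def[of Z] cinner_adj[OF lin, symmetric] flag_map_def intro: corthD)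
  have "adj \<Phi> x \<in> corth (corth Z)"
    using assms(2) by (auto simp: corth_def[of "corth Z"] cinner_adj[OF lin, symmetric] flag_map_def)
  then show "adj \<Phi> x \<in> Z" using flagD[OF assms(1)] by (simp add: corth_corth)
qed

lemma adj_congr: "adj A = A \<Longrightarrow> adj (congr \<Phi> A) = congr \<Phi> A"
  by (simp add: congr_def adj_compose blinfun_compose_assoc)

lemma congr_flag_ops:
  assumes "flag V Z" "flag V' Z'" "flag_map \<Phi> V Z V' Z'" "A \<in> flag_ops V Z"
  shows "congr \<Phi> A \<in> flag_ops V' Z'"
proof -
  have lin: "clin \<Phi>" "clin A" "adj A = A" using assms(3,4) by (auto simp: flag_map_def flag_ops_def)
  have "congr \<Phi> A x \<in> V'" if "x \<in> corth V'" for x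
    using adj_flag_map(1)[OF assms(1,3) that] assms(3,4) by (auto simp: flag_ops_def flag_map_def)
  moreover have "congr \<Phi> A x = 0" if "x \<in> corth Z'" for x
    using adj_flag_map(2)[OF assms(1,3) that] assms(4) by (auto simp: flag_ops_def)
  moreover have "clin (congr \<Phi> A)" unfolding congr_def by (intro clin_compose clin_adj lin)
  ultimately show ?thesis using adj_congr[OF lin(3)] by (simp add: flag_ops_def)
qed

lemma linear_congr: "linear (congr \<Phi>)"
  unfolding congr_def
  by (rule linearI)
     (auto intro!: blinfun_eqI simp: blinfun.add_left blinfun.add_right blinfun.scaleR_left blinfun.scaleR_right)

lemma congr_compose: "congr (\<Psi> o\<^sub>L \<Phi>) A = congr \<Psi> (congr \<Phi> A)"
  by (simp add: congr_def adj_compose blinfun_compose_assoc)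

lemma congr_orth_proj:
  assumes "flag V Z" "A \<in> flag_ops V Z" shows "congr (orth_proj Z) A = A"
proof (rule blinfun_eqI)
  fix x
  have Z: "hsub Z" using flagD assms by blast
  have "A (x - orth_proj Z x) = 0" using assms(2) Z by (auto simp: flag_ops_def)
  then have "A (orth_proj Z x) = A x" by (simp add: blinfun.diff_right)
  then show "congr (orth_proj Z) A x = A x" using flag_ops_range[OF assms] Z by simp
qed

lemma flag_iso_orth_proj: "flag V Z \<Longrightarrow> flag_iso (orth_proj Z) V Z V Z"
proof -
  assume f: "flag V Z"
  have Z: "hsub Z" "V \<subseteq> Z" using flagD[OF f] by auto
  then have "orth_proj Z x = x" if "x \<in> Z" for x using that by simp
  then have "orth_proj Z ` V = V" "orth_proj Z ` Z = Z" using Z by (force simp: image_iff)+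
  then show ?thesis using Z by (simp add: flag_iso_def)
qed

lemma flag_iso_compose:
  assumes "flag_iso \<Phi> V Z V' Z'" "flag_iso \<Psi> V' Z' V'' Z''"
  shows "flag_iso (\<Psi> o\<^sub>L \<Phi>) V Z V'' Z''"
  using assms unfolding flag_iso_def by (auto simp: clin_compose image_comp[symmetric] o_def)

lemma flag_iso_inverse:
  assumes f: "flag V Z" "flag V' Z'" and \<Phi>: "flag_iso \<Phi> V Z V' Z'"
  shows "\<exists>\<Psi>. flag_iso \<Psi> V' Z' V Z \<and> \<Psi> o\<^sub>L \<Phi> = orth_proj Z \<and> \<Phi> o\<^sub>L \<Psi> = orth_proj Z'"
proof -
  have lin: "clin \<Phi>" and V': "\<Phi> ` V = V'" and Z': "\<Phi> ` Z = Z'"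
    and inj: "\<And>x. x \<in> Z \<Longrightarrow> \<Phi> x = 0 \<Longrightarrow> x = 0" and z: "\<And>x. x \<in> corth Z \<Longrightarrow> \<Phi> x = 0"
    using \<Phi> by (auto simp: flag_iso_def)
  have inj': "inj_on \<Phi> Z"
  using inj_on_if_kernel flagD(7)[OF f(1)] inj by blast
  obtain B where B: "finite B" "cvs.independent B" "cvs.span B = Z'" "B \<subseteq> Z'"
    using cfinite_dimE flagD[OF f(2)] by metis
  let ?g = "inv_into Z \<Phi>"
  obtain \<Psi> where \<Psi>: "clin \<Psi>" "\<forall>b\<in>B. \<Psi> b = ?g b" "\<forall>x\<in>corth Z'. \<Psi> x = 0"
    "\<forall>x. \<Psi> x \<in> cvs.span (?g ` B)"
    using finite_rank_extension[OF B(1,2), of ?g] B(3) by auto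
  have g: "?g b \<in> Z" "\<Phi> (?g b) = b" if "b \<in> B" for b
    using that B Z' inv_into_into[of b \<Phi> Z] f_inv_into_f[of b \<Phi> Z] by auto
  have rng: "\<Psi> x \<in> Z" for x
  proof -
    have "cvs.span (?g ` B) \<subseteq> Z" using g flagD[OF f(1)] by (intro cvs.span_minimal) auto
    then show ?thesis using \<Psi>(4) by blast
  qed
  have \<Phi>\<Psi>: "\<Phi> (\<Psi> y) = y" if "y \<in> Z'" for y
  proof -
    have "(\<Phi> o\<^sub>L \<Psi>) y = id_blinfun y"
      by (rule cvp.linear_eq_on[OF clin_linear clin_linear, of _ _ _ B])
         (use lin \<Psi> B that g in \<open>auto simp: clin_compose\<close>)
    then show ?thesis by simp
  qed
  have \<Psi>\<Phi>: "\<Psi> (\<Phi> x) = x" if "x \<in> Z" for x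
    using inj' that rng \<Phi>\<Psi>[of "\<Phi> x"] Z' by (metis imageI inj_onD)
  have comp: "\<Psi> o\<^sub>L \<Phi> = orth_proj Z"
  proof (rule blinfun_eqI)
    fix x
    have "\<Phi> (x - orth_proj Z x) = 0" using z flagD[OF f(1)] by simp
    then have "\<Phi> x = \<Phi> (orth_proj Z x)" by (simp add: blinfun.diff_right)
    then show "(\<Psi> o\<^sub>L \<Phi>) x = orth_proj Z x" using \<Psi>\<Phi>[of "orth_proj Z x"] flagD[OF f(1)] by simp
  qed
  have comp': "\<Phi> o\<^sub>L \<Psi> = orth_proj Z'"
  proof (rule blinfun_eqI)
    fix x
    have "\<Psi> (x - orth_proj Z' x) = 0" using \<Psi>(3) flagD[OF f(2)] by simp
    then have "\<Psi> x = \<Psi> (orth_proj Z' x)" by (simp add: blinfun.diff_right)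
    then show "(\<Phi> o\<^sub>L \<Psi>) x = orth_proj Z' x" using \<Phi>\<Psi>[of "orth_proj Z' x"] flagD[OF f(2)] by simp
  qed
  have im: "\<Psi> ` \<Phi> ` X = X" if "X \<subseteq> Z" for X
  proof -
    have "\<Psi> (\<Phi> x) = x" if "x \<in> X" for x using \<Psi>\<Phi> that \<open>X \<subseteq> Z\<close> by blast
    then show ?thesis by (force simp: image_iff)
  qed
  have "\<Psi> ` V' = V" "\<Psi> ` Z' = Z" using im[of V] im[of Z] V' Z' flagD(3)[OF f(1)] by auto
  moreover have "y = 0" if "y \<in> Z'" "\<Psi> y = 0" for y using \<Phi>\<Psi>[OF that(1)] that(2) by simp
  ultimately have "flag_iso \<Psi> V' Z' V Z" using \<Psi> by (auto simp: flag_iso_def)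
  then show ?thesis using comp comp' by blast
qed

lemma ordered_basis_congr:
  assumes f: "flag V Z" "flag V' Z'" and \<Phi>: "flag_iso \<Phi> V Z V' Z'"
    and bs: "ordered_basis (flag_ops V Z) bs"
  shows "ordered_basis (flag_ops V' Z') (map (congr \<Phi>) bs)"
proof -
  obtain \<Psi> where \<Psi>: "flag_iso \<Psi> V' Z' V Z" "\<Psi> o\<^sub>L \<Phi> = orth_proj Z" "\<Phi> o\<^sub>L \<Psi> = orth_proj Z'"
    using flag_iso_inverse[OF f \<Phi>] by blast
  have 1: "congr \<Psi> (congr \<Phi> A) = A" if "A \<in> flag_ops V Z" for A
    using congr_orth_proj[OF f(1) that] by (simp add: congr_compose[symmetric] \<Psi>)
  have 2: "congr \<Phi> (congr \<Psi> A) = A" if "A \<in> flag_ops V' Z'" for A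
    using congr_orth_proj[OF f(2) that] by (simp add: congr_compose[symmetric] \<Psi>)
  have "inj_on (congr \<Phi>) (flag_ops V Z)" by (rule inj_on_inverseI[of _ "congr \<Psi>"]) (rule 1)
  moreover have "congr \<Phi> ` flag_ops V Z = flag_ops V' Z'"
  proof
    show "congr \<Phi> ` flag_ops V Z \<subseteq> flag_ops V' Z'"
      using congr_flag_ops[OF f flag_iso_imp_map[OF \<Phi>]] by blast
    show "flag_ops V' Z' \<subseteq> congr \<Phi> ` flag_ops V Z"
      using congr_flag_ops[OF f(2,1) flag_iso_imp_map[OF \<Psi>(1)]] 2 by (metis image_eqI subsetI)
  qed
  ultimately show ?thesis using ordered_basis_map[OF linear_congr _ bs] by metis
qed

lemma flag_iso_dim:
  assumes "flag V Z" "flag_iso \<Phi> V Z V' Z'"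
  shows "cvs.dim V' = cvs.dim V" "cvs.dim Z' = cvs.dim Z"
proof -
  have lin: "clin \<Phi>" and inj: "\<And>x. x \<in> Z \<Longrightarrow> \<Phi> x = 0 \<Longrightarrow> x = 0" using assms(2) by (auto simp: flag_iso_def)
  have "inj_on \<Phi> Z"
  using inj_on_if_kernel flagD(7)[OF assms(1)] inj by blast
  then have "inj_on \<Phi> V" "inj_on \<Phi> Z" using flagD(3)[OF assms(1)] inj_on_subset by blast+
  then show "cvs.dim V' = cvs.dim V" "cvs.dim Z' = cvs.dim Z"
    using cdim_image_eq[OF lin] flagD[OF assms(1)] assms(2) unfolding flag_iso_def by metis+
qed

lemma flag_map_inj_imp_iso:
  assumes f: "flag V Z" "flag V' Z'" and dim: "cvs.dim V' = cvs.dim V" "cvs.dim Z' = cvs.dim Z"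
    and \<Phi>: "flag_map \<Phi> V Z V' Z'" and inj: "\<And>x. x \<in> Z \<Longrightarrow> \<Phi> x = 0 \<Longrightarrow> x = 0"
  shows "flag_iso \<Phi> V Z V' Z'"
proof -
  have lin: "clin \<Phi>" using \<Phi> by (simp add: flag_map_def)
  have "inj_on \<Phi> Z"
  using inj_on_if_kernel flagD(7)[OF f(1)] inj by blast
  then have "inj_on \<Phi> V" "inj_on \<Phi> Z" using flagD(3)[OF f(1)] inj_on_subset by blast+
  then have d: "cvs.dim (\<Phi> ` V) = cvs.dim V" "cvs.dim (\<Phi> ` Z) = cvs.dim Z"
    using cdim_image_eq[OF lin] flagD[OF f(1)] by auto
  have "\<Phi> ` V = V'"
    using flagD[OF f(2)] flagD[OF f(1)] \<Phi> d dim
    by (intro csubspace_dim_eq csubspace_image lin) (auto simp: flag_map_def)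
  moreover have "\<Phi> ` Z = Z'"
    using flagD[OF f(2)] flagD[OF f(1)] \<Phi> d dim
    by (intro csubspace_dim_eq csubspace_image lin) (auto simp: flag_map_def)
  ultimately show ?thesis using \<Phi> inj by (auto simp: flag_iso_def flag_map_def)
qed

lemma orth_decomp_in:
  assumes "hsub V" "hsub L" "V \<subseteq> L" "x \<in> L" shows "x - orth_proj V x \<in> L \<inter> corth V"
  using assms hsub_diff[OF assms(2,4)] orth_proj_in[OF assms(1), of x] orth_proj_diff_in[OF assms(1), of x] by blast

lemma flag_dim: "flag V Z \<Longrightarrow> cvs.dim Z = cvs.dim V + cvs.dim (Z \<inter> corth V)"
proof -
  assume f: "flag V Z"
  have h: "hsub V" "hsub Z" "V \<subseteq> Z" using flagD[OF f] by auto
  have "Z = ssum V (Z \<inter> corth V)"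
  proof (intro equalityI subsetI)
    fix z assume "z \<in> Z"
    then have "z - orth_proj V z \<in> Z \<inter> corth V" using orth_decomp_in h by blast
    moreover have "z = orth_proj V z + (z - orth_proj V z)" by simp
    ultimately show "z \<in> ssum V (Z \<inter> corth V)" unfolding ssum_def using orth_proj_in[OF h(1), of z] by blast
  next
    fix z assume "z \<in> ssum V (Z \<inter> corth V)"
    then obtain v y where "v \<in> V" "y \<in> Z" "z = v + y" unfolding ssum_def by blast
    then show "z \<in> Z" using h hsub_add by blast
  qed
  moreover have "cfinite_dim (Z \<inter> corth V)" by (rule cfinite_dim_subset[OF flagD(4)[OF f]]) blast
  moreover have "V \<subseteq> corth (Z \<inter> corth V)" by (rule subset_corth_commute) blast
  ultimately show ?thesis
    using cdim_orth_sum(1)[of V "Z \<inter> corth V"] flagD[OF f] hsub_Int[OF h(2) hsub_corth] by (simp add: hsub_def)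
qed

text \<open>An isomorphism of the first steps and one of their orthogonal complements inside
  \<open>Z\<close> and \<open>Z'\<close> are added; the sum is injective because the two images are
  orthogonal.\<close>

lemma flag_iso_exists:
  assumes f: "flag V Z" "flag V' Z'" and d: "cvs.dim V = cvs.dim V'" "cvs.dim Z = cvs.dim Z'"
  shows "\<exists>\<Phi>. flag_iso \<Phi> V Z V' Z'"
proof -
  let ?l = "Z \<inter> corth V" and ?l' = "Z' \<inter> corth V'"
  have h: "hsub V" "hsub Z" "V \<subseteq> Z" "hsub V'" "hsub Z'" "V' \<subseteq> Z'" using flagD[OF f(1)] flagD[OF f(2)] by auto
  have l: "hsub ?l" "hsub ?l'" using h hsub_Int by blast+
  have fl: "cfinite_dim ?l" "cfinite_dim ?l'"
    by (rule cfinite_dim_subset[OF flagD(4)[OF f(1)]], blast) (rule cfinite_dim_subset[OF flagD(4)[OF f(2)]], blast)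
  have "cvs.dim ?l = cvs.dim ?l'" using flag_dim[OF f(1)] flag_dim[OF f(2)] d by simp
  then obtain \<Phi>2 where \<Phi>2: "clin \<Phi>2" "\<forall>x\<in>?l. \<Phi>2 x \<in> ?l'" "\<forall>x\<in>?l. \<Phi>2 x = 0 \<longrightarrow> x = 0"
    using isomorphism_exists[of ?l ?l'] l fl unfolding hsub_def by (elim conjE) (meson that)
  obtain \<Phi>1 where \<Phi>1: "clin \<Phi>1" "\<forall>x\<in>V. \<Phi>1 x \<in> V'" "\<forall>x\<in>V. \<Phi>1 x = 0 \<longrightarrow> x = 0"
    using isomorphism_exists[OF flagD(6)[OF f(1)] flagD(5)[OF f(1)] flagD(6)[OF f(2)] flagD(5)[OF f(2)] d(1)]
    by (elim exE conjE) (rule that)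
  define \<Phi> where "\<Phi> = (\<Phi>1 o\<^sub>L orth_proj V) + (\<Phi>2 o\<^sub>L orth_proj ?l)"
  have \<Phi>: "\<Phi> x = \<Phi>1 (orth_proj V x) + \<Phi>2 (orth_proj ?l x)" for x by (simp add: \<Phi>_def blinfun.add_left)
  have pl: "orth_proj ?l x = orth_proj Z x - orth_proj V x" for x by (rule orth_proj_Int_corth[OF h(1-3)])
  have in1: "\<Phi>1 (orth_proj V x) \<in> V'" for x by (rule bspec[OF \<Phi>1(2) orth_proj_in[OF h(1)]])
  have in2: "\<Phi>2 (orth_proj ?l x) \<in> ?l'" for x by (rule bspec[OF \<Phi>2(2) orth_proj_in[OF l(1)]])
  have "flag_map \<Phi> V Z V' Z'"
    unfolding flag_map_def
  proof (intro conjI ballI)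
    show "clin \<Phi>" unfolding \<Phi>_def using \<Phi>1(1) \<Phi>2(1) h l by (intro clin_intros clin_orth_proj)
    show "\<Phi> x \<in> V'" if "x \<in> V" for x
    proof -
      have "orth_proj ?l x = 0" unfolding pl using that h by (simp add: subsetD)
      then show ?thesis using in1[of x] by (simp add: \<Phi>)
    qed
    show "\<Phi> x \<in> Z'" for x unfolding \<Phi> using in1[of x] in2[of x] h hsub_add[OF h(5)] by blast
    show "\<Phi> x = 0" if "x \<in> corth Z" for x
    proof -
      have "x \<in> corth V" using that corth_antimono[OF h(3)] by blast
      then have "orth_proj V x = 0" "orth_proj Z x = 0" using that h by simp_all
      then show ?thesis by (simp add: \<Phi> pl)
    qed
  qed
  moreover have "x = 0" if x: "x \<in> Z" "\<Phi> x = 0" for x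
  proof -
    have "\<Phi>1 (orth_proj V x) = - \<Phi>2 (orth_proj ?l x)" using x(2) by (simp add: \<Phi> eq_neg_iff_add_eq_0)
    then have "\<Phi>1 (orth_proj V x) \<in> corth V'" using in2[of x] hsub_minus[OF hsub_corth] by auto
    then have 1: "\<Phi>1 (orth_proj V x) = 0" using in1[of x] corth_disjoint by blast
    then have "\<Phi>2 (orth_proj ?l x) = 0" using x(2) by (simp add: \<Phi>)
    then have "orth_proj ?l x = 0" using \<Phi>2(3) orth_proj_in[OF l(1), of x] by blast
    moreover have "orth_proj V x = 0" using 1 \<Phi>1(3) orth_proj_in[OF h(1), of x] by blast
    ultimately show ?thesis using x(1) h(2) by (simp add: pl)
  qed
  ultimately show ?thesis using flag_map_inj_imp_iso[OF f] d by metis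
qed

text \<open>A pencil \<open>\<Phi> + z (\<Psi> - \<Phi>)\<close> of complex linear maps is singular for finitely many \<open>z\<close> only, and
  the complement of a finite set in the plane is connected.\<close>

lemma same_oriented_congr:
  assumes f: "flag V Z" "flag V' Z'"
    and \<Phi>: "flag_iso \<Phi> V Z V' Z'" and \<Psi>: "flag_iso \<Psi> V Z V' Z'"
    and bs: "ordered_basis (flag_ops V Z) bs"
  shows "same_oriented (map (congr \<Phi>) bs) (map (congr \<Psi>) bs)"
proof -
  define D where "D = \<Psi> - \<Phi>"
  define E where "E = i_op o\<^sub>L D"
  have fm: "flag_map \<Phi> V Z V' Z'" "flag_map D V Z V' Z'" "flag_map E V Z V' Z'"
    using flag_iso_imp_map[OF \<Phi>] flag_iso_imp_map[OF \<Psi>] f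
    by (auto simp: D_def E_def intro!: flag_map_diff flag_map_i_op)
  \<comment> \<open>The pencil \<open>\<Phi> + z D\<close>. Operators form a real vector space here,
    so the imaginary part of \<open>z\<close> acts through \<open>E\<close>, which is
    \<open>i D\<close>.\<close>
  define X where "X z = \<Phi> + (Re z *\<^sub>R D + Im z *\<^sub>R E)" for z
  have Xfm: "flag_map (X z) V Z V' Z'" for z
    unfolding X_def by (intro flag_map_add flag_map_scaleR fm f)
  have Xapp: "X z x = \<Phi> x + z *\<^sub>C D x" for z x
  proof -
    have z: "complex_of_real (Re z) + complex_of_real (Im z) * \<i> = z" by (simp add: complex_eq_iff)
    have "X z x = \<Phi> x + (complex_of_real (Re z) + complex_of_real (Im z) * \<i>) *\<^sub>C D x"
      by (simp add: X_def E_def blinfun.add_left blinfun.scaleR_left scaleR_scaleC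
          scaleC_scaleC scaleC_add_left del: of_real_mult)
    then show ?thesis by (simp only: z)
  qed
  define S where "S = - {z. \<exists>x\<in>Z. x \<noteq> 0 \<and> \<Phi> x + z *\<^sub>C D x = 0}"
  have fin: "finite {z. \<exists>x\<in>Z. x \<noteq> 0 \<and> \<Phi> x + z *\<^sub>C D x = 0}"
    using fm flagD[OF f(1)] \<Phi>
    by (intro finite_singular_pencil) (auto simp: flag_map_def flag_iso_def)
  have conn: "connected S"
    unfolding S_def Compl_eq_Diff_UNIV
    by (intro connected_open_diff_countable countable_finite fin) auto
  have iso: "flag_iso (X z) V Z V' Z'" if "z \<in> S" for z
    using that flag_iso_dim[OF f(1) \<Phi>]
    by (intro flag_map_inj_imp_iso f Xfm) (auto simp: S_def Xapp)
  have in0: "0 \<in> S" "1 \<in> S" using \<Phi> \<Psi> by (auto simp: S_def D_def flag_iso_def blinfun.diff_left)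
  have X01: "X 0 = \<Phi>" "X 1 = \<Psi>" by (simp_all add: X_def D_def)
  define C where "C = flag_ops V' Z'"
  have C: "subspace C" unfolding C_def using subspace_flag_ops f by blast
  define cs where "cs = map (congr \<Phi>) bs"
  have cs: "ordered_basis C cs" unfolding C_def cs_def by (rule ordered_basis_congr[OF f \<Phi> bs])
  define n where "n = length bs"
  have ln: "length cs = n" by (simp add: cs_def n_def)
  \<comment> \<open>The polar form of the quadratic map from \<open>A\<close> to
    \<open>congr A T\<close>. Expanding \<open>congr (X z) T\<close> with it shows that the entries
    of the change of basis are polynomials in the real and imaginary part of \<open>z\<close>, hence
    continuous.\<close>
  define pol where "pol A B T = congr (A + B) T - congr A T - congr B T" for A B T :: "'a \<Rightarrow>\<^sub>L 'a"
  have cC: "congr A (bs ! j) \<in> C" if "flag_map A V Z V' Z'" "j < n" for A j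
    using congr_flag_ops[OF f that(1)] ordered_basis_in[OF bs] that(2) by (simp add: C_def n_def)
  have pC: "pol A B (bs ! j) \<in> C" if "flag_map A V Z V' Z'" "flag_map B V Z V' Z'" "j < n" for A B j
    unfolding pol_def using that by (intro subspace_diff[OF C] cC flag_map_add f) auto
  have expand: "congr (X z) T = congr \<Phi> T + Re z *\<^sub>R pol \<Phi> D T + Im z *\<^sub>R pol \<Phi> E T
      + (Re z)\<^sup>2 *\<^sub>R congr D T + (Im z)\<^sup>2 *\<^sub>R congr E T + (Re z * Im z) *\<^sub>R pol D E T" for z T
    by (rule blinfun_eqI)
       (simp add: X_def pol_def adj_add adj_scaleR blinfun.add_left blinfun.add_right blinfun.scaleR_left
        blinfun.scaleR_right blinfun.diff_left blinfun.diff_right algebra_simps power2_eq_square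
        scaleR_add_right)
  define co where "co c = (SOME x. c = (\<Sum>i<n. x i *\<^sub>R (cs ! i)))" for c
  have co: "c = (\<Sum>i<n. co c i *\<^sub>R (cs ! i))" if "c \<in> C" for c
    unfolding co_def using ordered_basis_coords_exist[OF cs that] unfolding ln by (rule someI_ex)
  define M where "M z = mat n n (\<lambda>(i, j). co (congr \<Phi> (bs ! j)) i + Re z * co (pol \<Phi> D (bs ! j)) i
      + Im z * co (pol \<Phi> E (bs ! j)) i + (Re z)\<^sup>2 * co (congr D (bs ! j)) i
      + (Im z)\<^sup>2 * co (congr E (bs ! j)) i + (Re z * Im z) * co (pol D E (bs ! j)) i)" for z
  have bc: "base_change cs (M z) (map (congr (X z)) bs)" for z
  proof -
    have "congr (X z) (bs ! j) = (\<Sum>i<n. (M z $$ (i, j)) *\<^sub>R (cs ! i))" if j: "j < n" for j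
    proof -
      have "(\<Sum>i<n. (M z $$ (i, j)) *\<^sub>R (cs ! i)) =
          (\<Sum>i<n. co (congr \<Phi> (bs ! j)) i *\<^sub>R (cs ! i))
          + Re z *\<^sub>R (\<Sum>i<n. co (pol \<Phi> D (bs ! j)) i *\<^sub>R (cs ! i))
          + Im z *\<^sub>R (\<Sum>i<n. co (pol \<Phi> E (bs ! j)) i *\<^sub>R (cs ! i))
          + (Re z)\<^sup>2 *\<^sub>R (\<Sum>i<n. co (congr D (bs ! j)) i *\<^sub>R (cs ! i))
          + (Im z)\<^sup>2 *\<^sub>R (\<Sum>i<n. co (congr E (bs ! j)) i *\<^sub>R (cs ! i))
          + (Re z * Im z) *\<^sub>R (\<Sum>i<n. co (pol D E (bs ! j)) i *\<^sub>R (cs ! i))"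
        unfolding scaleR_sum_right sum.distrib[symmetric]
        using j by (intro sum.cong) (auto simp: M_def scaleR_add_left)
      also have "\<dots> = congr (X z) (bs ! j)"
        unfolding expand using j fm
        by (simp only: co[OF cC, symmetric] co[OF pC, symmetric])
      finally show ?thesis by simp
    qed
    then show ?thesis by (auto simp: base_change_def ln n_def[symmetric] M_def)
  qed
  have "same_oriented (map (congr (X 0)) bs) (map (congr (X 1)) bs)"
  proof (rule same_oriented_connected_family[OF conn cs _ bc _ in0])
    show "ordered_basis C (map (congr (X z)) bs)" if "z \<in> S" for z
      unfolding C_def by (rule ordered_basis_congr[OF f iso[OF that] bs])
    show "continuous_on S (\<lambda>z. M z $$ (i, j))" if "i < length cs" "j < length cs" for i j
      using that unfolding M_def ln by (auto intro!: continuous_intros)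
  qed
  then show ?thesis by (simp add: X01)
qed

text \<open>Sending \<open>corth V\<close> into \<open>V\<close> kills the block of
  \<open>Z \<inter> corth V\<close> with itself, vanishing on \<open>corth Z\<close> kills the third
  row and column, and self-adjointness ties the two off-diagonal blocks together. The right-hand
  side no longer mentions the splitting, which a flag isomorphism need not respect.\<close>

lemma block_ops_eq_flag_ops:
  assumes L: "hsub L" and VZ: "flag V Z" "Z \<subseteq> L"
  shows "{S \<in> Sym_op L. \<exists>S1 \<in> Hom_op (Z \<inter> corth V) V. \<exists>S2 \<in> Hom_op V V. S = block_op S1 S2} = flag_ops V Z"
proof (intro equalityI subsetI)
  let ?l = "Z \<inter> corth V"
  have V: "hsub V" and Z: "hsub Z" and VZ': "V \<subseteq> Z" using flagD[OF VZ(1)] by auto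
  have l: "hsub ?l" using Z by (simp add: hsub_Int)
  {
    fix S assume "S \<in> {S \<in> Sym_op L. \<exists>S1 \<in> Hom_op ?l V. \<exists>S2 \<in> Hom_op V V. S = block_op S1 S2}"
    then obtain S1 S2 where S: "S \<in> Sym_op L" "S1 \<in> Hom_op ?l V" "S2 \<in> Hom_op V V" "S = block_op S1 S2"
      by blast
    have lin: "clin S1" using S(2) by (simp add: Hom_op_def clin_def)
    have Seq: "S = adj S1 + S1 + S2" using S(4) lin by (simp add: block_op_def hadjoint_eq_adj)
    have "clin S" and sa: "adj S = S"
      using S(1) by (auto simp: Sym_op_def Hom_op_def clin_def intro: adj_eqI_cinner)
    have a0: "adj S1 x = 0" if "x \<in> corth V" for x
    proof (rule cinner_ext)
      fix z show "cinner z (adj S1 x) = cinner z 0"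
        using S(2) that by (simp add: cinner_adj[OF lin, symmetric] Hom_op_def corth_def)
    qed
    have "S x \<in> V" if "x \<in> corth V" for x
      using a0[OF that] S(2,3) that V by (auto simp: Seq blinfun.add_left Hom_op_def intro: hsub_add)
    moreover have "S x = 0" if "x \<in> corth Z" for x
    proof -
      have "x \<in> corth V" "x \<in> corth ?l" using that VZ' corth_antimono by blast+
      then show ?thesis using a0 S(2,3) by (auto simp: Seq blinfun.add_left Hom_op_def)
    qed
    ultimately show "S \<in> flag_ops V Z" using \<open>clin S\<close> sa by (simp add: flag_ops_def)
  }
  fix S assume S: "S \<in> flag_ops V Z"
  have lin: "clin S" and sa: "adj S = S" and SV: "\<And>x. x \<in> corth V \<Longrightarrow> S x \<in> V"
    and S0: "\<And>x. x \<in> corth Z \<Longrightarrow> S x = 0" using S by (auto simp: flag_ops_def)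
  have rng: "S x \<in> Z" for x using flag_ops_range[OF VZ(1) S] .
  have "cinner (S x) y = cinner x (S y)" for x y using cinner_adj[OF lin] sa by metis
  moreover have "S x = 0" if "x \<in> corth L" for x using S0 that VZ(2) corth_antimono by blast
  ultimately have Sym: "S \<in> Sym_op L" using lin rng VZ(2) by (auto simp: Sym_op_def Hom_op_def clinD)
  define S1 where "S1 = orth_proj V o\<^sub>L (S o\<^sub>L orth_proj ?l)"
  define S2 where "S2 = orth_proj V o\<^sub>L (S o\<^sub>L orth_proj V)"
  have lin12: "clin S1" "clin S2" unfolding S1_def S2_def using V l lin by (intro clin_compose; simp)+
  have "S1 x \<in> V" "S2 x \<in> V" "x \<in> corth ?l \<Longrightarrow> S1 x = 0" "x \<in> corth V \<Longrightarrow> S2 x = 0" for x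
    unfolding S1_def S2_def using V l by auto
  then have H1: "S1 \<in> Hom_op ?l V" and H2: "S2 \<in> Hom_op V V"
    unfolding Hom_op_def using clinD[OF lin12(1)] clinD[OF lin12(2)] by blast+
  have aS1: "adj S1 = orth_proj ?l o\<^sub>L (S o\<^sub>L orth_proj V)"
    using V l sa by (simp add: S1_def adj_compose blinfun_compose_assoc)
  have "S = adj S1 + S1 + S2"
  proof (rule blinfun_eqI)
    fix x
    define v where "v = orth_proj V x"
    define y where "y = orth_proj ?l x"
    have yl: "y = orth_proj Z x - v" unfolding y_def v_def using orth_proj_Int_corth[OF V Z VZ'] by simp
    have "S (x - orth_proj Z x) = 0" using S0 Z by simp
    then have Sx: "S x = S v + S y" by (simp add: yl blinfun.diff_right)
    have yl': "y \<in> corth V" using orth_proj_in[OF l, of x] by (simp add: y_def)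
    have Sy: "orth_proj V (S y) = S y" using SV[OF yl'] V by simp
    have Sv: "S v = orth_proj ?l (S v) + orth_proj V (S v)"
      using orth_proj_Int_corth[OF V Z VZ', of "S v"] rng Z by simp
    have "adj S1 x = orth_proj ?l (S v)" by (simp add: aS1 v_def)
    moreover have "S1 x = S y" using Sy by (simp add: S1_def y_def)
    moreover have "S2 x = orth_proj V (S v)" by (simp add: S2_def v_def)
    ultimately show "S x = (adj S1 + S1 + S2) x" using Sx Sv by (simp add: blinfun.add_left)
  qed
  then have "S = block_op S1 S2" using lin12 by (simp add: block_op_def hadjoint_eq_adj)
  then show "S \<in> {S \<in> Sym_op L. \<exists>S1 \<in> Hom_op ?l V. \<exists>S2 \<in> Hom_op V V. S = block_op S1 S2}"
    using Sym H1 H2 by blast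
qed

subsection \<open>Flags with a one-dimensional first step\<close>

text \<open>The sign of the second vector compensates the antilinearity of \<open>rank1 e\<close>:
  \<open>rank1 e (- (i f))\<close> is \<open>i\<close> times \<open>rank1 e f\<close>. The list thus
  corresponds to \<open>realify\<close> under \<open>rank1 e\<close>.\<close>

definition realv :: "'a::complex_hilbert_space list \<Rightarrow> 'a list" where
  "realv fs = concat (map (\<lambda>f. [f, - (\<i> *\<^sub>C f)]) fs)"

lemma realv_simps [simp]: "realv [] = []" "realv (f # fs) = f # (- (\<i> *\<^sub>C f)) # realv fs"
  by (simp_all add: realv_def)

lemma length_realv [simp]: "length (realv fs) = 2 * length fs"
  by (induction fs) auto

text \<open>If \<open>f\<close> were in the real span, some \<open>(1 + k i) f\<close> with real
  \<open>k\<close> would lie in \<open>E\<close>; the factor is never zero and can be divided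
  out.\<close>

lemma complex_line_notin:
  assumes E: "cvs.subspace E" and f: "f \<notin> E"
  shows "- (\<i> *\<^sub>C f) \<notin> E" "f \<notin> span (insert (- (\<i> *\<^sub>C f)) E)"
proof -
  have rE: "span E = E" using E csubspace_imp_subspace span_eq_iff by blast
  have sc: "f \<in> E" if "c \<noteq> 0" "c *\<^sub>C f \<in> E" for c
    using cvs.subspace_scale[OF E that(2), of "1 / c"] that(1) by (simp add: scaleC_scaleC)
  show "- (\<i> *\<^sub>C f) \<notin> E" using sc[of "- \<i>"] f by auto
  show "f \<notin> span (insert (- (\<i> *\<^sub>C f)) E)"
  proof
    assume "f \<in> span (insert (- (\<i> *\<^sub>C f)) E)"
    then obtain k where "f - k *\<^sub>R (- (\<i> *\<^sub>C f)) \<in> E" by (auto simp: span_insert rE)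
    moreover have "f - k *\<^sub>R (- (\<i> *\<^sub>C f)) = (1 + complex_of_real k * \<i>) *\<^sub>C f"
      by (simp add: scaleR_scaleC scaleC_scaleC scaleC_add_left)
    moreover have "1 + complex_of_real k * \<i> \<noteq> 0" by (simp add: complex_eq_iff)
    ultimately show False using sc f by metis
  qed
qed

lemma span_complex_line:
  assumes E: "cvs.subspace E"
  shows "span (insert f (insert (- (\<i> *\<^sub>C f)) E)) = cvs.span (insert f E)"
proof -
  have rE: "span E = E" using E csubspace_imp_subspace span_eq_iff by blast
  have cE: "cvs.span E = E" using E cvs.span_eq_iff by blast
  have "y \<in> span (insert f (insert (- (\<i> *\<^sub>C f)) E)) \<longleftrightarrow> y \<in> cvs.span (insert f E)" for y
  proof -
    have eq: "y - a *\<^sub>R f - b *\<^sub>R (- (\<i> *\<^sub>C f)) = y - (complex_of_real a - complex_of_real b * \<i>) *\<^sub>C f" for a b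
      by (simp add: scaleR_scaleC scaleC_scaleC cvs.scale_left_diff_distrib)
    have "y \<in> span (insert f (insert (- (\<i> *\<^sub>C f)) E)) \<longleftrightarrow>
        (\<exists>a b. y - (complex_of_real a - complex_of_real b * \<i>) *\<^sub>C f \<in> E)"
      unfolding span_insert mem_Collect_eq rE eq[symmetric] by blast
    also have "\<dots> \<longleftrightarrow> (\<exists>k. y - k *\<^sub>C f \<in> E)"
    proof
      assume "\<exists>k. y - k *\<^sub>C f \<in> E"
      then obtain k where "y - k *\<^sub>C f \<in> E" by blast
      moreover have "k = complex_of_real (Re k) - complex_of_real (- Im k) * \<i>" by (simp add: complex_eq_iff)
      ultimately show "\<exists>a b. y - (complex_of_real a - complex_of_real b * \<i>) *\<^sub>C f \<in> E" by metis
    qed blast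
    finally show ?thesis unfolding cvs.span_insert mem_Collect_eq cE .
  qed
  then show ?thesis by blast
qed

lemma span_span_insert2: "span (insert a (insert b (span S))) = span (insert a (insert b S))"
  by (rule span_eq[THEN iffD2])
     (auto intro: span_base span_mono[THEN subsetD, rotated] span_superset[THEN subsetD]
       simp: insert_subset)

lemma realv_basis:
  assumes "distinct fs" "cvs.independent (set fs)"
  shows "ordered_basis (cvs.span (set fs)) (realv fs)"
  using assms
proof (induction fs)
  case Nil
  then show ?case by (simp add: ordered_basis_def independent_empty)
next
  case (Cons f fs)
  let ?E = "cvs.span (set fs)"
  have f: "f \<notin> ?E" and ind: "cvs.independent (set fs)" "distinct fs"
    using Cons.prems by (auto simp: cvs.independent_insert)
  have IH: "distinct (realv fs)" "independent (set (realv fs))" "span (set (realv fs)) = ?E"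
    using Cons.IH ind by (auto simp: ordered_basis_def)
  have E: "cvs.subspace ?E" by simp
  note n = complex_line_notin[OF E f]
  let ?g = "- (\<i> *\<^sub>C f)"
  have sp: "span (insert ?g (set (realv fs))) \<subseteq> span (insert ?g ?E)"
    using IH(3) span_superset by (intro span_mono) blast
  have i1: "independent (insert ?g (set (realv fs)))"
    by (rule independent_insertI[OF _ IH(2)]) (use IH(3) n(1) in simp)
  have i2: "independent (insert f (insert ?g (set (realv fs))))"
    using n(2) sp by (intro independent_insertI[OF _ i1]) blast
  have "f \<notin> insert ?g (set (realv fs))" using n(2) sp span_superset by blast
  moreover have "?g \<notin> set (realv fs)" using n(1) IH(3) span_superset by blast
  moreover have "span (insert f (insert ?g (set (realv fs)))) = cvs.span (set (f # fs))"
    using span_complex_line[OF E, of f] span_span_insert2[of f ?g "set (realv fs)"] IH(3) span_insert_Un[of f "set fs"]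
    by simp
  ultimately show ?case using i2 IH(1) by (simp add: ordered_basis_def)
qed

text \<open>The natural orientation only provides a real basis of the form
  \<open>realify Ts\<close>. Complex independence is recovered by induction, the real span of the
  tail being already known to be its complex span.\<close>

lemma realv_basis_converse:
  assumes "distinct (realv fs)" "independent (set (realv fs))"
  shows "distinct fs \<and> cvs.independent (set fs)"
  using assms
proof (induction fs)
  case (Cons f fs)
  have sub: "independent (insert f (set (realv fs)))" and d: "distinct (realv fs)" "f \<notin> set (realv fs)"
    using Cons.prems independent_mono[of _ "insert f (set (realv fs))"] by auto
  then have IH: "distinct fs" "cvs.independent (set fs)"
    using Cons.IH independent_mono by blast+
  have "span (set (realv fs)) = cvs.span (set fs)"
    using realv_basis[OF IH] by (simp add: ordered_basis_def)
  then have f: "f \<notin> cvs.span (set fs)" using sub d by (auto simp: independent_insert)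
  then have "f \<notin> set fs" using cvs.span_base by blast
  then show ?case using IH f by (auto simp: cvs.independent_insert)
qed (simp add: cvs.independent_empty)

lemma realify_rank1: "realify (map (rank1 e) fs) = map (rank1 e) (realv fs)"
proof (induction fs)
  case (Cons f fs)
  have "i_op o\<^sub>L rank1 e f = rank1 e (- (\<i> *\<^sub>C f))"
    by (rule blinfun_eqI) (simp add: cinner_scaleC_left scaleC_scaleC mult.commute)
  then show ?case using Cons by (simp add: realify_def)
qed (simp add: realify_def)

text \<open>This is \<open>block_op (rank1 e h) 0\<close>. It is linear in \<open>h\<close> over the
  reals only.\<close>

definition sym1 :: "'a::complex_hilbert_space \<Rightarrow> 'a \<Rightarrow> 'a \<Rightarrow>\<^sub>L 'a" where
  "sym1 e h = rank1 h e + rank1 e h"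

text \<open>The list that defines the natural orientation, rewritten in terms of a unit vector
  \<open>e\<close> of \<open>V\<close> and a complex basis \<open>fs\<close> of the complement. In
  this form a congruence simply acts on the vectors \<open>e\<close> and \<open>fs\<close>.\<close>

definition line_frame :: "'a::complex_hilbert_space \<Rightarrow> 'a list \<Rightarrow> ('a \<Rightarrow>\<^sub>L 'a) list" where
  "line_frame e fs = rank1 e e # map (sym1 e) (realv fs)"

lemma linear_sym1: "linear (sym1 e)"
  by (rule linearI)
     (auto intro!: blinfun_eqI simp: sym1_def blinfun.add_left blinfun.scaleR_left cinner_add_left
       cinner_scaleC_left scaleC_add_left scaleC_add_right scaleR_scaleC scaleC_scaleC algebra_simps)

lemma linear_rank1_right: "linear (rank1 e)"
  by (rule linearI)
     (auto intro!: blinfun_eqI simp: blinfun.add_left blinfun.scaleR_left cinner_add_left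
       cinner_scaleC_left scaleC_add_left scaleR_scaleC scaleC_scaleC)

lemma congr_rank1: "clin \<Phi> \<Longrightarrow> congr \<Phi> (rank1 u w) = rank1 (\<Phi> u) (\<Phi> w)"
  by (rule blinfun_eqI) (simp add: clinD cinner_adj)

lemma congr_line_frame:
  assumes "clin \<Phi>"
  shows "map (congr \<Phi>) (line_frame e fs) = line_frame (\<Phi> e) (map \<Phi> fs)"
proof -
  have r: "map \<Phi> (realv fs) = realv (map \<Phi> fs)"
    by (induction fs) (auto simp: blinfun.minus_right clinD[OF assms])
  have sy: "congr \<Phi> (sym1 e h) = sym1 (\<Phi> e) (\<Phi> h)" for h
    by (simp add: sym1_def linear_add[OF linear_congr] congr_rank1[OF assms])
  then have "map (congr \<Phi>) (map (sym1 e) xs) = map (sym1 (\<Phi> e)) (map \<Phi> xs)" for xs by simp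
  then show ?thesis by (simp only: line_frame_def list.map congr_rank1[OF assms] r)
qed

lemma line_orth_proj:
  assumes "norm e = 1" "V = cvs.span {e}"
  shows "hsub V" "orth_proj V = rank1 e e"
proof -
  have o: "orthonormal {e}" using assms by (simp add: orthonormal_def cinner_self)
  show "hsub V" using assms hsub_span_finite[of "{e}"] by simp
  show "orth_proj V = rank1 e e"
    by (rule blinfun_eqI) (use orth_proj_orthonormal[OF _ o] assms in simp)
qed

text \<open>An operator \<open>S\<close> of the flag is determined by its value on \<open>e\<close>,
  namely \<open>S e = r e + h\<close> with \<open>h\<close> in the complement of \<open>V\<close>
  inside \<open>Z\<close>; self-adjointness makes \<open>r\<close> real. Then \<open>S\<close> is
  \<open>r\<close> times \<open>rank1 e e\<close> plus \<open>sym1 e h\<close>.\<close>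

lemma line_frame_basis:
  assumes e: "norm e = 1" "V = cvs.span {e}" and VZ: "flag V Z"
    and fs: "ordered_basis (Z \<inter> corth V) (realv fs)"
  shows "ordered_basis (flag_ops V Z) (line_frame e fs)"
proof -
  let ?l = "Z \<inter> corth V"
  have ee: "cinner e e = 1" using e by (simp add: cinner_self)
  have eV: "e \<in> V" using e by (simp add: cvs.span_base)
  have eh: "cinner h e = 0" "cinner e h = 0" if "h \<in> ?l" for h
    using that eV corthD corthD' by blast+
  have s: "sym1 e h e = h" if "h \<in> ?l" for h
    using eh[OF that] ee by (simp add: sym1_def blinfun.add_left)
  have "inj_on (sym1 e) ?l" by (rule inj_on_inverseI[of _ "\<lambda>A. blinfun_apply A e"]) (rule s)
  then have b: "ordered_basis (sym1 e ` ?l) (map (sym1 e) (realv fs))"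
    by (rule ordered_basis_map[OF linear_sym1 _ fs])
  have P: "rank1 e e \<notin> sym1 e ` ?l"
  proof
    assume "rank1 e e \<in> sym1 e ` ?l"
    then obtain h where h: "h \<in> ?l" "rank1 e e = sym1 e h" by blast
    then have "e = h" using s[OF h(1)] ee by (metis rank1_apply cvs.scale_one)
    then show False using eh(1)[OF h(1)] ee by simp
  qed
  let ?C = "sym1 e ` ?l"
  have sC: "span (set (map (sym1 e) (realv fs))) = ?C" and dC: "distinct (map (sym1 e) (realv fs))"
    and iC: "independent (set (map (sym1 e) (realv fs)))" using b by (auto simp: ordered_basis_def)
  have ind: "independent (insert (rank1 e e) (set (map (sym1 e) (realv fs))))"
    using P iC sC by (intro independent_insertI) simp_all
  have nin: "rank1 e e \<notin> set (map (sym1 e) (realv fs))" using P sC span_superset by blast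
  have "S \<in> span (insert (rank1 e e) (set (map (sym1 e) (realv fs)))) \<longleftrightarrow> S \<in> flag_ops V Z" for S
  proof
    assume "S \<in> span (insert (rank1 e e) (set (map (sym1 e) (realv fs))))"
    then obtain k h where h: "h \<in> ?l" "S - k *\<^sub>R rank1 e e = sym1 e h"
      unfolding span_insert sC by blast
    then have S: "S = k *\<^sub>R rank1 e e + sym1 e h" by (simp add: algebra_simps)
    have "clin S" unfolding S sym1_def by (intro clin_intros clin_rank1)
    moreover have "adj S = S" unfolding S sym1_def by (simp add: adj_add adj_scaleR adj_rank1 add.commute)
    moreover have "S x \<in> V" if "x \<in> corth V" for x
    proof -
      have "cinner e x = 0" using that eV corthD by blast
      then have "S x = cinner h x *\<^sub>C e" by (simp add: S sym1_def blinfun.add_left blinfun.scaleR_left)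
      then show ?thesis using e by (simp add: cvs.span_scale cvs.span_base)
    qed
    moreover have "S x = 0" if "x \<in> corth Z" for x
    proof -
      have "cinner e x = 0" "cinner h x = 0" using that eV h(1) flagD(3)[OF VZ] corthD by blast+
      then show ?thesis by (simp add: S sym1_def blinfun.add_left blinfun.scaleR_left)
    qed
    ultimately show "S \<in> flag_ops V Z" by (simp add: flag_ops_def)
  next
    assume S: "S \<in> flag_ops V Z"
    then have lin: "clin S" and sa: "adj S = S" by (auto simp: flag_ops_def)
    have sy: "cinner (S x) y = cinner x (S y)" for x y using cinner_adj[OF lin] sa by metis
    define r where "r = Re (cinner e (S e))"
    have r: "cinner e (S e) = complex_of_real r"
    proof -
      have "cinner e (S e) = cnj (cinner e (S e))" using sy[of e e] cinner_commute by metis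
      then show ?thesis by (simp add: r_def complex_eq_iff)
    qed
    define h where "h = S e - complex_of_real r *\<^sub>C e"
    have hZ: "h \<in> Z" unfolding h_def
      using flag_ops_range[OF VZ S, of e] eV flagD[OF VZ] by (intro cvs.subspace_diff cvs.subspace_scale) auto
    have he: "cinner e h = 0" "cinner h e = 0"
    proof -
      show "cinner e h = 0" by (simp add: h_def cinner_bilin r ee)
      then show "cinner h e = 0" by (simp add: cinner_eq_0_commute)
    qed
    have "cinner y h = 0" if "y \<in> V" for y
      using that he by (auto simp: e(2) cvs.span_singleton cinner_scaleC_left)
    then have hl: "h \<in> ?l" using hZ by (simp add: corth_def)
    have "S - r *\<^sub>R rank1 e e = sym1 e h"
    proof (rule blinfun_eqI)
      fix x
      define y where "y = x - cinner e x *\<^sub>C e"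
      have "orth_proj V x = cinner e x *\<^sub>C e" using line_orth_proj[OF e] by simp
      then have "y \<in> corth V" using orth_proj_diff_in[OF line_orth_proj(1)[OF e], of x] by (simp add: y_def)
      then have SyV: "S y \<in> V" using S by (simp add: flag_ops_def)
      have "S y = orth_proj V (S y)" using SyV line_orth_proj(1)[OF e] by simp
      also have "\<dots> = cinner e (S y) *\<^sub>C e" using line_orth_proj[OF e] by simp
      also have "cinner e (S y) = cinner h x"
        by (simp add: sy[symmetric] y_def h_def cinner_bilin r ee)
           (metis r cinner_commute complex_cnj_complex_of_real sy)
      finally have Sy: "S y = cinner h x *\<^sub>C e" .
      have "S x = cinner e x *\<^sub>C S e + S y" by (simp add: y_def blinfun.diff_right clinD[OF lin])
      also have "S e = complex_of_real r *\<^sub>C e + h" by (simp add: h_def)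
      finally show "(S - r *\<^sub>R rank1 e e) x = sym1 e h x"
        by (simp add: Sy sym1_def blinfun.add_left blinfun.diff_left blinfun.scaleR_left scaleR_scaleC
            scaleC_add_right scaleC_scaleC mult.commute)
    qed
    then show "S \<in> span (insert (rank1 e e) (set (map (sym1 e) (realv fs))))"
      unfolding span_insert sC using hl by blast
  qed
  then show ?thesis unfolding ordered_basis_def line_frame_def using ind nin dC by auto
qed

lemma unit_vector_line:
  assumes "cvs.subspace V" "cvs.dim V = 1"
  shows "\<exists>e. norm e = 1 \<and> V = cvs.span {e}"
proof -
  obtain B where B: "B \<subseteq> V" "cvs.independent B" "V \<subseteq> cvs.span B" "card B = 1"
    using cvs.basis_exists[of V] assms(2) by metis
  then obtain b where b: "B = {b}" using card_1_singletonE by blast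
  have b0: "b \<noteq> 0" using B(2) b cvs.dependent_zero by blast
  define e where "e = complex_of_real (1 / norm b) *\<^sub>C b"
  have "norm e = 1" using b0 by (simp add: e_def norm_scaleC norm_divide)
  moreover have "V = cvs.span {e}"
  proof
    have "b = complex_of_real (norm b) *\<^sub>C e" using b0 by (simp add: e_def scaleC_scaleC)
    then have "b \<in> cvs.span {e}" by (metis cvs.span_base cvs.span_scale singletonI)
    then show "V \<subseteq> cvs.span {e}" using B(3) b cvs.span_minimal[of "{b}" "cvs.span {e}"] by auto
    show "cvs.span {e} \<subseteq> V"
      using B(1) b assms(1) by (intro cvs.span_minimal) (auto simp: e_def cvs.subspace_scale)
  qed
  ultimately show ?thesis by blast
qed

text \<open>A map into the line of \<open>e\<close> is recovered from its adjoint, as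
  \<open>rank1 e (adj T e)\<close>. So the space of homomorphisms is the conjugate of
  \<open>l\<close>.\<close>

lemma Hom_op_line:
  assumes e: "norm e = 1" "V = cvs.span {e}" and l: "hsub l"
  shows "Hom_op l V = rank1 e ` l" "inj_on (rank1 e) l"
proof -
  have ee: "cinner e e = 1" using e by (simp add: cinner_self)
  show "Hom_op l V = rank1 e ` l"
  proof (intro equalityI subsetI)
    fix T assume T: "T \<in> Hom_op l V"
    then have lin: "clin T" by (simp add: Hom_op_def clin_def)
    have f: "adj T e \<in> l"
    proof -
      have "cinner y (adj T e) = 0" if "y \<in> corth l" for y
        using T that by (simp add: cinner_adj[OF lin, symmetric] Hom_op_def)
      then have "adj T e \<in> corth (corth l)" by (simp add: corth_def)
      then show ?thesis using l corth_corth by blast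
    qed
    have "T = rank1 e (adj T e)"
    proof (rule blinfun_eqI)
      fix x
      have "T x \<in> V" using T by (simp add: Hom_op_def)
      then have "T x = orth_proj V (T x)" using line_orth_proj(1)[OF e] by simp
      then show "T x = rank1 e (adj T e) x" using line_orth_proj(2)[OF e] by (simp add: cinner_adj_left[OF lin])
    qed
    then show "T \<in> rank1 e ` l" using f by blast
  next
    fix T assume "T \<in> rank1 e ` l"
    then obtain f where f: "f \<in> l" "T = rank1 e f" by blast
    then show "T \<in> Hom_op l V"
      using clinD[OF clin_rank1, of e f] e by (auto simp: Hom_op_def cvs.span_scale cvs.span_base cinner_scaleC_right scaleC_scaleC corthD)
  qed
  have "adj (rank1 e f) e = f" for f using ee by (simp add: adj_rank1)
  then show "inj_on (rank1 e) l" by (intro inj_on_inverseI[of _ "\<lambda>T. adj T e"])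
qed

context
  fixes e :: "'a::complex_hilbert_space" and V Z
  assumes e: "norm e = 1" "V = cvs.span {e}" and VZ: "flag V Z"
begin

private lemma hl: "hsub (Z \<inter> corth V)"
  using flagD[OF VZ] by (simp add: hsub_Int)

private lemma block: "block_op (rank1 e h) 0 = sym1 e h" "block_op 0 (orth_proj V) = rank1 e e"
  using line_orth_proj[OF e] by (simp_all add: block_op_def hadjoint_eq_adj adj_rank1 sym1_def)

lemma line_complex_basis_exists:
  "\<exists>Ts. ordered_basis (Hom_op (Z \<inter> corth V) V) (realify Ts)"
proof -
  have "cfinite_dim (Z \<inter> corth V)" using flagD(4)[OF VZ] cfinite_dim_subset by blast
  then obtain B where B: "finite B" "cvs.independent B" "cvs.span B = Z \<inter> corth V"
    using cfinite_dimE hl hsub_def by metis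
  obtain fs where fs: "set fs = B" "distinct fs" using finite_distinct_list B(1) by blast
  have "ordered_basis (Z \<inter> corth V) (realv fs)" using realv_basis[OF fs(2)] fs B by simp
  then have "ordered_basis (rank1 e ` (Z \<inter> corth V)) (map (rank1 e) (realv fs))"
    using Hom_op_line(2)[OF e hl] by (intro ordered_basis_map linear_rank1_right)
  then have "ordered_basis (Hom_op (Z \<inter> corth V) V) (realify (map (rank1 e) fs))"
    using Hom_op_line(1)[OF e hl] by (simp add: realify_rank1)
  then show ?thesis by blast
qed

lemma line_complex_basisE:
  assumes Ts: "ordered_basis (Hom_op (Z \<inter> corth V) V) (realify Ts)"
  obtains fs where "distinct fs" "cvs.independent (set fs)" "cvs.span (set fs) = Z \<inter> corth V"
    "ordered_basis (Z \<inter> corth V) (realv fs)"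
    "block_op 0 (orth_proj V) # map (\<lambda>T. block_op T 0) (realify Ts) = line_frame e fs"
proof -
  let ?l = "Z \<inter> corth V"
  have "set Ts \<subseteq> set (realify Ts)" by (auto simp: realify_def)
  then have "set Ts \<subseteq> rank1 e ` ?l" using ordered_basis_subset[OF Ts] Hom_op_line(1)[OF e hl] by blast
  then have "\<exists>fs. Ts = map (rank1 e) fs \<and> set fs \<subseteq> ?l"
  proof (induction Ts)
    case (Cons T Ts)
    then obtain fs f where "Ts = map (rank1 e) fs" "set fs \<subseteq> ?l" "T = rank1 e f" "f \<in> ?l" by auto
    then show ?case by (intro exI[of _ "f # fs"]) auto
  qed simp
  then obtain fs where fs: "Ts = map (rank1 e) fs" "set fs \<subseteq> ?l" by blast
  have ob: "ordered_basis (rank1 e ` ?l) (map (rank1 e) (realv fs))"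
    using Ts unfolding fs(1) realify_rank1 Hom_op_line(1)[OF e hl] .
  let ?d = "\<lambda>T. adj T e"
  have d: "?d (rank1 e h) = h" for h using e by (simp add: adj_rank1 cinner_self)
  have "linear ?d"
    by (rule linearI) (simp_all add: adj_add adj_scaleR blinfun.add_left blinfun.scaleR_left)
  moreover have "inj_on ?d (rank1 e ` ?l)" by (rule inj_on_inverseI[of _ "rank1 e"]) (auto simp: d)
  ultimately have "ordered_basis (?d ` rank1 e ` ?l) (map ?d (map (rank1 e) (realv fs)))"
    by (rule ordered_basis_map[OF _ _ ob])
  then have rb: "ordered_basis ?l (realv fs)" by (simp add: d image_image comp_def)
  then have fi: "distinct fs" "cvs.independent (set fs)"
    using realv_basis_converse unfolding ordered_basis_def by blast+
  moreover have "cvs.span (set fs) = ?l"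
    using realv_basis[OF fi] rb by (simp add: ordered_basis_def)
  moreover have "block_op 0 (orth_proj V) # map (\<lambda>T. block_op T 0) (realify Ts) = line_frame e fs"
    unfolding fs(1) realify_rank1 line_frame_def block(2) by (simp add: block(1))
  ultimately show thesis using that rb by blast
qed

end

text \<open>The complex bases consisting of \<open>e\<close> and \<open>fs\<close>, respectively of
  \<open>e'\<close> and \<open>fs'\<close>, determine a flag isomorphism \<open>\<Theta>\<close>
  that carries the first list exactly onto the second. By \<open>same_oriented_congr\<close> the
  given \<open>\<Phi>\<close> transports with the same orientation as
  \<open>\<Theta>\<close>.\<close>

lemma same_oriented_line_frames:
  assumes f: "flag V Z" "flag V' Z'" and dim: "cvs.dim V = 1" and \<Phi>: "flag_iso \<Phi> V Z V' Z'"
    and Ts: "ordered_basis (Hom_op (Z \<inter> corth V) V) (realify Ts)"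
    and Ts': "ordered_basis (Hom_op (Z' \<inter> corth V') V') (realify Ts')"
  defines "b \<equiv> block_op 0 (orth_proj V) # map (\<lambda>T. block_op T 0) (realify Ts)"
    and "b' \<equiv> block_op 0 (orth_proj V') # map (\<lambda>T. block_op T 0) (realify Ts')"
  shows "ordered_basis (flag_ops V Z) b" "ordered_basis (flag_ops V' Z') b'"
    "same_oriented (map (congr \<Phi>) b) b'"
proof -
  have dim': "cvs.dim V' = 1" using flag_iso_dim(1)[OF f(1) \<Phi>] dim by simp
  obtain e where e: "norm e = 1" "V = cvs.span {e}" using unit_vector_line flagD(6)[OF f(1)] dim by blast
  obtain e' where e': "norm e' = 1" "V' = cvs.span {e'}" using unit_vector_line flagD(6)[OF f(2)] dim' by blast
  obtain fs where fs: "distinct fs" "cvs.independent (set fs)" "cvs.span (set fs) = Z \<inter> corth V"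
    "ordered_basis (Z \<inter> corth V) (realv fs)" "b = line_frame e fs"
    using line_complex_basisE[OF e f(1) Ts] unfolding b_def by blast
  obtain fs' where fs': "distinct fs'" "cvs.independent (set fs')" "cvs.span (set fs') = Z' \<inter> corth V'"
    "ordered_basis (Z' \<inter> corth V') (realv fs')" "b' = line_frame e' fs'"
    using line_complex_basisE[OF e' f(2) Ts'] unfolding b'_def by blast
  show ob: "ordered_basis (flag_ops V Z) b" unfolding fs(5) by (rule line_frame_basis[OF e f(1) fs(4)])
  show ob': "ordered_basis (flag_ops V' Z') b'" unfolding fs'(5) by (rule line_frame_basis[OF e' f(2) fs'(4)])
  \<comment> \<open>The two operator spaces are isomorphic, and their frames have lengths
    \<open>1 + 2 * length fs\<close> and \<open>1 + 2 * length fs'\<close>.\<close>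
  have len: "length fs' = length fs"
    using ordered_basis_length[OF ordered_basis_congr[OF f \<Phi> ob] ob'] by (simp add: fs(5) fs'(5) line_frame_def)
  have gen: "e \<notin> cvs.span (set fs)" "cvs.independent (insert e (set fs))" "cvs.span (insert e (set fs)) = Z"
    if e: "norm e = 1" "V = cvs.span {e}" and f: "flag V Z" and fs: "cvs.independent (set fs)"
      "cvs.span (set fs) = Z \<inter> corth V" for e fs and V Z :: "'a set"
  proof -
    have eV: "e \<in> V" using e by (simp add: cvs.span_base)
    have e0: "e \<noteq> 0" using e by auto
    show n: "e \<notin> cvs.span (set fs)" using corth_disjoint[OF eV] e0 fs(2) by blast
    then show "cvs.independent (insert e (set fs))" using fs(1) by (rule cvs.independent_insertI)
    show "cvs.span (insert e (set fs)) = Z"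
    proof
      have "set fs \<subseteq> Z" using fs(2) cvs.span_superset by blast
      then show "cvs.span (insert e (set fs)) \<subseteq> Z"
        using eV flagD[OF f] by (intro cvs.span_minimal) auto
      show "Z \<subseteq> cvs.span (insert e (set fs))"
      proof
        fix z assume z: "z \<in> Z"
        have h: "hsub V" "V \<subseteq> Z" using flagD[OF f] by auto
        have "orth_proj V z = cinner e z *\<^sub>C e" using line_orth_proj[OF e] by simp
        then have 1: "orth_proj V z \<in> cvs.span (insert e (set fs))" by (simp add: cvs.span_scale cvs.span_base)
        have "z - orth_proj V z \<in> Z \<inter> corth V"
          using h z flagD(7)[OF f] orth_proj_in[OF h(1), of z] by (auto intro: cvs.subspace_diff)
        then have 2: "z - orth_proj V z \<in> cvs.span (insert e (set fs))"
          using fs(2) cvs.span_mono[of "set fs" "insert e (set fs)"] by blast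
        show "z \<in> cvs.span (insert e (set fs))" using cvs.span_add[OF 1 2] by simp
      qed
    qed
  qed
  note g = gen[OF e f(1) fs(2,3)] and g' = gen[OF e' f(2) fs'(2,3)]
  \<comment> \<open>Stated for arbitrary bases, since it is used in both directions: for
    \<open>\<Theta>\<close>, and for the operator \<open>\<Xi>\<close> that inverts it on
    \<open>Z\<close>.\<close>
  have ext: "\<exists>\<Theta>. clin \<Theta> \<and> \<Theta> e = e' \<and> map \<Theta> fs = fs' \<and> (\<forall>x\<in>corth Z. \<Theta> x = 0)"
    if prem: "e \<notin> cvs.span (set fs)" "cvs.independent (insert e (set fs))" "cvs.span (insert e (set fs)) = Z"
      "distinct fs" "length fs' = length fs" for e e' :: 'a and fs fs' and Z :: "'a set"
  proof -
    let ?g = "\<lambda>x. the (map_of (zip (e # fs) (e' # fs')) x)"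
    obtain \<Theta> where \<Theta>: "clin \<Theta>" "\<forall>x\<in>insert e (set fs). \<Theta> x = ?g x" "\<forall>x\<in>corth Z. \<Theta> x = 0"
      using finite_rank_extension[of "insert e (set fs)" ?g] prem(2,3) by auto
    have "e \<notin> set fs" using prem(1) cvs.span_base by blast
    then have "?g (fs ! i) = fs' ! i" if "i < length fs" for i
      using that \<open>distinct fs\<close> \<open>length fs' = length fs\<close> map_of_zip_nth[of fs fs' i] nth_mem[OF that] by auto
    then have "map \<Theta> fs = fs'" using \<Theta>(2) prem(5) by (auto intro!: nth_equalityI)
    moreover have "\<Theta> e = e'" using \<Theta>(2) by simp
    ultimately show ?thesis using \<Theta> by blast
  qed
  obtain \<Theta> where \<Theta>: "clin \<Theta>" "\<Theta> e = e'" "map \<Theta> fs = fs'" "\<forall>x\<in>corth Z. \<Theta> x = 0"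
    using ext[OF g fs(1) len] by blast
  obtain \<Xi> where \<Xi>: "clin \<Xi>" "\<Xi> e' = e" "map \<Xi> fs' = fs" using ext[OF g' fs'(1) len[symmetric]] by blast
  have iso: "flag_iso \<Theta> V Z V' Z'"
  proof -
    have im: "\<Theta> ` insert e (set fs) = insert e' (set fs')" using \<Theta>(2,3) by (metis image_insert image_set)
    have "\<Theta> ` Z = Z'"
      using cvp.linear_span_image[OF clin_linear[OF \<Theta>(1)], of "insert e (set fs)"] im g(3) g'(3) by simp
    moreover have "\<Theta> ` V = V'"
      using cvp.linear_span_image[OF clin_linear[OF \<Theta>(1)], of "{e}"] \<Theta>(2) e(2) e'(2) by simp
    moreover have "x = 0" if "x \<in> Z" "\<Theta> x = 0" for x
    proof -
      have inv: "\<Xi> (\<Theta> b) = b" if "b \<in> insert e (set fs)" for b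
      proof (cases "b = e")
        case False
        then obtain i where i: "i < length fs" "b = fs ! i" using \<open>b \<in> insert e (set fs)\<close> by (auto simp: in_set_conv_nth)
        have "\<Theta> (fs ! i) = fs' ! i" using arg_cong[OF \<Theta>(3), of "\<lambda>l. l ! i"] i by simp
        moreover have "\<Xi> (fs' ! i) = fs ! i" using arg_cong[OF \<Xi>(3), of "\<lambda>l. l ! i"] i len by simp
        ultimately show ?thesis using i by simp
      qed (use \<Theta> \<Xi> in simp)
      have "(\<Xi> o\<^sub>L \<Theta>) x = id_blinfun x"
        by (rule cvp.linear_eq_on[OF clin_linear[OF clin_compose[OF \<Xi>(1) \<Theta>(1)]] clin_linear[OF clin_id],
              where B = "insert e (set fs)"])
           (use that(1) g(3) inv in simp_all)
      then show ?thesis using that(2) by simp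
    qed
    ultimately show ?thesis using \<Theta> by (simp add: flag_iso_def)
  qed
  have "map (congr \<Theta>) b = b'" unfolding fs(5) fs'(5) congr_line_frame[OF \<Theta>(1)] \<Theta>(2,3) ..
  then show "same_oriented (map (congr \<Phi>) b) b'" using same_oriented_congr[OF f \<Phi> iso ob] by simp
qed

section \<open>Lagrangian subspaces\<close>

lemma Jmap_Jmap [simp]: "Jmap (Jmap x) = - x"
  by (simp add: Jmap_def prod_eq_iff)

lemma Jmap_0 [simp]: "Jmap 0 = 0" by (simp add: Jmap_def zero_prod_def)
lemma Jmap_add: "Jmap (x + y) = Jmap x + Jmap y" by (simp add: Jmap_def)
lemma Jmap_diff: "Jmap (x - y) = Jmap x - Jmap y" by (simp add: Jmap_def)
lemma Jmap_minus: "Jmap (- x) = - Jmap x" by (simp add: Jmap_def)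
lemma Jmap_scaleC: "Jmap (c *\<^sub>C x) = c *\<^sub>C Jmap x" by (simp add: Jmap_def scaleC_prod_def)
lemma Jmap_scaleR: "Jmap (r *\<^sub>R x) = r *\<^sub>R Jmap x" by (simp add: Jmap_def)

lemma norm_Jmap [simp]: "norm (Jmap x) = norm x"
  by (cases x) (simp add: Jmap_def norm_Pair add.commute)

lemma cinner_Jmap: "cinner (Jmap x) y = - cinner x (Jmap y)"
  by (simp add: Jmap_def cinner_prod_def)

lemma cinner_Jmap_Jmap: "cinner (Jmap x) (Jmap y) = cinner x y"
  by (simp add: cinner_Jmap)

definition J_op :: "('h::complex_hilbert_space \<times> 'h) \<Rightarrow>\<^sub>L ('h \<times> 'h)" where
  "J_op = Blinfun Jmap"

lemma J_op_apply [simp]: "J_op x = Jmap x"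
proof -
  have "bounded_linear (Jmap :: 'a \<times> 'a \<Rightarrow> _)"
    by (rule bounded_linear_intro[where K = 1]) (simp_all add: Jmap_add Jmap_scaleR)
  then show ?thesis by (simp add: J_op_def bounded_linear_Blinfun_apply)
qed

lemma clin_J_op [simp]: "clin J_op"
  by (simp add: clin_def Jmap_scaleC)

lemma Jmap_image_iff: "x \<in> Jmap ` E \<longleftrightarrow> - Jmap x \<in> E"
proof
  assume "- Jmap x \<in> E"
  then show "x \<in> Jmap ` E" by (intro image_eqI[of _ _ "- Jmap x"]) (simp_all add: Jmap_minus)
qed auto

lemma Jmap_image_iff': "cvs.subspace E \<Longrightarrow> x \<in> Jmap ` E \<longleftrightarrow> Jmap x \<in> E"
  unfolding Jmap_image_iff using cvs.subspace_neg by fastforce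

lemma csubspace_Jmap_image: "cvs.subspace E \<Longrightarrow> cvs.subspace (Jmap ` E)"
  using csubspace_image[OF clin_J_op, of E] by simp

lemma Jmap_image_image: "cvs.subspace E \<Longrightarrow> Jmap ` Jmap ` E = E"
  by (rule Set.set_eqI) (simp add: Jmap_image_iff Jmap_minus csubspace_neg_iff)

lemma corth_Jmap_image: "corth (Jmap ` E) = Jmap ` corth E"
proof -
  have "x \<in> corth (Jmap ` E) \<longleftrightarrow> - Jmap x \<in> corth E" for x by (auto simp: corth_def cinner_Jmap)
  then have "x \<in> corth (Jmap ` E) \<longleftrightarrow> x \<in> Jmap ` corth E" for x by (simp add: Jmap_image_iff)
  then show ?thesis by blast
qed

lemma inj_Jmap: "inj Jmap"
  by (rule inj_on_inverseI[of _ "\<lambda>x. - Jmap x"]) simp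

lemma Jmap_Int: "Jmap ` (A \<inter> B) = Jmap ` A \<inter> Jmap ` B"
  by (rule image_Int[OF inj_Jmap])

lemma LagD:
  assumes "L \<in> Lag"
  shows "hsub L" "cvs.subspace L" "corth L = Jmap ` L" "x \<in> corth L \<longleftrightarrow> Jmap x \<in> L"
    "x \<in> L \<Longrightarrow> y \<in> L \<Longrightarrow> cinner x (Jmap y) = 0" "x \<in> L \<Longrightarrow> Jmap x \<in> corth L"
proof -
  show s: "cvs.subspace L" and c: "corth L = Jmap ` L" using assms by (auto simp: Lag_def)
  have "corth (corth L) = L" using s by (simp add: c corth_Jmap_image Jmap_image_image)
  then show "hsub L" by (metis hsub_corth)
  show "x \<in> corth L \<longleftrightarrow> Jmap x \<in> L" using s by (simp add: c Jmap_image_iff')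
  show "x \<in> L \<Longrightarrow> y \<in> L \<Longrightarrow> cinner x (Jmap y) = 0" using c corthD by blast
  show "x \<in> L \<Longrightarrow> Jmap x \<in> corth L" using c by blast
qed

lemma LagI:
  assumes "cvs.subspace L" "\<And>x y. x \<in> L \<Longrightarrow> y \<in> L \<Longrightarrow> cinner x (Jmap y) = 0"
    "\<And>x. x \<in> corth L \<Longrightarrow> Jmap x \<in> L"
  shows "L \<in> Lag"
  using assms by (auto simp: Lag_def Jmap_image_iff' corth_def)

text \<open>Orthogonal complements reverse the inclusion, and \<open>J\<close> turns the reversed
  inclusion back into one between the spaces themselves.\<close>

lemma Lag_subset_eq:
  assumes "L \<in> Lag" "L' \<in> Lag" "L \<subseteq> L'" shows "L = L'"
  using assms corth_antimono[OF assms(3)] LagD(4)[OF assms(1)] LagD(4)[OF assms(2)] LagD(6)[OF assms(2)]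
    LagD(2)[OF assms(1)] cvs.subspace_neg by (metis Jmap_Jmap minus_minus subset_antisym subsetD subsetI)

text \<open>\<open>J\<close> interchanges \<open>L\<close> and its orthogonal complement, so the
  complementary projection is the conjugate of \<open>orth_proj L\<close> by \<open>J\<close>; the
  sign comes from the inverse of \<open>J\<close> being \<open>- J\<close>.\<close>

lemma orth_proj_Lag:
  assumes L: "L \<in> Lag"
  shows "x - orth_proj L x = - Jmap (orth_proj L (Jmap x))"
proof -
  have h: "hsub L" using LagD L by blast
  have "orth_proj L x = x + Jmap (orth_proj L (Jmap x))"
  proof (rule orth_proj_eqI[OF h])
    let ?y = "x + Jmap (orth_proj L (Jmap x))"
    have "Jmap ?y = Jmap x - orth_proj L (Jmap x)" by (simp add: Jmap_add)
    then have "Jmap (Jmap ?y) \<in> L" using LagD(4)[OF L] orth_proj_diff_in[OF h, of "Jmap x"] by simp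
    then have "- ?y \<in> L" by (simp only: Jmap_Jmap)
    then show "?y \<in> L" using csubspace_neg_iff LagD(2)[OF L] by blast
    show "x - ?y \<in> corth L"
      using LagD(6)[OF L orth_proj_in[OF h, of "Jmap x"]] by (simp add: csubspace_neg_iff)
  qed
  then show ?thesis by simp
qed

lemma orth_proj_Lag_Jmap:
  assumes L: "L \<in> Lag"
  shows "Jmap y = orth_proj L (Jmap y) + Jmap (orth_proj L y)"
  using orth_proj_Lag[OF L, of "Jmap y"] by (simp add: blinfun.minus_right Jmap_minus algebra_simps)

section \<open>Arnold charts as graphs of self-adjoint operators\<close>

lemma Sym_opD:
  assumes "S \<in> Sym_op L"
  shows "clin S" "S x \<in> L" "x \<in> corth L \<Longrightarrow> S x = 0" "cinner (S x) y = cinner x (S y)" "adj S = S"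
  using assms by (auto simp: Sym_op_def Hom_op_def clin_def intro: adj_eqI_cinner)

lemma Sym_opI:
  assumes "clin S" "\<And>x. S x \<in> L" "\<And>x. x \<in> corth L \<Longrightarrow> S x = 0" "adj S = S"
  shows "S \<in> Sym_op L"
  using assms cinner_adj[OF assms(1)] by (auto simp: Sym_op_def Hom_op_def clin_def)

lemma Sym_op_orth_proj: "hsub L \<Longrightarrow> S \<in> Sym_op L \<Longrightarrow> S (orth_proj L x) = S x"
  using Sym_opD(3)[of S L "x - orth_proj L x"] by (simp add: blinfun.diff_right)

lemma subspace_Sym_op: "cvs.subspace L \<Longrightarrow> subspace (Sym_op L)"
  unfolding subspace_def
proof (intro conjI ballI allI)
  assume L: "cvs.subspace L"
  show "0 \<in> Sym_op L" by (rule Sym_opI) (simp_all add: cvs.subspace_0[OF L])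
  fix S T r assume S: "S \<in> Sym_op L" and T: "T \<in> Sym_op L"
  show "S + T \<in> Sym_op L"
    by (rule Sym_opI) (simp_all add: clin_add Sym_opD[OF S] Sym_opD[OF T] cvs.subspace_add[OF L] blinfun.add_left adj_add)
  show "r *\<^sub>R S \<in> Sym_op L"
    by (rule Sym_opI) (simp_all add: clin_scaleR Sym_opD[OF S] cvs.subspace_scale[OF L] blinfun.scaleR_left
        adj_scaleR scaleR_scaleC)
qed

lemma arnold_iff: "x \<in> arnold L S \<longleftrightarrow> (\<exists>v\<in>L. x = v + Jmap (S v))"
  by (auto simp: arnold_def)

lemma csubspace_arnold:
  assumes "cvs.subspace L" "clin S" shows "cvs.subspace (arnold L S)"
proof -
  have "arnold L S = (id_blinfun + (J_op o\<^sub>L S)) ` L" by (auto simp: arnold_iff blinfun.add_left)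
  then show ?thesis using assms by (simp add: csubspace_image clin_intros)
qed

lemma orth_proj_arnold:
  assumes "L \<in> Lag" "S \<in> Sym_op L" "v \<in> L"
  shows "orth_proj L (v + Jmap (S v)) = v"
  using assms LagD(1,6)[OF assms(1)] Sym_opD(2)[OF assms(2)] by (simp add: blinfun.add_right)

text \<open>Isotropy of the graph is the symmetry of \<open>S\<close>. For maximality, a vector
  orthogonal to the graph is written as \<open>a + J b\<close> with \<open>a\<close> and
  \<open>b\<close> in \<open>L\<close>; orthogonality then says \<open>a = - S b\<close>, so that
  \<open>J\<close> of the vector is the graph point over \<open>- b\<close>.\<close>

lemma arnold_Lag:
  assumes L: "L \<in> Lag" and S: "S \<in> Sym_op L"
  shows "arnold L S \<in> Lag"
proof (rule LagI)
  show "cvs.subspace (arnold L S)" using csubspace_arnold LagD(2) L Sym_opD(1) S by blast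
  fix x y assume "x \<in> arnold L S" "y \<in> arnold L S"
  then obtain v u where vu: "v \<in> L" "x = v + Jmap (S v)" "u \<in> L" "y = u + Jmap (S u)" by (auto simp: arnold_iff)
  have "cinner v (Jmap u) = 0" "cinner (S v) (Jmap (S u)) = 0"
    using LagD(5)[OF L] vu Sym_opD(2)[OF S] by blast+
  then show "cinner x (Jmap y) = 0"
    using Sym_opD(4)[OF S, of v u] by (simp add: vu Jmap_add cinner_bilin cinner_Jmap)
next
  fix x assume x: "x \<in> corth (arnold L S)"
  have h: "hsub L" using LagD L by blast
  define a where "a = orth_proj L x"
  define b where "b = - orth_proj L (Jmap x)"
  have ab: "a \<in> L" "b \<in> L" using h by (auto simp: a_def b_def hsub_minus)
  have xe: "x = a + Jmap b" using orth_proj_Lag[OF L, of x] by (simp add: a_def b_def Jmap_minus algebra_simps)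
  have "cinner v (a + S b) = 0" if "v \<in> L" for v
  proof -
    have "0 = cinner (v + Jmap (S v)) x" using corthD[OF x, of "v + Jmap (S v)"] that unfolding arnold_iff by auto
    also have "\<dots> = cinner v a + cinner (S v) b"
      using that ab Sym_opD(2)[OF S] LagD(5)[OF L]
      by (simp add: xe cinner_bilin cinner_Jmap cinner_Jmap_Jmap)
    finally show ?thesis by (simp add: Sym_opD(4)[OF S] cinner_bilin)
  qed
  then have "a + S b \<in> corth L" by (simp add: corth_def)
  moreover have "a + S b \<in> L" using ab Sym_opD(2)[OF S] h hsub_add by blast
  ultimately have "a = - S b" using corth_disjoint by (metis eq_neg_iff_add_eq_0)
  then have "Jmap x = - (b + Jmap (S b))" by (simp add: xe Jmap_add Jmap_minus Jmap_diff)
  moreover have "- b + Jmap (S (- b)) \<in> arnold L S" unfolding arnold_iff using ab h hsub_minus by blast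
  ultimately show "Jmap x \<in> arnold L S" by (simp add: blinfun.minus_right Jmap_minus)
qed

lemma arnold_inj:
  assumes L: "L \<in> Lag" and S: "S \<in> Sym_op L" "T \<in> Sym_op L" "arnold L S = arnold L T"
  shows "S = T"
proof (rule blinfun_eqI)
  fix x
  have h: "hsub L" using LagD L by blast
  let ?v = "orth_proj L x"
  have v: "?v \<in> L" using h by simp
  then have "?v + Jmap (S ?v) \<in> arnold L S" unfolding arnold_iff by blast
  then have "?v + Jmap (S ?v) \<in> arnold L T" using S(3) by simp
  then obtain u where u: "u \<in> L" "?v + Jmap (S ?v) = u + Jmap (T u)" by (auto simp: arnold_iff)
  then have "?v = u" using orth_proj_arnold[OF L S(1) v] orth_proj_arnold[OF L S(2) u(1)] by simp
  then have "Jmap (S ?v) = Jmap (T ?v)" using u by simp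
  then have "S ?v = T ?v" by (metis inj_Jmap injD)
  then show "S x = T x" using Sym_op_orth_proj[OF h] S by simp
qed

subsection \<open>Quantitative transversality\<close>

text \<open>The intersection of \<open>L\<close> and \<open>Y\<close> is finite-dimensional, and the distance to \<open>Y\<close> is bounded below
  on its complement in \<open>L\<close>; by the open mapping theorem the latter amounts to \<open>L + Y\<close> being closed.\<close>

definition transv :: "'a::complex_hilbert_space set \<Rightarrow> 'a set \<Rightarrow> bool" where
  "transv L Y \<longleftrightarrow> hsub L \<and> hsub Y \<and> cfinite_dim (L \<inter> Y) \<and>
     (\<exists>c>0. \<forall>m\<in>L \<inter> corth (L \<inter> Y). c * norm m \<le> norm (orth_proj (corth Y) m))"

text \<open>The lower bound makes the projection of \<open>M\<close> along \<open>Y\<close>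
  complete, and the sum is the preimage of this projection.\<close>

lemma bounded_below_imp_closed_ssum:
  assumes M: "hsub M" and Y: "hsub Y" and "c > 0"
    and "\<And>m. m \<in> M \<Longrightarrow> c * norm m \<le> norm (orth_proj (corth Y) m)"
  shows "hsub (ssum M Y)"
proof -
  let ?Q = "orth_proj (corth Y)"
  have "complete (?Q ` M)"
    using assms by (intro complete_image_bounded_below[of M c]) (auto simp: hsub_def csubspace_imp_subspace)
  then have "closed (?Q ` M)" by (rule complete_imp_closed)
  then have "closed (?Q -` (?Q ` M))"
    by (rule continuous_closed_vimage) (auto intro!: continuous_intros)
  moreover have "ssum M Y = ?Q -` (?Q ` M)"
  proof (intro equalityI subsetI)
    fix x assume "x \<in> ssum M Y"
    then obtain m y where "m \<in> M" "y \<in> Y" "x = m + y" by (auto simp: ssum_def)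
    then show "x \<in> ?Q -` (?Q ` M)" using Y by (auto simp: orth_proj_corth blinfun.add_right)
  next
    fix x assume "x \<in> ?Q -` (?Q ` M)"
    then obtain m where m: "m \<in> M" "?Q x = ?Q m" by auto
    then have "?Q (x - m) = 0" by (simp add: blinfun.diff_right)
    then have "x - m \<in> Y" using Y orth_proj_eq_0_iff[OF hsub_corth] corth_corth by blast
    then show "x \<in> ssum M Y" using m unfolding ssum_def by (intro CollectI exI[of _ m] exI[of _ "x - m"]) simp
  qed
  moreover have "cvs.subspace (ssum M Y)"
    unfolding ssum_def using M Y by (intro cvs.subspace_sums) (auto simp: hsub_def)
  ultimately show ?thesis by (simp add: hsub_def)
qed

lemma transv_closed:
  assumes "transv L Y" shows "hsub (ssum L Y)"
proof -
  let ?V = "L \<inter> Y"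
  have h: "hsub L" "hsub Y" "hsub ?V" using assms hsub_Int by (auto simp: transv_def)
  obtain c where c: "c > 0" "\<forall>m\<in>L \<inter> corth ?V. c * norm m \<le> norm (orth_proj (corth Y) m)"
    using assms by (auto simp: transv_def)
  have "ssum L Y = ssum (L \<inter> corth ?V) Y"
  proof (intro equalityI subsetI)
    fix x assume "x \<in> ssum L Y"
    then obtain l y where l: "l \<in> L" "y \<in> Y" "x = l + y" by (auto simp: ssum_def)
    have "orth_proj ?V l \<in> Y" using h by (metis IntD2 orth_proj_in)
    then have "orth_proj ?V l + y \<in> Y" using h l hsub_add by blast
    moreover have "x = (l - orth_proj ?V l) + (orth_proj ?V l + y)" using l by simp
    ultimately show "x \<in> ssum (L \<inter> corth ?V) Y"
      unfolding ssum_def using orth_decomp_in[OF h(3,1) _ l(1)] by blast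
  qed (auto simp: ssum_def)
  then show ?thesis using bounded_below_imp_closed_ssum[OF hsub_Int[OF h(1) hsub_corth] h(2) c(1)] c(2) by simp
qed

text \<open>The distance to \<open>W\<close> is at least the distance to \<open>Y\<close>, so the
  old bound persists on the old complement. The new complement exceeds it by a finite-dimensional
  space, on which the projection stays injective because all of \<open>L \<inter> W\<close> has been
  removed.\<close>

lemma transv_subset:
  assumes t: "transv L Y" and W: "hsub W" "W \<subseteq> Y"
  shows "transv L W"
proof -
  let ?K = "L \<inter> Y" and ?V = "L \<inter> W"
  have h: "hsub L" "hsub Y" "cfinite_dim ?K" "hsub ?K" "hsub ?V" using t W hsub_Int by (auto simp: transv_def)
  have VK: "?V \<subseteq> ?K" using W by blast
  let ?M = "L \<inter> corth ?K"
  obtain c where c: "c > 0" "\<forall>m\<in>?M. c * norm m \<le> norm (orth_proj (corth Y) m)"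
    using t by (auto simp: transv_def)
  have M: "hsub ?M" using h by (simp add: hsub_Int)
  let ?Q = "orth_proj (corth W)"
  have QQ: "norm (orth_proj (corth Y) m) \<le> norm (?Q m)" for m
  proof -
    have "orth_proj W m \<in> Y" using W orth_proj_in by blast
    then have "orth_proj (corth Y) (?Q m) = orth_proj (corth Y) m"
      using h W by (simp add: orth_proj_corth blinfun.diff_right)
    then show ?thesis using norm_orth_proj_le[OF hsub_corth] by metis
  qed
  have hF: "hsub (?K \<inter> corth ?V)" using h by (simp add: hsub_Int)
  have "cfinite_dim (?K \<inter> corth ?V)" by (rule cfinite_dim_subset[OF h(3)]) blast
  then obtain B where B: "finite B" "cvs.span B = ?K \<inter> corth ?V"
    using cfinite_dimE hF unfolding hsub_def by metis
  have "B \<subseteq> L \<inter> corth ?V" using B cvs.span_superset by blast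
  moreover have "?M \<subseteq> L \<inter> corth ?V" using corth_antimono[OF VK] by blast
  ultimately have sub: "cvs.span (?M \<union> B) \<subseteq> L \<inter> corth ?V"
    using hsub_Int[OF h(1) hsub_corth] by (intro cvs.span_minimal) (auto simp: hsub_def)
  have inj: "y = 0" if "y \<in> cvs.span (?M \<union> B)" "?Q y = 0" for y
  proof -
    have "y \<in> W" using that(2) W orth_proj_eq_0_iff[OF hsub_corth] corth_corth by blast
    then show ?thesis using that(1) sub corth_disjoint[of y ?V] by blast
  qed
  have bb: "c * norm m \<le> norm (?Q m)" if "m \<in> ?M" for m using c(2) that QQ order_trans by blast
  obtain c' where c': "c' > 0" "\<forall>y\<in>cvs.span (?M \<union> B). c' * norm y \<le> norm (?Q y)"
    using bounded_below_span_Un_finite[OF clin_orth_proj[OF hsub_corth] M c(1) bb B(1) inj] by blast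
  have "x \<in> cvs.span (?M \<union> B)" if x: "x \<in> L \<inter> corth ?V" for x
  proof -
    have 1: "x - orth_proj ?K x \<in> ?M" using orth_decomp_in h x by blast
    have "x - orth_proj ?K x \<in> corth ?V" using 1 corth_antimono[OF VK] by blast
    then have "x - (x - orth_proj ?K x) \<in> corth ?V" using x hsub_diff[OF hsub_corth] by blast
    then have "orth_proj ?K x \<in> cvs.span B" using B(2) orth_proj_in[OF h(4), of x] by simp
    then have "orth_proj ?K x \<in> cvs.span (?M \<union> B)" using cvs.span_mono[of B "?M \<union> B"] by blast
    moreover have "x - orth_proj ?K x \<in> cvs.span (?M \<union> B)" using 1 by (intro cvs.span_base UnI1)
    ultimately show ?thesis using cvs.span_add by fastforce
  qed
  moreover have "cfinite_dim ?V" using h(3) VK cfinite_dim_subset by blast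
  ultimately show ?thesis using c' h W unfolding transv_def by blast
qed

text \<open>The distance to a sum is treated as a bound for pairs of a vector of \<open>L\<close>
  and a vector of \<open>R\<close>. On pairs with second entry zero it is the bound for
  \<open>W\<close>; the finite-dimensional \<open>R\<close> is then added by
  \<open>bounded_below_span_Un_finite\<close>.\<close>

lemma transv_add_finite:
  assumes t: "transv L W" and R: "cfinite_dim R" "hsub R" "R \<subseteq> corth W"
    and Y: "Y = ssum W R" and fin: "cfinite_dim (L \<inter> Y)"
  shows "transv L Y"
proof -
  let ?V = "L \<inter> W" and ?Z = "L \<inter> Y"
  have h: "hsub L" "hsub W" using t by (auto simp: transv_def)
  have WR: "W \<subseteq> corth R" using R(3) subset_corth_commute by blast
  have PY: "x - (orth_proj W x + orth_proj R x) \<in> corth Y" for x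
  proof -
    have "x - orth_proj W x - orth_proj R x \<in> corth W"
      using R(3) orth_proj_in[OF R(2), of x] orth_proj_diff_in[OF h(2), of x] hsub_diff[OF hsub_corth] by blast
    moreover have "x - orth_proj R x - orth_proj W x \<in> corth R"
      using WR orth_proj_in[OF h(2), of x] orth_proj_diff_in[OF R(2), of x] hsub_diff[OF hsub_corth] by blast
    ultimately have "x - (orth_proj W x + orth_proj R x) \<in> corth W" "x - (orth_proj W x + orth_proj R x) \<in> corth R"
      by (simp_all add: algebra_simps)
    then show ?thesis unfolding Y by (auto simp: corth_def ssum_def cinner_add_left)
  qed
  have hY: "hsub Y"
  proof -
    have "Y = corth (corth W \<inter> corth R)"
    proof (intro equalityI subsetI)
      fix x assume "x \<in> Y"
      then obtain w r where wr: "w \<in> W" "r \<in> R" "x = w + r" unfolding Y ssum_def by blast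
      have "cinner y w = 0" "cinner y r = 0" if "y \<in> corth W \<inter> corth R" for y
        using that wr corthD' by blast+
      then show "x \<in> corth (corth W \<inter> corth R)"
        unfolding corth_def[of "corth W \<inter> corth R"] wr(3) by (simp add: cinner_add_right)
    next
      fix x assume x: "x \<in> corth (corth W \<inter> corth R)"
      let ?p = "orth_proj W x + orth_proj R x"
      have "?p \<in> Y" unfolding Y ssum_def using h R by blast
      have "W \<subseteq> Y" "R \<subseteq> Y" unfolding Y ssum_def using hsub_0[OF h(2)] hsub_0[OF R(2)] by force+
      then have 1: "x - ?p \<in> corth W \<inter> corth R" using PY corth_antimono by blast
      have "?p \<in> corth (corth W \<inter> corth R)"
        using orth_proj_in[OF h(2), of x] orth_proj_in[OF R(2), of x] subset_corth_corth[of W] subset_corth_corth[of R]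
          corth_antimono[of "corth W \<inter> corth R" "corth W"] corth_antimono[of "corth W \<inter> corth R" "corth R"]
        by (intro hsub_add[OF hsub_corth]) blast+
      then have "x - ?p \<in> corth (corth W \<inter> corth R)" using x hsub_diff[OF hsub_corth] by blast
      then have "x - ?p = 0" by (rule corth_disjoint[OF 1])
      then have "x = ?p" by simp
      then show "x \<in> Y" using \<open>?p \<in> Y\<close> by simp
    qed
    then show ?thesis by simp
  qed
  have WY: "W \<subseteq> Y" and RY: "R \<subseteq> Y" unfolding Y ssum_def using hsub_0[OF h(2)] hsub_0[OF R(2)] by force+
  have QY: "orth_proj (corth Y) x = orth_proj (corth W) x - orth_proj R x" for x
  proof -
    have "orth_proj Y x = orth_proj W x + orth_proj R x"
    proof (rule orth_proj_eqI[OF hY _ PY])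
      show "orth_proj W x + orth_proj R x \<in> Y" unfolding Y ssum_def using h R by blast
    qed
    then show ?thesis using hY h by (simp add: orth_proj_corth algebra_simps)
  qed
  obtain c where c: "c > 0" "\<forall>m\<in>L \<inter> corth ?V. c * norm m \<le> norm (orth_proj (corth W) m)"
    using t by (auto simp: transv_def)
  let ?Q = "orth_proj (corth W)"
  \<comment> \<open>On a pair \<open>(l, r)\<close> with \<open>r\<close> in \<open>R\<close> this
    is the part of \<open>l - r\<close> orthogonal to \<open>W\<close>, so it can vanish only if
    \<open>l\<close> lies in \<open>Y\<close>. With \<open>r = orth_proj R l\<close> it is the part
    of \<open>l\<close> orthogonal to \<open>Y\<close>.\<close>
  define T where "T = Blinfun (\<lambda>z. ?Q (fst z) - snd z)"
  have Tapp: "T z = ?Q (fst z) - snd z" for z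
    unfolding T_def
    by (subst bounded_linear_Blinfun_apply)
       (auto intro!: bounded_linear_intros blinfun.bounded_linear_right)
  have lin: "clin T" by (simp add: clin_def Tapp scaleC_prod_def clinD[OF clin_orth_proj[OF hsub_corth]] cvs.scale_right_diff_distrib)
  let ?\<Lambda> = "L \<inter> corth ?Z"
  have h\<Lambda>: "hsub ?\<Lambda>" using h by (simp add: hsub_Int)
  have s0: "cvs.subspace (?\<Lambda> \<times> {0})" "closed (?\<Lambda> \<times> {0 :: 'a})"
    using h\<Lambda> by (auto simp: hsub_def cvs.subspace_def scaleC_prod_def zero_prod_def closed_Times)
  have hM: "hsub (?\<Lambda> \<times> {0 :: 'a})" unfolding hsub_def using s0 by blast
  obtain B where B: "finite B" "cvs.span B = R" using cfinite_dimE R unfolding hsub_def by metis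
  let ?M = "?\<Lambda> \<times> {0 :: 'a}" and ?B = "(Pair 0) ` B"
  have sub: "cvs.span (?M \<union> ?B) \<subseteq> ?\<Lambda> \<times> R"
  proof (rule cvs.span_minimal)
    have "B \<subseteq> R" using B cvs.span_superset by blast
    then show "?M \<union> ?B \<subseteq> ?\<Lambda> \<times> R" using hsub_0[OF h\<Lambda>] hsub_0[OF R(2)] by auto
    show "cvs.subspace (?\<Lambda> \<times> R)"
      using h\<Lambda> R(2) by (auto simp: hsub_def cvs.subspace_def scaleC_prod_def zero_prod_def)
  qed
  have inj: "y = 0" if y0: "y \<in> cvs.span (?M \<union> ?B)" "T y = 0" for y
  proof -
    have "y \<in> ?\<Lambda> \<times> R" using y0(1) sub by blast
    then obtain l r where y: "y = (l, r)" "l \<in> ?\<Lambda>" "r \<in> R" by blast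
    have e: "l - orth_proj W l = r" using y0(2) h by (simp add: Tapp y orth_proj_corth)
    then have "l = orth_proj W l + r" by (simp add: algebra_simps)
    then have "l \<in> Y" unfolding Y ssum_def using h y orth_proj_in[OF h(2), of l] by blast
    then have "l = 0" using y(2) corth_disjoint[of l ?Z] by blast
    then show ?thesis using e y by (simp add: zero_prod_def)
  qed
  have bb: "c * norm n \<le> norm (T n)" if "n \<in> ?M" for n
  proof -
    have "?V \<subseteq> ?Z" using WY by blast
    then have "fst n \<in> L \<inter> corth ?V" "snd n = 0" using that corth_antimono[of ?V ?Z] by auto
    then show ?thesis using c(2) by (cases n) (simp add: Tapp norm_Pair)
  qed
  obtain c' where c': "c' > 0" "\<forall>y\<in>cvs.span (?M \<union> ?B). c' * norm y \<le> norm (T y)"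
    using bounded_below_span_Un_finite[OF lin hM c(1) bb finite_imageI[OF B(1)] inj] by blast
  have "c' * norm m \<le> norm (orth_proj (corth Y) m)" if "m \<in> ?\<Lambda>" for m
  proof -
    have "Pair 0 ` cvs.span B \<subseteq> cvs.span (?M \<union> ?B)"
    proof -
      have "cvs.subspace {x. (0 :: 'a, x) \<in> cvs.span (?M \<union> ?B)}"
      proof (rule cvs.subspaceI)
        show "0 \<in> {x. (0 :: 'a, x) \<in> cvs.span (?M \<union> ?B)}"
          using cvs.span_zero[of "?M \<union> ?B"] by (simp add: zero_prod_def)
        fix x y c assume "x \<in> {x. (0 :: 'a, x) \<in> cvs.span (?M \<union> ?B)}" "y \<in> {x. (0 :: 'a, x) \<in> cvs.span (?M \<union> ?B)}"
        then have x: "(0, x) \<in> cvs.span (?M \<union> ?B)" and y: "(0, y) \<in> cvs.span (?M \<union> ?B)" by simp_all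
        show "x + y \<in> {x. (0 :: 'a, x) \<in> cvs.span (?M \<union> ?B)}" using cvs.span_add[OF x y] by simp
        show "c *\<^sub>C x \<in> {x. (0 :: 'a, x) \<in> cvs.span (?M \<union> ?B)}"
          using cvs.span_scale[OF x, of c] by (simp add: scaleC_prod_def)
      qed
      moreover have "B \<subseteq> {x. (0 :: 'a, x) \<in> cvs.span (?M \<union> ?B)}" by (auto intro: cvs.span_base)
      ultimately have "cvs.span B \<subseteq> {x. (0 :: 'a, x) \<in> cvs.span (?M \<union> ?B)}" by (rule cvs.span_minimal[rotated])
      then show ?thesis by blast
    qed
    moreover have "(0, orth_proj R m) \<in> Pair 0 ` cvs.span B" using B(2) R(2) by simp
    ultimately have "(0, orth_proj R m) \<in> cvs.span (?M \<union> ?B)" by (rule subsetD)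
    have "(m, 0) \<in> cvs.span (?M \<union> ?B)" using that by (intro cvs.span_base) auto
    then have "(m, 0) + (0, orth_proj R m) \<in> cvs.span (?M \<union> ?B)"
      using \<open>(0, orth_proj R m) \<in> cvs.span (?M \<union> ?B)\<close> by (rule cvs.span_add)
    then have "c' * norm (m, orth_proj R m) \<le> norm (T (m, orth_proj R m))" using c'(2) by simp
    moreover have "norm m \<le> norm (m, orth_proj R m)" by (rule norm_fst_le)
    then have "c' * norm m \<le> c' * norm (m, orth_proj R m)" using c'(1) by (intro mult_left_mono) auto
    ultimately show ?thesis unfolding QY by (simp add: Tapp)
  qed
  then show ?thesis unfolding transv_def using h hY fin c'(1) by blast
qed

lemma hsub_Hminus [simp]: "hsub Hminus"
proof -
  have "Hminus = {z :: 'a \<times> 'a. fst z = 0}" by (auto simp: Hminus_def)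
  moreover have "closed {z :: 'a \<times> 'a. fst z = 0}" by (intro closed_Collect_eq continuous_intros)
  ultimately show ?thesis by (auto simp: hsub_def Hminus_def cvs.subspace_def scaleC_prod_def zero_prod_def)
qed

lemma orth_proj_Hminus: "orth_proj Hminus z = (0, snd z)" "orth_proj (corth Hminus) z = (fst z, 0)"
proof -
  show 1: "orth_proj Hminus z = (0, snd z)"
    by (rule orth_proj_eqI[OF hsub_Hminus]) (auto simp: Hminus_def corth_def cinner_prod_def)
  show "orth_proj (corth Hminus) z = (fst z, 0)" by (simp add: orth_proj_corth 1 prod_eq_iff)
qed

text \<open>A form of the Hellinger-Toeplitz theorem: \<open>L\<close> is the direct sum of \<open>L \<inter> Hminus\<close> and of the graph of an
  everywhere defined symmetric operator on the closed subspace \<open>fst ` L\<close>.\<close>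

lemma Lagminus_transv:
  assumes "L \<in> Lagminus" shows "transv L Hminus"
proof -
  have L: "L \<in> Lag" and fin: "cfinite_dim (L \<inter> Hminus)" and cl: "closed (ssum L Hminus)"
    using assms by (auto simp: Lagminus_def ssum_def)
  let ?K = "L \<inter> Hminus"
  let ?R = "fst ` L"
  have hL: "hsub L" using LagD L by blast
  have Rmem: "h \<in> ?R \<longleftrightarrow> (h, 0) \<in> ssum L Hminus" for h
  proof
    assume "h \<in> ?R"
    then obtain x where x: "x \<in> L" "h = fst x" by blast
    have "(h, 0) = x + (0, - snd x)" using x by (cases x) simp
    then show "(h, 0) \<in> ssum L Hminus" using x unfolding ssum_def Hminus_def by blast
  next
    assume "(h, 0) \<in> ssum L Hminus"
    then obtain x y where x: "x \<in> L" "y \<in> Hminus" "(h, 0) = x + y" unfolding ssum_def by blast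
    then have "h = fst x" by (cases x; cases y) (auto simp: Hminus_def)
    then show "h \<in> ?R" using x by blast
  qed
  \<comment> \<open>Here the closedness of the sum enters: it makes the domain of the symmetric
    operator complete.\<close>
  have hR: "hsub ?R"
  proof -
    have "closed ((\<lambda>h. (h, 0)) -` ssum L Hminus)"
      by (rule continuous_closed_vimage[OF cl]) (auto intro!: continuous_intros)
    moreover have "(\<lambda>h. (h, 0)) -` ssum L Hminus = ?R" using Rmem by auto
    moreover have "cvs.subspace ?R"
    proof -
      have lf: "clin (Blinfun fst :: ('a \<times> 'a) \<Rightarrow>\<^sub>L 'a)"
        by (simp add: clin_def bounded_linear_Blinfun_apply bounded_linear_fst scaleC_prod_def)
      show ?thesis using csubspace_image[OF lf LagD(2)[OF L]]
        by (simp add: bounded_linear_Blinfun_apply bounded_linear_fst)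
    qed
    ultimately show ?thesis by (simp add: hsub_def)
  qed
  have corthR: "(0, h) \<in> L" if "h \<in> corth ?R" for h
  proof -
    have "cinner x (h, 0) = 0" if "x \<in> L" for x
      using \<open>h \<in> corth ?R\<close> that by (simp add: cinner_prod_def corthD)
    then have "(h, 0) \<in> corth L" by (simp add: corth_def)
    then have "Jmap (h, 0) \<in> L" using LagD(4)[OF L] by blast
    then show ?thesis using hsub_minus[OF hL] by (fastforce simp: Jmap_def)
  qed
  \<comment> \<open>The values of the operator on the unit ball. For fixed \<open>h\<close>, the
    component of \<open>h\<close> outside the domain is orthogonal to all these values, and symmetry
    moves the operator onto the component \<open>h1\<close> inside it; so the products are bounded
    by the norm of one fixed vector \<open>snd x\<close>.\<close>
  define B where "B = {snd m | m. m \<in> L \<inter> corth ?K \<and> norm (fst m) \<le> 1}"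
  have "bounded B"
  proof (rule uniform_boundedness)
    fix h
    define h1 where "h1 = orth_proj ?R h"
    obtain x where x: "x \<in> L" "h1 = fst x" using orth_proj_in[OF hR, of h] by (auto simp: h1_def)
    have "\<bar>inner b h\<bar> \<le> norm (snd x)" if b: "b \<in> B" for b
    proof -
      obtain m where m: "m \<in> L" "m \<in> corth ?K" "norm (fst m) \<le> 1" "b = snd m"
        using b unfolding B_def by blast
      have "(0, h - h1) \<in> ?K" using corthR hR by (auto simp: h1_def Hminus_def)
      then have "cinner m (0, h - h1) = 0" using m(2) corthD' by blast
      then have "cinner b (h - h1) = 0" using m by (simp add: cinner_prod_def)
      then have "inner b h = inner b h1" by (simp add: inner_cinner cinner_diff_right)
      have "cinner (Jmap m) x = 0" using LagD(5)[OF L m(1) x(1)] by (simp add: cinner_Jmap)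
      then have "cinner b h1 = cinner (fst m) (snd x)" using m x by (simp add: Jmap_def cinner_prod_def)
      then have "inner b h = inner (fst m) (snd x)" using \<open>inner b h = inner b h1\<close> by (simp add: inner_cinner)
      also have "\<bar>\<dots>\<bar> \<le> norm (fst m) * norm (snd x)" by (rule Cauchy_Schwarz_ineq2)
      also have "\<dots> \<le> 1 * norm (snd x)" using m(3) by (intro mult_right_mono) auto
      finally show ?thesis by simp
    qed
    then show "\<exists>C. \<forall>b\<in>B. \<bar>inner b h\<bar> \<le> C" by blast
  qed
  then obtain C where C: "C > 0" "\<And>b. b \<in> B \<Longrightarrow> norm b \<le> C" by (auto simp: bounded_pos)
  have main: "norm (snd m) \<le> C * norm (fst m)" if m: "m \<in> L \<inter> corth ?K" for m
  proof (cases "fst m = 0")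
    case True
    then have "m \<in> ?K" using m by (cases m) (auto simp: Hminus_def)
    then have "m = 0" using m corth_disjoint[of m ?K] by blast
    then show ?thesis by simp
  next
    case False
    define t where "t = 1 / norm (fst m)"
    have t: "t > 0" using False by (simp add: t_def)
    have "t *\<^sub>R m \<in> L \<inter> corth ?K" using m hsub_scaleR[OF hsub_Int[OF hL hsub_corth]] by blast
    moreover have "norm (fst (t *\<^sub>R m)) \<le> 1" using False by (simp add: t_def)
    ultimately have "snd (t *\<^sub>R m) \<in> B" unfolding B_def by blast
    then have "t * norm (snd m) \<le> C" using C(2) t by fastforce
    then show ?thesis using False by (simp add: t_def field_simps)
  qed
  have low: "1 / (1 + C) * norm m \<le> norm (orth_proj (corth Hminus) m)" if m: "m \<in> L \<inter> corth ?K" for m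
  proof -
    have "norm m \<le> norm (fst m) + norm (snd m)" by (cases m) (simp add: norm_Pair_le)
    also have "\<dots> \<le> (1 + C) * norm (fst m)" using main[OF m] by (simp add: algebra_simps)
    finally show ?thesis using C(1) by (simp add: orth_proj_Hminus norm_Pair field_simps)
  qed
  have "\<exists>c>0. \<forall>m\<in>L \<inter> corth ?K. c * norm m \<le> norm (orth_proj (corth Hminus) m)"
  proof (rule exI, rule conjI)
    show "1 / (1 + C) > 0" using C by simp
    show "\<forall>m\<in>L \<inter> corth ?K. 1 / (1 + C) * norm m \<le> norm (orth_proj (corth Hminus) m)"
      by (rule ballI) (rule low)
  qed
  then show ?thesis unfolding transv_def using hL fin by simp
qed

subsection \<open>The reduction of a Lagrangian subspace\<close>

lemma Hminus_isotropic: "x \<in> Hminus \<Longrightarrow> y \<in> Hminus \<Longrightarrow> cinner x (Jmap y) = 0"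
  by (auto simp: Hminus_def Jmap_def cinner_prod_def)

lemma omega_compl_eq: "omega_compl W = Jmap ` corth W"
  by (simp add: omega_compl_def corth_Jmap_image)

lemma hsub_omega [simp]: "hsub (omega_compl W)"
  by (simp add: omega_compl_def)

lemma omega_complD: "x \<in> omega_compl W \<Longrightarrow> w \<in> W \<Longrightarrow> cinner x (Jmap w) = 0"
  unfolding omega_compl_def using corthD' by blast

lemma omega_compl_iff: "x \<in> omega_compl W \<longleftrightarrow> Jmap x \<in> corth W"
  unfolding omega_compl_eq by (rule Jmap_image_iff') simp

lemma corth_eq_Jmap_omega: "corth W = Jmap ` omega_compl W"
  unfolding omega_compl_eq by (simp add: Jmap_image_image)

context
  fixes W :: "('h::complex_hilbert_space \<times> 'h) set"
  assumes W: "cvs.subspace W" "closed W" "W \<subseteq> Hminus" "cfinite_codim_in W Hminus"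
begin

lemma hsub_W: "hsub W"
  using W by (simp add: hsub_def)

lemma W_subset_omega: "W \<subseteq> omega_compl W"
proof
  fix x assume "x \<in> W"
  then have "cinner w (Jmap x) = 0" if "w \<in> W" for w using that W(3) Hminus_isotropic by blast
  then show "x \<in> omega_compl W" by (simp add: omega_compl_iff corth_def)
qed

text \<open>The symplectic quotient of \<open>omega_compl W\<close> by \<open>W\<close>, realised as
  an orthogonal complement so that \<open>J\<close> acts on it.\<close>

definition reduced :: "('h \<times> 'h) set" where
  "reduced = omega_compl W \<inter> corth W"

lemma hsub_reduced: "hsub reduced"
  unfolding reduced_def by (simp add: hsub_Int)

lemma Jmap_reduced: "Jmap ` reduced = reduced"
  unfolding reduced_def Jmap_Int corth_eq_Jmap_omega[symmetric] omega_compl_eq[symmetric] by blast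

text \<open>For \<open>r = (a, b)\<close> both \<open>(0, b)\<close> and \<open>(0, - a)\<close> lie
  in the orthogonal complement of \<open>W\<close> inside \<open>Hminus\<close>, the first because
  of \<open>r\<close> and the second because of \<open>J r\<close>. That complement is spanned by
  the projections of finitely many vectors.\<close>

lemma cfinite_dim_reduced: "cfinite_dim reduced"
proof -
  let ?Q = "orth_proj (corth W)"
  obtain B where B: "finite B" "cvs.span (W \<union> B) = Hminus" using W(4) by (auto simp: cfinite_codim_in_def)
  have X: "Hminus \<inter> corth W \<subseteq> cvs.span (?Q ` B)"
  proof
    fix x assume x: "x \<in> Hminus \<inter> corth W"
    have "?Q x = x" using x by simp
    moreover have "?Q x \<in> ?Q ` cvs.span (W \<union> B)" using x B by blast
    moreover have "?Q ` cvs.span (W \<union> B) = cvs.span (?Q ` (W \<union> B))"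
      using cvp.linear_span_image[OF clin_linear[OF clin_orth_proj[OF hsub_corth]]] by metis
    moreover have "cvs.span (?Q ` (W \<union> B)) \<subseteq> cvs.span (?Q ` B)"
    proof (rule cvs.span_minimal)
      have "?Q w = 0" if "w \<in> W" for w using that hsub_W by (simp add: orth_proj_corth)
      then have "?Q ` (W \<union> B) \<subseteq> insert 0 (?Q ` B)" by auto
      also have "\<dots> \<subseteq> cvs.span (?Q ` B)" using cvs.span_zero[of "?Q ` B"] cvs.span_superset[of "?Q ` B"] by simp
      finally show "?Q ` (W \<union> B) \<subseteq> cvs.span (?Q ` B)" .
    qed simp
    ultimately show "x \<in> cvs.span (?Q ` B)" by auto
  qed
  let ?C = "?Q ` B \<union> Jmap ` ?Q ` B"
  have "reduced \<subseteq> cvs.span ?C"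
  proof
    fix r assume r: "r \<in> reduced"
    obtain a b where ab: "r = (a, b)" by (cases r)
    have c: "r \<in> corth W" "Jmap r \<in> corth W" using r by (auto simp: reduced_def omega_compl_iff)
    have "cinner w (0, b) = 0 \<and> cinner w (0, - a) = 0" if "w \<in> W" for w
    proof -
      have "fst w = 0" using that W(3) by (auto simp: Hminus_def)
      moreover have "cinner w r = 0" "cinner w (Jmap r) = 0" using c that corthD by blast+
      ultimately show ?thesis by (simp add: ab Jmap_def cinner_prod_def)
    qed
    then have "(0, b) \<in> Hminus \<inter> corth W" "(0, - a) \<in> Hminus \<inter> corth W" by (auto simp: corth_def Hminus_def)
    then have 1: "(0, b) \<in> cvs.span (?Q ` B)" "(0, - a) \<in> cvs.span (?Q ` B)" using X by blast+
    have "Jmap (0, - a) \<in> Jmap ` cvs.span (?Q ` B)" using 1 by blast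
    also have "Jmap ` cvs.span (?Q ` B) = cvs.span (Jmap ` ?Q ` B)"
      using cvp.linear_span_image[OF clin_linear[OF clin_J_op], of "?Q ` B"] by simp
    finally have "Jmap (0, - a) \<in> cvs.span ?C" using cvs.span_mono[of "Jmap ` ?Q ` B" ?C] by blast
    moreover have "(0, b) \<in> cvs.span ?C" using 1(1) cvs.span_mono[of "?Q ` B" ?C] by blast
    ultimately have "(0, b) - Jmap (0, - a) \<in> cvs.span ?C" by (intro cvs.span_diff)
    then show "r \<in> cvs.span ?C" by (simp add: ab Jmap_def)
  qed
  then show ?thesis unfolding cfinite_dim_def using B(1) by (metis finite_Un finite_imageI)
qed

lemma omega_eq_ssum: "omega_compl W = ssum W reduced"
proof (intro equalityI subsetI)
  fix x assume "x \<in> omega_compl W"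
  then have "x - orth_proj W x \<in> reduced"
    unfolding reduced_def using orth_decomp_in[OF hsub_W hsub_omega W_subset_omega] by blast
  moreover have "x = orth_proj W x + (x - orth_proj W x)" by simp
  ultimately show "x \<in> ssum W reduced" unfolding ssum_def using orth_proj_in[OF hsub_W, of x] by blast
next
  fix x assume "x \<in> ssum W reduced"
  then obtain w r where "w \<in> W" "r \<in> omega_compl W" "x = w + r" unfolding ssum_def reduced_def by blast
  then show "x \<in> omega_compl W" using W_subset_omega hsub_add[OF hsub_omega] by blast
qed

context
  fixes L :: "('h \<times> 'h) set"
  assumes L: "L \<in> Lagminus"
begin

private lemma Lag: "L \<in> Lag" using L by (simp add: Lagminus_def)

lemma transv_W: "transv L W"
  using transv_subset[OF Lagminus_transv[OF L] hsub_W W(3)] .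

text \<open>Finite dimension of the larger space is the point. \<open>L \<inter> W\<close> has it by
  transversality; its orthogonal complement in the larger space embeds into \<open>reduced\<close>,
  since a vector killed by the projection lies in \<open>W\<close>, hence in
  \<open>L \<inter> W\<close> and orthogonal to it.\<close>

lemma flag_W: "flag (L \<inter> W) (L \<inter> omega_compl W)"
proof -
  let ?V = "L \<inter> W" and ?Z = "L \<inter> omega_compl W"
  have hL: "hsub L" using LagD Lag by blast
  have hV: "hsub ?V" and hZ: "hsub ?Z" using hsub_Int hL hsub_W hsub_omega by blast+
  have VZ: "?V \<subseteq> ?Z" using W_subset_omega by blast
  let ?l = "?Z \<inter> corth ?V"
  have hl: "hsub ?l" using hZ by (simp add: hsub_Int)
  have "cfinite_dim ?l"
  proof (rule cfinite_dim_injective[OF clin_orth_proj[OF hsub_corth] _ _ cfinite_dim_reduced])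
    show "cvs.subspace ?l" using hl hsub_def by blast
    show "inj_on (orth_proj (corth W)) ?l"
    proof (rule inj_on_if_kernel)
      show "cvs.subspace ?l" using hl hsub_def by blast
      fix x assume x: "x \<in> ?l" "orth_proj (corth W) x = 0"
      then have "x \<in> W" using orth_proj_eq_0_iff[OF hsub_corth] corth_corth[OF hsub_W] by blast
      then show "x = 0" using x corth_disjoint[of x ?V] by blast
    qed
    show "orth_proj (corth W) ` ?l \<subseteq> reduced"
      unfolding reduced_def using orth_decomp_in[OF hsub_W hsub_omega W_subset_omega]
      by (auto simp: orth_proj_corth[OF hsub_W])
  qed
  moreover have "cfinite_dim ?V" using transv_W by (simp add: transv_def)
  moreover have "?V \<subseteq> corth ?l" by (rule subset_corth_commute) blast
  ultimately have "cfinite_dim (ssum ?V ?l)" using hV hl cdim_orth_sum(2) unfolding hsub_def by blast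
  moreover have "?Z \<subseteq> ssum ?V ?l"
  proof
    fix z assume "z \<in> ?Z"
    then have "z - orth_proj ?V z \<in> ?l" using orth_decomp_in[OF hV hZ VZ] by blast
    moreover have "z = orth_proj ?V z + (z - orth_proj ?V z)" by simp
    ultimately show "z \<in> ssum ?V ?l" unfolding ssum_def using orth_proj_in[OF hV, of z] by blast
  qed
  ultimately have "cfinite_dim ?Z" using cfinite_dim_subset by blast
  then show ?thesis using hV hZ VZ by (simp add: flag_def hsub_def)
qed

lemma transv_omega: "transv L (omega_compl W)"
proof (rule transv_add_finite[OF transv_W cfinite_dim_reduced hsub_reduced _ omega_eq_ssum])
  show "reduced \<subseteq> corth W" by (auto simp: reduced_def)
  show "cfinite_dim (L \<inter> omega_compl W)" using flagD(4)[OF flag_W] .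
qed

text \<open>The complement of \<open>L + W\<close> is the intersection of the two complements, which
  is the \<open>J\<close>-image on the left. Transversality makes the sum closed, so complements can
  be taken once more. This is the existence result behind both \<open>two_dim_ell\<close> and the
  tangent curves.\<close>

lemma corth_Jmap_Int_omega: "corth (Jmap ` (L \<inter> omega_compl W)) = ssum L W"
proof -
  have h: "hsub L" "hsub (ssum L W)" using LagD Lag transv_closed[OF transv_W] by blast+
  have "corth (ssum L W) = corth L \<inter> corth W"
    using corth_ssum hsub_0[OF h(1)] hsub_0[OF hsub_W] by blast
  also have "\<dots> = Jmap ` (L \<inter> omega_compl W)"
    unfolding Jmap_Int LagD(3)[OF Lag] corth_eq_Jmap_omega[of W] ..
  finally show ?thesis using corth_corth[OF h(2)] by simp
qed

text \<open>The projection \<open>N\<close> of \<open>L \<inter> omega_compl W\<close> is lagrangian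
  in \<open>reduced\<close>: isotropic because \<open>L\<close> and \<open>W\<close> are, maximal by
  \<open>corth_Jmap_Int_omega\<close>. As the projection is injective on the orthogonal complement
  of \<open>L \<inter> W\<close>, the dimension of that complement does not depend on
  \<open>L\<close>.\<close>

lemma two_dim_ell: "2 * cvs.dim ((L \<inter> omega_compl W) \<inter> corth (L \<inter> W)) = cvs.dim reduced"
proof -
  let ?V = "L \<inter> W" and ?Z = "L \<inter> omega_compl W"
  let ?l = "?Z \<inter> corth ?V"
  let ?P = "orth_proj (corth W)"
  have hV: "hsub ?V" and hZ: "hsub ?Z" and VZ: "?V \<subseteq> ?Z" using flagD[OF flag_W] by auto
  have hl: "hsub ?l" using hZ by (simp add: hsub_Int)
  have fl: "cfinite_dim ?l" by (rule cfinite_dim_subset[OF flagD(4)[OF flag_W]]) blast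
  define N where "N = ?P ` ?Z"
  have P0: "?P x = 0" if "x \<in> W" for x using that hsub_W by (simp add: orth_proj_corth)
  have Nl: "N = ?P ` ?l"
  proof (intro equalityI subsetI)
    fix n assume "n \<in> N"
    then obtain z where z: "z \<in> ?Z" "n = ?P z" by (auto simp: N_def)
    have "orth_proj ?V z \<in> W" using orth_proj_in[OF hV] by blast
    then have "?P (z - orth_proj ?V z) = n" using z P0 by (simp add: blinfun.diff_right)
    moreover have "z - orth_proj ?V z \<in> ?l" using orth_decomp_in[OF hV hZ VZ z(1)] .
    ultimately show "n \<in> ?P ` ?l" by (metis image_eqI)
  qed (auto simp: N_def)
  have inj: "inj_on ?P ?l"
  proof (rule inj_on_if_kernel)
    show "cvs.subspace ?l" using hl hsub_def by blast
    fix x assume x: "x \<in> ?l" "?P x = 0"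
    then have "x \<in> W" using orth_proj_eq_0_iff[OF hsub_corth] corth_corth[OF hsub_W] by blast
    then show "x = 0" using x corth_disjoint[of x ?V] by blast
  qed
  have dN: "cvs.dim N = cvs.dim ?l" "cfinite_dim N" "cvs.subspace N"
    unfolding Nl using cdim_image_eq[OF clin_orth_proj[OF hsub_corth] fl _ inj]
      cfinite_dim_image[OF clin_orth_proj[OF hsub_corth] fl] csubspace_image[OF clin_orth_proj[OF hsub_corth]] hl
    unfolding hsub_def by blast+
  have NR: "N \<subseteq> reduced"
    unfolding reduced_def N_def using orth_decomp_in[OF hsub_W hsub_omega W_subset_omega]
    by (auto simp: orth_proj_corth[OF hsub_W])
  have iJ: "inj_on (blinfun_apply J_op) N" using inj_on_subset[OF inj_Jmap, of N] by (simp add: inj_on_def)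
  have dJ: "cvs.dim (Jmap ` N) = cvs.dim N" "cfinite_dim (Jmap ` N)" "cvs.subspace (Jmap ` N)"
    using cdim_image_eq[OF clin_J_op dN(2,3) iJ] cfinite_dim_image[OF clin_J_op dN(2)] csubspace_Jmap_image[OF dN(3)]
    by simp_all
  have wr: "z - ?P z \<in> W" for z using hsub_W by (simp add: orth_proj_corth)
  have iso: "cinner x (Jmap y) = 0" if xy: "x \<in> N" "y \<in> N" for x y
  proof -
    obtain z where z1: "z \<in> ?Z" "x = ?P z" using xy(1) unfolding N_def by blast
    obtain z' where z2: "z' \<in> ?Z" "y = ?P z'" using xy(2) unfolding N_def by blast
    note z = z1 z2
    define w where "w = z - x" define w' where "w' = z' - y"
    have ww: "w \<in> W" "w' \<in> W" using wr by (auto simp: w_def w'_def z)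
    have Jy: "Jmap y \<in> corth W" "x \<in> omega_compl W"
      using subsetD[OF NR xy(1)] subsetD[OF NR xy(2)] by (simp_all add: reduced_def omega_compl_iff)
    have ww0: "cinner w (Jmap w') = 0" using ww W(3) Hminus_isotropic by blast
    have "0 = cinner z (Jmap z')" using LagD(5)[OF Lag] z by simp
    also have "\<dots> = cinner (x + w) (Jmap y + Jmap w')" by (simp add: w_def w'_def Jmap_add[symmetric])
    also have "\<dots> = cinner x (Jmap y)"
      using corthD[OF Jy(1) ww(1)] omega_complD[OF Jy(2) ww(2)] ww0 by (simp add: cinner_bilin)
    finally show ?thesis by simp
  qed
  have JNo: "N \<subseteq> corth (Jmap ` N)"
  proof
    fix x assume "x \<in> N"
    then have "cinner x (Jmap y) = 0" if "y \<in> N" for y using iso that by blast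
    then show "x \<in> corth (Jmap ` N)" by (auto simp: corth_def) (metis cinner_eq_0_commute)
  qed
  \<comment> \<open>Maximality: \<open>J r\<close> is orthogonal not only to \<open>N\<close> but to
    all of \<open>?Z\<close>, so \<open>r\<close> lies in the sum of \<open>L\<close> and
    \<open>W\<close>; its part in \<open>L\<close> then lies in \<open>?Z\<close> and projects to
    \<open>r\<close>.\<close>
  have key: "r \<in> N" if r: "r \<in> reduced" "Jmap r \<in> corth N" for r
  proof -
    have "cinner z (Jmap r) = 0" if z: "z \<in> ?Z" for z
    proof -
      have "Jmap r \<in> corth W" using r(1) Jmap_reduced reduced_def by blast
      then have "cinner (z - ?P z) (Jmap r) = 0" using wr corthD by blast
      moreover have "cinner (?P z) (Jmap r) = 0" using r(2) z corthD N_def by blast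
      ultimately show ?thesis by (simp add: cinner_diff_left)
    qed
    then have "r \<in> corth (Jmap ` ?Z)" by (auto simp: corth_def cinner_Jmap)
    then obtain l w where lw: "l \<in> L" "w \<in> W" "r = l + w" unfolding corth_Jmap_Int_omega ssum_def by blast
    then have "l = r - w" by simp
    then have "l \<in> ?Z" using lw r(1) W_subset_omega hsub_diff[OF hsub_omega] unfolding reduced_def by blast
    moreover have "?P l = r"
      using P0[OF lw(2)] r(1) by (simp add: \<open>l = r - w\<close> blinfun.diff_right reduced_def)
    ultimately show ?thesis unfolding N_def by (metis image_eqI)
  qed
  have "reduced = ssum N (Jmap ` N)"
  proof (intro equalityI subsetI)
    fix r assume r: "r \<in> reduced"
    have hN: "hsub N" using cfinite_dim_hsub dN by blast
    let ?s = "r - orth_proj N r"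
    have s: "?s \<in> reduced" "?s \<in> corth N" using orth_decomp_in[OF hN hsub_reduced NR r] by auto
    have "Jmap ?s \<in> reduced" using s(1) Jmap_reduced by blast
    moreover have "- ?s \<in> corth N" using s(2) csubspace_neg_iff[OF csubspace_corth] by blast
    then have "Jmap (Jmap ?s) \<in> corth N" by (simp only: Jmap_Jmap)
    ultimately have "Jmap ?s \<in> N" by (rule key)
    then have "?s \<in> Jmap ` N" using dN(3) by (simp add: Jmap_image_iff')
    moreover have "r = orth_proj N r + ?s" by simp
    ultimately show "r \<in> ssum N (Jmap ` N)" unfolding ssum_def using orth_proj_in[OF hN, of r] by blast
  next
    fix r assume "r \<in> ssum N (Jmap ` N)"
    then obtain a b where "a \<in> N" "b \<in> Jmap ` N" "r = a + b" unfolding ssum_def by blast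
    then show "r \<in> reduced" using NR Jmap_reduced hsub_add[OF hsub_reduced] by blast
  qed
  then show ?thesis using cdim_orth_sum(1)[OF dN(3,2) dJ(3,2) JNo] dJ(1) dN(1) by simp
qed

end

end

subsection \<open>Intersections with nearby Lagrangian subspaces\<close>

text \<open>Near \<open>S = 0\<close>, the vectors \<open>u\<close> of \<open>L\<close> with \<open>u + J S u \<in> Y\<close> are among the \<open>\<phi> S v\<close>, \<open>v \<in> L \<inter> Y\<close>,
  where \<open>\<phi> S v\<close> is the solution in \<open>v + (L \<inter> corth (L \<inter> Y))\<close> of the projected, coercive equation.\<close>

lemma local_graph:
  fixes L Y :: "('h::complex_hilbert_space \<times> 'h) set"
  assumes t: "transv L Y"
  defines "V \<equiv> L \<inter> Y"
  shows "\<exists>\<delta> (\<phi> :: (('h \<times> 'h) \<Rightarrow>\<^sub>L ('h \<times> 'h)) \<Rightarrow> (('h \<times> 'h) \<Rightarrow>\<^sub>L ('h \<times> 'h))). 0 < \<delta> \<and> smooth_on (ball 0 \<delta>) \<phi> \<and> (\<forall>v\<in>V. blinfun_apply (\<phi> 0) v = v) \<and>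
    (\<forall>S\<in>ball 0 \<delta>. (clin S \<longrightarrow> clin (\<phi> S)) \<and> (\<forall>x. blinfun_apply (\<phi> S) x \<in> L) \<and>
       (\<forall>x. blinfun_apply (\<phi> S) (orth_proj V x) = blinfun_apply (\<phi> S) x) \<and>
       (\<forall>v\<in>V. orth_proj V (blinfun_apply (\<phi> S) v) = v) \<and>
       (\<forall>u\<in>L. u + Jmap (blinfun_apply S u) \<in> Y \<longrightarrow> u = blinfun_apply (\<phi> S) (orth_proj V u)))"
proof -
  have h: "hsub L" "hsub Y" "hsub V" using t hsub_Int by (auto simp: transv_def V_def)
  define M where "M = L \<inter> corth V"
  have M: "hsub M" using h by (simp add: M_def hsub_Int)
  obtain c where c: "c > 0" "\<And>m. m \<in> M \<Longrightarrow> c * norm m \<le> norm (orth_proj (corth Y) m)"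
    using t by (auto simp: transv_def V_def M_def)
  let ?Q = "orth_proj (corth Y)" and ?PM = "orth_proj M" and ?PV = "orth_proj V"
  \<comment> \<open>The square of the lower bound \<open>c\<close> is the coercivity constant on
    \<open>M\<close> for \<open>S = 0\<close>, and operators below \<open>\<delta>\<close> use up at
    most half of it. The minimum with 1 in \<open>k\<close> accounts for the identity block outside
    \<open>M\<close>.\<close>
  define \<delta> where "\<delta> = c\<^sup>2 / 2"
  define k where "k = min 1 (c\<^sup>2 / 2)"
  have pos: "\<delta> > 0" "k > 0" "k \<le> 1" "k \<le> c\<^sup>2 / 2" using c by (auto simp: \<delta>_def k_def)
  \<comment> \<open>The compression of \<open>Q (1 + J S)\<close> to \<open>M\<close>, extended by
    the identity on the complement so that it can be inverted on the whole space.\<close>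
  define X where "X S = (id_blinfun - ?PM) + (?PM o\<^sub>L (?Q o\<^sub>L ((id_blinfun + (J_op o\<^sub>L S)) o\<^sub>L ?PM)))"
    for S :: "('h \<times> 'h) \<Rightarrow>\<^sub>L ('h \<times> 'h)"
  have X: "X S x = (x - ?PM x) + ?PM (?Q (?PM x + Jmap (S (?PM x))))" for S x
    by (simp add: X_def blinfun.add_left blinfun.diff_left)
  have sa: "inner (orth_proj E x) y = inner x (orth_proj E y)" if "hsub E" for E and x y :: "'h \<times> 'h"
    using inner_adj[of "orth_proj E" x y] that by simp
  have co: "k * (norm x)\<^sup>2 \<le> inner (X S x) x" if S: "S \<in> ball 0 \<delta>" for S x
  proof -
    define m where "m = ?PM x"
    have m: "m \<in> M" using M by (simp add: m_def)
    have "inner (?PM (?Q (m + Jmap (S m)))) x = inner (?Q m) m + inner (?Q (Jmap (S m))) m"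
      using M by (simp add: sa m_def[symmetric] blinfun.add_right inner_add_left)
    moreover have "inner (?Q m) m = (norm (?Q m))\<^sup>2"
      using sa[OF hsub_corth, of Y "?Q m" m] by (simp add: power2_norm_eq_inner)
    moreover have "(c * norm m)\<^sup>2 \<le> (norm (?Q m))\<^sup>2" using c m by (intro power_mono) auto
    moreover have "\<bar>inner (?Q (Jmap (S m))) m\<bar> \<le> \<delta> * (norm m)\<^sup>2"
    proof -
      have "\<bar>inner (?Q (Jmap (S m))) m\<bar> \<le> norm (?Q (Jmap (S m))) * norm m" by (rule Cauchy_Schwarz_ineq2)
      also have "\<dots> \<le> norm (S m) * norm m"
        using norm_orth_proj_le[OF hsub_corth, of Y "Jmap (S m)"] by (intro mult_right_mono) auto
      also have "\<dots> \<le> (\<delta> * norm m) * norm m"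
        using S norm_blinfun[of S m] mult_right_mono[of "norm S" \<delta> "norm m"]
        by (intro mult_right_mono) auto
      finally show ?thesis by (simp add: power2_eq_square)
    qed
    ultimately have 1: "inner (?PM (?Q (m + Jmap (S m)))) x \<ge> c\<^sup>2 / 2 * (norm m)\<^sup>2"
      by (simp add: \<delta>_def power_mult_distrib)
    have 2: "(norm x)\<^sup>2 = (norm m)\<^sup>2 + (norm (x - m))\<^sup>2"
      using norm_orth_proj_split[OF M, of x] by (simp add: orth_proj_corth[OF M] m_def)
    have "inner m (x - m) = 0" using M corth_iff_inner[of M] m orth_proj_diff_in[OF M, of x] by (auto simp: m_def hsub_def)
    then have "inner (x - m) x = (norm (x - m))\<^sup>2"
      by (simp add: power2_norm_eq_inner inner_diff_left inner_diff_right inner_commute)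
    then have "inner (X S x) x \<ge> (norm (x - m))\<^sup>2 + c\<^sup>2 / 2 * (norm m)\<^sup>2"
      using 1 by (simp add: X m_def[symmetric] inner_add_left)
    moreover have "k * (norm (x - m))\<^sup>2 \<le> 1 * (norm (x - m))\<^sup>2" "k * (norm m)\<^sup>2 \<le> c\<^sup>2 / 2 * (norm m)\<^sup>2"
      using pos by (intro mult_right_mono; simp)+
    ultimately show ?thesis unfolding 2 by (simp add: distrib_left)
  qed
  define R where "R S = (SOME B. X S o\<^sub>L B = id_blinfun \<and> B o\<^sub>L X S = id_blinfun \<and> norm B \<le> 1 / k)" for S
  have R: "X S o\<^sub>L R S = id_blinfun \<and> R S o\<^sub>L X S = id_blinfun \<and> norm (R S) \<le> 1 / k" if "S \<in> ball 0 \<delta>" for S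
    unfolding R_def by (rule someI_ex[OF lax_milgram_bound[OF pos(2) co[OF that]]])
  have XR: "X S (R S y) = y" "R S (X S y) = y" if "S \<in> ball 0 \<delta>" for S y
    using arg_cong[OF R[OF that, THEN conjunct1], of "\<lambda>T. blinfun_apply T y"]
      arg_cong[OF R[OF that, THEN conjunct2, THEN conjunct1], of "\<lambda>T. blinfun_apply T y"] by auto
  have smX: "smooth_on (ball 0 \<delta>) X" unfolding X_def by (intro smooth_intros)
  have smR: "smooth_on (ball 0 \<delta>) R"
    by (rule smooth_on_inverse[OF open_ball _ _ smX]) (use R in blast)+
  \<comment> \<open>From \<open>v\<close> in \<open>V\<close> this subtracts the element of
    \<open>M\<close> that makes the projected equation \<open>PM (Q (u + J S u)) = 0\<close> hold
    for \<open>u = \<phi> S v\<close>.\<close>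
  define \<phi> where "\<phi> S = ?PV - (R S o\<^sub>L (?PM o\<^sub>L (?Q o\<^sub>L ((id_blinfun + (J_op o\<^sub>L S)) o\<^sub>L ?PV))))" for S
  have \<phi>: "\<phi> S x = ?PV x - R S (?PM (?Q (?PV x + Jmap (S (?PV x)))))" for S x
    by (simp add: \<phi>_def blinfun.add_left blinfun.diff_left)
  have sm\<phi>: "smooth_on (ball 0 \<delta>) \<phi>" unfolding \<phi>_def by (intro smooth_intros smR)
  have RM: "R S y \<in> M" if "S \<in> ball 0 \<delta>" "y \<in> M" for S y
  proof -
    have "R S y - ?PM (R S y) = y - ?PM (?Q (?PM (R S y) + Jmap (S (?PM (R S y)))))"
      using XR(1)[OF that(1), of y] by (simp add: X algebra_simps)
    also have "\<dots> \<in> M" using that(2) M by (intro hsub_diff[OF M]) auto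
    finally have "(R S y - ?PM (R S y)) + ?PM (R S y) \<in> M" using M by (intro hsub_add[OF M]) auto
    then show ?thesis by simp
  qed
  have "\<phi> S x \<in> L" if "S \<in> ball 0 \<delta>" for S x
  proof -
    have "?PV x \<in> L" using orth_proj_in[OF h(3), of x] by (simp add: V_def)
    moreover have "R S (?PM y) \<in> L" for y using RM[OF that orth_proj_in[OF M], of y] unfolding M_def by blast
    ultimately show ?thesis unfolding \<phi> using h(1) hsub_diff by blast
  qed
  moreover have "blinfun_apply (\<phi> S) (?PV x) = \<phi> S x" for S x using h(3) by (simp add: \<phi>)
  moreover have "?PV (\<phi> S v) = v" if "S \<in> ball 0 \<delta>" "v \<in> V" for S v
  proof -
    have "R S (?PM y) \<in> corth V" for y using RM[OF that(1) orth_proj_in[OF M], of y] unfolding M_def by blast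
    then show ?thesis using that h(3) by (simp add: \<phi> blinfun.diff_right)
  qed
  moreover have "u = \<phi> S (?PV u)" if S: "S \<in> ball 0 \<delta>" and u: "u \<in> L" "u + Jmap (blinfun_apply S u) \<in> Y" for S u
  proof -
    define v where "v = ?PV u" define m where "m = u - v"
    have uv: "u = v + m" by (simp add: m_def)
    have m: "m \<in> M" unfolding m_def v_def M_def using orth_decomp_in[OF h(3,1) _ u(1)] by (simp add: V_def)
    have "?Q (u + Jmap (S u)) = 0" using u(2) h(2) by (simp add: orth_proj_corth)
    moreover have "u + Jmap (S u) = (m + Jmap (S m)) + (v + Jmap (S v))"
      unfolding uv by (simp add: blinfun.add_right Jmap_add)
    ultimately have "?Q (m + Jmap (S m)) + ?Q (v + Jmap (S v)) = 0" by (simp only: blinfun.add_right)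
    then have q: "?Q (m + Jmap (S m)) = - ?Q (v + Jmap (S v))" by (simp only: eq_neg_iff_add_eq_0)
    have "?PM m = m" using m M by simp
    then have "X S m = - ?PM (?Q (v + Jmap (S v)))" unfolding X by (simp only: q blinfun.minus_right) simp
    then have "R S (- ?PM (?Q (v + Jmap (S v)))) = m" using XR(2)[OF S, of m] by (simp only:)
    then have meq: "- R S (?PM (?Q (v + Jmap (S v)))) = m" by (simp only: blinfun.minus_right)
    have pv: "?PV v = v" using h(3) by (simp add: v_def)
    have "\<phi> S v = v - R S (?PM (?Q (v + Jmap (S v))))" unfolding \<phi> pv ..
    also have "\<dots> = v + m" unfolding meq[symmetric] by (rule diff_conv_add_uminus)
    finally have "\<phi> S v = u" unfolding uv .
    then show ?thesis unfolding v_def ..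
  qed
  moreover have "clin (\<phi> S)" if S: "S \<in> ball 0 \<delta>" "clin S" for S
  proof -
    have "clin (X S)" unfolding X_def using M S by (intro clin_intros clin_orth_proj clin_J_op hsub_corth)
    then have "clin (R S)" using R[OF S(1)] clin_inverse by blast
    then show ?thesis unfolding \<phi>_def using M S h by (intro clin_intros clin_orth_proj clin_J_op hsub_corth)
  qed
  moreover have "\<phi> 0 v = v" if "v \<in> V" for v
  proof -
    have "?Q v = 0" using that h(2) by (simp add: V_def orth_proj_corth)
    then show ?thesis using that h(3) by (simp add: \<phi>)
  qed
  ultimately show ?thesis using pos(1) sm\<phi> by blast
qed

text \<open>Solutions of the projected equation need not solve the full one, so in general the
  intersection is only contained in the parametrised space. Equality of dimensions turns the
  inclusion into an equality; hence the implication in the last clause.\<close>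

definition param_at ::
    "('h::complex_hilbert_space \<times> 'h) set \<Rightarrow> ('h \<times> 'h) set \<Rightarrow>
     (('h \<times> 'h) \<Rightarrow>\<^sub>L ('h \<times> 'h)) \<Rightarrow> (('h \<times> 'h) \<Rightarrow>\<^sub>L ('h \<times> 'h)) \<Rightarrow> bool" where
  "param_at L Y S F \<longleftrightarrow> clin F \<and> (\<forall>x. F x \<in> L) \<and>
     (\<forall>x. F (orth_proj (L \<inter> Y) x) = F x) \<and> (\<forall>v\<in>L \<inter> Y. orth_proj (L \<inter> Y) (F v) = v) \<and>
     cfinite_dim (arnold L S \<inter> Y) \<and> cvs.dim (arnold L S \<inter> Y) \<le> cvs.dim (L \<inter> Y) \<and>
     (cvs.dim (arnold L S \<inter> Y) = cvs.dim (L \<inter> Y) \<longrightarrow>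
        (\<lambda>v. F v + Jmap (S (F v))) ` (L \<inter> Y) = arnold L S \<inter> Y)"

text \<open>Smoothness refers to a full ball of operators because derivatives need an open set; the
  geometric statement is made only for those \<open>S\<close> that give points of the chart.\<close>

definition local_param ::
    "('h::complex_hilbert_space \<times> 'h) set \<Rightarrow> ('h \<times> 'h) set \<Rightarrow> real \<Rightarrow>
     ((('h \<times> 'h) \<Rightarrow>\<^sub>L ('h \<times> 'h)) \<Rightarrow> (('h \<times> 'h) \<Rightarrow>\<^sub>L ('h \<times> 'h))) \<Rightarrow> bool" where
  "local_param L Y \<delta> \<phi> \<longleftrightarrow> 0 < \<delta> \<and> smooth_on (ball 0 \<delta>) \<phi> \<and> (\<forall>v\<in>L \<inter> Y. \<phi> 0 v = v) \<and>
     (\<forall>S\<in>ball 0 \<delta> \<inter> Sym_op L. param_at L Y S (\<phi> S))"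

lemma param_atD:
  assumes "param_at L Y S F"
  shows "clin F" "F x \<in> L" "F (orth_proj (L \<inter> Y) x) = F x"
    "v \<in> L \<inter> Y \<Longrightarrow> orth_proj (L \<inter> Y) (F v) = v" "cfinite_dim (arnold L S \<inter> Y)"
    "cvs.dim (arnold L S \<inter> Y) \<le> cvs.dim (L \<inter> Y)"
    "cvs.dim (arnold L S \<inter> Y) = cvs.dim (L \<inter> Y) \<Longrightarrow>
      (\<lambda>v. F v + Jmap (S (F v))) ` (L \<inter> Y) = arnold L S \<inter> Y"
  using assms unfolding param_at_def by blast+

lemma local_paramD:
  assumes "local_param L Y \<delta> \<phi>"
  shows "0 < \<delta>" "smooth_on (ball 0 \<delta>) \<phi>" "v \<in> L \<inter> Y \<Longrightarrow> \<phi> 0 v = v"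
    "S \<in> ball 0 \<delta> \<Longrightarrow> S \<in> Sym_op L \<Longrightarrow> param_at L Y S (\<phi> S)"
  using assms unfolding local_param_def by blast+

lemma local_param_exists:
  assumes L: "L \<in> Lag" and t: "transv L Y"
  shows "\<exists>\<delta> \<phi>. local_param L Y \<delta> \<phi>"
proof -
  let ?V = "L \<inter> Y"
  obtain \<delta> \<phi> where \<phi>: "0 < \<delta>" "smooth_on (ball 0 \<delta>) \<phi>" "\<forall>v\<in>?V. blinfun_apply (\<phi> 0) v = v"
    and g0: "\<forall>S\<in>ball 0 \<delta>. (clin S \<longrightarrow> clin (\<phi> S)) \<and> (\<forall>x. blinfun_apply (\<phi> S) x \<in> L) \<and>
       (\<forall>x. blinfun_apply (\<phi> S) (orth_proj ?V x) = blinfun_apply (\<phi> S) x) \<and>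
       (\<forall>v\<in>?V. orth_proj ?V (blinfun_apply (\<phi> S) v) = v) \<and>
       (\<forall>u\<in>L. u + Jmap (blinfun_apply S u) \<in> Y \<longrightarrow> u = blinfun_apply (\<phi> S) (orth_proj ?V u))"
    using local_graph[OF t] by (elim exE conjE) (rule that)
  note g = bspec[OF g0]
  have V: "cfinite_dim ?V" "cvs.subspace ?V" "cvs.subspace Y" "hsub ?V"
    using t hsub_Int by (auto simp: transv_def hsub_def cvs.subspace_inter)
  have "cfinite_dim (arnold L S \<inter> Y) \<and> cvs.dim (arnold L S \<inter> Y) \<le> cvs.dim ?V \<and>
      (cvs.dim (arnold L S \<inter> Y) = cvs.dim ?V \<longrightarrow> (\<lambda>v. \<phi> S v + Jmap (S (\<phi> S v))) ` ?V = arnold L S \<inter> Y)"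
    if S: "S \<in> ball 0 \<delta>" "S \<in> Sym_op L" for S
  proof -
    define \<Theta> where "\<Theta> = (id_blinfun + (J_op o\<^sub>L S)) o\<^sub>L \<phi> S"
    have \<Theta>: "\<Theta> v = \<phi> S v + Jmap (S (\<phi> S v))" for v by (simp add: \<Theta>_def blinfun.add_left)
    have lin: "clin \<Theta>" unfolding \<Theta>_def using g[OF S(1)] Sym_opD(1)[OF S(2)]
      by (intro clin_compose clin_add clin_id clin_J_op) auto
    have sub: "arnold L S \<inter> Y \<subseteq> \<Theta> ` ?V"
    proof
      fix x assume "x \<in> arnold L S \<inter> Y"
      then obtain u where u: "u \<in> L" "x = u + Jmap (S u)" "u + Jmap (S u) \<in> Y"
        unfolding Int_iff arnold_iff by blast
      then have "u = \<phi> S (orth_proj ?V u)" using g[OF S(1)] by blast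
      then have "x = \<Theta> (orth_proj ?V u)" using u(2) by (simp add: \<Theta>)
      then show "x \<in> \<Theta> ` ?V" using orth_proj_in[OF V(4), of u] by blast
    qed
    have f: "cfinite_dim (\<Theta> ` ?V)" "cvs.subspace (\<Theta> ` ?V)" "cvs.dim (\<Theta> ` ?V) \<le> cvs.dim ?V"
      using cfinite_dim_image[OF lin V(1)] csubspace_image[OF lin V(2)] cdim_image_le[OF lin V(1,2)] .
    have s: "cvs.subspace (arnold L S \<inter> Y)"
      using csubspace_arnold LagD(2)[OF L] Sym_opD(1)[OF S(2)] V(3) cvs.subspace_inter by blast
    have 1: "cfinite_dim (arnold L S \<inter> Y)" using cfinite_dim_subset[OF f(1) sub] .
    have 2: "cvs.dim (arnold L S \<inter> Y) \<le> cvs.dim (\<Theta> ` ?V)" using cdim_le[OF f(1,2) sub] .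
    have im: "(\<lambda>v. \<phi> S v + Jmap (S (\<phi> S v))) ` ?V = \<Theta> ` ?V" by (simp add: \<Theta>)
    have 3: "arnold L S \<inter> Y = \<Theta> ` ?V" if "cvs.dim (arnold L S \<inter> Y) = cvs.dim ?V"
      using csubspace_dim_eq[OF f(1,2) s sub] f(3) that by simp
    show ?thesis using 1 2 3 f(3) unfolding im by auto
  qed
  note res = this
  have "\<forall>S\<in>ball 0 \<delta> \<inter> Sym_op L. param_at L Y S (\<phi> S)"
  proof (rule ballI)
    fix S assume "S \<in> ball 0 \<delta> \<inter> Sym_op L"
    then have S: "S \<in> ball 0 \<delta>" "S \<in> Sym_op L" by simp_all
    show "param_at L Y S (\<phi> S)"
      unfolding param_at_def
      using g[OF S(1)] res[OF S] Sym_opD(1)[OF S(2)] by (intro conjI) (elim conjE mp; assumption)+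
  qed
  then have "local_param L Y \<delta> \<phi>" unfolding local_param_def using \<phi> by (intro conjI)
  then show ?thesis by blast
qed

text \<open>Finite intersection comes from \<open>local_param\<close>. For the sum, the graph map
  followed by the projection along \<open>Hminus\<close> keeps the lower bound \<open>c / 2\<close>
  on the complement of \<open>?K\<close> when \<open>norm S\<close> is at most \<open>c / 2\<close>.
  Its image of \<open>L\<close> is therefore a closed subspace plus finitely many dimensions, and
  the sum is the preimage of that image.\<close>

lemma Lagminus_open:
  assumes L: "L \<in> Lagminus"
  shows "\<exists>\<delta>>0. \<forall>S\<in>ball 0 \<delta> \<inter> Sym_op L. arnold L S \<in> Lagminus"
proof -
  have Lag: "L \<in> Lag" using L by (simp add: Lagminus_def)
  have t: "transv L Hminus" by (rule Lagminus_transv[OF L])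
  obtain \<delta>1 \<phi> where lp: "local_param L Hminus \<delta>1 \<phi>" using local_param_exists[OF Lag t] by blast
  let ?K = "L \<inter> Hminus" and ?Q = "orth_proj (corth Hminus)"
  have h: "hsub L" "hsub ?K" using LagD(1)[OF Lag] hsub_Int hsub_Hminus by blast+
  let ?M = "L \<inter> corth ?K"
  have M: "hsub ?M" using h by (simp add: hsub_Int)
  obtain c where c: "c > 0" "\<And>m. m \<in> ?M \<Longrightarrow> c * norm m \<le> norm (?Q m)" using t by (auto simp: transv_def)
  have "arnold L S \<in> Lagminus" if S: "S \<in> ball 0 (min \<delta>1 (c / 2))" "S \<in> Sym_op L" for S
  proof -
    have "S \<in> ball 0 \<delta>1" using S(1) by simp
    then have fin: "cfinite_dim (arnold L S \<inter> Hminus)" by (rule param_atD(5)[OF local_paramD(4)[OF lp _ S(2)]])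
    have nS: "norm S \<le> c / 2" using S by simp
    define A where "A = id_blinfun + (J_op o\<^sub>L S)"
    have A: "A x = x + Jmap (S x)" for x by (simp add: A_def blinfun.add_left)
    define T where "T = ?Q o\<^sub>L A"
    have T: "T x = ?Q (A x)" for x by (simp add: T_def)
    have lin: "clin T" unfolding T_def A_def using Sym_opD(1)[OF S(2)]
      by (intro clin_compose clin_add clin_id clin_J_op clin_orth_proj hsub_corth)
    have low: "c / 2 * norm m \<le> norm (T m)" if "m \<in> ?M" for m
    proof -
      have "norm (?Q (Jmap (S m))) \<le> norm (S m)"
        using norm_orth_proj_le[OF hsub_corth, of Hminus "Jmap (S m)"] by simp
      also have "\<dots> \<le> c / 2 * norm m"
        using norm_blinfun[of S m] mult_right_mono[OF nS norm_ge_zero[of m]] by simp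
      finally have "norm (?Q (Jmap (S m))) \<le> c / 2 * norm m" .
      moreover have "T m = ?Q m + ?Q (Jmap (S m))" by (simp add: T A blinfun.add_right)
      ultimately show ?thesis using c(2)[OF that] norm_diff_ineq[of "?Q m" "?Q (Jmap (S m))"] by simp
    qed
    let ?F = "T ` ?M"
    have "complete ?F" using M c(1) low
      by (intro complete_image_bounded_below[of _ "c/2"]) (auto simp: hsub_def csubspace_imp_subspace)
    then have F: "hsub ?F" using csubspace_image[OF lin] M by (simp add: hsub_def complete_imp_closed)
    obtain B where B: "finite B" "cvs.span B = ?K"
      using cfinite_dimE t h(2) unfolding transv_def hsub_def by metis
    let ?G = "cvs.span (?F \<union> T ` B)"
    have G: "hsub ?G" by (rule closed_span_Un_finite[OF F finite_imageI[OF B(1)]])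
    have sp: "T ` ?K = cvs.span (T ` B)"
      using cvp.linear_span_image[OF clin_linear[OF lin], of B] B(2) by simp
    have TL: "T ` L = ?G"
    proof
      show "T ` L \<subseteq> ?G"
      proof
        fix y assume "y \<in> T ` L"
        then obtain l where l: "l \<in> L" "y = T l" by blast
        have "T (l - orth_proj ?K l) \<in> ?F" using orth_decomp_in[OF h(2,1) _ l(1)] by blast
        then have 1: "T (l - orth_proj ?K l) \<in> ?G" by (intro cvs.span_base UnI1)
        have "T (orth_proj ?K l) \<in> T ` ?K" using orth_proj_in[OF h(2)] by blast
        then have "T (orth_proj ?K l) \<in> ?G" unfolding sp using cvs.span_mono[of "T ` B" "?F \<union> T ` B"] by blast
        then have "T (l - orth_proj ?K l) + T (orth_proj ?K l) \<in> ?G" using 1 by (intro cvs.span_add)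
        then show "y \<in> ?G" using l(2) by (simp add: blinfun.diff_right)
      qed
      have "B \<subseteq> L" using B(2) cvs.span_superset by blast
      then show "?G \<subseteq> T ` L"
        using csubspace_image[OF lin] h(1) by (intro cvs.span_minimal) (auto simp: hsub_def)
    qed
    have "ssum (arnold L S) Hminus = ?Q -` ?G"
    proof (intro equalityI subsetI)
      fix x assume "x \<in> ssum (arnold L S) Hminus"
      then obtain a y where "a \<in> arnold L S" "y \<in> Hminus" "x = a + y" unfolding ssum_def by blast
      moreover from this obtain l where "l \<in> L" "a = A l" unfolding arnold_iff A by blast
      ultimately have "?Q x = T l" by (simp add: T blinfun.add_right orth_proj_corth[OF hsub_Hminus, of y])
      then show "x \<in> ?Q -` ?G" using TL \<open>l \<in> L\<close> by blast
    next
      fix x assume "x \<in> ?Q -` ?G"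
      then obtain l where l: "l \<in> L" "?Q x = T l" using TL by blast
      then have "?Q (x - A l) = 0" by (simp add: T blinfun.diff_right)
      then have "x - A l \<in> Hminus" using orth_proj_eq_0_iff[OF hsub_corth] corth_corth[OF hsub_Hminus] by blast
      moreover have "A l \<in> arnold L S" unfolding arnold_iff A using l(1) by blast
      moreover have "x = A l + (x - A l)" by simp
      ultimately show "x \<in> ssum (arnold L S) Hminus" unfolding ssum_def by blast
    qed
    moreover have "closed (?Q -` ?G)"
      using G by (intro continuous_closed_vimage) (auto simp: hsub_def intro!: continuous_intros)
    ultimately have "closed (ssum (arnold L S) Hminus)" by simp
    then show ?thesis using arnold_Lag[OF Lag S(2)] fin by (simp add: Lagminus_def ssum_def)
  qed
  moreover have "min \<delta>1 (c / 2) > 0" using lp c(1) by (simp add: local_param_def)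
  ultimately show ?thesis by blast
qed

subsection \<open>Tangent vectors\<close>

lemma has_vector_derivative_scaled:
  fixes \<tau> :: "real \<Rightarrow> 'a::real_normed_vector"
  assumes "isCont \<tau> 0" shows "((\<lambda>t. t *\<^sub>R \<tau> t) has_vector_derivative \<tau> 0) (at 0)"
proof -
  have "bounded_bilinear (\<lambda>(a::'a) (r::real). r *\<^sub>R a)"
    by (rule bounded_bilinear.flip[OF bounded_bilinear_scaleR])
  from has_derivative_bilinear_zero[OF this assms has_derivative_ident]
  show ?thesis by (simp add: has_vector_derivative_def)
qed

lemma velocity_quotient:
  fixes \<sigma> :: "real \<Rightarrow> 'a::real_normed_vector"
  assumes "(\<sigma> has_vector_derivative A) (at 0)" "\<sigma> 0 = 0"
  shows "(\<lambda>t. (1 / t) *\<^sub>R \<sigma> t) \<midarrow>0\<rightarrow> A"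
proof -
  have "(\<lambda>h. norm (\<sigma> (0 + h) - \<sigma> 0 - h *\<^sub>R A) / norm h) \<midarrow>0\<rightarrow> 0"
    using assms(1) unfolding has_vector_derivative_def has_derivative_at by blast
  then have "(\<lambda>h. norm ((1 / h) *\<^sub>R \<sigma> h - A)) \<midarrow>0\<rightarrow> 0"
  proof (rule Lim_transform_within[where d = 1])
    show "(0::real) < 1" by simp
    fix h :: real assume "0 < dist h 0"
    then have "h \<noteq> 0" by simp
    then have "(1 / h) *\<^sub>R \<sigma> h - A = (1 / h) *\<^sub>R (\<sigma> h - h *\<^sub>R A)" by (simp add: scaleR_diff_right)
    then show "norm (\<sigma> (0 + h) - \<sigma> 0 - h *\<^sub>R A) / norm h = norm ((1 / h) *\<^sub>R \<sigma> h - A)"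
      by (simp add: assms(2))
  qed
  then show ?thesis by (simp only: tendsto_norm_zero_iff LIM_zero_iff)
qed

lemma closed_Sym_op:
  assumes L: "hsub L" shows "closed (Sym_op L)"
proof -
  have ev: "continuous_on UNIV (\<lambda>A::'a \<Rightarrow>\<^sub>L 'a. blinfun_apply A x)" for x
    by (intro linear_continuous_on blinfun.bounded_linear_left)
  have c1: "closed {A::'a \<Rightarrow>\<^sub>L 'a. A (c *\<^sub>C x) = c *\<^sub>C A x}" for c x
    by (intro closed_Collect_eq ev bounded_linear.continuous_on[OF bounded_linear_scaleC])
  have c2: "closed {A::'a \<Rightarrow>\<^sub>L 'a. A x \<in> L}" for x
    using continuous_closed_vimage[of L "\<lambda>A::'a \<Rightarrow>\<^sub>L 'a. blinfun_apply A x"] L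
    by (auto simp: hsub_def vimage_def continuous_on_eq_continuous_at[OF open_UNIV, symmetric] ev
      intro!: linear_continuous_at blinfun.bounded_linear_left)
  have c3: "closed {A::'a \<Rightarrow>\<^sub>L 'a. x \<in> corth L \<longrightarrow> A x = 0}" for x
    by (cases "x \<in> corth L") (auto intro!: closed_Collect_eq ev continuous_on_const)
  have c4: "closed {A::'a \<Rightarrow>\<^sub>L 'a. adj A = A}"
    by (intro closed_Collect_eq linear_continuous_on bounded_linear_adj continuous_on_id)
  have "Sym_op L = {A. \<forall>c x. blinfun_apply A (c *\<^sub>C x) = c *\<^sub>C blinfun_apply A x} \<inter> {A. \<forall>x. blinfun_apply A x \<in> L} \<inter>
      {A. \<forall>x. x \<in> corth L \<longrightarrow> blinfun_apply A x = 0} \<inter> {A. adj A = A}"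
    using Sym_opD[of _ L] by (auto simp: clin_def intro!: Sym_opI)
  also have "closed \<dots>" by (intro closed_Int closed_Collect_all c1 c2 c3 c4)
  finally show ?thesis .
qed

lemma velocity_in_Sym_op:
  assumes "hsub L" "velocity L \<gamma> A" shows "A \<in> Sym_op L"
proof -
  obtain \<epsilon> \<sigma> where \<sigma>: "\<epsilon> > 0" "\<forall>t\<in>{-\<epsilon><..<\<epsilon>}. \<sigma> t \<in> Sym_op L" "\<sigma> 0 = 0" "(\<sigma> has_vector_derivative A) (at 0)"
    using assms(2) by (auto simp: velocity_def)
  show ?thesis
  proof (rule Lim_in_closed_set[OF closed_Sym_op[OF assms(1)] _ _ velocity_quotient[OF \<sigma>(4,3)]])
    have "\<forall>\<^sub>F t in at 0. t \<in> {-\<epsilon><..<\<epsilon>}" using \<sigma>(1) by (intro eventually_at_in_open') auto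
    then show "\<forall>\<^sub>F t in at 0. (1 / t) *\<^sub>R \<sigma> t \<in> Sym_op L"
      by (rule eventually_mono) (use \<sigma>(2) subspace_scale[OF subspace_Sym_op] assms(1) hsub_def in blast)
  qed simp
qed

section \<open>The tangent space of \<open>LagW W k\<close> and its complement at one point\<close>

context
  fixes W :: "('h::complex_hilbert_space \<times> 'h) set" and k :: nat and L
  assumes W: "cvs.subspace W" "closed W" "W \<subseteq> Hminus" "cfinite_codim_in W Hminus"
    and L: "L \<in> LagW W k"
begin

private lemma Lm: "L \<in> Lagminus" "L \<in> Lag" "cvs.dim (L \<inter> W) = k"
  using L by (auto simp: LagW_def Lagminus_def)

private lemma hs: "hsub L" "hsub (L \<inter> W)" "hsub (L \<inter> omega_compl W)" "L \<inter> W \<subseteq> L \<inter> omega_compl W"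
  using LagD(1)[OF Lm(2)] flagD[OF flag_W[OF W Lm(1)]] by auto

lemma tangent_space_LagW_subset:
  assumes "A \<in> tangent_space (LagW W k) L"
  shows "A \<in> Sym_op L" "v \<in> L \<inter> W \<Longrightarrow> u \<in> L \<inter> omega_compl W \<Longrightarrow> cinner (A v) u = 0"
proof -
  obtain \<gamma> \<epsilon>' where \<gamma>: "velocity L \<gamma> A" "\<epsilon>' > 0" "\<And>t. t \<in> {-\<epsilon>'<..<\<epsilon>'} \<Longrightarrow> \<gamma> t \<in> LagW W k"
    using assms by (auto simp: tangent_space_def)
  show A: "A \<in> Sym_op L" using velocity_in_Sym_op[OF hs(1) \<gamma>(1)] .
  assume v: "v \<in> L \<inter> W" and u: "u \<in> L \<inter> omega_compl W"
  obtain \<epsilon> \<sigma> where \<sigma>: "\<epsilon> > 0" "smooth_on {-\<epsilon><..<\<epsilon>} \<sigma>"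
    "\<And>t. t \<in> {-\<epsilon><..<\<epsilon>} \<Longrightarrow> \<sigma> t \<in> Sym_op L \<and> \<gamma> t = arnold L (\<sigma> t)" "\<sigma> 0 = 0" "(\<sigma> has_vector_derivative A) (at 0)"
    using \<gamma>(1) by (auto simp: velocity_def)
  obtain \<delta> \<phi> where lp: "local_param L W \<delta> \<phi>"
    using local_param_exists[OF Lm(2) transv_W[OF W Lm(1)]] by blast
  have \<sigma>c: "isCont \<sigma> 0" using has_vector_derivative_continuous[OF \<sigma>(5)] by simp
  have "isCont \<phi> 0"
    using smooth_on_continuous[OF local_paramD(2)[OF lp]] local_paramD(1)[OF lp]
    by (simp add: continuous_on_eq_continuous_at)
  then have "(\<lambda>t. \<phi> (\<sigma> t)) \<midarrow>0\<rightarrow> \<phi> (\<sigma> 0)"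
    using \<sigma>c \<sigma>(4) isCont_o2 isContD by metis
  then have lim1: "(\<lambda>t. \<phi> (\<sigma> t) v) \<midarrow>0\<rightarrow> \<phi> 0 v"
    unfolding \<sigma>(4) by (intro tendsto_intros)
  have \<phi>0: "\<phi> 0 v = v" by (rule local_paramD(3)[OF lp v])
  \<comment> \<open>\<open>\<sigma> t\<close> divided by \<open>t\<close> tends to \<open>A\<close>
    and the moving vector \<open>\<phi> (\<sigma> t) v\<close> tends to \<open>v\<close>, so
    continuity of \<open>\<phi>\<close> is enough.\<close>
  have lim2: "(\<lambda>t. cinner u (((1 / t) *\<^sub>R \<sigma> t) (\<phi> (\<sigma> t) v))) \<midarrow>0\<rightarrow> cinner u (A v)"
    using lim1 unfolding \<phi>0
    by (intro bounded_linear.tendsto[OF bounded_linear_cinner_right] blinfun.tendsto velocity_quotient[OF \<sigma>(5,4)])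
  have ev: "\<forall>\<^sub>F t in at 0. cinner u (((1 / t) *\<^sub>R \<sigma> t) (\<phi> (\<sigma> t) v)) = 0"
  proof -
    have "\<forall>\<^sub>F t in at 0. \<sigma> t \<in> ball 0 \<delta>"
      using isContD[OF \<sigma>c] local_paramD(1)[OF lp] unfolding \<sigma>(4) by (intro topological_tendstoD) auto
    moreover have "\<forall>\<^sub>F t in at 0. t \<in> {-\<epsilon><..<\<epsilon>}" using \<sigma>(1) by (intro eventually_at_in_open') auto
    moreover have "\<forall>\<^sub>F t in at 0. t \<in> {-\<epsilon>'<..<\<epsilon>'}" using \<gamma>(2) by (intro eventually_at_in_open') auto
    ultimately show ?thesis
    proof eventually_elim
      fix t assume t: "\<sigma> t \<in> ball 0 \<delta>" "t \<in> {-\<epsilon><..<\<epsilon>}" "t \<in> {-\<epsilon>'<..<\<epsilon>'}"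
      let ?y = "\<phi> (\<sigma> t) v"
      have St: "\<sigma> t \<in> Sym_op L" using \<sigma>(3) t by blast
      have "cvs.dim (arnold L (\<sigma> t) \<inter> W) = cvs.dim (L \<inter> W)"
        using \<gamma>(3)[OF t(3)] \<sigma>(3)[OF t(2)] Lm(3) by (simp add: LagW_def)
      then have im: "(\<lambda>v. \<phi> (\<sigma> t) v + Jmap (\<sigma> t (\<phi> (\<sigma> t) v))) ` (L \<inter> W) = arnold L (\<sigma> t) \<inter> W"
        and yL: "?y \<in> L" using param_atD(7,2)[OF local_paramD(4)[OF lp t(1) St]] by blast+
      then have w: "?y + Jmap (\<sigma> t ?y) \<in> W" using v by blast
      \<comment> \<open>The moving vector lies in \<open>W\<close>, so its \<open>J\<close>-image is
        orthogonal to \<open>u\<close>. The part coming from \<open>?y\<close> drops out because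
        \<open>L\<close> is lagrangian, and the term with \<open>\<sigma> t\<close> remains.\<close>
      have "0 = cinner u (Jmap (?y + Jmap (\<sigma> t ?y)))" using omega_complD[OF _ w, of u] u by simp
      also have "\<dots> = - cinner u (\<sigma> t ?y)"
        using LagD(5)[OF Lm(2), of u ?y] u yL by (simp add: Jmap_add cinner_add_right cinner_diff_right)
      finally show "cinner u (((1 / t) *\<^sub>R \<sigma> t) ?y) = 0"
        by (simp add: blinfun.scaleR_left scaleR_scaleC cinner_scaleC_right)
    qed
  qed
  have "(\<lambda>t::real. 0) \<midarrow>0\<rightarrow> cinner u (A v)" using lim2 tendsto_cong[OF ev] by blast
  then have "cinner u (A v) = 0" using LIM_unique[OF _ tendsto_const] by blast
  then show "cinner (A v) u = 0" by (simp add: cinner_eq_0_commute)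
qed

text \<open>The straight line \<open>t A\<close> leaves \<open>LagW W k\<close> to second order.  The operator \<open>B\<close> below is chosen such that
  \<open>v + t (B v + J A v)\<close> stays in \<open>W\<close> for \<open>v \<in> L \<inter> W\<close>, and \<open>\<sigma> t\<close> is the form whose graph contains these vectors.\<close>

lemma tangent_space_LagW_supset:
  assumes A: "A \<in> Sym_op L" and A0: "\<And>v u. v \<in> L \<inter> W \<Longrightarrow> u \<in> L \<inter> omega_compl W \<Longrightarrow> cinner (A v) u = 0"
  shows "A \<in> tangent_space (LagW W k) L"
proof -
  let ?V = "L \<inter> W" and ?Z = "L \<inter> omega_compl W"
  let ?P = "orth_proj ?V"
  \<comment> \<open>\<open>A0\<close> says that \<open>J A v\<close> is orthogonal to the
    \<open>J\<close>-image of \<open>?Z\<close>, hence a sum of a vector of \<open>L\<close> and one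
    of \<open>W\<close>. Up to sign, \<open>g v\<close> is the first of these; its component in
    \<open>?V\<close> is removed so that \<open>B\<close> below squares to zero.\<close>
  have "\<exists>g. g \<in> L \<inter> corth ?V \<and> Jmap (A v) + g \<in> W" if "v \<in> ?V" for v
  proof -
    have "cinner (Jmap z) (Jmap (A v)) = 0" if "z \<in> ?Z" for z
      using A0[OF \<open>v \<in> ?V\<close> that] by (simp add: cinner_Jmap_Jmap cinner_eq_0_commute)
    then have "Jmap (A v) \<in> corth (Jmap ` ?Z)" by (auto simp: corth_def)
    then obtain l w where lw: "l \<in> L" "w \<in> W" "Jmap (A v) = l + w"
      unfolding corth_Jmap_Int_omega[OF W Lm(1)] ssum_def by blast
    have d: "l - ?P l \<in> L \<inter> corth ?V" using orth_decomp_in[OF hs(2,1) _ lw(1)] by blast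
    have "?P l \<in> W" using orth_proj_in[OF hs(2), of l] by blast
    then have "Jmap (A v) + - (l - ?P l) \<in> W" using lw hsub_add[OF hsub_W[OF W]] by simp
    then show ?thesis using d hsub_minus[OF hsub_Int[OF hs(1) hsub_corth]] by blast
  qed
  then obtain g where g: "\<And>v. v \<in> ?V \<Longrightarrow> g v \<in> L \<inter> corth ?V \<and> Jmap (A v) + g v \<in> W" by metis
  obtain Bs where Bs: "finite Bs" "cvs.independent Bs" "Bs \<subseteq> ?V" "cvs.span Bs = ?V"
    using cfinite_dimE flagD[OF flag_W[OF W Lm(1)]] by metis
  obtain B where B: "clin B" "\<forall>b\<in>Bs. B b = g b" "\<forall>x\<in>corth ?V. B x = 0" "\<forall>x. B x \<in> cvs.span (g ` Bs)"
    using finite_rank_extension[OF Bs(1,2), of g] Bs(4) by auto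
  have BM: "B x \<in> L \<inter> corth ?V" for x
  proof -
    have "g ` Bs \<subseteq> L \<inter> corth ?V" using g Bs(3) by blast
    then have "cvs.span (g ` Bs) \<subseteq> L \<inter> corth ?V"
      using hsub_Int[OF hs(1) hsub_corth] by (intro cvs.span_minimal) (auto simp: hsub_def)
    then show ?thesis using B(4) by blast
  qed
  have linA: "clin A" and adjA: "adj A = A" using Sym_opD[OF A] by auto
  have BW: "Jmap (A v) + B v \<in> W" if "v \<in> ?V" for v
  proof -
    define D where "D = (J_op o\<^sub>L A) + B"
    have D: "D x = Jmap (A x) + B x" for x by (simp add: D_def blinfun.add_left)
    have lD: "clin D" unfolding D_def using linA B(1) by (intro clin_intros clin_J_op)
    have "D b \<in> W" if "b \<in> Bs" for b
      using g[OF subsetD[OF Bs(3) that]] bspec[OF B(2) that] by (simp add: D)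
    then have "D ` Bs \<subseteq> W" by blast
    then have "cvs.span (D ` Bs) \<subseteq> W" using W(1) cvs.span_minimal by blast
    then have "D ` ?V \<subseteq> W" using cvp.linear_span_image[OF clin_linear[OF lD], of Bs] Bs(4) by simp
    then show ?thesis using that D by (metis imageI subsetD)
  qed
  have BP: "B (?P x) = B x" for x
    using B(3) orth_proj_diff_in[OF hs(2), of x] by (metis blinfun.diff_right eq_iff_diff_eq_0)
  have PB: "?P (B x) = 0" for x using BM[of x] hs(2) by simp
  have BB: "B (B x) = 0" for x using BP[of "B x"] PB by simp
  let ?Bt = "adj B"
  have BtV: "?Bt x \<in> ?V" for x
  proof -
    have "cinner y (?Bt x) = 0" if "y \<in> corth ?V" for y using B(3) that by (simp add: cinner_adj[OF B(1), symmetric])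
    then have "?Bt x \<in> corth (corth ?V)" by (simp add: corth_def)
    then show ?thesis using corth_corth[OF hs(2)] by blast
  qed
  have BtBt: "?Bt (?Bt x) = 0" for x
  proof (rule cinner_ext)
    fix z show "cinner z (?Bt (?Bt x)) = cinner z 0" by (simp add: cinner_adj[OF B(1), symmetric] BB)
  qed
  \<comment> \<open>\<open>W\<close> is isotropic and contains the vectors
    \<open>J A v + B v\<close>. The resulting symmetry is what makes \<open>C\<close> below
    self-adjoint.\<close>
  have sym: "cinner (A v) (B v') = cinner (B v) (A v')" if "v \<in> ?V" "v' \<in> ?V" for v v'
  proof -
    have "0 = cinner (Jmap (A v) + B v) (Jmap (Jmap (A v') + B v'))"
      using BW that W(3) Hminus_isotropic by (metis subsetD)
    also have "\<dots> = cinner (A v) (B v') - cinner (B v) (A v')"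
      using LagD(5)[OF Lm(2), of "A v" "A v'"] LagD(5)[OF Lm(2), of "B v" "B v'"] BM Sym_opD(2)[OF A]
      by (simp add: Jmap_add cinner_bilin cinner_Jmap Jmap_minus)
    finally show ?thesis by simp
  qed
  \<comment> \<open>Chosen so that \<open>A + t C\<close> agrees with \<open>(1 + t adj B) A\<close>
    on \<open>?V\<close>. As \<open>B\<close> and \<open>adj B\<close> square to zero, the outer
    factors of \<open>\<tau>\<close> invert \<open>1 + t B\<close> and \<open>1 + t adj B\<close>,
    whence \<open>\<sigma> t\<close> maps \<open>v + t B v\<close> to \<open>t A v\<close>.\<close>
  define C where "C = ?Bt o\<^sub>L (A o\<^sub>L ?P)"
  have C: "C x = ?Bt (A (?P x))" for x by (simp add: C_def)
  have linC: "clin C" unfolding C_def using B(1) linA hs(2) by (intro clin_intros clin_adj clin_orth_proj)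
  have adjC: "adj C = C"
  proof (rule adj_eqI_cinner)
    fix x y
    have "cinner (C x) y = cinner (A (?P x)) (B (?P y))" by (simp add: C cinner_adj_left[OF B(1)] BP)
    also have "\<dots> = cinner (B (?P x)) (A (?P y))" by (rule sym[OF orth_proj_in[OF hs(2)] orth_proj_in[OF hs(2)]])
    also have "\<dots> = cinner x (C y)" by (simp add: C cinner_adj[OF B(1)] BP)
    finally show "cinner (C x) y = cinner x (C y)" .
  qed
  define \<tau> where "\<tau> t = (id_blinfun - t *\<^sub>R ?Bt) o\<^sub>L ((A + t *\<^sub>R C) o\<^sub>L (id_blinfun - t *\<^sub>R B))" for t :: real
  define \<sigma> where "\<sigma> t = t *\<^sub>R \<tau> t" for t :: real
  have smt: "smooth_on UNIV \<tau>" unfolding \<tau>_def by (intro smooth_intros)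
  have sm: "smooth_on UNIV \<sigma>" unfolding \<sigma>_def using smt by (intro smooth_intros)
  have "isCont \<tau> 0" using smooth_on_continuous[OF smt] by (simp add: continuous_on_eq_continuous_at)
  then have der: "(\<sigma> has_vector_derivative A) (at 0)"
    using has_vector_derivative_scaled[of \<tau>] unfolding \<sigma>_def[abs_def] by (simp add: \<tau>_def[of 0])
  have adj_diff: "adj (X - Y) = adj X - adj Y" for X Y :: "('h \<times> 'h) \<Rightarrow>\<^sub>L ('h \<times> 'h)"
    by (rule linear_diff[OF bounded_linear.linear[OF bounded_linear_adj]])
  have Sym: "\<sigma> t \<in> Sym_op L" for t
  proof (rule Sym_opI)
    show "clin (\<sigma> t)" unfolding \<sigma>_def \<tau>_def using B(1) linA linC by (intro clin_intros clin_adj)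
    have app: "\<sigma> t x = t *\<^sub>R ((A y + t *\<^sub>R C y) - t *\<^sub>R ?Bt (A y + t *\<^sub>R C y))" if "y = x - t *\<^sub>R B x" for x y
      unfolding that by (simp add: \<sigma>_def \<tau>_def blinfun.add_left blinfun.diff_left blinfun.scaleR_left)
    show "\<sigma> t x \<in> L" for x
    proof -
      have "?Bt y \<in> L" for y using BtV by blast
      then have c: "C y \<in> L" "?Bt y \<in> L" "A y \<in> L" for y using Sym_opD(2)[OF A] by (simp_all add: C)
      show ?thesis unfolding app[OF refl]
        by (intro hsub_scaleR[OF hs(1)] hsub_add[OF hs(1)] hsub_diff[OF hs(1)] c)
    qed
    show "\<sigma> t x = 0" if "x \<in> corth L" for x
    proof -
      have "x \<in> corth ?V" using that corth_antimono[of ?V L] by blast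
      then have "B x = 0" "A x = 0" "C x = 0" using B(3) Sym_opD(3)[OF A that] hs(2) by (auto simp: C)
      then show ?thesis unfolding app[OF refl] by simp
    qed
    show "adj (\<sigma> t) = \<sigma> t"
      unfolding \<sigma>_def \<tau>_def adj_scaleR adj_compose adj_diff adj_add adj_id adj_adj adjA adjC blinfun_compose_assoc ..
  qed
  have inW: "(v + t *\<^sub>R B v) + Jmap (\<sigma> t (v + t *\<^sub>R B v)) \<in> W" if "v \<in> ?V" for v t
  proof -
    have "\<sigma> t (v + t *\<^sub>R B v) = t *\<^sub>R A v"
    proof -
      have 1: "(id_blinfun - t *\<^sub>R B) (v + t *\<^sub>R B v) = v"
        by (simp add: blinfun.diff_left blinfun.scaleR_left blinfun.add_right blinfun.scaleR_right BB)
      have "C v = ?Bt (A v)" using that hs(2) by (simp add: C)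
      then have 2: "(A + t *\<^sub>R C) v = A v + t *\<^sub>R ?Bt (A v)" by (simp add: blinfun.add_left blinfun.scaleR_left)
      show ?thesis unfolding \<sigma>_def \<tau>_def
        by (simp add: 1 2 blinfun.scaleR_left) (simp add: blinfun.diff_left blinfun.scaleR_left blinfun.add_right
            blinfun.scaleR_right BtBt)
    qed
    then have eq: "(v + t *\<^sub>R B v) + Jmap (\<sigma> t (v + t *\<^sub>R B v)) = v + t *\<^sub>R (Jmap (A v) + B v)"
      by (simp add: Jmap_scaleR scaleR_add_right algebra_simps)
    show ?thesis unfolding eq
      by (rule hsub_add[OF hsub_W[OF W] _ hsub_scaleR[OF hsub_W[OF W] BW[OF that]]]) (use that in blast)
  qed
  obtain \<delta>1 \<phi> where lp: "local_param L W \<delta>1 \<phi>" using local_param_exists[OF Lm(2) transv_W[OF W Lm(1)]] by blast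
  obtain \<delta>2 where \<delta>2: "\<delta>2 > 0" "\<And>S. S \<in> ball 0 \<delta>2 \<Longrightarrow> S \<in> Sym_op L \<Longrightarrow> arnold L S \<in> Lagminus"
    using Lagminus_open[OF Lm(1)] by blast
  \<comment> \<open>The explicit vectors show that the intersection with \<open>W\<close> does not
    shrink, \<open>local_param\<close> that it does not grow, and \<open>Lagminus_open\<close> keeps
    the curve in \<open>Lagminus\<close>.\<close>
  have dim: "arnold L (\<sigma> t) \<in> LagW W k" if t: "\<sigma> t \<in> ball 0 \<delta>1" "\<sigma> t \<in> ball 0 \<delta>2" for t
  proof -
    define \<Theta> where "\<Theta> = (id_blinfun + (J_op o\<^sub>L \<sigma> t)) o\<^sub>L (id_blinfun + t *\<^sub>R B)"
    have \<Theta>: "\<Theta> v = (v + t *\<^sub>R B v) + Jmap (\<sigma> t (v + t *\<^sub>R B v))" for v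
      by (simp add: \<Theta>_def blinfun.add_left blinfun.scaleR_left)
    have lin: "clin \<Theta>" unfolding \<Theta>_def using Sym_opD(1)[OF Sym] B(1) by (intro clin_intros clin_J_op)
    have vL: "v + t *\<^sub>R B v \<in> L" if "v \<in> ?V" for v
      using that BM[of v] hsub_add[OF hs(1)] hsub_scaleR[OF hs(1)] by blast
    have sub: "\<Theta> ` ?V \<subseteq> arnold L (\<sigma> t) \<inter> W"
    proof
      fix x assume "x \<in> \<Theta> ` ?V"
      then obtain v where v: "v \<in> ?V" "x = \<Theta> v" by blast
      show "x \<in> arnold L (\<sigma> t) \<inter> W" 
        unfolding v(2) \<Theta> Int_iff arnold_iff using inW[OF v(1), of t] vL[OF v(1)] by blast
    qed
    have inj: "inj_on \<Theta> ?V"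
    proof (rule inj_on_inverseI[of _ "\<lambda>x. ?P (orth_proj L x)"])
      fix v assume v: "v \<in> ?V"
      have "orth_proj L (\<Theta> v) = v + t *\<^sub>R B v" unfolding \<Theta> by (rule orth_proj_arnold[OF Lm(2) Sym vL[OF v]])
      then show "?P (orth_proj L (\<Theta> v)) = v" using v hs(2) PB by (simp add: blinfun.add_right blinfun.scaleR_right)
    qed
    have fl: "cfinite_dim ?V" "cvs.subspace ?V" using flagD[OF flag_W[OF W Lm(1)]] by auto
    have s: "cvs.subspace (arnold L (\<sigma> t) \<inter> W)"
      using csubspace_arnold LagD(2)[OF Lm(2)] Sym_opD(1)[OF Sym] W(1) cvs.subspace_inter by blast
    have up: "cfinite_dim (arnold L (\<sigma> t) \<inter> W)" "cvs.dim (arnold L (\<sigma> t) \<inter> W) \<le> cvs.dim ?V"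
      using param_atD(5,6)[OF local_paramD(4)[OF lp t(1) Sym]] .
    have "cvs.dim ?V \<le> cvs.dim (arnold L (\<sigma> t) \<inter> W)"
      using cdim_le[OF up(1) s sub] cdim_image_eq[OF lin fl inj] by simp
    then show ?thesis using up(2) \<delta>2(2)[OF t(2) Sym] Lm(3) by (simp add: LagW_def)
  qed
  have "\<sigma> 0 = 0" by (simp add: \<sigma>_def)
  then have "velocity L (\<lambda>t. arnold L (\<sigma> t)) A"
    unfolding velocity_def using smooth_on_subset[OF sm subset_UNIV] Sym der
    by (intro exI[of _ "1::real"] conjI exI[of _ \<sigma>] ballI) simp_all
  moreover have "\<exists>\<epsilon>>0. \<forall>t\<in>{-\<epsilon><..<\<epsilon>}. arnold L (\<sigma> t) \<in> LagW W k"
  proof -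
    have "isCont \<sigma> 0" using has_vector_derivative_continuous[OF der] by simp
    moreover have "min \<delta>1 \<delta>2 > 0" using lp \<delta>2 by (simp add: local_param_def)
    ultimately obtain \<epsilon> where e: "\<epsilon> > 0" "\<And>t. dist t 0 < \<epsilon> \<Longrightarrow> dist (\<sigma> t) (\<sigma> 0) < min \<delta>1 \<delta>2"
      unfolding continuous_at_eps_delta by blast
    have "arnold L (\<sigma> t) \<in> LagW W k" if "t \<in> {-\<epsilon><..<\<epsilon>}" for t
      using e(2)[of t] that by (intro dim) (auto simp: \<sigma>_def dist_norm abs_less_iff)
    then show ?thesis using e(1) by blast
  qed
  ultimately show ?thesis unfolding tangent_space_def by blast
qed

lemma compl_fibre_eq: "compl_fibre W L = flag_ops (L \<inter> W) (L \<inter> omega_compl W)"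
  unfolding compl_fibre_def ell_def
  by (rule block_ops_eq_flag_ops[OF hs(1) flag_W[OF W Lm(1)]]) blast

lemma orth_decomp_LagW: "is_orth_decomp3 L (ell W L) (L \<inter> W) (Lam W L)"
proof -
  let ?V = "L \<inter> W" and ?Z = "L \<inter> omega_compl W"
  have s: "cvs.subspace (ell W L)" "cvs.subspace (Lam W L)" "cvs.subspace ?V"
    using hsub_Int[OF hs(3) hsub_corth, of ?V] hsub_Int[OF hs(1) hsub_corth, of ?Z] hs(2)
    by (auto simp: ell_def Lam_def hsub_def)
  have "ell W L \<subseteq> corth ?V" by (auto simp: ell_def)
  moreover have "ell W L \<subseteq> corth (Lam W L)" "?V \<subseteq> corth (Lam W L)"
    using subset_corth_commute[of "Lam W L" ?Z] hs(4) by (auto simp: ell_def Lam_def)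
  moreover have "L = {a + b + c | a b c. a \<in> ell W L \<and> b \<in> ?V \<and> c \<in> Lam W L}"
  proof (intro equalityI subsetI)
    fix x assume x: "x \<in> L"
    let ?z = "orth_proj ?Z x"
    have z: "?z \<in> ?Z" by (rule orth_proj_in[OF hs(3)])
    have "?z - orth_proj ?V ?z \<in> ell W L" unfolding ell_def using orth_decomp_in[OF hs(2,3,4) z] by blast
    moreover have "x - ?z \<in> Lam W L" unfolding Lam_def using orth_decomp_in[OF hs(3,1) _ x] by blast
    moreover have "x = (?z - orth_proj ?V ?z) + orth_proj ?V ?z + (x - ?z)" by simp
    ultimately show "x \<in> {a + b + c | a b c. a \<in> ell W L \<and> b \<in> ?V \<and> c \<in> Lam W L}"
      using orth_proj_in[OF hs(2), of ?z] by blast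
  next
    fix x assume "x \<in> {a + b + c | a b c. a \<in> ell W L \<and> b \<in> ?V \<and> c \<in> Lam W L}"
    then obtain a b c where "a \<in> L" "b \<in> L" "c \<in> L" "x = a + b + c" unfolding ell_def Lam_def by blast
    then show "x \<in> L" using hsub_add[OF hs(1)] by blast
  qed
  ultimately show ?thesis unfolding is_orth_decomp3_def using s by blast
qed

text \<open>Tangent vectors are the self-adjoint operators whose blocks from \<open>?V\<close> to
  \<open>?Z\<close> vanish; the fibre consists of the operators that have only these blocks and
  their adjoints.\<close>

lemma algebraic_complement_LagW:
  "algebraic_complement (Sym_op L) (tangent_space (LagW W k) L) (compl_fibre W L)"
proof -
  let ?V = "L \<inter> W" and ?Z = "L \<inter> omega_compl W" and ?T = "tangent_space (LagW W k) L"
  let ?P = "orth_proj ?V" and ?R = "orth_proj ?Z"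
  have T: "A \<in> ?T \<longleftrightarrow> A \<in> Sym_op L \<and> (\<forall>v\<in>?V. \<forall>u\<in>?Z. cinner (A v) u = 0)" for A
  proof (intro iffI)
    assume "A \<in> ?T"
    then show "A \<in> Sym_op L \<and> (\<forall>v\<in>?V. \<forall>u\<in>?Z. cinner (A v) u = 0)"
      using tangent_space_LagW_subset[of A] by (intro conjI ballI)
  next
    assume "A \<in> Sym_op L \<and> (\<forall>v\<in>?V. \<forall>u\<in>?Z. cinner (A v) u = 0)"
    then show "A \<in> ?T" by (intro tangent_space_LagW_supset) (elim conjE; simp)+
  qed
  have fl: "flag ?V ?Z" by (rule flag_W[OF W Lm(1)])
  have sS: "subspace (Sym_op L)" using subspace_Sym_op LagD(2)[OF Lm(2)] by blast
  have sT: "subspace ?T"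
    unfolding subspace_def
  proof (intro conjI ballI allI)
    show "0 \<in> ?T" unfolding T using subspace_0[OF sS] by simp
    fix A B r assume A: "A \<in> ?T" and B: "B \<in> ?T"
    show "A + B \<in> ?T" unfolding T
      using A B subspace_add[OF sS, of A B] unfolding T by (simp add: blinfun.add_left cinner_add_left)
    show "r *\<^sub>R A \<in> ?T" unfolding T
      using A subspace_scale[OF sS, of A r] unfolding T by (simp add: blinfun.scaleR_left scaleR_scaleC cinner_scaleC_left)
  qed
  have sC: "subspace (compl_fibre W L)" unfolding compl_fibre_eq by (rule subspace_flag_ops[OF fl])
  have CS: "compl_fibre W L \<subseteq> Sym_op L" by (auto simp: compl_fibre_def)
  have int: "A = 0" if A: "A \<in> ?T" "A \<in> compl_fibre W L" for A
  proof -
    have AF: "A \<in> flag_ops ?V ?Z" using A(2) compl_fibre_eq by simp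
    have lin: "clin A" and adjA: "adj A = A" using AF by (auto simp: flag_ops_def)
    have AV: "A v = 0" if "v \<in> ?V" for v
    proof -
      have "cinner (A v) (A v) = 0" using A(1) that flag_ops_range[OF fl AF, of v] unfolding T by blast
      then show ?thesis by simp
    qed
    have AVo: "A x = 0" if "x \<in> corth ?V" for x
    proof -
      have "A x \<in> ?V" using AF that by (simp add: flag_ops_def)
      then have "A (A x) = 0" by (rule AV)
      then have "cinner (A x) (A x) = 0" using cinner_adj[OF lin, of x "A x"] adjA by simp
      then show ?thesis by simp
    qed
    have "A x = 0" for x
    proof -
      have "A x = A (?P x) + A (x - ?P x)" by (simp add: blinfun.diff_right)
      also have "\<dots> = 0 + 0"
        by (intro arg_cong2[where f = "(+)"] AV AVo orth_proj_in[OF hs(2)] orth_proj_diff_in[OF hs(2)])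
      finally show ?thesis by simp
    qed
    then show "A = 0" by (intro blinfun_eqI) simp
  qed
  have sum: "\<exists>e g. A = e + g \<and> e \<in> ?T \<and> g \<in> compl_fibre W L" if A: "A \<in> Sym_op L" for A
  proof -
    \<comment> \<open>The rows and columns of \<open>A\<close> through \<open>?V\<close>, restricted
      to \<open>?Z\<close>. The block of \<open>?V\<close> with itself occurs in both products,
      hence the subtraction.\<close>
    define g where "g = (?P o\<^sub>L (A o\<^sub>L ?R)) + (?R o\<^sub>L (A o\<^sub>L ?P)) - (?P o\<^sub>L (A o\<^sub>L ?P))"
    have g: "g x = ?P (A (?R x)) + ?R (A (?P x)) - ?P (A (?P x))" for x
      by (simp add: g_def blinfun.add_left blinfun.diff_left)
    have lin: "clin A" and adjA: "adj A = A" using Sym_opD[OF A] by auto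
    have "clin g" unfolding g_def using lin hs by (intro clin_intros clin_orth_proj)
    moreover have "adj g = g"
      unfolding g_def linear_diff[OF bounded_linear.linear[OF bounded_linear_adj]] adj_add adj_compose
        adj_orth_proj[OF hs(2)] adj_orth_proj[OF hs(3)] adjA blinfun_compose_assoc
      by (simp add: add.commute)
    moreover have "g x \<in> ?V" if "x \<in> corth ?V" for x
      using that hs(2) orth_proj_in[OF hs(2)] by (simp add: g del: Int_iff)
    moreover have "g x = 0" if "x \<in> corth ?Z" for x
      using that hs corth_antimono[OF hs(4)] by (auto simp: g)
    ultimately have gF: "g \<in> flag_ops ?V ?Z" by (simp add: flag_ops_def)
    then have gC: "g \<in> compl_fibre W L" by (simp add: compl_fibre_eq)
    then have gS: "g \<in> Sym_op L" using CS by blast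
    have "cinner ((A - g) v) u = 0" if vu: "v \<in> ?V" "u \<in> ?Z" for v u
    proof -
      have "?P v = v" "?R v = v" using vu hs by auto
      then have "g v = ?R (A v)" by (simp add: g)
      then have "(A - g) v = A v - ?R (A v)" by (simp add: blinfun.diff_left)
      then show ?thesis using corthD'[OF orth_proj_diff_in[OF hs(3)] vu(2)] by simp
    qed
    then have "A - g \<in> ?T" unfolding T using subspace_diff[OF sS A gS] by blast
    then show ?thesis using gC by (intro exI[of _ "A - g"] exI[of _ g]) simp
  qed
  have "Sym_op L = {e + g | e g. e \<in> ?T \<and> g \<in> compl_fibre W L}"
  proof (intro equalityI subsetI)
    fix A assume "A \<in> {e + g | e g. e \<in> ?T \<and> g \<in> compl_fibre W L}"
    then obtain e g where "e \<in> ?T" "g \<in> compl_fibre W L" "A = e + g" by blast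
    then show "A \<in> Sym_op L" using subspace_add[OF sS, of e g] CS unfolding T by blast
  qed (use sum in blast)
  moreover have "?T \<inter> compl_fibre W L = {0}"
    using int subspace_0[OF sT] subspace_0[OF sC] by blast
  ultimately show ?thesis unfolding algebraic_complement_def using sS sT sC by blast
qed

end

subsection \<open>The differential of an Arnold chart\<close>

text \<open>The chart is injective, so the curves representing \<open>\<gamma>\<close> in it agree
  near 0. This makes the description in \<open>arnold_deriv\<close> unambiguous.\<close>

lemma velocity_unique:
  assumes L: "L \<in> Lag" and v: "velocity L \<gamma> A" "velocity L \<gamma> B"
  shows "A = B"
proof -
  obtain \<epsilon>1 \<sigma>1 where 1: "\<epsilon>1 > 0" "\<forall>t\<in>{-\<epsilon>1<..<\<epsilon>1}. \<sigma>1 t \<in> Sym_op L \<and> \<gamma> t = arnold L (\<sigma>1 t)"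
    "(\<sigma>1 has_vector_derivative A) (at 0)" using v(1) unfolding velocity_def by blast
  obtain \<epsilon>2 \<sigma>2 where 2: "\<epsilon>2 > 0" "\<forall>t\<in>{-\<epsilon>2<..<\<epsilon>2}. \<sigma>2 t \<in> Sym_op L \<and> \<gamma> t = arnold L (\<sigma>2 t)"
    "(\<sigma>2 has_vector_derivative B) (at 0)" using v(2) unfolding velocity_def by blast
  let ?\<epsilon> = "min \<epsilon>1 \<epsilon>2"
  have "\<sigma>1 t = \<sigma>2 t" if "t \<in> {-?\<epsilon><..<?\<epsilon>}" for t
    using bspec[OF 1(2), of t] bspec[OF 2(2), of t] that arnold_inj[OF L, of "\<sigma>1 t" "\<sigma>2 t"] by auto
  then have "(\<sigma>2 has_vector_derivative A) (at 0)"
    using 1(1) 2(1) by (intro has_vector_derivative_transform_within_open[OF 1(3), of "{-?\<epsilon><..<?\<epsilon>}"]) auto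
  then show ?thesis using vector_derivative_unique_at 2(3) by blast
qed

text \<open>For \<open>x = v + J S v\<close> one has \<open>v + J (S + t T) v = x + t J T x = x' + J (t P T P x)\<close> with
  \<open>x' = x + t P J T x\<close>, where \<open>P\<close> projects onto \<open>arnold L S\<close>.\<close>

lemma arnold_velocity:
  assumes L: "L \<in> Lag" and S: "S \<in> Sym_op L" and T: "T \<in> Sym_op L"
  shows "velocity (arnold L S) (\<lambda>t. arnold L (S + t *\<^sub>R T)) (congr (orth_proj (arnold L S)) T)"
proof -
  define N where "N = arnold L S"
  have NL: "N \<in> Lag" unfolding N_def by (rule arnold_Lag[OF L S])
  have hN: "hsub N" using LagD(1)[OF NL] .
  have hL: "hsub L" using LagD(1)[OF L] .
  let ?P = "orth_proj N"
  define G where "G = ?P o\<^sub>L (J_op o\<^sub>L (T o\<^sub>L ?P))"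
  have G: "G x = ?P (Jmap (T (?P x)))" for x by (simp add: G_def)
  define F where "F t = id_blinfun + t *\<^sub>R G" for t :: real
  have F: "F t x = x + t *\<^sub>R G x" for t x by (simp add: F_def blinfun.add_left blinfun.scaleR_left)
  \<comment> \<open>It keeps \<open>t G\<close> below norm 1/2, so that \<open>F t\<close> is
    coercive with constant 1/2; the summand 1 covers \<open>G = 0\<close>.\<close>
  define \<epsilon> where "\<epsilon> = 1 / (2 * (norm G + 1))"
  have \<epsilon>: "\<epsilon> > 0" by (auto simp: \<epsilon>_def intro!: divide_pos_pos add_nonneg_pos)
  have co: "1 / 2 * (norm x)\<^sup>2 \<le> inner (F t x) x" if t: "t \<in> {-\<epsilon><..<\<epsilon>}" for t x
  proof -
    have "\<bar>inner (G x) x\<bar> \<le> norm (G x) * norm x" by (rule Cauchy_Schwarz_ineq2)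
    also have "\<dots> \<le> (norm G * norm x) * norm x" by (intro mult_right_mono norm_blinfun) auto
    finally have "\<bar>inner (G x) x\<bar> \<le> norm G * (norm x)\<^sup>2" by (simp add: power2_eq_square)
    then have "\<bar>t\<bar> * \<bar>inner (G x) x\<bar> \<le> \<epsilon> * (norm G * (norm x)\<^sup>2)"
      using t \<epsilon> by (intro mult_mono) auto
    also have "\<dots> = (\<epsilon> * norm G) * (norm x)\<^sup>2" by simp
    also have "\<dots> \<le> 1 / 2 * (norm x)\<^sup>2"
    proof (rule mult_right_mono)
      have "norm G + 1 > 0" by (intro add_nonneg_pos) auto
      then show "\<epsilon> * norm G \<le> 1 / 2" by (simp add: \<epsilon>_def field_simps)
    qed simp
    finally have "\<bar>t * inner (G x) x\<bar> \<le> 1 / 2 * (norm x)\<^sup>2" by (simp add: abs_mult)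
    then show ?thesis by (simp add: F inner_add_left power2_norm_eq_inner)
  qed
  define R where "R t = (SOME B. F t o\<^sub>L B = id_blinfun \<and> B o\<^sub>L F t = id_blinfun \<and> norm B \<le> 1 / (1 / 2))" for t
  have R: "F t o\<^sub>L R t = id_blinfun \<and> R t o\<^sub>L F t = id_blinfun \<and> norm (R t) \<le> 1 / (1 / 2)" if "t \<in> {-\<epsilon><..<\<epsilon>}" for t
    unfolding R_def by (rule someI_ex[OF lax_milgram_bound[OF _ co[OF that]]]) simp
  have FR: "F t (R t y) = y" "R t (F t y) = y" if "t \<in> {-\<epsilon><..<\<epsilon>}" for t y
    using arg_cong[OF R[OF that, THEN conjunct1], of "\<lambda>T. blinfun_apply T y"]
      arg_cong[OF R[OF that, THEN conjunct2, THEN conjunct1], of "\<lambda>T. blinfun_apply T y"] by auto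
  have smF: "smooth_on {-\<epsilon><..<\<epsilon>} F" unfolding F_def by (intro smooth_intros)
  have smR: "smooth_on {-\<epsilon><..<\<epsilon>} R"
    by (rule smooth_on_inverse[OF open_greaterThanLessThan _ _ smF]) (use R in blast)+
  define E where "E = congr ?P T"
  have E: "E x = ?P (T (?P x))" for x using hN by (simp add: E_def)
  define \<sigma> where "\<sigma> t = t *\<^sub>R (E o\<^sub>L R t)" for t
  have \<sigma>: "\<sigma> t x = t *\<^sub>R E (R t x)" for t x by (simp add: \<sigma>_def blinfun.scaleR_left)
  have sm\<sigma>: "smooth_on {-\<epsilon><..<\<epsilon>} \<sigma>" unfolding \<sigma>_def by (intro smooth_intros smR)
  have ST: "S + t *\<^sub>R T \<in> Sym_op L" for t
    using subspace_add[OF subspace_Sym_op S subspace_scale[OF subspace_Sym_op T]] LagD(2)[OF L] by blast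
  have point: "x \<in> N \<and> F t x \<in> N \<and> F t x + Jmap (t *\<^sub>R E x) = v + Jmap ((S + t *\<^sub>R T) v)"
    if "v \<in> L" "x = v + Jmap (S v)" for v x t
  proof (intro conjI)
    show x: "x \<in> N" unfolding N_def arnold_iff using that by blast
    then show "F t x \<in> N" unfolding F G using hN by (intro hsub_add[OF hN] hsub_scaleR[OF hN] orth_proj_in)
    have "T x = T v"
      using Sym_opD(3)[OF T LagD(6)[OF L Sym_opD(2)[OF S, of v]]] by (simp add: that(2) blinfun.add_right)
    moreover have "?P x = x" using x hN by simp
    ultimately have "F t x + Jmap (t *\<^sub>R E x) = x + t *\<^sub>R (?P (Jmap (T v)) + Jmap (?P (T v)))"
      by (simp add: F G E Jmap_scaleR scaleR_add_right)
    also have "\<dots> = x + t *\<^sub>R Jmap (T v)" using orth_proj_Lag_Jmap[OF NL, of "T v"] by simp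
    finally show "F t x + Jmap (t *\<^sub>R E x) = v + Jmap ((S + t *\<^sub>R T) v)"
      by (simp add: that(2) blinfun.add_left blinfun.scaleR_left Jmap_add Jmap_scaleR)
  qed
  have RN: "R t y \<in> N" if "t \<in> {-\<epsilon><..<\<epsilon>}" "y \<in> N" for t y
  proof -
    have "R t y = y - t *\<^sub>R G (R t y)" using FR(1)[OF that(1), of y] by (simp add: F algebra_simps)
    moreover have "y - t *\<^sub>R G (R t y) \<in> N"
      unfolding G by (intro hsub_diff[OF hN] that(2) hsub_scaleR[OF hN] orth_proj_in[OF hN])
    ultimately show ?thesis by simp
  qed
  have onN: "y + Jmap (\<sigma> t y) \<in> arnold L (S + t *\<^sub>R T)" if t: "t \<in> {-\<epsilon><..<\<epsilon>}" and y: "y \<in> N" for t y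
  proof -
    obtain v where v: "v \<in> L" "R t y = v + Jmap (S v)" using RN[OF t y] unfolding N_def arnold_iff by blast
    have "y + Jmap (\<sigma> t y) = v + Jmap ((S + t *\<^sub>R T) v)"
      using point[OF v, of t] FR(1)[OF t, of y] by (simp add: \<sigma>)
    then show ?thesis unfolding arnold_iff using v(1) by blast
  qed
  have Sym: "\<sigma> t \<in> Sym_op N" if t: "t \<in> {-\<epsilon><..<\<epsilon>}" for t
  proof (rule Sym_opI)
    have linT: "clin T" using Sym_opD(1)[OF T] .
    have linF: "clin (F t)" unfolding F_def G_def using linT hN by (intro clin_intros clin_orth_proj clin_J_op)
    then have "clin (R t)" using R[OF t] clin_inverse by blast
    then show lin\<sigma>: "clin (\<sigma> t)" unfolding \<sigma>_def E_def congr_def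
      using linT hN by (intro clin_intros clin_orth_proj clin_adj)
    show r\<sigma>: "\<sigma> t x \<in> N" for x unfolding \<sigma> E by (intro hsub_scaleR[OF hN] orth_proj_in[OF hN])
    show z\<sigma>: "\<sigma> t x = 0" if "x \<in> corth N" for x
    proof -
      have "?P x = 0" using that hN by simp
      then have "F t x = x" "E x = 0" by (simp_all add: F G E)
      then have "R t x = x" using FR(2)[OF t, of x] by simp
      then show ?thesis using \<open>E x = 0\<close> by (simp add: \<sigma>)
    qed
    \<comment> \<open>Symmetry is not computed from the formula for \<open>\<sigma>\<close>: it is
      the isotropy of \<open>arnold L (S + t *\<^sub>R T)\<close>, which contains the graph of
      \<open>\<sigma> t\<close> over \<open>N\<close>.\<close>
    have symN: "cinner (\<sigma> t x) y = cinner x (\<sigma> t y)" if "x \<in> N" "y \<in> N" for x y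
    proof -
      have "0 = cinner (x + Jmap (\<sigma> t x)) (Jmap (y + Jmap (\<sigma> t y)))"
        using LagD(5)[OF arnold_Lag[OF L ST] onN[OF t that(1)] onN[OF t that(2)]] by simp
      also have "\<dots> = cinner (\<sigma> t x) y - cinner x (\<sigma> t y)"
        using LagD(5)[OF NL that] LagD(5)[OF NL r\<sigma> r\<sigma>, of x y]
        by (simp add: Jmap_add cinner_bilin cinner_Jmap)
      finally show ?thesis by simp
    qed
    have \<sigma>P: "\<sigma> t (?P x) = \<sigma> t x" for x
      using z\<sigma>[OF orth_proj_diff_in[OF hN], of x] by (simp add: blinfun.diff_right)
    show "adj (\<sigma> t) = \<sigma> t"
    proof (rule adj_eqI_cinner)
      fix x y
      have "cinner (\<sigma> t x) y = cinner (?P (\<sigma> t x)) y" using r\<sigma> hN by simp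
      also have "\<dots> = cinner (\<sigma> t (?P x)) (?P y)" unfolding cinner_orth_proj[OF hN] \<sigma>P ..
      also have "\<dots> = cinner (?P x) (\<sigma> t (?P y))" by (rule symN[OF orth_proj_in[OF hN] orth_proj_in[OF hN]])
      also have "\<dots> = cinner x (?P (\<sigma> t y))" unfolding cinner_orth_proj[OF hN] \<sigma>P ..
      also have "\<dots> = cinner x (\<sigma> t y)" using r\<sigma> hN by simp
      finally show "cinner (\<sigma> t x) y = cinner x (\<sigma> t y)" .
    qed
  qed
  \<comment> \<open>Both sides are lagrangian, so one inclusion suffices.\<close>
  have curve: "arnold L (S + t *\<^sub>R T) = arnold N (\<sigma> t)" if t: "t \<in> {-\<epsilon><..<\<epsilon>}" for t
  proof (rule Lag_subset_eq[OF arnold_Lag[OF L ST] arnold_Lag[OF NL Sym[OF t]]])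
    show "arnold L (S + t *\<^sub>R T) \<subseteq> arnold N (\<sigma> t)"
    proof
      fix y assume "y \<in> arnold L (S + t *\<^sub>R T)"
      then obtain v where v: "v \<in> L" "y = v + Jmap ((S + t *\<^sub>R T) v)" unfolding arnold_iff by blast
      define x where "x = v + Jmap (S v)"
      have p: "F t x \<in> N" "F t x + Jmap (t *\<^sub>R E x) = y" using point[OF v(1) x_def, of t] v(2) by auto
      have "\<sigma> t (F t x) = t *\<^sub>R E x" using FR(2)[OF t] by (simp add: \<sigma>)
      then show "y \<in> arnold N (\<sigma> t)" unfolding arnold_iff using p by (intro bexI[of _ "F t x"]) simp_all
    qed
  qed
  have "isCont (\<lambda>t. E o\<^sub>L R t) 0"
    using smooth_on_continuous[OF smooth_on_compose[OF smooth_on_const[of _ E] smR]] \<epsilon>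
    by (simp add: continuous_on_eq_continuous_at)
  moreover have "R 0 = id_blinfun"
  proof -
    have "R 0 o\<^sub>L F 0 = id_blinfun" using R[of 0] \<epsilon> by simp
    then show ?thesis by (simp add: F_def)
  qed
  ultimately have "(\<sigma> has_vector_derivative E) (at 0)"
    using has_vector_derivative_scaled[of "\<lambda>t. E o\<^sub>L R t"] unfolding \<sigma>_def[abs_def] by simp
  moreover have "\<sigma> 0 = 0" by (simp add: \<sigma>_def)
  ultimately have "velocity N (\<lambda>t. arnold L (S + t *\<^sub>R T)) E"
    unfolding velocity_def using \<epsilon> sm\<sigma> Sym curve by (intro exI[of _ \<epsilon>] conjI exI[of _ \<sigma>] ballI) simp_all
  then show ?thesis by (simp add: N_def E_def)
qed

lemma arnold_deriv_eq:
  assumes "L \<in> Lag" "S \<in> Sym_op L" "T \<in> Sym_op L"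
  shows "arnold_deriv L S T = congr (orth_proj (arnold L S)) T"
  unfolding arnold_deriv_def
proof (rule the_equality)
  show "velocity (arnold L S) (\<lambda>t. arnold L (S + t *\<^sub>R T)) (congr (orth_proj (arnold L S)) T)"
    by (rule arnold_velocity[OF assms])
  then show "A = congr (orth_proj (arnold L S)) T"
    if "velocity (arnold L S) (\<lambda>t. arnold L (S + t *\<^sub>R T)) A" for A
    using velocity_unique[OF arnold_Lag[OF assms(1,2)] that] by blast
qed

text \<open>The difference \<open>S (S y) - J S y\<close> is the \<open>J\<close>-image of the graph
  point over \<open>- S y\<close>, hence orthogonal to the graph. The graph point over
  \<open>y\<close> thus has the preimage \<open>(1 + S S) y\<close> inside \<open>L\<close>, which
  \<open>adapted_frame\<close> uses to write frames in the chart.\<close>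

lemma orth_proj_arnold_graph:
  assumes L: "L \<in> Lag" and S: "S \<in> Sym_op L" and y: "y \<in> L"
  shows "orth_proj (arnold L S) (y + S (S y)) = y + Jmap (S y)"
proof (rule orth_proj_eqI)
  have N: "arnold L S \<in> Lag" by (rule arnold_Lag[OF L S])
  show "hsub (arnold L S)" by (rule LagD(1)[OF N])
  show "y + Jmap (S y) \<in> arnold L S" unfolding arnold_iff using y by blast
  have "- S y + Jmap (S (- S y)) \<in> arnold L S"
    unfolding arnold_iff using hsub_minus[OF LagD(1)[OF L] Sym_opD(2)[OF S]] by blast
  then have "Jmap (- S y + Jmap (S (- S y))) \<in> corth (arnold L S)" by (rule LagD(6)[OF N])
  then show "y + S (S y) - (y + Jmap (S y)) \<in> corth (arnold L S)"
    by (simp add: Jmap_add Jmap_diff Jmap_minus blinfun.minus_right)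
qed

subsection \<open>Local frames and orientations of the complement\<close>

context
  fixes W :: "('h::complex_hilbert_space \<times> 'h) set" and k :: nat
  assumes W: "cvs.subspace W" "closed W" "W \<subseteq> Hminus" "cfinite_codim_in W Hminus"
begin

private abbreviation (input) "V L \<equiv> L \<inter> W"
private abbreviation (input) "Z L \<equiv> L \<inter> omega_compl W"

lemma LagW_flag: "L \<in> LagW W k \<Longrightarrow> flag (V L) (Z L)"
  by (rule flag_W[OF W]) (simp add: LagW_def)

lemma LagW_dims:
  assumes "L \<in> LagW W k" "L' \<in> LagW W k"
  shows "cvs.dim (V L) = cvs.dim (V L')" "cvs.dim (Z L) = cvs.dim (Z L')"
proof -
  have Lm: "L \<in> Lagminus" "L' \<in> Lagminus" using assms by (auto simp: LagW_def)
  show 1: "cvs.dim (V L) = cvs.dim (V L')" using assms by (simp add: LagW_def)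
  have "2 * cvs.dim (Z L \<inter> corth (V L)) = 2 * cvs.dim (Z L' \<inter> corth (V L'))"
    unfolding two_dim_ell[OF W Lm(1)] two_dim_ell[OF W Lm(2)] ..
  then show "cvs.dim (Z L) = cvs.dim (Z L')"
    using 1 flag_dim[OF LagW_flag[OF assms(1)]] flag_dim[OF LagW_flag[OF assms(2)]] by simp
qed

text \<open>The parametrisation for \<open>omega_compl W\<close> need not send
  \<open>L \<inter> W\<close> into \<open>W\<close>, so it is used only on the orthogonal complement
  of \<open>L \<inter> W\<close> and glued to the one for \<open>W\<close>. Injectivity holds near 0
  because \<open>\<phi> 0\<close> is the identity on \<open>Z L\<close> and \<open>\<phi> S\<close>
  stays within distance 1 of it.\<close>

lemma local_flag_iso:
  assumes L: "L \<in> LagW W k"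
  shows "\<exists>\<delta>>0. \<exists>\<phi>. smooth_on (ball 0 \<delta>) \<phi> \<and> (\<forall>S\<in>ball 0 \<delta> \<inter> Sym_op L. clin (\<phi> S) \<and> (\<forall>x. \<phi> S x \<in> L) \<and>
    (arnold L S \<in> LagW W k \<longrightarrow>
       flag_iso ((id_blinfun + (J_op o\<^sub>L S)) o\<^sub>L \<phi> S) (V L) (Z L) (V (arnold L S)) (Z (arnold L S))))"
proof -
  have Lm: "L \<in> Lagminus" "L \<in> Lag" using L by (auto simp: LagW_def Lagminus_def)
  have fl: "flag (V L) (Z L)" by (rule LagW_flag[OF L])
  have h: "hsub (V L)" "hsub (Z L)" "V L \<subseteq> Z L" "hsub L" using flagD[OF fl] LagD(1)[OF Lm(2)] by auto
  let ?l = "Z L \<inter> corth (V L)"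
  have hl: "hsub ?l" using h hsub_Int by blast
  have pl: "orth_proj ?l x = orth_proj (Z L) x - orth_proj (V L) x" for x
    by (rule orth_proj_Int_corth[OF h(1-3)])
  obtain \<delta>1 \<phi>1 where p1: "local_param L W \<delta>1 \<phi>1" using local_param_exists[OF Lm(2) transv_W[OF W Lm(1)]] by blast
  obtain \<delta>2 \<phi>2 where p2: "local_param L (omega_compl W) \<delta>2 \<phi>2"
    using local_param_exists[OF Lm(2) transv_omega[OF W Lm(1)]] by blast
  define \<phi> where "\<phi> S = (\<phi>1 S o\<^sub>L orth_proj (V L)) + (\<phi>2 S o\<^sub>L orth_proj ?l)" for S
  have \<phi>: "\<phi> S x = \<phi>1 S (orth_proj (V L) x) + \<phi>2 S (orth_proj ?l x)" for S x
    by (simp add: \<phi>_def blinfun.add_left)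
  define \<delta>0 where "\<delta>0 = min \<delta>1 \<delta>2"
  have d0: "\<delta>0 > 0" "ball (0 :: ('h \<times> 'h) \<Rightarrow>\<^sub>L ('h \<times> 'h)) \<delta>0 \<subseteq> ball 0 \<delta>1"
    "ball (0 :: ('h \<times> 'h) \<Rightarrow>\<^sub>L ('h \<times> 'h)) \<delta>0 \<subseteq> ball 0 \<delta>2"
    using local_paramD(1)[OF p1] local_paramD(1)[OF p2] by (auto simp: \<delta>0_def)
  have sm: "smooth_on (ball 0 \<delta>0) \<phi>" unfolding \<phi>_def
    by (intro smooth_intros smooth_on_subset[OF local_paramD(2)[OF p1] d0(2)]
        smooth_on_subset[OF local_paramD(2)[OF p2] d0(3)])
  have \<phi>0: "\<phi> 0 z = z" if z: "z \<in> Z L" for z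
  proof -
    have "orth_proj ?l z \<in> Z L" using orth_proj_in[OF hl, of z] by blast
    then have "\<phi> 0 z = orth_proj (V L) z + orth_proj ?l z"
      unfolding \<phi> by (simp only: local_paramD(3)[OF p1 orth_proj_in[OF h(1)]] local_paramD(3)[OF p2])
    then show ?thesis using z h(2) by (simp add: pl)
  qed
  have "isCont \<phi> 0" using smooth_on_continuous[OF sm] d0(1) by (simp add: continuous_on_eq_continuous_at)
  then have "\<exists>\<epsilon>>0. \<forall>S. dist S 0 < \<epsilon> \<longrightarrow> dist (\<phi> S) (\<phi> 0) < 1"
    unfolding continuous_at_eps_delta by (elim allE[of _ 1]) simp
  then obtain \<epsilon> where \<epsilon>: "\<epsilon> > 0" "\<And>S. dist S 0 < \<epsilon> \<Longrightarrow> dist (\<phi> S) (\<phi> 0) < 1" by blast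
  define \<delta> where "\<delta> = min \<delta>0 \<epsilon>"
  have d: "\<delta> > 0" "ball (0 :: ('h \<times> 'h) \<Rightarrow>\<^sub>L ('h \<times> 'h)) \<delta> \<subseteq> ball 0 \<delta>0" using d0(1) \<epsilon>(1) by (auto simp: \<delta>_def)
  have "\<forall>S\<in>ball 0 \<delta> \<inter> Sym_op L. clin (\<phi> S) \<and> (\<forall>x. \<phi> S x \<in> L) \<and> (arnold L S \<in> LagW W k \<longrightarrow>
       flag_iso ((id_blinfun + (J_op o\<^sub>L S)) o\<^sub>L \<phi> S) (V L) (Z L) (V (arnold L S)) (Z (arnold L S)))"
  proof (rule ballI)
    fix S assume S: "S \<in> ball 0 \<delta> \<inter> Sym_op L"
    have Sy: "S \<in> Sym_op L" and S12: "S \<in> ball 0 \<delta>1" "S \<in> ball 0 \<delta>2" using S d(2) d0(2,3) by blast+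
    have "dist S 0 < \<epsilon>" using S by (simp add: \<delta>_def dist_commute)
    then have nd: "norm (\<phi> S - \<phi> 0) < 1" using \<epsilon>(2)[of S] by (simp add: dist_norm)
    have a1: "param_at L W S (\<phi>1 S)" by (rule local_paramD(4)[OF p1 S12(1) Sy])
    have a2: "param_at L (omega_compl W) S (\<phi>2 S)" by (rule local_paramD(4)[OF p2 S12(2) Sy])
    have lin: "clin (\<phi> S)" unfolding \<phi>_def using param_atD(1)[OF a1] param_atD(1)[OF a2] h hl
      by (intro clin_intros clin_orth_proj)
    have rng: "\<phi> S x \<in> L" for x
      unfolding \<phi> using hsub_add[OF h(4)] param_atD(2)[OF a1] param_atD(2)[OF a2] by blast
    define \<Phi> where "\<Phi> = (id_blinfun + (J_op o\<^sub>L S)) o\<^sub>L \<phi> S"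
    have \<Phi>: "\<Phi> x = \<phi> S x + Jmap (S (\<phi> S x))" for x by (simp add: \<Phi>_def blinfun.add_left)
    have "flag_iso \<Phi> (V L) (Z L) (V (arnold L S)) (Z (arnold L S))" if N: "arnold L S \<in> LagW W k"
    proof -
      let ?N = "arnold L S"
      have fN: "flag (V ?N) (Z ?N)" by (rule LagW_flag[OF N])
      note dims = LagW_dims[OF N L]
      have im1: "\<phi>1 S v + Jmap (S (\<phi>1 S v)) \<in> V ?N" if "v \<in> V L" for v
        using param_atD(7)[OF a1 dims(1)] that by blast
      have im2: "\<phi>2 S v + Jmap (S (\<phi>2 S v)) \<in> Z ?N" if "v \<in> Z L" for v
        using param_atD(7)[OF a2 dims(2)] that by blast
      have "flag_map \<Phi> (V L) (Z L) (V ?N) (Z ?N)"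
        unfolding flag_map_def
      proof (intro conjI ballI)
        show "clin \<Phi>" unfolding \<Phi>_def using lin Sym_opD(1)[OF Sy] by (intro clin_compose clin_add clin_id clin_J_op)
        show "\<Phi> x \<in> V ?N" if x: "x \<in> V L" for x
        proof -
          have "orth_proj (V L) x = x" "orth_proj ?l x = 0"
            unfolding pl using orth_proj_id[OF h(1) x] orth_proj_id[OF h(2) subsetD[OF h(3) x]] by simp_all
          then have "\<phi> S x = \<phi>1 S x" by (simp add: \<phi>)
          then show ?thesis using im1[OF x] by (simp only: \<Phi>)
        qed
        show "\<Phi> x \<in> Z ?N" if x: "x \<in> Z L" for x
        proof -
          let ?v = "orth_proj (V L) x" and ?y = "orth_proj ?l x"
          have "?y \<in> Z L" using orth_proj_in[OF hl, of x] by blast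
          then have "\<phi>2 S ?y + Jmap (S (\<phi>2 S ?y)) \<in> Z ?N" by (rule im2)
          moreover have "\<phi>1 S ?v + Jmap (S (\<phi>1 S ?v)) \<in> Z ?N"
            using im1[OF orth_proj_in[OF h(1)], of x] flagD(3)[OF fN] by blast
          moreover have "\<Phi> x = (\<phi>1 S ?v + Jmap (S (\<phi>1 S ?v))) + (\<phi>2 S ?y + Jmap (S (\<phi>2 S ?y)))"
            unfolding \<Phi> \<phi> by (simp add: blinfun.add_right Jmap_add)
          ultimately show ?thesis using hsub_add[OF flagD(2)[OF fN]] by (simp only:)
        qed
        show "\<Phi> x = 0" if x: "x \<in> corth (Z L)" for x
        proof -
          have "orth_proj (V L) x = 0" "orth_proj (Z L) x = 0"
            using x h corth_antimono[OF h(3)] by (auto intro!: orth_proj_0)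
          then have "\<phi> S x = 0" by (simp add: \<phi> pl)
          then show ?thesis by (simp add: \<Phi>)
        qed
      qed
      moreover have "x = 0" if x: "x \<in> Z L" "\<Phi> x = 0" for x
      proof -
        have "\<phi> S x = 0" using orth_proj_arnold[OF Lm(2) Sy rng, of x] x(2) by (simp add: \<Phi>)
        then have "norm x = norm ((\<phi> S - \<phi> 0) x)" using \<phi>0[OF x(1)] by (simp add: blinfun.diff_left)
        also have "\<dots> \<le> norm (\<phi> S - \<phi> 0) * norm x" by (rule norm_blinfun)
        finally have "norm x \<le> norm (\<phi> S - \<phi> 0) * norm x" .
        then show ?thesis using nd mult_strict_right_mono[OF nd, of "norm x"] by (cases "x = 0") auto
      qed
      ultimately show ?thesis by (intro flag_map_inj_imp_iso fl fN dims)
    qed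
    then show "clin (\<phi> S) \<and> (\<forall>x. \<phi> S x \<in> L) \<and> (arnold L S \<in> LagW W k \<longrightarrow>
       flag_iso ((id_blinfun + (J_op o\<^sub>L S)) o\<^sub>L \<phi> S) (V L) (Z L) (V (arnold L S)) (Z (arnold L S)))"
      using lin rng by (simp add: \<Phi>_def)
  qed
  then show ?thesis using d(1) smooth_on_subset[OF sm d(2)] by (intro exI[of _ \<delta>] conjI exI[of _ \<phi>])
qed

text \<open>The wanted frame is the congruence of \<open>bs\<close> by
  \<open>(1 + J S) \<phi> S\<close>, which has values at \<open>arnold L S\<close>. By
  \<open>orth_proj_arnold_graph\<close> this map is the projection onto \<open>arnold L S\<close>
  after \<open>\<Xi> S = (1 + S S) \<phi> S\<close>, and congruence by that projection is
  \<open>arnold_deriv\<close>. So the sections in the chart are the congruences by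
  \<open>\<Xi> S\<close>, which stay in \<open>Sym_op L\<close> and depend smoothly on
  \<open>S\<close>.\<close>

lemma adapted_frame:
  assumes L: "L \<in> LagW W k" and bs: "ordered_basis (flag_ops (V L) (Z L)) bs"
  shows "\<exists>U ss. local_frame (LagW W k) (compl_fibre W) L U ss \<and> length ss = length bs \<and>
    (\<forall>S\<in>U \<inter> Sym_op L. arnold L S \<in> LagW W k \<longrightarrow>
       (\<exists>\<Phi>. flag_iso \<Phi> (V L) (Z L) (V (arnold L S)) (Z (arnold L S)) \<and> frame_at L ss S = map (congr \<Phi>) bs))"
proof -
  have Lag: "L \<in> Lag" using L by (auto simp: LagW_def Lagminus_def)
  have hL: "hsub L" using LagD(1)[OF Lag] .
  have fl: "flag (V L) (Z L)" by (rule LagW_flag[OF L])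
  obtain \<delta> \<phi> where \<delta>: "\<delta> > 0" and sm: "smooth_on (ball 0 \<delta>) \<phi>"
    and \<phi>: "\<forall>S\<in>ball 0 \<delta> \<inter> Sym_op L. clin (\<phi> S) \<and> (\<forall>x. blinfun_apply (\<phi> S) x \<in> L) \<and> (arnold L S \<in> LagW W k \<longrightarrow>
       flag_iso ((id_blinfun + (J_op o\<^sub>L S)) o\<^sub>L \<phi> S) (V L) (Z L) (V (arnold L S)) (Z (arnold L S)))"
    using local_flag_iso[OF L] by (elim exE conjE) (rule that)
  define \<Xi> where "\<Xi> S = (id_blinfun + (S o\<^sub>L S)) o\<^sub>L \<phi> S" for S
  have \<Xi>: "\<Xi> S x = \<phi> S x + S (S (\<phi> S x))" for S x by (simp add: \<Xi>_def blinfun.add_left)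
  define ss where "ss = map (\<lambda>b S. congr (\<Xi> S) b) bs"
  let ?U = "ball (0 :: ('h \<times> 'h) \<Rightarrow>\<^sub>L ('h \<times> 'h)) \<delta>"
  have sms: "smooth_on ?U (\<lambda>S. congr (\<Xi> S) b)" for b
    unfolding congr_def \<Xi>_def by (intro smooth_intros sm)
  have Sym: "congr (\<Xi> S) b \<in> Sym_op L" if S: "S \<in> ?U \<inter> Sym_op L" and b: "b \<in> set bs" for S b
  proof -
    have bF: "b \<in> flag_ops (V L) (Z L)" using ordered_basis_subset[OF bs] b by blast
    have Sy: "S \<in> Sym_op L" using S by blast
    have p: "clin (\<phi> S)" "\<And>x. \<phi> S x \<in> L" using bspec[OF \<phi> S] by blast+
    have lin: "clin (\<Xi> S)" unfolding \<Xi>_def using p(1) Sym_opD(1)[OF Sy] by (intro clin_compose clin_add clin_id)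
    have rng: "\<Xi> S x \<in> L" for x unfolding \<Xi> using hsub_add[OF hL p(2) Sym_opD(2)[OF Sy]] by blast
    show ?thesis
    proof (rule Sym_opI)
      show "clin (congr (\<Xi> S) b)" unfolding congr_def using lin bF by (intro clin_compose clin_adj) (auto simp: flag_ops_def)
      show "congr (\<Xi> S) b x \<in> L" for x using rng by simp
      show "adj (congr (\<Xi> S) b) = congr (\<Xi> S) b" by (rule adj_congr) (use bF in \<open>simp add: flag_ops_def\<close>)
      fix x assume x: "x \<in> corth L"
      have "adj (\<Xi> S) x = 0"
      proof (rule cinner_ext)
        fix z show "cinner z (adj (\<Xi> S) x) = cinner z 0"
          using corthD[OF x rng[of z]] by (simp add: cinner_adj[OF lin, symmetric])
      qed
      then show "congr (\<Xi> S) b x = 0" by simp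
    qed
  qed
  have fr: "frame_at L ss S = map (congr ((id_blinfun + (J_op o\<^sub>L S)) o\<^sub>L \<phi> S)) bs" if S: "S \<in> ?U \<inter> Sym_op L" for S
  proof -
    have Sy: "S \<in> Sym_op L" using S by blast
    have p: "\<And>x. \<phi> S x \<in> L" using bspec[OF \<phi> S] by blast
    have comp: "orth_proj (arnold L S) o\<^sub>L \<Xi> S = (id_blinfun + (J_op o\<^sub>L S)) o\<^sub>L \<phi> S"
      by (rule blinfun_eqI) (simp add: \<Xi> orth_proj_arnold_graph[OF Lag Sy p] blinfun.add_left)
    have "arnold_deriv L S (congr (\<Xi> S) b) = congr ((id_blinfun + (J_op o\<^sub>L S)) o\<^sub>L \<phi> S) b" if "b \<in> set bs" for b
      unfolding arnold_deriv_eq[OF Lag Sy Sym[OF S that]] congr_compose[symmetric] comp ..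
    then show ?thesis by (simp add: frame_at_def ss_def)
  qed
  have main: "\<exists>\<Phi>. flag_iso \<Phi> (V L) (Z L) (V (arnold L S)) (Z (arnold L S)) \<and> frame_at L ss S = map (congr \<Phi>) bs"
    if "S \<in> ?U \<inter> Sym_op L" "arnold L S \<in> LagW W k" for S
    using bspec[OF \<phi> that(1)] that(2) fr[OF that(1)] by blast
  have "local_frame (LagW W k) (compl_fibre W) L ?U ss"
    unfolding local_frame_def
  proof (intro conjI ballI impI)
    show "open ?U" "0 \<in> ?U" using \<delta> by simp_all
    fix s assume "s \<in> set ss"
    then obtain b where b: "b \<in> set bs" "s = (\<lambda>S. congr (\<Xi> S) b)" by (auto simp: ss_def)
    show "smooth_on ?U s" unfolding b(2) by (rule sms)
    show "s S \<in> Sym_op L" if "S \<in> ?U \<inter> Sym_op L" for S unfolding b(2) by (rule Sym[OF that b(1)])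
  next
    fix S assume S: "S \<in> ?U \<inter> Sym_op L" "arnold L S \<in> LagW W k"
    obtain \<Phi> where \<Phi>: "flag_iso \<Phi> (V L) (Z L) (V (arnold L S)) (Z (arnold L S))" "frame_at L ss S = map (congr \<Phi>) bs"
      using main[OF S] by blast
    show "ordered_basis (compl_fibre W (arnold L S)) (frame_at L ss S)"
      unfolding compl_fibre_eq[OF W S(2)] \<Phi>(2) by (rule ordered_basis_congr[OF fl LagW_flag[OF S(2)] \<Phi>(1) bs])
  qed
  moreover have "length ss = length bs" by (simp add: ss_def)
  ultimately show ?thesis using main by blast
qed

text \<open>One basis at a fixed \<open>L0\<close> is transported to every other point by flag
  isomorphisms. This yields a single rank without any connectedness of the base.\<close>

lemma finite_rank_compl_fibre: "finite_rank_subbundle (LagW W k) (compl_fibre W)"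
  unfolding finite_rank_subbundle_def
proof
  show "\<forall>L\<in>LagW W k. subspace (compl_fibre W L) \<and> compl_fibre W L \<subseteq> Sym_op L"
  proof (intro ballI conjI)
    fix L assume L: "L \<in> LagW W k"
    show "subspace (compl_fibre W L)" unfolding compl_fibre_eq[OF W L] by (rule subspace_flag_ops[OF LagW_flag[OF L]])
    show "compl_fibre W L \<subseteq> Sym_op L" by (auto simp: compl_fibre_def)
  qed
  show "\<exists>n. \<forall>L\<in>LagW W k. \<exists>U ss. length ss = n \<and> local_frame (LagW W k) (compl_fibre W) L U ss"
  proof (cases "LagW W k = {}")
    case False
    then obtain L0 where L0: "L0 \<in> LagW W k" by blast
    obtain b0 where b0: "ordered_basis (flag_ops (V L0) (Z L0)) b0" using flag_ops_basis_exists[OF LagW_flag[OF L0]] by blast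
    show ?thesis
    proof (rule exI[of _ "length b0"], rule ballI)
      fix L assume L: "L \<in> LagW W k"
      obtain \<Psi> where "flag_iso \<Psi> (V L0) (Z L0) (V L) (Z L)"
        using flag_iso_exists[OF LagW_flag[OF L0] LagW_flag[OF L] LagW_dims[OF L0 L]] by blast
      then have "ordered_basis (flag_ops (V L) (Z L)) (map (congr \<Psi>) b0)"
        by (rule ordered_basis_congr[OF LagW_flag[OF L0] LagW_flag[OF L] _ b0])
      from adapted_frame[OF L this]
      show "\<exists>U ss. length ss = length b0 \<and> local_frame (LagW W k) (compl_fibre W) L U ss" by auto
    qed
  qed simp
qed

text \<open>The isomorphisms \<open>\<Psi> L\<close> are chosen independently of each other, with no
  continuity in \<open>L\<close>. Local consistency is still automatic, because at a nearby point
  the transport through \<open>L\<close> and the direct one are two isomorphisms of the same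
  flags.\<close>

lemma orientable_compl_fibre: "orientable_bundle (LagW W k) (compl_fibre W)"
proof (cases "LagW W k = {}")
  case True
  then show ?thesis by (simp add: orientable_bundle_def bundle_orientation_def)
next
  case False
  then obtain L0 where L0: "L0 \<in> LagW W k" by blast
  obtain b0 where b0: "ordered_basis (flag_ops (V L0) (Z L0)) b0" using flag_ops_basis_exists[OF LagW_flag[OF L0]] by blast
  define \<Psi> where "\<Psi> L = (SOME \<Psi>. flag_iso \<Psi> (V L0) (Z L0) (V L) (Z L))" for L
  have \<Psi>: "flag_iso (\<Psi> L) (V L0) (Z L0) (V L) (Z L)" if "L \<in> LagW W k" for L
    unfolding \<Psi>_def by (rule someI_ex[OF flag_iso_exists[OF LagW_flag[OF L0] LagW_flag[OF that] LagW_dims[OF L0 that]]])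
  define Or where "Or L = {cs. ordered_basis (compl_fibre W L) cs \<and> same_oriented (map (congr (\<Psi> L)) b0) cs}" for L
  have ob: "ordered_basis (flag_ops (V L) (Z L)) (map (congr (\<Psi> L)) b0)" if "L \<in> LagW W k" for L
    by (rule ordered_basis_congr[OF LagW_flag[OF L0] LagW_flag[OF that] \<Psi>[OF that] b0])
  have "bundle_orientation (LagW W k) (compl_fibre W) Or"
    unfolding bundle_orientation_def
  proof (intro conjI ballI)
    fix L assume L: "L \<in> LagW W k"
    show "is_orientation (compl_fibre W L) (Or L)"
      unfolding is_orientation_def Or_def compl_fibre_eq[OF W L] using ob[OF L] by blast
    obtain U ss where f: "local_frame (LagW W k) (compl_fibre W) L U ss"
      "\<forall>S\<in>U \<inter> Sym_op L. arnold L S \<in> LagW W k \<longrightarrow>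
       (\<exists>\<Phi>. flag_iso \<Phi> (V L) (Z L) (V (arnold L S)) (Z (arnold L S)) \<and>
          frame_at L ss S = map (congr \<Phi>) (map (congr (\<Psi> L)) b0))"
      using adapted_frame[OF L ob[OF L]] by blast
    have "frame_at L ss S \<in> Or (arnold L S)" if S: "S \<in> U \<inter> Sym_op L" "arnold L S \<in> LagW W k" for S
    proof -
      let ?N = "arnold L S"
      obtain \<Phi> where \<Phi>: "flag_iso \<Phi> (V L) (Z L) (V ?N) (Z ?N)"
        "frame_at L ss S = map (congr \<Phi>) (map (congr (\<Psi> L)) b0)" using f(2) S by blast
      have eq: "map (congr \<Phi>) (map (congr (\<Psi> L)) b0) = map (congr (\<Phi> o\<^sub>L \<Psi> L)) b0"
        by (simp add: congr_compose)
      have "same_oriented (map (congr (\<Psi> ?N)) b0) (frame_at L ss S)"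
        unfolding \<Phi>(2) eq
        by (rule same_oriented_congr[OF LagW_flag[OF L0] LagW_flag[OF S(2)] \<Psi>[OF S(2)]
              flag_iso_compose[OF \<Psi>[OF L] \<Phi>(1)] b0])
      moreover have "ordered_basis (compl_fibre W ?N) (frame_at L ss S)"
        using f(1) S unfolding local_frame_def by blast
      ultimately show ?thesis by (simp add: Or_def)
    qed
    then show "\<exists>U ss. local_frame (LagW W k) (compl_fibre W) L U ss \<and>
        (\<forall>S\<in>U \<inter> Sym_op L. arnold L S \<in> LagW W k \<longrightarrow> frame_at L ss S \<in> Or (arnold L S))" using f(1) by blast
  qed
  then show ?thesis unfolding orientable_bundle_def by blast
qed

text \<open>The defining list at \<open>L\<close> is transported by flag isomorphisms, and
  \<open>same_oriented_line_frames\<close> compares the result with any such list at the nearby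
  point. The case of \<open>orth_proj (Z L)\<close>, which acts as the identity, shows that the
  orientation does not depend on the complex basis \<open>Ts\<close>.\<close>

lemma natural_orientation_compl_fibre:
  assumes k: "k = 1"
  shows "bundle_orientation (LagW W k) (compl_fibre W) (natural_orientation W)"
proof -
  define nb where "nb L Ts = block_op 0 (orth_proj (V L)) # map (\<lambda>T. block_op T 0) (realify Ts)"
    for L :: "('h \<times> 'h) set" and Ts
  define cb where "cb L Ts \<longleftrightarrow> ordered_basis (Hom_op (Z L \<inter> corth (V L)) (V L)) (realify Ts)" for L Ts
  have nat: "natural_orientation W L = {cs. ordered_basis (compl_fibre W L) cs \<and> (\<exists>Ts. cb L Ts \<and> same_oriented (nb L Ts) cs)}" for L
    unfolding natural_orientation_def ell_def cb_def nb_def ..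
  have d1: "cvs.dim (V L) = 1" if "L \<in> LagW W k" for L using that k by (simp add: LagW_def)
  have ex: "\<exists>Ts. cb L Ts" if L: "L \<in> LagW W k" for L
  proof -
    obtain e where e: "norm e = 1" "V L = cvs.span {e}"
      using unit_vector_line[OF flagD(6)[OF LagW_flag[OF L]] d1[OF L]] by blast
    show ?thesis unfolding cb_def by (rule line_complex_basis_exists[OF e LagW_flag[OF L]])
  qed
  have cmp: "ordered_basis (flag_ops (V L) (Z L)) (nb L Ts)" "ordered_basis (flag_ops (V L') (Z L')) (nb L' Ts')"
    "same_oriented (map (congr \<Phi>) (nb L Ts)) (nb L' Ts')"
    if "L \<in> LagW W k" "L' \<in> LagW W k" "flag_iso \<Phi> (V L) (Z L) (V L') (Z L')" "cb L Ts" "cb L' Ts'" for L L' \<Phi> Ts Ts'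
    unfolding nb_def
    using same_oriented_line_frames[OF LagW_flag[OF that(1)] LagW_flag[OF that(2)] d1[OF that(1)] that(3)
        that(4)[unfolded cb_def] that(5)[unfolded cb_def]] .
  show ?thesis
    unfolding bundle_orientation_def
  proof (intro conjI ballI)
    fix L assume L: "L \<in> LagW W k"
    have fl: "flag (V L) (Z L)" by (rule LagW_flag[OF L])
    obtain Ts where Ts: "cb L Ts" using ex[OF L] by blast
    note self = cmp[OF L L flag_iso_orth_proj[OF fl] Ts]
    have ob: "ordered_basis (flag_ops (V L) (Z L)) (nb L Ts)" by (rule self(1)[OF Ts])
    have id: "map (congr (orth_proj (Z L))) (nb L Ts) = nb L Ts"
      using ordered_basis_subset[OF ob] congr_orth_proj[OF fl] by (intro map_idI) blast
    have "natural_orientation W L = {cs. ordered_basis (compl_fibre W L) cs \<and> same_oriented (nb L Ts) cs}"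
    proof -
      have "same_oriented (nb L Ts) cs" if "cb L Ts'" "same_oriented (nb L Ts') cs" for Ts' cs
        using same_oriented_trans[OF self(3)[OF that(1), unfolded id] that(2)] .
      then show ?thesis unfolding nat using Ts by blast
    qed
    then show "is_orientation (compl_fibre W L) (natural_orientation W L)"
      unfolding is_orientation_def compl_fibre_eq[OF W L] using ob by blast
    obtain U ss where f: "local_frame (LagW W k) (compl_fibre W) L U ss"
      "\<forall>S\<in>U \<inter> Sym_op L. arnold L S \<in> LagW W k \<longrightarrow>
       (\<exists>\<Phi>. flag_iso \<Phi> (V L) (Z L) (V (arnold L S)) (Z (arnold L S)) \<and>
          frame_at L ss S = map (congr \<Phi>) (nb L Ts))"
      using adapted_frame[OF L ob] by blast
    have "frame_at L ss S \<in> natural_orientation W (arnold L S)"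
      if S: "S \<in> U \<inter> Sym_op L" "arnold L S \<in> LagW W k" for S
    proof -
      let ?N = "arnold L S"
      obtain \<Phi> where \<Phi>: "flag_iso \<Phi> (V L) (Z L) (V ?N) (Z ?N)" "frame_at L ss S = map (congr \<Phi>) (nb L Ts)"
        using f(2) S by blast
      obtain Ts' where Ts': "cb ?N Ts'" using ex[OF S(2)] by blast
      have ob': "ordered_basis (compl_fibre W ?N) (frame_at L ss S)"
        using f(1) S unfolding local_frame_def by blast
      have "same_oriented (nb ?N Ts') (frame_at L ss S)"
      proof (rule same_oriented_sym)
        show "ordered_basis (compl_fibre W ?N) (frame_at L ss S)" by (rule ob')
        show "ordered_basis (compl_fibre W ?N) (nb ?N Ts')"
          unfolding compl_fibre_eq[OF W S(2)] by (rule cmp(2)[OF L S(2) \<Phi>(1) Ts Ts'])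
        show "same_oriented (frame_at L ss S) (nb ?N Ts')"
          unfolding \<Phi>(2) by (rule cmp(3)[OF L S(2) \<Phi>(1) Ts Ts'])
      qed
      then show ?thesis unfolding nat using ob' Ts' by blast
    qed
    then show "\<exists>U ss. local_frame (LagW W k) (compl_fibre W) L U ss \<and>
        (\<forall>S\<in>U \<inter> Sym_op L. arnold L S \<in> LagW W k \<longrightarrow> frame_at L ss S \<in> natural_orientation W (arnold L S))"
      using f(1) by blast
  qed
qed

end

theorem proposition3p46:
  fixes W :: "('h::complex_hilbert_space \<times> 'h) set" and k :: nat
  assumes separable: "separable_space (euclidean :: 'h topology)"
    and W: "cvs.subspace W" "closed W" "W \<subseteq> Hminus" "cfinite_codim_in W Hminus"
  shows "(\<forall>L \<in> LagW W k.
            is_orth_decomp3 L (ell W L) (L \<inter> W) (Lam W L) \<and>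
            algebraic_complement (Sym_op L) (tangent_space (LagW W k) L) (compl_fibre W L)) \<and>
         finite_rank_subbundle (LagW W k) (compl_fibre W) \<and>
         orientable_bundle (LagW W k) (compl_fibre W) \<and>
         (k = 1 \<longrightarrow> bundle_orientation (LagW W k) (compl_fibre W) (natural_orientation W))"
proof (intro conjI ballI impI)
  fix L assume L: "L \<in> LagW W k"
  show "is_orth_decomp3 L (ell W L) (L \<inter> W) (Lam W L)" by (rule orth_decomp_LagW[OF W L])
  show "algebraic_complement (Sym_op L) (tangent_space (LagW W k) L) (compl_fibre W L)"
    by (rule algebraic_complement_LagW[OF W L])
next
  show "finite_rank_subbundle (LagW W k) (compl_fibre W)" by (rule finite_rank_compl_fibre[OF W])
  show "orientable_bundle (LagW W k) (compl_fibre W)" by (rule orientable_compl_fibre[OF W])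
  assume "k = 1"
  then show "bundle_orientation (LagW W k) (compl_fibre W) (natural_orientation W)"
    by (rule natural_orientation_compl_fibre[OF W])
qed

end
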